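(* Let $F$ be a field, $A$ a commutative $F$-algebra, and $W$ an $A$-module of finite presentation which admits a $\mathbf{V}_W$-connection, where $\mathbf{V}_W\subseteq \operatorname{Der}_F(A)$ is the linear Lie-Rinehart algebra of $W$. Let $U\subseteq \operatorname{Spec}(A)$ be the open subset where $W$ is locally free. Then there exists a class $c_1(W)\in \operatorname{H}^2(\mathbf{V}_W|_U,\mathcal{O}_U)$, namely the class of the 2-cocycle $\operatorname{trace}\circ R_\nabla|_U$, where $R_\nabla$ is the curvature of a $\mathbf{V}_W$-connection $\nabla$ on $W$, and this class is independent of the choice of the $\mathbf{V}_W$-connection $\nabla$.
   Context: Linear Lie-Rinehart algebra. For an $A$-module $W$, regard $\operatorname{End}_F(W)=\operatorname{Hom}_F(W,W)$ as an $A$-bimodule by $(a\varphi)(w)=a\varphi(w)$, $(\varphi a)(w)=\varphi(aw)$. For $\delta\in\operatorname{Der}_F(A)$ let $C(\delta)\in \operatorname{Der}_F(A,\operatorname{End}_F(W))$ be the derivation $C(\delta)(a)(w)=\delta(a)w$. The Kodaira-Spencer map is the $A$-linear map $g:\operatorname{Der}_F(A)\to \operatorname{Ext}^1_A(W,W)=\operatorname{HH}^1(A,\operatorname{End}_F(W))$ sending $\delta$ to the class of $C(\delta)$ modulo the inner derivations $a\mapsto \varphi a-a\varphi$, $\varphi\in \operatorname{End}_F(W)$. Put $\mathbf{V}_W=\ker(g)$. It is an $A$-submodule and $F$-Lie subalgebra of $\operatorname{Der}_F(A)$, hence a Lie-Rinehart algebra with anchor the inclusion. Connections. A $\mathbf{V}_W$-connection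 on $W$ is an $A$-linear map $\nabla:\mathbf{V}_W\to\operatorname{End}_F(W)$, $\delta\mapsto\nabla_\delta$, with $\nabla_\delta(aw)=a\nabla_\delta(w)+\delta(a)w$ for all $\delta\in \mathbf{V}_W$, $a\in A$, $w\in W$. Its curvature is $R_\nabla(\delta\wedge\eta)=[\nabla_\delta,\nabla_\eta]-\nabla_{[\delta,\eta]}$, which takes values in $\operatorname{End}_A(W)$ and is $A$-bilinear and alternating. Cohomology. $\mathbf{V}_W|_U$ is the restriction to $U$ of the quasi-coherent sheaf associated to $\mathbf{V}_W$, with the Lie-Rinehart structure obtained by localization; it acts on $\mathcal{O}_U$ by derivations. The Chevalley-Hochschild complex is $\operatorname{C}^p(\mathbf{V}_W|_U,\mathcal{O}_U)=\operatorname{Hom}_{\mathcal{O}_U}(\wedge^p\mathbf{V}_W|_U,\mathcal{O}_U)$ (global homomorphisms of sheaves), with differential given on local sections by $$d^p\phi(g_1\wedge\cdots\wedge g_{p+1})=\sum_{i=1}^{p+1}(-1)^{i+1}g_i\,\phi(g_1\wedge\cdots\widehat{g_i}\cdots\wedge g_{p+1})+\sum_{i<j}(-1)^{i+j}\phi([g_i,g_j]\wedge\cdots\widehat{g_i}\cdots\widehat{g_j}\cdots\wedge g_{p+1}),$$ and $\operatorname{H}^i(\mathbf{V}_W|_U,\mathcal{O}_U)$ denotes its $i$-th cohomology. On $U$ the module $W$ is locally free of finite rank, so $\operatorname{trace}:\operatorname{End}_{\mathcal{O}_U}(W|_U)\to\mathcal{O}_U$ is defined, and $\operatorname{trace}\circ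 R_\nabla|_U\in \operatorname{C}^2(\mathbf{V}_W|_U,\mathcal{O}_U)$. *)

theory Defs
  imports "HOL-Analysis.Abstract_Topology" "HOL-Algebra.Ideal" "HOL-Algebra.Module"
begin

section \<open>Modules, derivations, connections\<close>

text \<open>
  Modules are records of HOL-Algebra; their fields for multiplication and unit carry no
  information. Maps between structures are extensional on the carrier of
  their domain, so that equality of maps is equality of HOL functions.
\<close>

definition self_module :: "('a, 'y) ring_scheme \<Rightarrow> ('a, 'a) module" where
  "self_module A = \<lparr>carrier = carrier A, mult = mult A, one = \<one>\<^bsub>A\<^esub>, zero = \<zero>\<^bsub>A\<^esub>, add = add A,
     smult = mult A\<rparr>"

definition restrict_scalars ::
    "('f, 'a, 'y) module_scheme \<Rightarrow> ('a, 'w, 'z) module_scheme \<Rightarrow> ('f, 'w) module" where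
  "restrict_scalars A W = \<lparr>carrier = carrier W, mult = mult W, one = \<one>\<^bsub>W\<^esub>, zero = \<zero>\<^bsub>W\<^esub>,
     add = add W, smult = (\<lambda>c w. (c \<odot>\<^bsub>A\<^esub> \<one>\<^bsub>A\<^esub>) \<odot>\<^bsub>W\<^esub> w)\<rparr>"

definition linear_maps ::
    "('r, 'k) ring_scheme \<Rightarrow> ('r, 'm, 'x) module_scheme \<Rightarrow> ('r, 'n, 'y) module_scheme
      \<Rightarrow> ('m \<Rightarrow> 'n) set" where
  "linear_maps R M N = {f \<in> carrier M \<rightarrow>\<^sub>E carrier N.
     (\<forall>x\<in>carrier M. \<forall>y\<in>carrier M. f (x \<oplus>\<^bsub>M\<^esub> y) = f x \<oplus>\<^bsub>N\<^esub> f y) \<and>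
     (\<forall>r\<in>carrier R. \<forall>x\<in>carrier M. f (r \<odot>\<^bsub>M\<^esub> x) = r \<odot>\<^bsub>N\<^esub> f x)}"

definition pointwise_module ::
    "'x set \<Rightarrow> ('a, 'm, 'y) module_scheme \<Rightarrow> ('x \<Rightarrow> 'm) set \<Rightarrow> ('a, 'x \<Rightarrow> 'm) module" where
  "pointwise_module X M C = \<lparr>carrier = C, mult = undefined, one = undefined,
     zero = (\<lambda>x\<in>X. \<zero>\<^bsub>M\<^esub>), add = (\<lambda>f g. \<lambda>x\<in>X. f x \<oplus>\<^bsub>M\<^esub> g x), smult = (\<lambda>a f. \<lambda>x\<in>X. a \<odot>\<^bsub>M\<^esub> f x)\<rparr>"

definition Der :: "('f, 'k) ring_scheme \<Rightarrow> ('f, 'a, 'y) module_scheme \<Rightarrow> ('a, 'a \<Rightarrow> 'a) module" where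
  "Der F A = pointwise_module (carrier A) (self_module A)
     {\<delta> \<in> linear_maps F A A. \<forall>a\<in>carrier A. \<forall>b\<in>carrier A.
        \<delta> (a \<otimes>\<^bsub>A\<^esub> b) = a \<otimes>\<^bsub>A\<^esub> \<delta> b \<oplus>\<^bsub>A\<^esub> \<delta> a \<otimes>\<^bsub>A\<^esub> b}"

definition lie_bracket :: "('a, 'y) ring_scheme \<Rightarrow> ('a \<Rightarrow> 'a) \<Rightarrow> ('a \<Rightarrow> 'a) \<Rightarrow> 'a \<Rightarrow> 'a" where
  "lie_bracket A \<delta> \<eta> = (\<lambda>a\<in>carrier A. \<delta> (\<eta> a) \<ominus>\<^bsub>A\<^esub> \<eta> (\<delta> a))"

text \<open>The record carries the left \<open>A\<close>-module structure; \<open>End_right\<close> is the right one.\<close>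

definition EndF ::
    "('f, 'k) ring_scheme \<Rightarrow> ('f, 'a, 'y) module_scheme \<Rightarrow> ('a, 'w, 'z) module_scheme
      \<Rightarrow> ('a, 'w \<Rightarrow> 'w) module" where
  "EndF F A W = pointwise_module (carrier W) W
     (linear_maps F (restrict_scalars A W) (restrict_scalars A W))"

definition End_right :: "('a, 'w, 'z) module_scheme \<Rightarrow> ('w \<Rightarrow> 'w) \<Rightarrow> 'a \<Rightarrow> 'w \<Rightarrow> 'w" where
  "End_right W \<phi> a = (\<lambda>w\<in>carrier W. \<phi> (a \<odot>\<^bsub>W\<^esub> w))"

definition Der_End ::
    "('f, 'k) ring_scheme \<Rightarrow> ('f, 'a, 'y) module_scheme \<Rightarrow> ('a, 'w, 'z) module_scheme
      \<Rightarrow> ('a, 'a \<Rightarrow> 'w \<Rightarrow> 'w) module" where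
  "Der_End F A W = pointwise_module (carrier A) (EndF F A W)
     {D \<in> linear_maps F A (restrict_scalars A (EndF F A W)). \<forall>a\<in>carrier A. \<forall>b\<in>carrier A.
        D (a \<otimes>\<^bsub>A\<^esub> b) = a \<odot>\<^bsub>EndF F A W\<^esub> D b \<oplus>\<^bsub>EndF F A W\<^esub> End_right W (D a) b}"

definition inner_derivations ::
    "('f, 'k) ring_scheme \<Rightarrow> ('f, 'a, 'y) module_scheme \<Rightarrow> ('a, 'w, 'z) module_scheme
      \<Rightarrow> ('a \<Rightarrow> 'w \<Rightarrow> 'w) set" where
  "inner_derivations F A W =
     (\<lambda>\<phi>. \<lambda>a\<in>carrier A. End_right W \<phi> a \<ominus>\<^bsub>EndF F A W\<^esub> (a \<odot>\<^bsub>EndF F A W\<^esub> \<phi>)) ` carrier (EndF F A W)"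

definition HH1_End ::
    "('f, 'k) ring_scheme \<Rightarrow> ('f, 'a, 'y) module_scheme \<Rightarrow> ('a, 'w, 'z) module_scheme
      \<Rightarrow> ('a \<Rightarrow> 'w \<Rightarrow> 'w) set monoid" where
  "HH1_End F A W = Der_End F A W A_Mod inner_derivations F A W"

definition der_to_End ::
    "('a, 'y) ring_scheme \<Rightarrow> ('a, 'w, 'z) module_scheme \<Rightarrow> ('a \<Rightarrow> 'a) \<Rightarrow> 'a \<Rightarrow> 'w \<Rightarrow> 'w" where
  "der_to_End A W \<delta> = (\<lambda>a\<in>carrier A. \<lambda>w\<in>carrier W. \<delta> a \<odot>\<^bsub>W\<^esub> w)"

definition kodaira_spencer ::
    "('f, 'k) ring_scheme \<Rightarrow> ('f, 'a, 'y) module_scheme \<Rightarrow> ('a, 'w, 'z) module_scheme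
      \<Rightarrow> ('a \<Rightarrow> 'a) \<Rightarrow> ('a \<Rightarrow> 'w \<Rightarrow> 'w) set" where
  "kodaira_spencer F A W \<delta> = inner_derivations F A W +>\<^bsub>Der_End F A W\<^esub> der_to_End A W \<delta>"

definition linear_LR ::
    "('f, 'k) ring_scheme \<Rightarrow> ('f, 'a, 'y) module_scheme \<Rightarrow> ('a, 'w, 'z) module_scheme
      \<Rightarrow> ('a, 'a \<Rightarrow> 'a) module" where
  "linear_LR F A W = (Der F A)
     \<lparr>carrier := kernel (add_monoid (Der F A)) (HH1_End F A W) (kodaira_spencer F A W)\<rparr>"

definition is_connection ::
    "('f, 'k) ring_scheme \<Rightarrow> ('f, 'a, 'y) module_scheme \<Rightarrow> ('a, 'w, 'z) module_scheme
      \<Rightarrow> (('a \<Rightarrow> 'a) \<Rightarrow> 'w \<Rightarrow> 'w) \<Rightarrow> bool" where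
  "is_connection F A W nabla \<longleftrightarrow> nabla \<in> linear_maps A (linear_LR F A W) (EndF F A W) \<and>
     (\<forall>\<delta>\<in>carrier (linear_LR F A W). \<forall>a\<in>carrier A. \<forall>w\<in>carrier W.
        nabla \<delta> (a \<odot>\<^bsub>W\<^esub> w) = a \<odot>\<^bsub>W\<^esub> nabla \<delta> w \<oplus>\<^bsub>W\<^esub> \<delta> a \<odot>\<^bsub>W\<^esub> w)"

definition curvature ::
    "('a, 'y) ring_scheme \<Rightarrow> ('a, 'w, 'z) module_scheme \<Rightarrow> (('a \<Rightarrow> 'a) \<Rightarrow> 'w \<Rightarrow> 'w)
      \<Rightarrow> ('a \<Rightarrow> 'a) \<Rightarrow> ('a \<Rightarrow> 'a) \<Rightarrow> 'w \<Rightarrow> 'w" where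
  "curvature A W nabla \<delta> \<eta> = (\<lambda>w\<in>carrier W.
     (nabla \<delta> (nabla \<eta> w) \<ominus>\<^bsub>W\<^esub> nabla \<eta> (nabla \<delta> w)) \<ominus>\<^bsub>W\<^esub> nabla (lie_bracket A \<delta> \<eta>) w)"

text \<open>Exactness of \<open>A^m \<rightarrow> A^n \<rightarrow> W \<rightarrow> 0\<close>, the first map having rows \<open>r j\<close>.\<close>

definition finitely_presented :: "('a, 'y) ring_scheme \<Rightarrow> ('a, 'w, 'z) module_scheme \<Rightarrow> bool" where
  "finitely_presented A W \<longleftrightarrow> (\<exists>(n::nat) w (m::nat) r.
     w \<in> {..<n} \<rightarrow> carrier W \<and> r \<in> {..<m} \<rightarrow> ({..<n} \<rightarrow> carrier A) \<and>
     (\<forall>x\<in>carrier W. \<exists>c\<in>{..<n} \<rightarrow> carrier A. x = (\<Oplus>\<^bsub>W\<^esub>i\<in>{..<n}. c i \<odot>\<^bsub>W\<^esub> w i)) \<and>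
     (\<forall>j<m. (\<Oplus>\<^bsub>W\<^esub>i\<in>{..<n}. r j i \<odot>\<^bsub>W\<^esub> w i) = \<zero>\<^bsub>W\<^esub>) \<and>
     (\<forall>c\<in>{..<n} \<rightarrow> carrier A. (\<Oplus>\<^bsub>W\<^esub>i\<in>{..<n}. c i \<odot>\<^bsub>W\<^esub> w i) = \<zero>\<^bsub>W\<^esub> \<longrightarrow>
        (\<exists>b\<in>{..<m} \<rightarrow> carrier A. \<forall>i<n. c i = (\<Oplus>\<^bsub>A\<^esub>j\<in>{..<m}. b j \<otimes>\<^bsub>A\<^esub> r j i))))"

definition is_basis ::
    "('r, 'k) ring_scheme \<Rightarrow> ('r, 'm, 'x) module_scheme \<Rightarrow> nat \<Rightarrow> (nat \<Rightarrow> 'm) \<Rightarrow> bool" where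
  "is_basis R M n e \<longleftrightarrow> e \<in> {..<n} \<rightarrow> carrier M \<and>
     (\<forall>x\<in>carrier M. \<exists>!c. c \<in> {..<n} \<rightarrow>\<^sub>E carrier R \<and> x = (\<Oplus>\<^bsub>M\<^esub>i\<in>{..<n}. c i \<odot>\<^bsub>M\<^esub> e i))"

definition module_trace ::
    "('r, 'k) ring_scheme \<Rightarrow> ('r, 'm, 'x) module_scheme \<Rightarrow> ('m \<Rightarrow> 'm) \<Rightarrow> 'r" where
  "module_trace R M f = (THE t. \<exists>n e c. is_basis R M n e \<and>
     (\<forall>i<n. \<forall>j<n. c i j \<in> carrier R) \<and>
     (\<forall>j<n. f (e j) = (\<Oplus>\<^bsub>M\<^esub>i\<in>{..<n}. c i j \<odot>\<^bsub>M\<^esub> e i)) \<and>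
     t = (\<Oplus>\<^bsub>R\<^esub>i\<in>{..<n}. c i i))"


section \<open>Localization\<close>

text \<open>The fraction \<open>m/s\<close> is the class of \<open>(m, s)\<close>. Operations on fractions are given on
  representatives; the unions below are unions of one repeated set.\<close>

definition fraction ::
    "('a, 'm, 'x) module_scheme \<Rightarrow> 'a set \<Rightarrow> 'm \<Rightarrow> 'a \<Rightarrow> ('m \<times> 'a) set" where
  "fraction M S m s = {(m', s'). m' \<in> carrier M \<and> s' \<in> S \<and>
     (\<exists>u\<in>S. u \<odot>\<^bsub>M\<^esub> (s \<odot>\<^bsub>M\<^esub> m') = u \<odot>\<^bsub>M\<^esub> (s' \<odot>\<^bsub>M\<^esub> m))}"

definition loc_module ::
    "('a, 'y) ring_scheme \<Rightarrow> ('a, 'm, 'x) module_scheme \<Rightarrow> 'a set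
      \<Rightarrow> (('a \<times> 'a) set, ('m \<times> 'a) set) module" where
  "loc_module A M S =
     \<lparr>carrier = {fraction M S m s | m s. m \<in> carrier M \<and> s \<in> S},
      mult = undefined, one = undefined,
      zero = fraction M S \<zero>\<^bsub>M\<^esub> \<one>\<^bsub>A\<^esub>,
      add = (\<lambda>X Y. \<Union>(m, s)\<in>X. \<Union>(n, t)\<in>Y.
               fraction M S (t \<odot>\<^bsub>M\<^esub> m \<oplus>\<^bsub>M\<^esub> s \<odot>\<^bsub>M\<^esub> n) (s \<otimes>\<^bsub>A\<^esub> t)),
      smult = (\<lambda>X Y. \<Union>(a, s)\<in>X. \<Union>(m, t)\<in>Y. fraction M S (a \<odot>\<^bsub>M\<^esub> m) (s \<otimes>\<^bsub>A\<^esub> t))\<rparr>"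

abbreviation stalk ::
    "('a, 'y) ring_scheme \<Rightarrow> ('a, 'm, 'x) module_scheme \<Rightarrow> 'a set
      \<Rightarrow> (('a \<times> 'a) set, ('m \<times> 'a) set) module" where
  "stalk A M p \<equiv> loc_module A M (carrier A - p)"

abbreviation germ_fraction ::
    "('a, 'y) ring_scheme \<Rightarrow> ('a, 'm, 'x) module_scheme \<Rightarrow> 'a set \<Rightarrow> 'm \<Rightarrow> 'a \<Rightarrow> ('m \<times> 'a) set" where
  "germ_fraction A M p m s \<equiv> fraction M (carrier A - p) m s"

text \<open>The quotient rule \<open>(\<delta>/s)(a/t) = (t \<delta>(a) - a \<delta>(t)) / (s t^2)\<close>.\<close>

definition stalk_action ::
    "('a, 'y) ring_scheme \<Rightarrow> 'a set \<Rightarrow> (('a \<Rightarrow> 'a) \<times> 'a) set \<Rightarrow> ('a \<times> 'a) set \<Rightarrow> ('a \<times> 'a) set" where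
  "stalk_action A p X Y = (\<Union>(\<delta>, s)\<in>X. \<Union>(a, t)\<in>Y.
     germ_fraction A (self_module A) p (t \<otimes>\<^bsub>A\<^esub> \<delta> a \<ominus>\<^bsub>A\<^esub> a \<otimes>\<^bsub>A\<^esub> \<delta> t) (s \<otimes>\<^bsub>A\<^esub> (t \<otimes>\<^bsub>A\<^esub> t)))"

text \<open>
  The Leibniz rule for the anchor and the quotient rule give
  \<open>[\<delta>/s, \<eta>/t] = [\<delta>, \<eta>]/(st) - (\<delta>(t)/(s t^2)) \<eta> + (\<eta>(s)/(s^2 t)) \<delta>\<close>,
  written below over the common denominator \<open>(st)^2\<close>.
\<close>

definition stalk_bracket ::
    "('a, 'y) ring_scheme \<Rightarrow> ('a, 'a \<Rightarrow> 'a, 'x) module_scheme \<Rightarrow> 'a set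
      \<Rightarrow> (('a \<Rightarrow> 'a) \<times> 'a) set \<Rightarrow> (('a \<Rightarrow> 'a) \<times> 'a) set \<Rightarrow> (('a \<Rightarrow> 'a) \<times> 'a) set" where
  "stalk_bracket A L p X Y = (\<Union>(\<delta>, s)\<in>X. \<Union>(\<eta>, t)\<in>Y.
     germ_fraction A L p
       (((s \<otimes>\<^bsub>A\<^esub> t) \<odot>\<^bsub>L\<^esub> lie_bracket A \<delta> \<eta> \<ominus>\<^bsub>L\<^esub> (s \<otimes>\<^bsub>A\<^esub> \<delta> t) \<odot>\<^bsub>L\<^esub> \<eta>) \<oplus>\<^bsub>L\<^esub> (t \<otimes>\<^bsub>A\<^esub> \<eta> s) \<odot>\<^bsub>L\<^esub> \<delta>)
       ((s \<otimes>\<^bsub>A\<^esub> t) \<otimes>\<^bsub>A\<^esub> (s \<otimes>\<^bsub>A\<^esub> t)))"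

definition stalk_curvature ::
    "('a, 'y) ring_scheme \<Rightarrow> ('a, 'w, 'z) module_scheme \<Rightarrow> (('a \<Rightarrow> 'a) \<Rightarrow> 'w \<Rightarrow> 'w) \<Rightarrow> 'a set
      \<Rightarrow> (('a \<Rightarrow> 'a) \<times> 'a) set \<Rightarrow> (('a \<Rightarrow> 'a) \<times> 'a) set \<Rightarrow> ('w \<times> 'a) set \<Rightarrow> ('w \<times> 'a) set" where
  "stalk_curvature A W nabla p X Y Z = (\<Union>(\<delta>, s)\<in>X. \<Union>(\<eta>, t)\<in>Y. \<Union>(w, u)\<in>Z.
     germ_fraction A W p (curvature A W nabla \<delta> \<eta> w) (s \<otimes>\<^bsub>A\<^esub> (t \<otimes>\<^bsub>A\<^esub> u)))"


section \<open>Sheaves on the prime spectrum\<close>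

definition Spec :: "('a, 'y) ring_scheme \<Rightarrow> 'a set set" where
  "Spec A = {p. primeideal p A}"

definition zariski :: "('a, 'y) ring_scheme \<Rightarrow> 'a set topology" where
  "zariski A = topology_generated_by {{p \<in> Spec A. f \<notin> p} | f. f \<in> carrier A}"

abbreviation opens :: "('a, 'y) ring_scheme \<Rightarrow> 'a set set \<Rightarrow> 'a set set set" where
  "opens A U \<equiv> {V. openin (zariski A) V \<and> V \<subseteq> U}"

text \<open>
  Sections over \<open>V\<close> of the quasi-coherent sheaf associated to \<open>M\<close>: families of germs that are
  locally of the form \<open>m/s\<close>.
\<close>

type_synonym ('m, 'a) sec = "'a set \<Rightarrow> ('m \<times> 'a) set"

definition sections ::
    "('a, 'y) ring_scheme \<Rightarrow> ('a, 'm, 'x) module_scheme \<Rightarrow> 'a set set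
      \<Rightarrow> (('a, 'a) sec, ('m, 'a) sec) module" where
  "sections A M V =
     \<lparr>carrier = {\<sigma> \<in> extensional V. \<forall>p\<in>V. \<exists>V'\<in>opens A V. p \<in> V' \<and>
        (\<exists>m\<in>carrier M. \<exists>s\<in>carrier A. \<forall>q\<in>V'. s \<notin> q \<and> \<sigma> q = germ_fraction A M q m s)},
      mult = undefined, one = undefined,
      zero = (\<lambda>p\<in>V. \<zero>\<^bsub>stalk A M p\<^esub>),
      add = (\<lambda>\<sigma> \<tau>. \<lambda>p\<in>V. \<sigma> p \<oplus>\<^bsub>stalk A M p\<^esub> \<tau> p),
      smult = (\<lambda>f \<sigma>. \<lambda>p\<in>V. f p \<odot>\<^bsub>stalk A M p\<^esub> \<sigma> p)\<rparr>"

definition struct_sheaf :: "('a, 'y) ring_scheme \<Rightarrow> 'a set set \<Rightarrow> ('a, 'a) sec ring" where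
  "struct_sheaf A V = (let Q = sections A (self_module A) V in
     \<lparr>carrier = carrier Q, mult = smult Q,
      one = (\<lambda>p\<in>V. germ_fraction A (self_module A) p \<one>\<^bsub>A\<^esub> \<one>\<^bsub>A\<^esub>),
      zero = \<zero>\<^bsub>Q\<^esub>, add = add Q\<rparr>)"

text \<open>\<open>e\<close> induces an isomorphism of sheaves from \<open>O^n\<close> to the sheaf of \<open>W\<close> over \<open>V\<close>.\<close>

definition is_frame ::
    "('a, 'y) ring_scheme \<Rightarrow> ('a, 'w, 'z) module_scheme \<Rightarrow> 'a set set \<Rightarrow> nat
      \<Rightarrow> (nat \<Rightarrow> ('w, 'a) sec) \<Rightarrow> bool" where
  "is_frame A W V n e \<longleftrightarrow> openin (zariski A) V \<and> e \<in> {..<n} \<rightarrow> carrier (sections A W V) \<and>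
     (\<forall>V'\<in>opens A V. is_basis (struct_sheaf A V') (sections A W V') n (\<lambda>i. restrict (e i) V'))"

definition locally_free_locus ::
    "('a, 'y) ring_scheme \<Rightarrow> ('a, 'w, 'z) module_scheme \<Rightarrow> 'a set set" where
  "locally_free_locus A W = \<Union>{V. \<exists>n e. is_frame A W V n e}"

text \<open>
  An endomorphism of the sheaf of \<open>W\<close> restricted to \<open>V\<close> is a family of maps on sections over the
  open subsets of \<open>V\<close>; its trace is the section over \<open>V\<close> which over each open subset with a frame is
  the trace of the map on sections there.
\<close>

definition sheaf_trace ::
    "('a, 'y) ring_scheme \<Rightarrow> ('a, 'w, 'z) module_scheme \<Rightarrow> 'a set set
      \<Rightarrow> ('a set set \<Rightarrow> ('w, 'a) sec \<Rightarrow> ('w, 'a) sec) \<Rightarrow> ('a, 'a) sec" where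
  "sheaf_trace A W V \<Phi> = (THE t. t \<in> carrier (struct_sheaf A V) \<and>
     (\<forall>V'\<in>opens A V. (\<exists>n e. is_frame A W V' n e) \<longrightarrow>
        restrict t V' = module_trace (struct_sheaf A V') (sections A W V') (\<Phi> V')))"

definition sheaf_curvature ::
    "('a, 'y) ring_scheme \<Rightarrow> ('a, 'w, 'z) module_scheme \<Rightarrow> (('a \<Rightarrow> 'a) \<Rightarrow> 'w \<Rightarrow> 'w)
      \<Rightarrow> ('a \<Rightarrow> 'a, 'a) sec \<Rightarrow> ('a \<Rightarrow> 'a, 'a) sec
      \<Rightarrow> 'a set set \<Rightarrow> ('w, 'a) sec \<Rightarrow> ('w, 'a) sec" where
  "sheaf_curvature A W nabla \<sigma> \<tau> V' \<omega> = (\<lambda>p\<in>V'. stalk_curvature A W nabla p (\<sigma> p) (\<tau> p) (\<omega> p))"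


section \<open>The Chevalley-Hochschild complex\<close>

type_synonym 'a cochain = "'a set set \<Rightarrow> ('a \<Rightarrow> 'a, 'a) sec list \<Rightarrow> ('a, 'a) sec"

definition tuples ::
    "('a, 'y) ring_scheme \<Rightarrow> ('a, 'a \<Rightarrow> 'a, 'x) module_scheme \<Rightarrow> nat \<Rightarrow> 'a set set
      \<Rightarrow> ('a \<Rightarrow> 'a, 'a) sec list set" where
  "tuples A L p V = {gs. length gs = p \<and> set gs \<subseteq> carrier (sections A L V)}"

text \<open>
  By the universal property of sheafification and of exterior powers, homomorphisms from the
  \<open>p\<close>-th exterior power of a sheaf of modules to the structure sheaf are the alternating multilinear
  sheaf maps in \<open>p\<close> arguments. Here \<open>L\<close> is an \<open>A\<close>-submodule and Lie subalgebra of the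
  derivations of \<open>A\<close>, with the inclusion as anchor.
\<close>

definition cochains ::
    "('a, 'y) ring_scheme \<Rightarrow> ('a, 'a \<Rightarrow> 'a, 'x) module_scheme \<Rightarrow> 'a set set \<Rightarrow> nat
      \<Rightarrow> 'a cochain ring" where
  "cochains A L U p =
     \<lparr>carrier = {\<phi> \<in> (\<Pi>\<^sub>E V\<in>opens A U. tuples A L p V \<rightarrow>\<^sub>E carrier (struct_sheaf A V)).
        (\<forall>V\<in>opens A U. \<forall>gs\<in>tuples A L p V.
           (\<forall>i<p. \<forall>g\<in>carrier (sections A L V). \<forall>h\<in>carrier (sections A L V).
              \<phi> V (gs[i := g \<oplus>\<^bsub>sections A L V\<^esub> h]) =
                \<phi> V (gs[i := g]) \<oplus>\<^bsub>struct_sheaf A V\<^esub> \<phi> V (gs[i := h])) \<and>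
           (\<forall>i<p. \<forall>f\<in>carrier (struct_sheaf A V). \<forall>g\<in>carrier (sections A L V).
              \<phi> V (gs[i := f \<odot>\<^bsub>sections A L V\<^esub> g]) = f \<otimes>\<^bsub>struct_sheaf A V\<^esub> \<phi> V (gs[i := g])) \<and>
           (\<forall>i<p. \<forall>j<i. gs ! i = gs ! j \<longrightarrow> \<phi> V gs = \<zero>\<^bsub>struct_sheaf A V\<^esub>) \<and>
           (\<forall>V'\<in>opens A V. \<phi> V' (map (\<lambda>g. restrict g V') gs) = restrict (\<phi> V gs) V'))},
      mult = undefined, one = undefined,
      zero = (\<lambda>V\<in>opens A U. \<lambda>gs\<in>tuples A L p V. \<zero>\<^bsub>struct_sheaf A V\<^esub>),
      add = (\<lambda>\<phi> \<psi>. \<lambda>V\<in>opens A U. \<lambda>gs\<in>tuples A L p V. \<phi> V gs \<oplus>\<^bsub>struct_sheaf A V\<^esub> \<psi> V gs)\<rparr>"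

text \<open>List indices start at 0, which shifts both indices of the usual formula by one:
  the sign of the \<open>i\<close>-th term of the first sum becomes \<open>(-1)^i\<close>, the signs of the second sum are
  unchanged.\<close>

definition differential ::
    "('a, 'y) ring_scheme \<Rightarrow> ('a, 'a \<Rightarrow> 'a, 'x) module_scheme \<Rightarrow> 'a set set \<Rightarrow> nat
      \<Rightarrow> 'a cochain \<Rightarrow> 'a cochain" where
  "differential A L U p \<phi> = (\<lambda>V\<in>opens A U. \<lambda>gs\<in>tuples A L (Suc p) V.
     (\<Oplus>\<^bsub>struct_sheaf A V\<^esub>i\<in>{..p}. [((-1) ^ i :: int)] \<cdot>\<^bsub>struct_sheaf A V\<^esub>
        (\<lambda>q\<in>V. stalk_action A q ((gs ! i) q) (\<phi> V (nths gs (- {i})) q)))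
     \<oplus>\<^bsub>struct_sheaf A V\<^esub>
     (\<Oplus>\<^bsub>struct_sheaf A V\<^esub>ij\<in>{(i, j). i < j \<and> j \<le> p}. [((-1) ^ (fst ij + snd ij) :: int)] \<cdot>\<^bsub>struct_sheaf A V\<^esub>
        \<phi> V ((\<lambda>q\<in>V. stalk_bracket A L q ((gs ! fst ij) q) ((gs ! snd ij) q))
             # nths gs (- {fst ij, snd ij}))))"

definition cocycles ::
    "('a, 'y) ring_scheme \<Rightarrow> ('a, 'a \<Rightarrow> 'a, 'x) module_scheme \<Rightarrow> 'a set set \<Rightarrow> nat
      \<Rightarrow> 'a cochain ring" where
  "cocycles A L U p = (cochains A L U p)
     \<lparr>carrier := a_kernel (cochains A L U p) (cochains A L U (Suc p)) (differential A L U p)\<rparr>"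

definition coboundaries ::
    "('a, 'y) ring_scheme \<Rightarrow> ('a, 'a \<Rightarrow> 'a, 'x) module_scheme \<Rightarrow> 'a set set \<Rightarrow> nat
      \<Rightarrow> 'a cochain set" where
  "coboundaries A L U p = (case p of 0 \<Rightarrow> {\<zero>\<^bsub>cochains A L U 0\<^esub>}
     | Suc k \<Rightarrow> differential A L U k ` carrier (cochains A L U k))"

definition cohomology ::
    "('a, 'y) ring_scheme \<Rightarrow> ('a, 'a \<Rightarrow> 'a, 'x) module_scheme \<Rightarrow> 'a set set \<Rightarrow> nat
      \<Rightarrow> 'a cochain set monoid" where
  "cohomology A L U p = cocycles A L U p A_Mod coboundaries A L U p"

definition cohomology_class ::
    "('a, 'y) ring_scheme \<Rightarrow> ('a, 'a \<Rightarrow> 'a, 'x) module_scheme \<Rightarrow> 'a set set \<Rightarrow> nat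
      \<Rightarrow> 'a cochain \<Rightarrow> 'a cochain set" where
  "cohomology_class A L U p \<phi> = coboundaries A L U p +>\<^bsub>cocycles A L U p\<^esub> \<phi>"

definition trace_curvature ::
    "('a, 'y) ring_scheme \<Rightarrow> ('a, 'a \<Rightarrow> 'a, 'x) module_scheme \<Rightarrow> ('a, 'w, 'z) module_scheme
      \<Rightarrow> 'a set set \<Rightarrow> (('a \<Rightarrow> 'a) \<Rightarrow> 'w \<Rightarrow> 'w) \<Rightarrow> 'a cochain" where
  "trace_curvature A L W U nabla = (\<lambda>V\<in>opens A U. \<lambda>gs\<in>tuples A L 2 V.
     sheaf_trace A W V (sheaf_curvature A W nabla (gs ! 0) (gs ! 1)))"

end

theory Submission imports Defs
begin

text \<open>
The trace of the curvature is studied at the primes of the locally free locus. All operations of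
the complex (the action of \<open>L\<close> on functions, the bracket, addition, the trace of an endomorphism)
are computed on germs, and a section is determined by its germs, so both claims reduce to
identities in a stalk, where the module is free with a basis coming from a frame
(\<open>frame_stalk_basis\<close>, \<open>sheaf_trace_eq\<close>).

On a stalk every germ of a derivation is \<open>\<delta>/s = (1/s) \<delta>\<close> with \<open>\<delta>\<close> a global derivation of \<open>A\<close>, and
the connection is defined for such \<open>\<delta>\<close>. Let \<open>R\<close> be the curvature and \<open>D\<close> the operator on the stalk
of \<open>W\<close> induced by \<open>\<nabla> \<delta>\<close>. The key fact is \<open>tr [D, f] = \<delta> (tr f)\<close> for linear \<open>f\<close>
(\<open>trace_commutator\<close>): in a basis \<open>D = \<delta> + \<Gamma>\<close>, hence \<open>[D, f] = \<delta>(f) + [\<Gamma>, f]\<close>, and a commutator of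
matrices has trace zero. Taking traces in the Bianchi identity (\<open>bianchi\<close>), which is the Jacobi
identity for the operators \<open>\<nabla> \<delta>\<close>, \<open>\<nabla> \<eta>\<close>, \<open>\<nabla> \<theta>\<close> combined with the one for the bracket, gives the
cocycle condition for global derivations. The expression \<open>d(tr R)\<close> is
linear over the local ring in each argument: the derivatives of denominators contributed by the
action cancel against those contributed by the bracket (\<open>stalk_cocycle\<close>). So the condition passes
from \<open>\<delta>\<close> to \<open>\<delta>/s\<close>.

For two connections the difference \<open>E = \<nabla>' - \<nabla>\<close> is linear over \<open>A\<close> in both arguments, and expanding
commutators of \<open>\<nabla> + E\<close> gives
\<open>R'(\<delta>, \<eta>) + [\<nabla>' \<eta>, E \<delta>] + E [\<delta>, \<eta>] = R(\<delta>, \<eta>) + [\<nabla> \<delta>, E \<eta>]\<close>.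
In this arrangement the quadratic term \<open>[E \<delta>, E \<eta>]\<close> is absorbed by using \<open>\<nabla>'\<close> in one commutator and
\<open>\<nabla>\<close> in the other. Taking traces, with \<open>trace_commutator\<close> for \<open>\<nabla>\<close> and for \<open>\<nabla>'\<close>, yields
\<open>tr R' = tr R + d\<psi>\<close> with \<open>\<psi> = tr E\<close> (\<open>trace_curvature_diff\<close>). The cochain \<open>\<psi>\<close> is defined on the whole
locus, so the two classes agree.

It remains to see that the kernel of the Kodaira-Spencer map is a Lie-Rinehart algebra. A derivation
\<open>\<delta>\<close> lies in this kernel if and only if some operator on \<open>W\<close> satisfies the Leibniz rule over \<open>\<delta>\<close>
(\<open>linear_LR_iff\<close>), and such operators can be added, multiplied by elements of \<open>A\<close>, and composed to
commutators.
\<close>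

section \<open>Linear identities in modules\<close>

context abelian_group
begin

lemma add_diff: "a \<in> carrier G \<Longrightarrow> b \<in> carrier G \<Longrightarrow> c \<in> carrier G \<Longrightarrow> a \<oplus> (b \<ominus> c) = (a \<oplus> b) \<ominus> c"
  by (simp add: minus_eq a_assoc)

lemma diff_add: "a \<in> carrier G \<Longrightarrow> b \<in> carrier G \<Longrightarrow> c \<in> carrier G \<Longrightarrow> (a \<ominus> b) \<oplus> c = (a \<oplus> c) \<ominus> b"
  by (simp add: minus_eq a_ac)

lemma diff_diff: "a \<in> carrier G \<Longrightarrow> b \<in> carrier G \<Longrightarrow> c \<in> carrier G \<Longrightarrow> (a \<ominus> b) \<ominus> c = a \<ominus> (b \<oplus> c)"
  by (simp add: minus_eq minus_add a_ac)

lemma diff_diff2: "a \<in> carrier G \<Longrightarrow> b \<in> carrier G \<Longrightarrow> c \<in> carrier G \<Longrightarrow> a \<ominus> (b \<ominus> c) = (a \<oplus> c) \<ominus> b"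
  by (simp add: minus_eq minus_add a_ac)

lemma diff_eq_iff: "a \<in> carrier G \<Longrightarrow> b \<in> carrier G \<Longrightarrow> c \<in> carrier G \<Longrightarrow> a \<ominus> b = c \<longleftrightarrow> a = c \<oplus> b"
  using minus_equality [of b a] by (auto simp: minus_eq a_assoc r_neg l_neg)

lemma eq_diff_iff: "a \<in> carrier G \<Longrightarrow> b \<in> carrier G \<Longrightarrow> c \<in> carrier G \<Longrightarrow> c = a \<ominus> b \<longleftrightarrow> c \<oplus> b = a"
  using diff_eq_iff by metis

lemma diff_zero [simp]: "a \<in> carrier G \<Longrightarrow> a \<ominus> \<zero> = a"
  by (simp add: diff_eq_iff)

lemma diff_self [simp]: "a \<in> carrier G \<Longrightarrow> a \<ominus> a = \<zero>"
  by (simp add: diff_eq_iff)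

lemma diff_swap:
  assumes "a \<oplus> b = c \<oplus> d" "a \<in> carrier G" "b \<in> carrier G" "c \<in> carrier G" "d \<in> carrier G"
  shows "a \<ominus> d = c \<ominus> b"
  using assms by (simp add: diff_eq_iff diff_add eq_diff_iff)

lemma neg_diff: "a \<in> carrier G \<Longrightarrow> \<ominus> a = \<zero> \<ominus> a"
  by (simp add: minus_eq)

text \<open>Rewriting moves every difference to the outside and clears it across equations, so that identities
involving differences become identities between sums, which commutativity and associativity decide.\<close>

lemmas diff_simps = add_diff diff_add diff_diff diff_diff2 diff_eq_iff eq_diff_iff neg_diff

end

lemma (in abelian_group) diff_add_cancel [simp]:
  "a \<in> carrier G \<Longrightarrow> b \<in> carrier G \<Longrightarrow> a \<ominus> b \<oplus> b = a"
  by (simp add: minus_eq a_assoc l_neg)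

lemma (in ring) minus_distr:
  assumes "a \<in> carrier R" "b \<in> carrier R" "c \<in> carrier R"
  shows "(a \<ominus> b) \<otimes> c = a \<otimes> c \<ominus> b \<otimes> c" and "c \<otimes> (a \<ominus> b) = c \<otimes> a \<ominus> c \<otimes> b"
  using assms by (simp_all add: minus_eq l_distr r_distr l_minus r_minus)

lemma (in module) smult_minus_distr:
  assumes "a \<in> carrier R" "b \<in> carrier R" "x \<in> carrier M" "y \<in> carrier M"
  shows "(a \<ominus> b) \<odot>\<^bsub>M\<^esub> x = a \<odot>\<^bsub>M\<^esub> x \<ominus>\<^bsub>M\<^esub> b \<odot>\<^bsub>M\<^esub> x"
    and "a \<odot>\<^bsub>M\<^esub> (x \<ominus>\<^bsub>M\<^esub> y) = a \<odot>\<^bsub>M\<^esub> x \<ominus>\<^bsub>M\<^esub> a \<odot>\<^bsub>M\<^esub> y"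
  using assms
  by (simp_all add: R.minus_eq M.minus_eq smult_l_distr smult_r_distr smult_l_minus smult_r_minus)

lemmas (in cring) ring_lin = diff_simps minus_distr l_distr r_distr m_ac a_ac

lemmas (in module) lin = M.diff_simps R.diff_simps R.minus_distr R.l_distr R.r_distr smult_minus_distr
  smult_l_distr smult_r_distr smult_assoc1 [symmetric] R.m_ac M.a_ac R.a_ac

text \<open>An additive map satisfying the Leibniz rule over a map of the ring; \<open>\<delta> = 0\<close> means linear maps.\<close>

definition deriv_over :: "('a, 'y) ring_scheme \<Rightarrow> ('a, 'm, 'x) module_scheme \<Rightarrow> ('a \<Rightarrow> 'a) \<Rightarrow> ('m \<Rightarrow> 'm) \<Rightarrow> bool" where
  "deriv_over A M \<delta> D \<longleftrightarrow> (\<forall>a\<in>carrier A. \<delta> a \<in> carrier A) \<and> (\<forall>x\<in>carrier M. D x \<in> carrier M) \<and>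
     (\<forall>x\<in>carrier M. \<forall>y\<in>carrier M. D (x \<oplus>\<^bsub>M\<^esub> y) = D x \<oplus>\<^bsub>M\<^esub> D y) \<and>
     (\<forall>a\<in>carrier A. \<forall>x\<in>carrier M. D (a \<odot>\<^bsub>M\<^esub> x) = a \<odot>\<^bsub>M\<^esub> D x \<oplus>\<^bsub>M\<^esub> \<delta> a \<odot>\<^bsub>M\<^esub> x)"

lemma (in module) deriv_overD:
  assumes "deriv_over R M \<delta> D"
  shows "a \<in> carrier R \<Longrightarrow> \<delta> a \<in> carrier R" "x \<in> carrier M \<Longrightarrow> D x \<in> carrier M"
    "x \<in> carrier M \<Longrightarrow> y \<in> carrier M \<Longrightarrow> D (x \<oplus>\<^bsub>M\<^esub> y) = D x \<oplus>\<^bsub>M\<^esub> D y"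
    "a \<in> carrier R \<Longrightarrow> x \<in> carrier M \<Longrightarrow> D (a \<odot>\<^bsub>M\<^esub> x) = a \<odot>\<^bsub>M\<^esub> D x \<oplus>\<^bsub>M\<^esub> \<delta> a \<odot>\<^bsub>M\<^esub> x"
  using assms by (auto simp: deriv_over_def)

lemma (in module) linearI:
  assumes "\<And>x. x \<in> carrier M \<Longrightarrow> f x \<in> carrier M"
    and "\<And>x y. x \<in> carrier M \<Longrightarrow> y \<in> carrier M \<Longrightarrow> f (x \<oplus>\<^bsub>M\<^esub> y) = f x \<oplus>\<^bsub>M\<^esub> f y"
    and "\<And>a x. a \<in> carrier R \<Longrightarrow> x \<in> carrier M \<Longrightarrow> f (a \<odot>\<^bsub>M\<^esub> x) = a \<odot>\<^bsub>M\<^esub> f x"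
  shows "deriv_over R M (\<lambda>_. \<zero>) f"
  using assms by (simp add: deriv_over_def)

lemma (in module) linearD:
  assumes "deriv_over R M (\<lambda>_. \<zero>) f"
  shows "x \<in> carrier M \<Longrightarrow> f x \<in> carrier M"
    and "x \<in> carrier M \<Longrightarrow> y \<in> carrier M \<Longrightarrow> f (x \<oplus>\<^bsub>M\<^esub> y) = f x \<oplus>\<^bsub>M\<^esub> f y"
    and "a \<in> carrier R \<Longrightarrow> x \<in> carrier M \<Longrightarrow> f (a \<odot>\<^bsub>M\<^esub> x) = a \<odot>\<^bsub>M\<^esub> f x"
  using assms by (simp_all add: deriv_over_def)

lemma (in module) linear_add:
  assumes "deriv_over R M (\<lambda>_. \<zero>) f" "deriv_over R M (\<lambda>_. \<zero>) g"
  shows "deriv_over R M (\<lambda>_. \<zero>) (\<lambda>x. f x \<oplus>\<^bsub>M\<^esub> g x)"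
  by (rule linearI) (simp_all add: linearD [OF assms(1)] linearD [OF assms(2)] M.a_ac smult_r_distr)

lemma (in module) linear_zero: "deriv_over R M (\<lambda>_. \<zero>) (\<lambda>_. \<zero>\<^bsub>M\<^esub>)"
  by (simp add: deriv_over_def)

section \<open>Localization\<close>

lemma (in cring) module_self: "module R (self_module R)"
  by (rule moduleI)
    (auto simp: self_module_def m_ac a_ac l_distr r_distr is_cring
      intro!: abelian_groupI a_assoc l_zero exI bexI [of _ "\<ominus> _"] l_neg)

lemma self_module_simps [simp]:
  "carrier (self_module A) = carrier A" "smult (self_module A) = mult A" "add (self_module A) = add A"
  "\<zero>\<^bsub>self_module A\<^esub> = \<zero>\<^bsub>A\<^esub>"
  by (simp_all add: self_module_def)

lemma a_inv_self_module [simp]: "a_inv (self_module A) x = a_inv A x"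
  by (simp add: self_module_def a_inv_def m_inv_def)

lemma a_minus_self_module [simp]: "a_minus (self_module A) x y = a_minus A x y"
  by (simp add: a_minus_def)

locale multset = cring A for A (structure) + fixes S
  assumes S_carrier: "S \<subseteq> carrier A" and S_one [simp, intro]: "\<one> \<in> S"
    and S_mult [simp, intro]: "s \<in> S \<Longrightarrow> t \<in> S \<Longrightarrow> s \<otimes> t \<in> S"
begin

lemma S_in [simp, intro]: "s \<in> S \<Longrightarrow> s \<in> carrier A"
  using S_carrier by blast

end

definition loc_ring :: "('a, 'y) ring_scheme \<Rightarrow> 'a set \<Rightarrow> ('a \<times> 'a) set ring" where
  "loc_ring A S = (let Q = loc_module A (self_module A) S in
     \<lparr>carrier = carrier Q, mult = smult Q, one = fraction (self_module A) S \<one>\<^bsub>A\<^esub> \<one>\<^bsub>A\<^esub>,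
      zero = \<zero>\<^bsub>Q\<^esub>, add = add Q\<rparr>)"

locale loc_mod = multset A S + module A M for A (structure) and S and M (structure)
begin

abbreviation frac where "frac \<equiv> fraction M S"
abbreviation Q where "Q \<equiv> loc_module A M S"

lemma mem_frac: "(m', s') \<in> frac m s \<longleftrightarrow> m' \<in> carrier M \<and> s' \<in> S \<and>
     (\<exists>u\<in>S. u \<odot>\<^bsub>M\<^esub> (s \<odot>\<^bsub>M\<^esub> m') = u \<odot>\<^bsub>M\<^esub> (s' \<odot>\<^bsub>M\<^esub> m))"
  by (simp add: fraction_def)

lemma mem_fracD: "(m', s') \<in> frac m s \<Longrightarrow> m' \<in> carrier M \<and> s' \<in> S"
  by (simp add: mem_frac)

lemma mem_frac_self: "m \<in> carrier M \<Longrightarrow> s \<in> S \<Longrightarrow> (m, s) \<in> frac m s"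
  by (auto simp: mem_frac)

text \<open>The cross-multiplied relation between representatives is transitive, with the witness \<open>u v s'\<close>.\<close>

lemma frac_trans:
  assumes "m \<in> carrier M" "m' \<in> carrier M" "m'' \<in> carrier M" "s \<in> S" "s' \<in> S" "s'' \<in> S" "u \<in> S" "v \<in> S"
    and "u \<odot>\<^bsub>M\<^esub> (s \<odot>\<^bsub>M\<^esub> m') = u \<odot>\<^bsub>M\<^esub> (s' \<odot>\<^bsub>M\<^esub> m)"
    and "v \<odot>\<^bsub>M\<^esub> (s' \<odot>\<^bsub>M\<^esub> m'') = v \<odot>\<^bsub>M\<^esub> (s'' \<odot>\<^bsub>M\<^esub> m')"
  shows "(u \<otimes> v \<otimes> s') \<odot>\<^bsub>M\<^esub> (s \<odot>\<^bsub>M\<^esub> m'') = (u \<otimes> v \<otimes> s') \<odot>\<^bsub>M\<^esub> (s'' \<odot>\<^bsub>M\<^esub> m)"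
proof -
  have "(u \<otimes> v \<otimes> s') \<odot>\<^bsub>M\<^esub> (s \<odot>\<^bsub>M\<^esub> m'') = (u \<otimes> s) \<odot>\<^bsub>M\<^esub> (v \<odot>\<^bsub>M\<^esub> (s' \<odot>\<^bsub>M\<^esub> m''))"
    using assms(1-8) by (simp add: lin)
  also have "\<dots> = (v \<otimes> s'') \<odot>\<^bsub>M\<^esub> (u \<odot>\<^bsub>M\<^esub> (s \<odot>\<^bsub>M\<^esub> m'))"
    using assms(1-8) by (simp add: assms(10)) (simp add: lin)
  also have "\<dots> = (u \<otimes> v \<otimes> s') \<odot>\<^bsub>M\<^esub> (s'' \<odot>\<^bsub>M\<^esub> m)"
    using assms(1-8) by (simp add: assms(9)) (simp add: lin)
  finally show ?thesis .
qed

lemma frac_eq_iff: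
  assumes "m \<in> carrier M" "m' \<in> carrier M" "s \<in> S" "s' \<in> S"
  shows "frac m s = frac m' s' \<longleftrightarrow> (\<exists>u\<in>S. u \<odot>\<^bsub>M\<^esub> (s \<odot>\<^bsub>M\<^esub> m') = u \<odot>\<^bsub>M\<^esub> (s' \<odot>\<^bsub>M\<^esub> m))"
proof
  assume eq: "frac m s = frac m' s'"
  show "\<exists>u\<in>S. u \<odot>\<^bsub>M\<^esub> (s \<odot>\<^bsub>M\<^esub> m') = u \<odot>\<^bsub>M\<^esub> (s' \<odot>\<^bsub>M\<^esub> m)"
  proof -
    have "(m', s') \<in> frac m s" using mem_frac_self [of m' s'] assms eq by simp
    then show ?thesis by (simp add: mem_frac)
  qed
next
  assume "\<exists>u\<in>S. u \<odot>\<^bsub>M\<^esub> (s \<odot>\<^bsub>M\<^esub> m') = u \<odot>\<^bsub>M\<^esub> (s' \<odot>\<^bsub>M\<^esub> m)"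
  then obtain u where u: "u \<in> S" "u \<odot>\<^bsub>M\<^esub> (s \<odot>\<^bsub>M\<^esub> m') = u \<odot>\<^bsub>M\<^esub> (s' \<odot>\<^bsub>M\<^esub> m)" by blast
  show "frac m s = frac m' s'"
  proof (rule Set.set_eqI)
    fix x show "x \<in> frac m s \<longleftrightarrow> x \<in> frac m' s'"
    proof (cases x)
      case (Pair n t)
      show ?thesis unfolding Pair mem_frac
      proof (intro conj_cong refl iffI; elim bexE)
        fix v assume n: "n \<in> carrier M" "t \<in> S" and v: "v \<in> S"
          and eq: "v \<odot>\<^bsub>M\<^esub> (s \<odot>\<^bsub>M\<^esub> n) = v \<odot>\<^bsub>M\<^esub> (t \<odot>\<^bsub>M\<^esub> m)"
        have "(u \<otimes> v \<otimes> s) \<odot>\<^bsub>M\<^esub> (s' \<odot>\<^bsub>M\<^esub> n) = (u \<otimes> v \<otimes> s) \<odot>\<^bsub>M\<^esub> (t \<odot>\<^bsub>M\<^esub> m')"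
          by (rule frac_trans [of m' m n s' s t u v]) (use assms n v u eq in auto)
        then show "\<exists>u\<in>S. u \<odot>\<^bsub>M\<^esub> (s' \<odot>\<^bsub>M\<^esub> n) = u \<odot>\<^bsub>M\<^esub> (t \<odot>\<^bsub>M\<^esub> m')"
          using u v assms by blast
      next
        fix v assume n: "n \<in> carrier M" "t \<in> S" and v: "v \<in> S"
          and eq: "v \<odot>\<^bsub>M\<^esub> (s' \<odot>\<^bsub>M\<^esub> n) = v \<odot>\<^bsub>M\<^esub> (t \<odot>\<^bsub>M\<^esub> m')"
        have "(u \<otimes> v \<otimes> s') \<odot>\<^bsub>M\<^esub> (s \<odot>\<^bsub>M\<^esub> n) = (u \<otimes> v \<otimes> s') \<odot>\<^bsub>M\<^esub> (t \<odot>\<^bsub>M\<^esub> m)"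
          by (rule frac_trans [of m m' n s s' t u v]) (use assms n v u eq in auto)
        then show "\<exists>u\<in>S. u \<odot>\<^bsub>M\<^esub> (s \<odot>\<^bsub>M\<^esub> n) = u \<odot>\<^bsub>M\<^esub> (t \<odot>\<^bsub>M\<^esub> m)"
          using u v assms by blast
      qed
    qed
  qed
qed

lemma frac_eqI:
  assumes "m \<in> carrier M" "m' \<in> carrier M" "s \<in> S" "s' \<in> S" "s \<odot>\<^bsub>M\<^esub> m' = s' \<odot>\<^bsub>M\<^esub> m"
  shows "frac m s = frac m' s'"
  using assms by (auto simp: frac_eq_iff)

lemma frac_cancel:
  assumes "m \<in> carrier M" "s \<in> S" "r \<in> S"
  shows "frac (r \<odot>\<^bsub>M\<^esub> m) (r \<otimes> s) = frac m s"
  by (rule frac_eqI) (use assms in \<open>auto simp: lin\<close>)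

text \<open>An operation given as a union over representatives is evaluated at any one of them as soon as it
does not depend on the representative.\<close>

lemma UN_frac:
  assumes "m \<in> carrier M" "s \<in> S"
    and "\<And>m' s'. m' \<in> carrier M \<Longrightarrow> s' \<in> S \<Longrightarrow> frac m' s' = frac m s \<Longrightarrow> f m' s' = f m s"
  shows "(\<Union>(m', s')\<in>frac m s. f m' s') = f m s"
proof -
  have "f m' s' = f m s" if "(m', s') \<in> frac m s" for m' s'
  proof (rule assms(3))
    show "m' \<in> carrier M" "s' \<in> S" using that by (auto simp: mem_frac)
    then show "frac m' s' = frac m s"
      using that assms by (metis (no_types, lifting) frac_eq_iff mem_frac)
  qed
  then show ?thesis by (intro UN_constant_eq [OF mem_frac_self [OF assms(1,2)]]) auto
qed

lemma Q_carrier: "carrier Q = {frac m s | m s. m \<in> carrier M \<and> s \<in> S}"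
  by (simp add: loc_module_def)

lemma frac_closed [simp, intro]: "m \<in> carrier M \<Longrightarrow> s \<in> S \<Longrightarrow> frac m s \<in> carrier Q"
  by (auto simp: Q_carrier)

lemma Q_cases:
  assumes "X \<in> carrier Q" obtains m s where "m \<in> carrier M" "s \<in> S" "X = frac m s"
  using assms by (auto simp: Q_carrier)

lemma Q_cases2:
  assumes "X \<in> carrier Q" "Y \<in> carrier Q"
  obtains m n s where "m \<in> carrier M" "n \<in> carrier M" "s \<in> S" "X = frac m s" "Y = frac n s"
proof -
  obtain m s where 1: "m \<in> carrier M" "s \<in> S" "X = frac m s" using assms Q_cases by metis
  obtain n t where 2: "n \<in> carrier M" "t \<in> S" "Y = frac n t" using assms Q_cases by metis
  show thesis
  proof (rule that [of "t \<odot>\<^bsub>M\<^esub> m" "s \<odot>\<^bsub>M\<^esub> n" "s \<otimes> t"])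
    show "X = frac (t \<odot>\<^bsub>M\<^esub> m) (s \<otimes> t)" using frac_cancel [of m s t] 1 2 by (simp add: m_comm)
    show "Y = frac (s \<odot>\<^bsub>M\<^esub> n) (s \<otimes> t)" using frac_cancel [of n t s] 1 2 by simp
  qed (use 1 2 in auto)
qed

lemma frac_add_frac:
  assumes "m \<in> carrier M" "n \<in> carrier M" "s \<in> S" "t \<in> S"
  shows "frac m s \<oplus>\<^bsub>Q\<^esub> frac n t = frac (t \<odot>\<^bsub>M\<^esub> m \<oplus>\<^bsub>M\<^esub> s \<odot>\<^bsub>M\<^esub> n) (s \<otimes> t)"
proof -
  have *: "frac (t' \<odot>\<^bsub>M\<^esub> m' \<oplus>\<^bsub>M\<^esub> s' \<odot>\<^bsub>M\<^esub> n') (s' \<otimes> t') = frac (t \<odot>\<^bsub>M\<^esub> m \<oplus>\<^bsub>M\<^esub> s \<odot>\<^bsub>M\<^esub> n) (s \<otimes> t)"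
    if 1: "m' \<in> carrier M" "n' \<in> carrier M" "s' \<in> S" "t' \<in> S" "frac m' s' = frac m s" "frac n' t' = frac n t"
      and 2: "m \<in> carrier M" "n \<in> carrier M" "s \<in> S" "t \<in> S"
    for m n s t m' n' s' t'
  proof -
    obtain u v where u: "u \<in> S" "u \<odot>\<^bsub>M\<^esub> (s' \<odot>\<^bsub>M\<^esub> m) = u \<odot>\<^bsub>M\<^esub> (s \<odot>\<^bsub>M\<^esub> m')"
      and v: "v \<in> S" "v \<odot>\<^bsub>M\<^esub> (t' \<odot>\<^bsub>M\<^esub> n) = v \<odot>\<^bsub>M\<^esub> (t \<odot>\<^bsub>M\<^esub> n')"
      using 1 2 by (auto simp: frac_eq_iff)
    have "(u \<otimes> v) \<odot>\<^bsub>M\<^esub> ((s' \<otimes> t') \<odot>\<^bsub>M\<^esub> (t \<odot>\<^bsub>M\<^esub> m \<oplus>\<^bsub>M\<^esub> s \<odot>\<^bsub>M\<^esub> n)) =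
       (v \<otimes> t' \<otimes> t) \<odot>\<^bsub>M\<^esub> (u \<odot>\<^bsub>M\<^esub> (s' \<odot>\<^bsub>M\<^esub> m)) \<oplus>\<^bsub>M\<^esub> (u \<otimes> s' \<otimes> s) \<odot>\<^bsub>M\<^esub> (v \<odot>\<^bsub>M\<^esub> (t' \<odot>\<^bsub>M\<^esub> n))"
      using that u(1) v(1) by (simp add: lin)
    also have "\<dots> = (u \<otimes> v) \<odot>\<^bsub>M\<^esub> ((s \<otimes> t) \<odot>\<^bsub>M\<^esub> (t' \<odot>\<^bsub>M\<^esub> m' \<oplus>\<^bsub>M\<^esub> s' \<odot>\<^bsub>M\<^esub> n'))"
      unfolding u(2) v(2) using that u(1) v(1) by (simp add: lin)
    finally show ?thesis
      using 1 2 u(1) v(1) by (subst frac_eq_iff) (auto intro!: bexI [of _ "u \<otimes> v"])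
  qed
  have "frac m s \<oplus>\<^bsub>Q\<^esub> frac n t = (\<Union>(m, s)\<in>frac m s. \<Union>(n, t)\<in>frac n t. frac (t \<odot>\<^bsub>M\<^esub> m \<oplus>\<^bsub>M\<^esub> s \<odot>\<^bsub>M\<^esub> n) (s \<otimes> t))"
    by (simp add: loc_module_def)
  also have "\<dots> = (\<Union>(n, t)\<in>frac n t. frac (t \<odot>\<^bsub>M\<^esub> m \<oplus>\<^bsub>M\<^esub> s \<odot>\<^bsub>M\<^esub> n) (s \<otimes> t))"
  proof (rule UN_frac [OF assms(1,3)])
    fix m' s' assume 1: "m' \<in> carrier M" "s' \<in> S" "frac m' s' = frac m s"
    show "(\<Union>(n, t)\<in>frac n t. frac (t \<odot>\<^bsub>M\<^esub> m' \<oplus>\<^bsub>M\<^esub> s' \<odot>\<^bsub>M\<^esub> n) (s' \<otimes> t)) =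
       (\<Union>(n, t)\<in>frac n t. frac (t \<odot>\<^bsub>M\<^esub> m \<oplus>\<^bsub>M\<^esub> s \<odot>\<^bsub>M\<^esub> n) (s \<otimes> t))"
      by (rule SUP_cong [OF refl], clarify, drule mem_fracD, rule *) (use 1 assms in auto)
  qed
  also have "\<dots> = frac (t \<odot>\<^bsub>M\<^esub> m \<oplus>\<^bsub>M\<^esub> s \<odot>\<^bsub>M\<^esub> n) (s \<otimes> t)"
    using assms by (intro UN_frac *) auto
  finally show ?thesis .
qed

lemma frac_add [simp]:
  assumes "m \<in> carrier M" "n \<in> carrier M" "s \<in> S"
  shows "frac m s \<oplus>\<^bsub>Q\<^esub> frac n s = frac (m \<oplus>\<^bsub>M\<^esub> n) s"
proof -
  have "frac m s \<oplus>\<^bsub>Q\<^esub> frac n s = frac (s \<odot>\<^bsub>M\<^esub> (m \<oplus>\<^bsub>M\<^esub> n)) (s \<otimes> s)"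
    by (subst frac_add_frac) (use assms in \<open>auto simp: smult_r_distr\<close>)
  also have "\<dots> = frac (m \<oplus>\<^bsub>M\<^esub> n) s"
    by (rule frac_cancel) (use assms in auto)
  finally show ?thesis .
qed

lemma frac_smult [simp]:
  assumes "a \<in> carrier A" "m \<in> carrier M" "s \<in> S" "t \<in> S"
  shows "fraction (self_module A) S a s \<odot>\<^bsub>Q\<^esub> frac m t = frac (a \<odot>\<^bsub>M\<^esub> m) (s \<otimes> t)"
proof -
  interpret N: loc_mod A S "self_module A"
    by (intro loc_mod.intro multset_axioms module_self)
  have *: "frac (a' \<odot>\<^bsub>M\<^esub> m') (s' \<otimes> t') = frac (a \<odot>\<^bsub>M\<^esub> m) (s \<otimes> t)"
    if 1: "a' \<in> carrier A" "m' \<in> carrier M" "s' \<in> S" "t' \<in> S" "N.frac a' s' = N.frac a s" "frac m' t' = frac m t"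
      and 2: "a \<in> carrier A" "m \<in> carrier M" "s \<in> S" "t \<in> S"
    for a m s t a' m' s' t'
  proof -
    obtain u v where u: "u \<in> S" "u \<otimes> (s' \<otimes> a) = u \<otimes> (s \<otimes> a')"
      and v: "v \<in> S" "v \<odot>\<^bsub>M\<^esub> (t' \<odot>\<^bsub>M\<^esub> m) = v \<odot>\<^bsub>M\<^esub> (t \<odot>\<^bsub>M\<^esub> m')"
      using 1 2 by (auto simp: frac_eq_iff N.frac_eq_iff)
    have "(u \<otimes> v) \<odot>\<^bsub>M\<^esub> ((s' \<otimes> t') \<odot>\<^bsub>M\<^esub> (a \<odot>\<^bsub>M\<^esub> m)) =
       (u \<otimes> (s' \<otimes> a)) \<odot>\<^bsub>M\<^esub> (v \<odot>\<^bsub>M\<^esub> (t' \<odot>\<^bsub>M\<^esub> m))"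
      using that u(1) v(1) by (simp add: lin)
    also have "\<dots> = (u \<otimes> v) \<odot>\<^bsub>M\<^esub> ((s \<otimes> t) \<odot>\<^bsub>M\<^esub> (a' \<odot>\<^bsub>M\<^esub> m'))"
      unfolding u(2) v(2) using that u(1) v(1) by (simp add: lin)
    finally show ?thesis
      using 1 2 u(1) v(1) by (subst frac_eq_iff) (auto intro!: bexI [of _ "u \<otimes> v"])
  qed
  have "N.frac a s \<odot>\<^bsub>Q\<^esub> frac m t = (\<Union>(a, s)\<in>N.frac a s. \<Union>(m, t)\<in>frac m t. frac (a \<odot>\<^bsub>M\<^esub> m) (s \<otimes> t))"
    by (simp add: loc_module_def)
  also have "\<dots> = (\<Union>(m, t)\<in>frac m t. frac (a \<odot>\<^bsub>M\<^esub> m) (s \<otimes> t))"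
  proof (rule N.UN_frac)
    fix a' s' assume 1: "a' \<in> carrier (self_module A)" "s' \<in> S" "N.frac a' s' = N.frac a s"
    show "(\<Union>(m, t)\<in>frac m t. frac (a' \<odot>\<^bsub>M\<^esub> m) (s' \<otimes> t)) = (\<Union>(m, t)\<in>frac m t. frac (a \<odot>\<^bsub>M\<^esub> m) (s \<otimes> t))"
      by (rule SUP_cong [OF refl], clarify, drule mem_fracD, rule *) (use 1 assms in auto)
  qed (use assms in auto)
  also have "\<dots> = frac (a \<odot>\<^bsub>M\<^esub> m) (s \<otimes> t)"
    using assms by (intro UN_frac *) auto
  finally show ?thesis .
qed

lemma Q_zero: "\<zero>\<^bsub>Q\<^esub> = frac \<zero>\<^bsub>M\<^esub> \<one>"
  by (simp add: loc_module_def)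

lemma frac_zero: "s \<in> S \<Longrightarrow> frac \<zero>\<^bsub>M\<^esub> s = \<zero>\<^bsub>Q\<^esub>"
  unfolding Q_zero by (rule frac_eqI) auto

lemma Q_cases3:
  assumes "X \<in> carrier Q" "Y \<in> carrier Q" "Z \<in> carrier Q"
  obtains m n k s where "m \<in> carrier M" "n \<in> carrier M" "k \<in> carrier M" "s \<in> S"
    "X = frac m s" "Y = frac n s" "Z = frac k s"
proof -
  obtain m n s where 1: "m \<in> carrier M" "n \<in> carrier M" "s \<in> S" "X = frac m s" "Y = frac n s"
    using assms Q_cases2 by metis
  obtain k t where 2: "k \<in> carrier M" "t \<in> S" "Z = frac k t" using assms Q_cases by metis
  show thesis
  proof (rule that [of "t \<odot>\<^bsub>M\<^esub> m" "t \<odot>\<^bsub>M\<^esub> n" "s \<odot>\<^bsub>M\<^esub> k" "s \<otimes> t"])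
    show "X = frac (t \<odot>\<^bsub>M\<^esub> m) (s \<otimes> t)" using frac_cancel [of m s t] 1 2 by (simp add: m_comm)
    show "Y = frac (t \<odot>\<^bsub>M\<^esub> n) (s \<otimes> t)" using frac_cancel [of n s t] 1 2 by (simp add: m_comm)
    show "Z = frac (s \<odot>\<^bsub>M\<^esub> k) (s \<otimes> t)" using frac_cancel [of k t s] 1 2 by simp
  qed (use 1 2 in auto)
qed

lemma Q_abelian_group: "abelian_group Q"
proof (rule abelian_groupI)
  fix X Y Z assume X: "X \<in> carrier Q" and Y: "Y \<in> carrier Q" and Z: "Z \<in> carrier Q"
  obtain m n k s where e: "m \<in> carrier M" "n \<in> carrier M" "k \<in> carrier M" "s \<in> S"
    "X = frac m s" "Y = frac n s" "Z = frac k s" by (rule Q_cases3 [OF X Y Z])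
  show "X \<oplus>\<^bsub>Q\<^esub> Y \<oplus>\<^bsub>Q\<^esub> Z = X \<oplus>\<^bsub>Q\<^esub> (Y \<oplus>\<^bsub>Q\<^esub> Z)" using e by (simp add: M.a_assoc)
next
  fix X Y assume X: "X \<in> carrier Q" and Y: "Y \<in> carrier Q"
  obtain m n s where e: "m \<in> carrier M" "n \<in> carrier M" "s \<in> S"
    "X = frac m s" "Y = frac n s" by (rule Q_cases2 [OF X Y])
  show "X \<oplus>\<^bsub>Q\<^esub> Y = Y \<oplus>\<^bsub>Q\<^esub> X" using e by (simp add: M.a_comm)
  show "X \<oplus>\<^bsub>Q\<^esub> Y \<in> carrier Q" using e by simp
next
  fix X assume X: "X \<in> carrier Q"
  obtain m s where e: "m \<in> carrier M" "s \<in> S" "X = frac m s" by (rule Q_cases [OF X])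
  show "\<zero>\<^bsub>Q\<^esub> \<oplus>\<^bsub>Q\<^esub> X = X" using e by (simp add: frac_zero [of s, symmetric])
  show "\<exists>Y\<in>carrier Q. Y \<oplus>\<^bsub>Q\<^esub> X = \<zero>\<^bsub>Q\<^esub>"
    using e by (intro bexI [of _ "frac (\<ominus>\<^bsub>M\<^esub> m) s"]) (simp_all add: M.l_neg frac_zero)
qed (simp add: Q_zero)

end

lemma (in multset) loc_mod_self: "loc_mod A S (self_module A)"
  by (intro loc_mod.intro multset_axioms module_self)

lemma loc_ring_simps [simp]:
  "carrier (loc_ring A S) = carrier (loc_module A (self_module A) S)"
  "mult (loc_ring A S) = smult (loc_module A (self_module A) S)"
  "one (loc_ring A S) = fraction (self_module A) S \<one>\<^bsub>A\<^esub> \<one>\<^bsub>A\<^esub>"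
  "zero (loc_ring A S) = zero (loc_module A (self_module A) S)"
  "add (loc_ring A S) = add (loc_module A (self_module A) S)"
  by (simp_all add: loc_ring_def Let_def)

lemma (in multset) loc_ring_cases:
  assumes "X \<in> carrier (loc_ring A S)"
  obtains a s where "a \<in> carrier A" "s \<in> S" "X = fraction (self_module A) S a s"
proof -
  interpret N: loc_mod A S "self_module A" by (rule loc_mod_self)
  show thesis using N.Q_cases [of X] assms that by auto
qed

lemma (in multset) loc_ring_cases2:
  assumes "X \<in> carrier (loc_ring A S)" "Y \<in> carrier (loc_ring A S)"
  obtains a b s where "a \<in> carrier A" "b \<in> carrier A" "s \<in> S"
    "X = fraction (self_module A) S a s" "Y = fraction (self_module A) S b s"
proof -
  interpret N: loc_mod A S "self_module A" by (rule loc_mod_self)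
  show thesis by (rule N.Q_cases2 [of X Y]) (use assms that in auto)
qed

lemma (in multset) loc_ring_cases3:
  assumes "X \<in> carrier (loc_ring A S)" "Y \<in> carrier (loc_ring A S)" "Z \<in> carrier (loc_ring A S)"
  obtains a b c s where "a \<in> carrier A" "b \<in> carrier A" "c \<in> carrier A" "s \<in> S"
    "X = fraction (self_module A) S a s" "Y = fraction (self_module A) S b s"
    "Z = fraction (self_module A) S c s"
proof -
  interpret N: loc_mod A S "self_module A" by (rule loc_mod_self)
  show thesis by (rule N.Q_cases3 [of X Y Z]) (use assms that in auto)
qed

lemma (in multset) loc_ring_cring: "cring (loc_ring A S)"
proof -
  interpret N: loc_mod A S "self_module A" by (rule loc_mod_self)
  interpret G: abelian_group "loc_module A (self_module A) S" by (rule N.Q_abelian_group)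
  show ?thesis
  proof (rule cringI)
    show "abelian_group (loc_ring A S)"
      proof (rule abelian_groupI)
      fix X assume X: "X \<in> carrier (loc_ring A S)"
      then show "\<exists>Y\<in>carrier (loc_ring A S). Y \<oplus>\<^bsub>loc_ring A S\<^esub> X = \<zero>\<^bsub>loc_ring A S\<^esub>"
        by (intro bexI [of _ "\<ominus>\<^bsub>N.Q\<^esub> X"]) (auto simp: G.l_neg)
    qed (auto simp: G.a_ac)
    show "comm_monoid (loc_ring A S)"
    proof (rule comm_monoidI)
      fix X Y Z assume *: "X \<in> carrier (loc_ring A S)" "Y \<in> carrier (loc_ring A S)" "Z \<in> carrier (loc_ring A S)"
      then obtain m n k s where e: "m \<in> carrier A" "n \<in> carrier A" "k \<in> carrier A" "s \<in> S"
        "X = N.frac m s" "Y = N.frac n s" "Z = N.frac k s"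
        by (rule loc_ring_cases3)
      show "X \<otimes>\<^bsub>loc_ring A S\<^esub> Y \<otimes>\<^bsub>loc_ring A S\<^esub> Z = X \<otimes>\<^bsub>loc_ring A S\<^esub> (Y \<otimes>\<^bsub>loc_ring A S\<^esub> Z)"
        using e by (simp add: m_assoc)
    next
      fix X Y assume *: "X \<in> carrier (loc_ring A S)" "Y \<in> carrier (loc_ring A S)"
      then obtain m n s where e: "m \<in> carrier A" "n \<in> carrier A" "s \<in> S" "X = N.frac m s" "Y = N.frac n s"
        by (rule loc_ring_cases2)
      show "X \<otimes>\<^bsub>loc_ring A S\<^esub> Y = Y \<otimes>\<^bsub>loc_ring A S\<^esub> X" using e by (simp add: m_comm)
      show "X \<otimes>\<^bsub>loc_ring A S\<^esub> Y \<in> carrier (loc_ring A S)" using e by auto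
    next
      fix X assume *: "X \<in> carrier (loc_ring A S)"
      then show "\<one>\<^bsub>loc_ring A S\<^esub> \<otimes>\<^bsub>loc_ring A S\<^esub> X = X" by (elim loc_ring_cases) auto
    qed auto
  next
    fix X Y Z assume *: "X \<in> carrier (loc_ring A S)" "Y \<in> carrier (loc_ring A S)" "Z \<in> carrier (loc_ring A S)"
    then obtain m n k s where e: "m \<in> carrier A" "n \<in> carrier A" "k \<in> carrier A" "s \<in> S"
      "X = N.frac m s" "Y = N.frac n s" "Z = N.frac k s"
      by (rule loc_ring_cases3)
    show "(X \<oplus>\<^bsub>loc_ring A S\<^esub> Y) \<otimes>\<^bsub>loc_ring A S\<^esub> Z = X \<otimes>\<^bsub>loc_ring A S\<^esub> Z \<oplus>\<^bsub>loc_ring A S\<^esub> Y \<otimes>\<^bsub>loc_ring A S\<^esub> Z"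
      using e by (simp add: l_distr)
  qed
qed

lemma (in loc_mod) loc_module_module: "module (loc_ring A S) Q"
proof -
  interpret N: loc_mod A S "self_module A" by (rule loc_mod_self)
  show ?thesis
  proof (rule moduleI [OF loc_ring_cring Q_abelian_group])
    fix X Y assume X: "X \<in> carrier (loc_ring A S)" and Y: "Y \<in> carrier Q"
    show "X \<odot>\<^bsub>Q\<^esub> Y \<in> carrier Q" by (rule loc_ring_cases [OF X], rule Q_cases [OF Y]) auto
  next
    fix X Y Z assume X: "X \<in> carrier (loc_ring A S)" and Y: "Y \<in> carrier (loc_ring A S)" and Z: "Z \<in> carrier Q"
    obtain a b s where e1: "a \<in> carrier A" "b \<in> carrier A" "s \<in> S" "X = N.frac a s" "Y = N.frac b s"
      by (rule loc_ring_cases2 [OF X Y])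
    obtain m t where e2: "m \<in> carrier M" "t \<in> S" "Z = frac m t" by (rule Q_cases [OF Z])
    note e = e1 e2
    show "(X \<oplus>\<^bsub>loc_ring A S\<^esub> Y) \<odot>\<^bsub>Q\<^esub> Z = X \<odot>\<^bsub>Q\<^esub> Z \<oplus>\<^bsub>Q\<^esub> Y \<odot>\<^bsub>Q\<^esub> Z"
      using e by (simp add: smult_l_distr)
    show "(X \<otimes>\<^bsub>loc_ring A S\<^esub> Y) \<odot>\<^bsub>Q\<^esub> Z = X \<odot>\<^bsub>Q\<^esub> (Y \<odot>\<^bsub>Q\<^esub> Z)"
      using e by (simp add: smult_assoc1 m_assoc)
  next
    fix X Y Z assume X: "X \<in> carrier (loc_ring A S)" and Y: "Y \<in> carrier Q" and Z: "Z \<in> carrier Q"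
    obtain a s where e1: "a \<in> carrier A" "s \<in> S" "X = N.frac a s" by (rule loc_ring_cases [OF X])
    obtain m n t where e2: "m \<in> carrier M" "n \<in> carrier M" "t \<in> S" "Y = frac m t" "Z = frac n t"
      by (rule Q_cases2 [OF Y Z])
    note e = e1 e2
    show "X \<odot>\<^bsub>Q\<^esub> (Y \<oplus>\<^bsub>Q\<^esub> Z) = X \<odot>\<^bsub>Q\<^esub> Y \<oplus>\<^bsub>Q\<^esub> X \<odot>\<^bsub>Q\<^esub> Z"
      using e by (simp add: smult_r_distr)
  next
    fix X assume X: "X \<in> carrier Q"
    then show "\<one>\<^bsub>loc_ring A S\<^esub> \<odot>\<^bsub>Q\<^esub> X = X" by (elim Q_cases) auto
  qed
qed

section \<open>Localized derivations\<close>

text \<open>The extension of an operator \<open>D\<close> that is a derivation over \<open>\<delta>\<close> to fractions. For \<open>\<delta> = 0\<close> it is the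
localization of a linear map.\<close>

definition loc_der :: "('a, 'y) ring_scheme \<Rightarrow> ('a, 'm, 'x) module_scheme \<Rightarrow> 'a set \<Rightarrow> ('a \<Rightarrow> 'a) \<Rightarrow> ('m \<Rightarrow> 'm)
    \<Rightarrow> ('m \<times> 'a) set \<Rightarrow> ('m \<times> 'a) set" where
  "loc_der A M S \<delta> D X = (\<Union>(m, t)\<in>X. fraction M S (t \<odot>\<^bsub>M\<^esub> D m \<ominus>\<^bsub>M\<^esub> \<delta> t \<odot>\<^bsub>M\<^esub> m) (t \<otimes>\<^bsub>A\<^esub> t))"

context loc_mod
begin

lemma frac_eq_of_mem:
  assumes "m \<in> carrier M" "s \<in> S" "(m', s') \<in> frac m s"
  shows "frac m' s' = frac m s"
  using assms by (intro sym [OF iffD2 [OF frac_eq_iff]]) (simp_all add: mem_frac)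

text \<open>The quotient rule is independent of the representative: apply \<open>D\<close> to the equation
\<open>u (t' m) = u (t m')\<close> and multiply by \<open>u t t'\<close>. The derivative of \<open>u\<close> then multiplies the two sides of
the original equation and drops out.\<close>

lemma loc_der_frac:
  assumes D: "deriv_over A M \<delta> D" and m: "m \<in> carrier M" and t: "t \<in> S"
  shows "loc_der A M S \<delta> D (frac m t) = frac (t \<odot>\<^bsub>M\<^esub> D m \<ominus>\<^bsub>M\<^esub> \<delta> t \<odot>\<^bsub>M\<^esub> m) (t \<otimes> t)"
  unfolding loc_der_def
proof (rule UN_frac [OF m t])
  note d = deriv_overD [OF D]
  fix m' t' assume m': "m' \<in> carrier M" and t': "t' \<in> S" and eq: "frac m' t' = frac m t"
  then obtain u where u: "u \<in> S" and eq: "u \<odot>\<^bsub>M\<^esub> (t' \<odot>\<^bsub>M\<^esub> m) = u \<odot>\<^bsub>M\<^esub> (t \<odot>\<^bsub>M\<^esub> m')"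
    using m t by (auto simp: frac_eq_iff)
  note c = m m' S_in [OF t] S_in [OF t'] S_in [OF u] d(1) d(2)
  have "D (u \<odot>\<^bsub>M\<^esub> (t' \<odot>\<^bsub>M\<^esub> m)) = D (u \<odot>\<^bsub>M\<^esub> (t \<odot>\<^bsub>M\<^esub> m'))" using eq by simp
  then have "u \<odot>\<^bsub>M\<^esub> (t' \<odot>\<^bsub>M\<^esub> D m \<oplus>\<^bsub>M\<^esub> \<delta> t' \<odot>\<^bsub>M\<^esub> m) \<oplus>\<^bsub>M\<^esub> \<delta> u \<odot>\<^bsub>M\<^esub> (t' \<odot>\<^bsub>M\<^esub> m) =
     u \<odot>\<^bsub>M\<^esub> (t \<odot>\<^bsub>M\<^esub> D m' \<oplus>\<^bsub>M\<^esub> \<delta> t \<odot>\<^bsub>M\<^esub> m') \<oplus>\<^bsub>M\<^esub> \<delta> u \<odot>\<^bsub>M\<^esub> (t \<odot>\<^bsub>M\<^esub> m')" (is "?l = ?r")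
    using c by (simp add: d(4))
  then have "(u \<otimes> t \<otimes> t') \<odot>\<^bsub>M\<^esub> ?l = (u \<otimes> t \<otimes> t') \<odot>\<^bsub>M\<^esub> ?r" by simp
  moreover have "(u \<otimes> t \<otimes> t') \<odot>\<^bsub>M\<^esub> ?l = (u \<otimes> u \<otimes> t \<otimes> t') \<odot>\<^bsub>M\<^esub> (t' \<odot>\<^bsub>M\<^esub> D m) \<oplus>\<^bsub>M\<^esub> (u \<otimes> t \<otimes> \<delta> t') \<odot>\<^bsub>M\<^esub> (u \<odot>\<^bsub>M\<^esub> (t' \<odot>\<^bsub>M\<^esub> m))
     \<oplus>\<^bsub>M\<^esub> (\<delta> u \<otimes> t \<otimes> t') \<odot>\<^bsub>M\<^esub> (u \<odot>\<^bsub>M\<^esub> (t' \<odot>\<^bsub>M\<^esub> m))"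
    using c by (simp add: lin)
  moreover have "(u \<otimes> t \<otimes> t') \<odot>\<^bsub>M\<^esub> ?r = (u \<otimes> u \<otimes> t \<otimes> t') \<odot>\<^bsub>M\<^esub> (t \<odot>\<^bsub>M\<^esub> D m') \<oplus>\<^bsub>M\<^esub> (u \<otimes> t' \<otimes> \<delta> t) \<odot>\<^bsub>M\<^esub> (u \<odot>\<^bsub>M\<^esub> (t \<odot>\<^bsub>M\<^esub> m'))
     \<oplus>\<^bsub>M\<^esub> (\<delta> u \<otimes> t \<otimes> t') \<odot>\<^bsub>M\<^esub> (u \<odot>\<^bsub>M\<^esub> (t \<odot>\<^bsub>M\<^esub> m'))"
    using c by (simp add: lin)
  ultimately have "(u \<otimes> u \<otimes> t \<otimes> t') \<odot>\<^bsub>M\<^esub> (t' \<odot>\<^bsub>M\<^esub> D m) \<oplus>\<^bsub>M\<^esub> (u \<otimes> t \<otimes> \<delta> t') \<odot>\<^bsub>M\<^esub> (u \<odot>\<^bsub>M\<^esub> (t \<odot>\<^bsub>M\<^esub> m')) =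
      (u \<otimes> u \<otimes> t \<otimes> t') \<odot>\<^bsub>M\<^esub> (t \<odot>\<^bsub>M\<^esub> D m') \<oplus>\<^bsub>M\<^esub> (u \<otimes> t' \<otimes> \<delta> t) \<odot>\<^bsub>M\<^esub> (u \<odot>\<^bsub>M\<^esub> (t' \<odot>\<^bsub>M\<^esub> m))"
    using c by (simp add: eq)
  from M.diff_swap [OF this] have "(u \<otimes> u \<otimes> t \<otimes> t') \<odot>\<^bsub>M\<^esub> (t' \<odot>\<^bsub>M\<^esub> D m) \<ominus>\<^bsub>M\<^esub> (u \<otimes> t' \<otimes> \<delta> t) \<odot>\<^bsub>M\<^esub> (u \<odot>\<^bsub>M\<^esub> (t' \<odot>\<^bsub>M\<^esub> m)) =
      (u \<otimes> u \<otimes> t \<otimes> t') \<odot>\<^bsub>M\<^esub> (t \<odot>\<^bsub>M\<^esub> D m') \<ominus>\<^bsub>M\<^esub> (u \<otimes> t \<otimes> \<delta> t') \<odot>\<^bsub>M\<^esub> (u \<odot>\<^bsub>M\<^esub> (t \<odot>\<^bsub>M\<^esub> m'))"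
    using c by simp
  also have "\<dots> = (u \<otimes> u) \<odot>\<^bsub>M\<^esub> ((t \<otimes> t) \<odot>\<^bsub>M\<^esub> (t' \<odot>\<^bsub>M\<^esub> D m' \<ominus>\<^bsub>M\<^esub> \<delta> t' \<odot>\<^bsub>M\<^esub> m'))"
    using c by (simp add: lin)
  finally have "(u \<otimes> u) \<odot>\<^bsub>M\<^esub> ((t \<otimes> t) \<odot>\<^bsub>M\<^esub> (t' \<odot>\<^bsub>M\<^esub> D m' \<ominus>\<^bsub>M\<^esub> \<delta> t' \<odot>\<^bsub>M\<^esub> m')) =
    (u \<otimes> u \<otimes> t \<otimes> t') \<odot>\<^bsub>M\<^esub> (t' \<odot>\<^bsub>M\<^esub> D m) \<ominus>\<^bsub>M\<^esub> (u \<otimes> t' \<otimes> \<delta> t) \<odot>\<^bsub>M\<^esub> (u \<odot>\<^bsub>M\<^esub> (t' \<odot>\<^bsub>M\<^esub> m))"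
    by (rule sym)
  also have "\<dots> = (u \<otimes> u) \<odot>\<^bsub>M\<^esub> ((t' \<otimes> t') \<odot>\<^bsub>M\<^esub> (t \<odot>\<^bsub>M\<^esub> D m \<ominus>\<^bsub>M\<^esub> \<delta> t \<odot>\<^bsub>M\<^esub> m))"
    using c by (simp add: lin)
  finally have fin: "(u \<otimes> u) \<odot>\<^bsub>M\<^esub> ((t' \<otimes> t') \<odot>\<^bsub>M\<^esub> (t \<odot>\<^bsub>M\<^esub> D m \<ominus>\<^bsub>M\<^esub> \<delta> t \<odot>\<^bsub>M\<^esub> m)) =
    (u \<otimes> u) \<odot>\<^bsub>M\<^esub> ((t \<otimes> t) \<odot>\<^bsub>M\<^esub> (t' \<odot>\<^bsub>M\<^esub> D m' \<ominus>\<^bsub>M\<^esub> \<delta> t' \<odot>\<^bsub>M\<^esub> m'))" by (rule sym)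
  show "frac (t' \<odot>\<^bsub>M\<^esub> D m' \<ominus>\<^bsub>M\<^esub> \<delta> t' \<odot>\<^bsub>M\<^esub> m') (t' \<otimes> t') = frac (t \<odot>\<^bsub>M\<^esub> D m \<ominus>\<^bsub>M\<^esub> \<delta> t \<odot>\<^bsub>M\<^esub> m) (t \<otimes> t)"
    using c t t' u fin by (subst frac_eq_iff) (auto intro: bexI [of _ "u \<otimes> u"])
qed

lemma loc_der_linear:
  assumes f: "deriv_over A M (\<lambda>_. \<zero>) f" and m: "m \<in> carrier M" and t: "t \<in> S"
  shows "loc_der A M S (\<lambda>_. \<zero>) f (frac m t) = frac (f m) t"
  using deriv_overD(2) [OF f] m t frac_cancel [of "f m" t t] by (simp add: loc_der_frac [OF f])

end

lemma (in loc_mod) loc_der_deriv: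
  assumes D: "deriv_over A M \<delta> D" and \<delta>: "deriv_over A (self_module A) \<delta> \<delta>"
  shows "deriv_over (loc_ring A S) Q (loc_der A (self_module A) S \<delta> \<delta>) (loc_der A M S \<delta> D)"
proof -
  interpret N: loc_mod A S "self_module A" by (rule loc_mod_self)
  note d = deriv_overD [OF D] and e = N.deriv_overD [OF \<delta>, simplified]
  show ?thesis unfolding deriv_over_def
  proof (intro conjI ballI)
    fix X assume "X \<in> carrier (loc_ring A S)"
    then show "loc_der A (self_module A) S \<delta> \<delta> X \<in> carrier (loc_ring A S)"
      by (elim loc_ring_cases) (auto simp: N.loc_der_frac [OF \<delta>] e)
  next
    fix X assume "X \<in> carrier Q"
    then show "loc_der A M S \<delta> D X \<in> carrier Q"
      by (elim Q_cases) (auto simp: loc_der_frac [OF D] d)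
  next
    fix X Y assume X: "X \<in> carrier Q" and Y: "Y \<in> carrier Q"
    obtain m n s where x: "m \<in> carrier M" "n \<in> carrier M" "s \<in> S" "X = frac m s" "Y = frac n s"
      by (rule Q_cases2 [OF X Y])
    then show "loc_der A M S \<delta> D (X \<oplus>\<^bsub>Q\<^esub> Y) = loc_der A M S \<delta> D X \<oplus>\<^bsub>Q\<^esub> loc_der A M S \<delta> D Y"
      by (simp add: loc_der_frac [OF D] d) (simp add: lin d)
  next
    fix X Y assume X: "X \<in> carrier (loc_ring A S)" and Y: "Y \<in> carrier Q"
    obtain a r where x1: "a \<in> carrier A" "r \<in> S" "X = N.frac a r" by (rule loc_ring_cases [OF X])
    obtain m t where x2: "m \<in> carrier M" "t \<in> S" "Y = frac m t" by (rule Q_cases [OF Y])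
    note x = x1 x2
    let ?l = "(r \<otimes> t) \<odot>\<^bsub>M\<^esub> D (a \<odot>\<^bsub>M\<^esub> m) \<ominus>\<^bsub>M\<^esub> \<delta> (r \<otimes> t) \<odot>\<^bsub>M\<^esub> (a \<odot>\<^bsub>M\<^esub> m)"
    let ?p = "a \<odot>\<^bsub>M\<^esub> (t \<odot>\<^bsub>M\<^esub> D m \<ominus>\<^bsub>M\<^esub> \<delta> t \<odot>\<^bsub>M\<^esub> m)" and ?q = "(r \<otimes> \<delta> a \<ominus> \<delta> r \<otimes> a) \<odot>\<^bsub>M\<^esub> m"
    have "loc_der A M S \<delta> D (X \<odot>\<^bsub>Q\<^esub> Y) = frac ?l ((r \<otimes> t) \<otimes> (r \<otimes> t))"
      using x d by (simp add: loc_der_frac [OF D])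
    also have "\<dots> = frac (r \<odot>\<^bsub>M\<^esub> ?p \<oplus>\<^bsub>M\<^esub> t \<odot>\<^bsub>M\<^esub> ?q) ((r \<otimes> t) \<otimes> (r \<otimes> t))"
      using x d e by (intro arg_cong2 [of _ _ _ _ frac] refl) (simp add: lin)
    also have "\<dots> = frac (r \<odot>\<^bsub>M\<^esub> ?p) (r \<otimes> (r \<otimes> (t \<otimes> t))) \<oplus>\<^bsub>Q\<^esub> frac (t \<odot>\<^bsub>M\<^esub> ?q) (t \<otimes> ((r \<otimes> r) \<otimes> t))"
    proof -
      have 1: "(r \<otimes> t) \<otimes> (r \<otimes> t) = r \<otimes> (r \<otimes> (t \<otimes> t))" using x by (simp add: m_ac)
      have 2: "t \<otimes> ((r \<otimes> r) \<otimes> t) = r \<otimes> (r \<otimes> (t \<otimes> t))" using x by (simp add: m_ac)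
      show ?thesis unfolding 1 2 using x d e by (subst frac_add) auto
    qed
    also have "\<dots> = frac ?p (r \<otimes> (t \<otimes> t)) \<oplus>\<^bsub>Q\<^esub> frac ?q ((r \<otimes> r) \<otimes> t)"
      using x d e by (subst (1 2) frac_cancel) auto
    also have "\<dots> = X \<odot>\<^bsub>Q\<^esub> loc_der A M S \<delta> D Y \<oplus>\<^bsub>Q\<^esub> loc_der A (self_module A) S \<delta> \<delta> X \<odot>\<^bsub>Q\<^esub> Y"
      using x d e by (simp add: loc_der_frac [OF D] N.loc_der_frac [OF \<delta>])
    finally show "loc_der A M S \<delta> D (X \<odot>\<^bsub>Q\<^esub> Y) =
      X \<odot>\<^bsub>Q\<^esub> loc_der A M S \<delta> D Y \<oplus>\<^bsub>Q\<^esub> loc_der A (self_module A) S \<delta> \<delta> X \<odot>\<^bsub>Q\<^esub> Y" .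
  qed
qed

section \<open>Bases and traces\<close>

lemma (in abelian_monoid) finsum_swap:
  assumes "finite I" "finite J" "\<And>i j. i \<in> I \<Longrightarrow> j \<in> J \<Longrightarrow> f i j \<in> carrier G"
  shows "(\<Oplus>i\<in>I. \<Oplus>j\<in>J. f i j) = (\<Oplus>j\<in>J. \<Oplus>i\<in>I. f i j)"
  using assms(1,3)
proof (induction I)
  case empty
  then show ?case by (simp add: finsum_zero)
next
  case (insert k I)
  then have "(\<Oplus>i\<in>insert k I. \<Oplus>j\<in>J. f i j) = (\<Oplus>j\<in>J. f k j) \<oplus> (\<Oplus>j\<in>J. \<Oplus>i\<in>I. f i j)"
    by (subst finsum_insert) auto
  also have "\<dots> = (\<Oplus>j\<in>J. f k j \<oplus> (\<Oplus>i\<in>I. f i j))"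
    using insert by (intro finsum_addf [symmetric]) auto
  also have "\<dots> = (\<Oplus>j\<in>J. \<Oplus>i\<in>insert k I. f i j)"
    using insert by (intro finsum_cong) (auto simp: simp_implies_def)
  finally show ?case .
qed

lemma finsum_additive:
  assumes "abelian_group G" "abelian_group H"
    and "\<And>x. x \<in> carrier G \<Longrightarrow> f x \<in> carrier H"
    and add: "\<And>x y. x \<in> carrier G \<Longrightarrow> y \<in> carrier G \<Longrightarrow> f (x \<oplus>\<^bsub>G\<^esub> y) = f x \<oplus>\<^bsub>H\<^esub> f y"
    and "finite I" and "\<And>i. i \<in> I \<Longrightarrow> g i \<in> carrier G"
  shows "f (\<Oplus>\<^bsub>G\<^esub>i\<in>I. g i) = (\<Oplus>\<^bsub>H\<^esub>i\<in>I. f (g i))"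
proof -
  interpret G: abelian_group G by fact
  interpret H: abelian_group H by fact
  have f0: "f \<zero>\<^bsub>G\<^esub> = \<zero>\<^bsub>H\<^esub>"
  proof -
    have "f \<zero>\<^bsub>G\<^esub> \<oplus>\<^bsub>H\<^esub> f \<zero>\<^bsub>G\<^esub> = f \<zero>\<^bsub>G\<^esub>" using add [of "\<zero>\<^bsub>G\<^esub>" "\<zero>\<^bsub>G\<^esub>"] by simp
    then show ?thesis using assms(3) [of "\<zero>\<^bsub>G\<^esub>"] by (simp add: H.add.r_cancel_one')
  qed
  show ?thesis
    using assms(5,6)
  proof (induction I)
    case empty then show ?case by (simp add: f0)
  next
    case (insert k I)
    then show ?case using assms(3) by (simp add: add Pi_def)
  qed
qed

context cring
begin

text \<open>The product of an \<open>n\<close>-by-\<open>p\<close> and a \<open>p\<close>-by-\<open>m\<close> matrix, given entrywise on functions of indices, because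
the rank varies with the frame.\<close>

definition mat_mult :: "nat \<Rightarrow> (nat \<Rightarrow> nat \<Rightarrow> 'a) \<Rightarrow> (nat \<Rightarrow> nat \<Rightarrow> 'a) \<Rightarrow> nat \<Rightarrow> nat \<Rightarrow> 'a"
  where "mat_mult p X Y i j = (\<Oplus>k\<in>{..<p}. X i k \<otimes> Y k j)"

lemma mat_mult_closed [intro]:
  "(\<And>k. k < p \<Longrightarrow> X i k \<in> carrier R) \<Longrightarrow> (\<And>k. k < p \<Longrightarrow> Y k j \<in> carrier R) \<Longrightarrow> mat_mult p X Y i j \<in> carrier R"
  unfolding mat_mult_def by (intro finsum_closed) auto

lemma mat_mult_assoc:
  assumes X: "\<And>l. l < q \<Longrightarrow> X i l \<in> carrier R" and Y: "\<And>l k. l < q \<Longrightarrow> k < p \<Longrightarrow> Y l k \<in> carrier R"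
    and Z: "\<And>k. k < p \<Longrightarrow> Z k j \<in> carrier R"
  shows "mat_mult p (mat_mult q X Y) Z i j = mat_mult q X (mat_mult p Y Z) i j"
proof -
  have "mat_mult p (mat_mult q X Y) Z i j = (\<Oplus>k\<in>{..<p}. \<Oplus>l\<in>{..<q}. X i l \<otimes> Y l k \<otimes> Z k j)"
    unfolding mat_mult_def using assms by (intro finsum_cong' finsum_ldistr refl) auto
  also have "\<dots> = (\<Oplus>l\<in>{..<q}. \<Oplus>k\<in>{..<p}. X i l \<otimes> (Y l k \<otimes> Z k j))"
    using assms by (subst finsum_swap) (auto intro!: finsum_cong' finsum_closed simp: m_assoc)
  also have "\<dots> = mat_mult q X (mat_mult p Y Z) i j"
    unfolding mat_mult_def using assms by (intro finsum_cong' finsum_rdistr [symmetric] refl) auto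
  finally show ?thesis .
qed

lemma mat_trace_comm:
  assumes "\<And>i k. i < n \<Longrightarrow> k < p \<Longrightarrow> X i k \<in> carrier R" "\<And>i k. i < n \<Longrightarrow> k < p \<Longrightarrow> Y k i \<in> carrier R"
  shows "(\<Oplus>i\<in>{..<n}. mat_mult p X Y i i) = (\<Oplus>k\<in>{..<p}. mat_mult n Y X k k)"
  unfolding mat_mult_def using assms
  by (subst finsum_swap) (auto intro!: finsum_cong' finsum_closed simp: m_comm)

lemma mat_mult_one:
  assumes "\<And>i j. i < n \<Longrightarrow> j < n \<Longrightarrow> X i j \<in> carrier R" "i < n" "j < n"
    and "\<And>i j. i < n \<Longrightarrow> j < n \<Longrightarrow> I i j = (if i = j then \<one> else \<zero>)"
  shows "mat_mult n X I i j = X i j" "mat_mult n I X i j = X i j"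
proof -
  have "mat_mult n X I i j = (\<Oplus>k\<in>{..<n}. if j = k then X i k else \<zero>)"
    unfolding mat_mult_def using assms by (intro finsum_cong') auto
  also have "\<dots> = X i j" using assms by (intro finsum_singleton) auto
  finally show "mat_mult n X I i j = X i j" .
  have "mat_mult n I X i j = (\<Oplus>k\<in>{..<n}. if i = k then X k j else \<zero>)"
    unfolding mat_mult_def using assms by (intro finsum_cong') auto
  also have "\<dots> = X i j" using assms by (intro finsum_singleton) auto
  finally show "mat_mult n I X i j = X i j" .
qed

end

context module
begin

lemma finsum_smult_rdistr:
  assumes "finite I" "x \<in> carrier M" "\<And>i. i \<in> I \<Longrightarrow> f i \<in> carrier R"
  shows "(\<Oplus>i\<in>I. f i) \<odot>\<^bsub>M\<^esub> x = (\<Oplus>\<^bsub>M\<^esub>i\<in>I. f i \<odot>\<^bsub>M\<^esub> x)"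
  by (rule finsum_additive [where f = "\<lambda>a. a \<odot>\<^bsub>M\<^esub> x" and G = R and H = M])
    (use assms R.abelian_group_axioms M.abelian_group_axioms in \<open>auto simp: smult_l_distr\<close>)

abbreviation lincomb where "lincomb n c e \<equiv> (\<Oplus>\<^bsub>M\<^esub>i\<in>{..<n}. c i \<odot>\<^bsub>M\<^esub> e i)"

lemma lincomb_closed [intro]:
  "(\<And>i. i < n \<Longrightarrow> c i \<in> carrier R) \<Longrightarrow> (\<And>i. i < n \<Longrightarrow> e i \<in> carrier M) \<Longrightarrow> lincomb n c e \<in> carrier M"
  by (intro M.finsum_closed) auto

lemma lincomb_add:
  assumes "\<And>i. i < n \<Longrightarrow> c i \<in> carrier R" "\<And>i. i < n \<Longrightarrow> d i \<in> carrier R" "\<And>i. i < n \<Longrightarrow> e i \<in> carrier M"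
  shows "lincomb n (\<lambda>i. c i \<oplus> d i) e = lincomb n c e \<oplus>\<^bsub>M\<^esub> lincomb n d e"
proof -
  have "lincomb n (\<lambda>i. c i \<oplus> d i) e = (\<Oplus>\<^bsub>M\<^esub>i\<in>{..<n}. c i \<odot>\<^bsub>M\<^esub> e i \<oplus>\<^bsub>M\<^esub> d i \<odot>\<^bsub>M\<^esub> e i)"
    using assms by (intro M.finsum_cong') (auto simp: smult_l_distr)
  also have "\<dots> = lincomb n c e \<oplus>\<^bsub>M\<^esub> lincomb n d e"
    using assms by (intro M.finsum_addf) auto
  finally show ?thesis .
qed

lemma lincomb_lincomb:
  fixes n p :: nat
  assumes a: "\<And>j. j < p \<Longrightarrow> a j \<in> carrier R" and b: "\<And>i j. i < n \<Longrightarrow> j < p \<Longrightarrow> b i j \<in> carrier R"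
    and e: "\<And>i. i < n \<Longrightarrow> e i \<in> carrier M"
  shows "lincomb p a (\<lambda>j. lincomb n (\<lambda>i. b i j) e) = lincomb n (\<lambda>i. \<Oplus>j\<in>{..<p}. b i j \<otimes> a j) e"
proof -
  have "lincomb p a (\<lambda>j. lincomb n (\<lambda>i. b i j) e) = (\<Oplus>\<^bsub>M\<^esub>j\<in>{..<p}. \<Oplus>\<^bsub>M\<^esub>i\<in>{..<n}. (b i j \<otimes> a j) \<odot>\<^bsub>M\<^esub> e i)"
  proof (rule M.finsum_cong')
    fix j assume j: "j \<in> {..<p}"
    then have "a j \<odot>\<^bsub>M\<^esub> lincomb n (\<lambda>i. b i j) e = (\<Oplus>\<^bsub>M\<^esub>i\<in>{..<n}. a j \<odot>\<^bsub>M\<^esub> (b i j \<odot>\<^bsub>M\<^esub> e i))"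
      using assms by (intro finsum_smult_ldistr) auto
    also have "\<dots> = (\<Oplus>\<^bsub>M\<^esub>i\<in>{..<n}. (b i j \<otimes> a j) \<odot>\<^bsub>M\<^esub> e i)"
      using assms j by (intro M.finsum_cong') (auto simp: smult_assoc1 [symmetric] R.m_comm)
    finally show "a j \<odot>\<^bsub>M\<^esub> lincomb n (\<lambda>i. b i j) e = (\<Oplus>\<^bsub>M\<^esub>i\<in>{..<n}. (b i j \<otimes> a j) \<odot>\<^bsub>M\<^esub> e i)" .
  qed (use assms in auto)
  also have "\<dots> = (\<Oplus>\<^bsub>M\<^esub>i\<in>{..<n}. \<Oplus>\<^bsub>M\<^esub>j\<in>{..<p}. (b i j \<otimes> a j) \<odot>\<^bsub>M\<^esub> e i)"
    using assms by (intro M.finsum_swap) auto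
  also have "\<dots> = lincomb n (\<lambda>i. \<Oplus>j\<in>{..<p}. b i j \<otimes> a j) e"
  proof (rule M.finsum_cong' [OF refl])
    fix i assume i: "i \<in> {..<n}"
    show "(\<Oplus>\<^bsub>M\<^esub>j\<in>{..<p}. (b i j \<otimes> a j) \<odot>\<^bsub>M\<^esub> e i) = (\<Oplus>j\<in>{..<p}. b i j \<otimes> a j) \<odot>\<^bsub>M\<^esub> e i"
      by (rule finsum_smult_rdistr [symmetric]) (use assms i in auto)
  qed (use assms in \<open>auto intro!: smult_closed R.finsum_closed\<close>)
  finally show ?thesis .
qed

lemma deriv_over_lincomb:
  fixes n :: nat
  assumes D: "deriv_over R M \<delta> D" and c: "\<And>i. i < n \<Longrightarrow> c i \<in> carrier R" and e: "\<And>i. i < n \<Longrightarrow> e i \<in> carrier M"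
  shows "D (lincomb n c e) = lincomb n c (\<lambda>i. D (e i)) \<oplus>\<^bsub>M\<^esub> lincomb n (\<lambda>i. \<delta> (c i)) e"
proof -
  note d = deriv_overD [OF D]
  have "D (lincomb n c e) = (\<Oplus>\<^bsub>M\<^esub>i\<in>{..<n}. D (c i \<odot>\<^bsub>M\<^esub> e i))"
    by (rule finsum_additive) (use assms d M.abelian_group_axioms in auto)
  also have "\<dots> = (\<Oplus>\<^bsub>M\<^esub>i\<in>{..<n}. c i \<odot>\<^bsub>M\<^esub> D (e i) \<oplus>\<^bsub>M\<^esub> \<delta> (c i) \<odot>\<^bsub>M\<^esub> e i)"
    using assms d by (intro M.finsum_cong') auto
  also have "\<dots> = lincomb n c (\<lambda>i. D (e i)) \<oplus>\<^bsub>M\<^esub> lincomb n (\<lambda>i. \<delta> (c i)) e"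
    using assms d by (intro M.finsum_addf) auto
  finally show ?thesis .
qed

lemma linear_lincomb:
  fixes n :: nat
  assumes f: "deriv_over R M (\<lambda>_. \<zero>) f" and c: "\<And>i. i < n \<Longrightarrow> c i \<in> carrier R" and e: "\<And>i. i < n \<Longrightarrow> e i \<in> carrier M"
  shows "f (lincomb n c e) = lincomb n c (\<lambda>i. f (e i))"
proof -
  have "lincomb n (\<lambda>i. \<zero>) e = \<zero>\<^bsub>M\<^esub>" using e by (intro M.add.finprod_one_eqI) auto
  moreover have "lincomb n c (\<lambda>i. f (e i)) \<in> carrier M"
    using c e deriv_overD(2) [OF f] by auto
  ultimately show ?thesis using deriv_over_lincomb [OF f, of n c e] c e by simp
qed

lemma basis_closed: "is_basis R M n e \<Longrightarrow> i < n \<Longrightarrow> e i \<in> carrier M"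
  by (auto simp: is_basis_def)

lemma basis_unique:
  assumes "is_basis R M n e" "\<And>i. i < n \<Longrightarrow> c i \<in> carrier R" "\<And>i. i < n \<Longrightarrow> d i \<in> carrier R"
    and eq: "lincomb n c e = lincomb n d e" and i: "i < n"
  shows "c i = d i"
proof -
  note e = basis_closed [OF assms(1)]
  have r: "lincomb n (restrict c {..<n}) e = lincomb n c e" if "\<And>i. i < n \<Longrightarrow> c i \<in> carrier R" for c
    using e that by (intro M.finsum_cong') auto
  have "\<exists>!k. k \<in> {..<n} \<rightarrow>\<^sub>E carrier R \<and> lincomb n c e = lincomb n k e"
    using assms(1) lincomb_closed [of n c e] assms(2) e unfolding is_basis_def by blast
  moreover have "restrict c {..<n} \<in> {..<n} \<rightarrow>\<^sub>E carrier R" "restrict d {..<n} \<in> {..<n} \<rightarrow>\<^sub>E carrier R"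
    using assms by auto
  moreover have "lincomb n c e = lincomb n (restrict c {..<n}) e" "lincomb n c e = lincomb n (restrict d {..<n}) e"
    using r [of c] r [of d] eq assms(2,3) by simp_all
  ultimately have "restrict c {..<n} = restrict d {..<n}" by blast
  from fun_cong [OF this, of i] show ?thesis using i by simp
qed

lemma basis_matrix:
  assumes b: "is_basis R M n e" and x: "\<And>j. j < p \<Longrightarrow> x j \<in> carrier M"
  obtains c where "\<And>i j. i < n \<Longrightarrow> j < p \<Longrightarrow> c i j \<in> carrier R" "\<And>j. j < p \<Longrightarrow> x j = lincomb n (\<lambda>i. c i j) e"
proof -
  have "\<exists>k. (\<forall>i<n. k i \<in> carrier R) \<and> x j = lincomb n k e" if j: "j < p" for j
  proof -
    obtain k where "k \<in> {..<n} \<rightarrow>\<^sub>E carrier R" "x j = lincomb n k e"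
      using b x [OF j] unfolding is_basis_def by blast
    then show ?thesis by auto
  qed
  then have "\<forall>j. \<exists>k. j < p \<longrightarrow> (\<forall>i<n. k i \<in> carrier R) \<and> x j = lincomb n k e" by blast
  from choice [OF this] obtain k where "\<forall>j. j < p \<longrightarrow> (\<forall>i<n. k j i \<in> carrier R) \<and> x j = lincomb n (k j) e" ..
  then show thesis by (intro that [of "\<lambda>i j. k j i"]) auto
qed

text \<open>Column \<open>j\<close> of the product and of the identity matrix are both the coordinates of \<open>e j\<close>.\<close>

lemma basis_change_inverse:
  assumes b: "is_basis R M n e" and b': "is_basis R M n' e'"
    and P: "\<And>i k. i < n \<Longrightarrow> k < n' \<Longrightarrow> P i k \<in> carrier R" and eP: "\<And>k. k < n' \<Longrightarrow> e' k = lincomb n (\<lambda>i. P i k) e"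
    and Q: "\<And>k i. k < n' \<Longrightarrow> i < n \<Longrightarrow> Q k i \<in> carrier R" and eQ: "\<And>i. i < n \<Longrightarrow> e i = lincomb n' (\<lambda>k. Q k i) e'"
    and i: "i < n" and j: "j < n"
  shows "R.mat_mult n' P Q i j = (if i = j then \<one> else \<zero>)"
  unfolding R.mat_mult_def
proof (rule basis_unique [OF b _ _ _ i])
  note e = basis_closed [OF b] and e' = basis_closed [OF b']
  have "lincomb n (\<lambda>i. if i = j then \<one> else \<zero>) e = e j"
  proof -
    have "lincomb n (\<lambda>i. if i = j then \<one> else \<zero>) e = (\<Oplus>\<^bsub>M\<^esub>i\<in>{..<n}. if j = i then e i else \<zero>\<^bsub>M\<^esub>)"
      using e by (intro M.finsum_cong') auto
    also have "\<dots> = e j" using e j by (intro M.finsum_singleton) auto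
    finally show ?thesis .
  qed
  also have "\<dots> = lincomb n' (\<lambda>k. Q k j) (\<lambda>k. lincomb n (\<lambda>i. P i k) e)"
    unfolding eQ [OF j] using Q j P e e' eP by (intro M.finsum_cong') auto
  also have "\<dots> = lincomb n (\<lambda>i. \<Oplus>k\<in>{..<n'}. P i k \<otimes> Q k j) e"
    by (rule lincomb_lincomb) (use Q j P e in auto)
  finally show "lincomb n (\<lambda>i. \<Oplus>k\<in>{..<n'}. P i k \<otimes> Q k j) e = lincomb n (\<lambda>i. if i = j then \<one> else \<zero>) e"
    by (rule sym)
qed (use P Q j in auto)

text \<open>If \<open>c\<close> and \<open>c'\<close> are the matrices of \<open>f\<close> and \<open>P\<close>, \<open>Q\<close> those of the change of basis, then
\<open>tr c = tr (c P Q) = tr (P c' Q) = tr (Q P c') = tr c'\<close>. The ranks \<open>n\<close> and \<open>n'\<close> may differ a priori, so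
rectangular matrices are used throughout.\<close>

lemma trace_unique:
  assumes b: "is_basis R M n e" and b': "is_basis R M n' e'" and f: "deriv_over R M (\<lambda>_. \<zero>) f"
    and c: "\<And>i j. i < n \<Longrightarrow> j < n \<Longrightarrow> c i j \<in> carrier R"
    and fc: "\<And>j. j < n \<Longrightarrow> f (e j) = lincomb n (\<lambda>i. c i j) e"
    and c': "\<And>i j. i < n' \<Longrightarrow> j < n' \<Longrightarrow> c' i j \<in> carrier R"
    and fc': "\<And>j. j < n' \<Longrightarrow> f (e' j) = lincomb n' (\<lambda>i. c' i j) e'"
  shows "(\<Oplus>i\<in>{..<n}. c i i) = (\<Oplus>i\<in>{..<n'}. c' i i)"
proof -
  note e = basis_closed [OF b] and e' = basis_closed [OF b']
  obtain P where P: "\<And>i k. i < n \<Longrightarrow> k < n' \<Longrightarrow> P i k \<in> carrier R"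
      and eP: "\<And>k. k < n' \<Longrightarrow> e' k = lincomb n (\<lambda>i. P i k) e"
    using basis_matrix [OF b, of n' e'] e' by blast
  obtain Q where Q: "\<And>k i. k < n' \<Longrightarrow> i < n \<Longrightarrow> Q k i \<in> carrier R"
      and eQ: "\<And>i. i < n \<Longrightarrow> e i = lincomb n' (\<lambda>k. Q k i) e'"
    using basis_matrix [OF b', of n e] e by blast
  have cP: "R.mat_mult n c P i j = R.mat_mult n' P c' i j" if i: "i < n" and j: "j < n'" for i j
    unfolding R.mat_mult_def
  proof (rule basis_unique [OF b _ _ _ i])
    have "lincomb n (\<lambda>i. \<Oplus>l\<in>{..<n}. c i l \<otimes> P l j) e = lincomb n (\<lambda>l. P l j) (\<lambda>l. lincomb n (\<lambda>i. c i l) e)"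
      by (rule lincomb_lincomb [symmetric]) (use P j c e in auto)
    also have "\<dots> = lincomb n (\<lambda>l. P l j) (\<lambda>l. f (e l))"
      using P j c e fc by (intro M.finsum_cong') auto
    also have "\<dots> = f (e' j)"
      unfolding eP [OF j] by (rule linear_lincomb [OF f, symmetric]) (use P j e in auto)
    also have "\<dots> = lincomb n' (\<lambda>k. c' k j) (\<lambda>k. lincomb n (\<lambda>i. P i k) e)"
      unfolding fc' [OF j] using c' j P e e' eP by (intro M.finsum_cong') auto
    also have "\<dots> = lincomb n (\<lambda>i. \<Oplus>k\<in>{..<n'}. P i k \<otimes> c' k j) e"
      by (rule lincomb_lincomb) (use c' j P e in auto)
    finally show "lincomb n (\<lambda>i. \<Oplus>l\<in>{..<n}. c i l \<otimes> P l j) e = lincomb n (\<lambda>i. \<Oplus>k\<in>{..<n'}. P i k \<otimes> c' k j) e" .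
  qed (use P c c' j in auto)
  have PQ: "R.mat_mult n' P Q i j = (if i = j then \<one> else \<zero>)" if "i < n" "j < n" for i j
    by (rule basis_change_inverse [OF b b' P eP Q eQ that])
  have QP: "R.mat_mult n Q P i j = (if i = j then \<one> else \<zero>)" if "i < n'" "j < n'" for i j
    by (rule basis_change_inverse [OF b' b Q eQ P eP that])
  have "(\<Oplus>i\<in>{..<n}. c i i) = (\<Oplus>i\<in>{..<n}. R.mat_mult n c (R.mat_mult n' P Q) i i)"
    using c P Q by (intro R.finsum_cong' R.mat_mult_one(1) [symmetric]) (auto simp: PQ)
  also have "\<dots> = (\<Oplus>i\<in>{..<n}. R.mat_mult n' (R.mat_mult n c P) Q i i)"
    using c P Q by (intro R.finsum_cong' R.mat_mult_assoc [symmetric]) (auto intro!: R.mat_mult_closed)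
  also have "\<dots> = (\<Oplus>i\<in>{..<n}. R.mat_mult n' (R.mat_mult n' P c') Q i i)"
    using c c' P Q by (intro R.finsum_cong') (auto simp: R.mat_mult_def [of n' _ Q] cP intro!: R.finsum_cong' R.finsum_closed R.m_closed R.mat_mult_closed)
  also have "\<dots> = (\<Oplus>k\<in>{..<n'}. R.mat_mult n Q (R.mat_mult n' P c') k k)"
    using c' P Q by (intro R.mat_trace_comm) auto
  also have "\<dots> = (\<Oplus>k\<in>{..<n'}. R.mat_mult n' (R.mat_mult n Q P) c' k k)"
    using c' P Q by (intro R.finsum_cong' R.mat_mult_assoc [symmetric]) (auto intro!: R.mat_mult_closed)
  also have "\<dots> = (\<Oplus>k\<in>{..<n'}. c' k k)"
    using c' P Q by (intro R.finsum_cong' R.mat_mult_one(2)) (auto simp: QP)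
  finally show ?thesis .
qed

text \<open>Independence of the basis makes the definite description in the trace well defined.\<close>

lemma module_trace_eq:
  assumes b: "is_basis R M n e" and f: "deriv_over R M (\<lambda>_. \<zero>) f"
    and c: "\<And>i j. i < n \<Longrightarrow> j < n \<Longrightarrow> c i j \<in> carrier R"
    and fc: "\<And>j. j < n \<Longrightarrow> f (e j) = lincomb n (\<lambda>i. c i j) e"
  shows "module_trace R M f = (\<Oplus>i\<in>{..<n}. c i i)"
  unfolding module_trace_def
proof (rule the_equality)
  show "\<exists>n' e' c'. is_basis R M n' e' \<and> (\<forall>i<n'. \<forall>j<n'. c' i j \<in> carrier R) \<and>
     (\<forall>j<n'. f (e' j) = lincomb n' (\<lambda>i. c' i j) e') \<and> (\<Oplus>i\<in>{..<n}. c i i) = (\<Oplus>i\<in>{..<n'}. c' i i)"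
    using assms by (intro exI [of _ n] exI [of _ e] exI [of _ c]) auto
next
  fix t
  assume "\<exists>n' e' c'. is_basis R M n' e' \<and> (\<forall>i<n'. \<forall>j<n'. c' i j \<in> carrier R) \<and>
     (\<forall>j<n'. f (e' j) = lincomb n' (\<lambda>i. c' i j) e') \<and> t = (\<Oplus>i\<in>{..<n'}. c' i i)"
  then obtain n' e' c' where *: "is_basis R M n' e'" "\<forall>i<n'. \<forall>j<n'. c' i j \<in> carrier R"
    "\<forall>j<n'. f (e' j) = lincomb n' (\<lambda>i. c' i j) e'" and t: "t = (\<Oplus>i\<in>{..<n'}. c' i i)" by blast
  show "t = (\<Oplus>i\<in>{..<n}. c i i)"
    unfolding t by (rule trace_unique [OF *(1) b f]) (use * c fc in auto)
qed

lemma linear_matrix: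
  assumes b: "is_basis R M n e" and f: "deriv_over R M (\<lambda>_. \<zero>) f"
  obtains c where "\<And>i j. i < n \<Longrightarrow> j < n \<Longrightarrow> c i j \<in> carrier R" "\<And>j. j < n \<Longrightarrow> f (e j) = lincomb n (\<lambda>i. c i j) e"
    "module_trace R M f = (\<Oplus>i\<in>{..<n}. c i i)"
proof -
  obtain c where c: "\<And>i j. i < n \<Longrightarrow> j < n \<Longrightarrow> c i j \<in> carrier R" "\<And>j. j < n \<Longrightarrow> f (e j) = lincomb n (\<lambda>i. c i j) e"
    using basis_matrix [OF b, of n "\<lambda>j. f (e j)"] basis_closed [OF b] deriv_overD(2) [OF f] by blast
  then show thesis using module_trace_eq [OF b f] that by blast
qed

lemma trace_closed:
  assumes b: "is_basis R M n e" and f: "deriv_over R M (\<lambda>_. \<zero>) f"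
  shows "module_trace R M f \<in> carrier R"
  by (rule linear_matrix [OF b f]) (auto intro: R.finsum_closed)

lemma trace_cong:
  assumes b: "is_basis R M n e" and f: "deriv_over R M (\<lambda>_. \<zero>) f" and g: "deriv_over R M (\<lambda>_. \<zero>) g"
    and eq: "\<And>x. x \<in> carrier M \<Longrightarrow> f x = g x"
  shows "module_trace R M f = module_trace R M g"
proof -
  obtain c where c: "\<And>i j. i < n \<Longrightarrow> j < n \<Longrightarrow> c i j \<in> carrier R" "\<And>j. j < n \<Longrightarrow> g (e j) = lincomb n (\<lambda>i. c i j) e"
    "module_trace R M g = (\<Oplus>i\<in>{..<n}. c i i)"
    using linear_matrix [OF b g] by blast
  show ?thesis unfolding c(3) by (rule module_trace_eq [OF b f]) (use c eq basis_closed [OF b] in auto)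
qed

lemma trace_add:
  assumes b: "is_basis R M n e" and f: "deriv_over R M (\<lambda>_. \<zero>) f" and g: "deriv_over R M (\<lambda>_. \<zero>) g"
    and h: "deriv_over R M (\<lambda>_. \<zero>) h" and eq: "\<And>x. x \<in> carrier M \<Longrightarrow> h x = f x \<oplus>\<^bsub>M\<^esub> g x"
  shows "module_trace R M h = module_trace R M f \<oplus> module_trace R M g"
proof -
  obtain c where c: "\<And>i j. i < n \<Longrightarrow> j < n \<Longrightarrow> c i j \<in> carrier R" "\<And>j. j < n \<Longrightarrow> f (e j) = lincomb n (\<lambda>i. c i j) e"
    "module_trace R M f = (\<Oplus>i\<in>{..<n}. c i i)"
    using linear_matrix [OF b f] by blast
  obtain d where d: "\<And>i j. i < n \<Longrightarrow> j < n \<Longrightarrow> d i j \<in> carrier R" "\<And>j. j < n \<Longrightarrow> g (e j) = lincomb n (\<lambda>i. d i j) e"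
    "module_trace R M g = (\<Oplus>i\<in>{..<n}. d i i)"
    using linear_matrix [OF b g] by blast
  have "module_trace R M h = (\<Oplus>i\<in>{..<n}. c i i \<oplus> d i i)"
    by (rule module_trace_eq [OF b h, where c = "\<lambda>i j. c i j \<oplus> d i j"]) (use c d eq basis_closed [OF b] in \<open>auto simp: lincomb_add\<close>)
  also have "\<dots> = module_trace R M f \<oplus> module_trace R M g"
    unfolding c(3) d(3) using c d by (intro R.finsum_addf) auto
  finally show ?thesis .
qed

lemma trace_smult:
  assumes b: "is_basis R M n e" and f: "deriv_over R M (\<lambda>_. \<zero>) f" and a: "a \<in> carrier R"
    and h: "deriv_over R M (\<lambda>_. \<zero>) h" and eq: "\<And>x. x \<in> carrier M \<Longrightarrow> h x = a \<odot>\<^bsub>M\<^esub> f x"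
  shows "module_trace R M h = a \<otimes> module_trace R M f"
proof -
  obtain c where c: "\<And>i j. i < n \<Longrightarrow> j < n \<Longrightarrow> c i j \<in> carrier R" "\<And>j. j < n \<Longrightarrow> f (e j) = lincomb n (\<lambda>i. c i j) e"
    "module_trace R M f = (\<Oplus>i\<in>{..<n}. c i i)"
    using linear_matrix [OF b f] by blast
  note e = basis_closed [OF b]
  have "module_trace R M h = (\<Oplus>i\<in>{..<n}. a \<otimes> c i i)"
  proof (rule module_trace_eq [OF b h, where c = "\<lambda>i j. a \<otimes> c i j"])
    fix j assume j: "j < n"
    have "h (e j) = a \<odot>\<^bsub>M\<^esub> lincomb n (\<lambda>i. c i j) e" using eq e c(2) j by simp
    also have "\<dots> = (\<Oplus>\<^bsub>M\<^esub>i\<in>{..<n}. a \<odot>\<^bsub>M\<^esub> (c i j \<odot>\<^bsub>M\<^esub> e i))"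
      using a c e j by (intro finsum_smult_ldistr) auto
    also have "\<dots> = lincomb n (\<lambda>i. a \<otimes> c i j) e"
      using a c e j by (intro M.finsum_cong') (auto simp: smult_assoc1)
    finally show "h (e j) = lincomb n (\<lambda>i. a \<otimes> c i j) e" .
  qed (use a c in auto)
  also have "\<dots> = a \<otimes> module_trace R M f"
    unfolding c(3) using c a by (intro R.finsum_rdistr [symmetric]) auto
  finally show ?thesis .
qed

text \<open>In a basis \<open>D\<close> is \<open>\<delta> + \<Gamma>\<close> and \<open>f\<close> is a matrix \<open>c\<close>, so the commutator has the matrix
\<open>\<delta>(c) + (\<Gamma> c - c \<Gamma>)\<close>. The last two terms have the same trace.\<close>

lemma trace_commutator:
  assumes b: "is_basis R M n e" and f: "deriv_over R M (\<lambda>_. \<zero>) f"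
    and \<delta>: "deriv_over R (self_module R) \<delta> \<delta>" and D: "deriv_over R M \<delta> D"
    and h: "deriv_over R M (\<lambda>_. \<zero>) h" and eq: "\<And>x. x \<in> carrier M \<Longrightarrow> h x = D (f x) \<ominus>\<^bsub>M\<^esub> f (D x)"
  shows "module_trace R M h = \<delta> (module_trace R M f)"
proof -
  note e = basis_closed [OF b]
  note D' = deriv_overD [OF D] and f' = deriv_overD [OF f]
  note \<delta>' = module.deriv_overD [OF R.module_self \<delta>, simplified]
  obtain c where c: "\<And>i j. i < n \<Longrightarrow> j < n \<Longrightarrow> c i j \<in> carrier R" "\<And>j. j < n \<Longrightarrow> f (e j) = lincomb n (\<lambda>i. c i j) e"
    "module_trace R M f = (\<Oplus>i\<in>{..<n}. c i i)"
    using linear_matrix [OF b f] by blast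
  \<comment> \<open>\<open>g\<close> is the connection matrix \<open>\<Gamma>\<close>.\<close>
  obtain g where g: "\<And>i j. i < n \<Longrightarrow> j < n \<Longrightarrow> g i j \<in> carrier R" "\<And>j. j < n \<Longrightarrow> D (e j) = lincomb n (\<lambda>i. g i j) e"
    using basis_matrix [OF b, of n "\<lambda>j. D (e j)"] e D'(2) by blast
  let ?h = "\<lambda>i j. R.mat_mult n g c i j \<oplus> \<delta> (c i j) \<ominus> R.mat_mult n c g i j"
  have cl: "R.mat_mult n g c i j \<in> carrier R" "R.mat_mult n c g i j \<in> carrier R" "\<delta> (c i j) \<in> carrier R"
    if "i < n" "j < n" for i j
    using that c g \<delta>'(1) by auto
  have "module_trace R M h = (\<Oplus>i\<in>{..<n}. ?h i i)"
  proof (rule module_trace_eq [OF b h, where c = ?h])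
    fix j assume j: "j < n"
    have 1: "D (f (e j)) = lincomb n (\<lambda>i. R.mat_mult n g c i j \<oplus> \<delta> (c i j)) e"
    proof -
      have "D (f (e j)) = lincomb n (\<lambda>i. c i j) (\<lambda>i. D (e i)) \<oplus>\<^bsub>M\<^esub> lincomb n (\<lambda>i. \<delta> (c i j)) e"
        unfolding c(2) [OF j] by (rule deriv_over_lincomb [OF D]) (use c j e in auto)
      also have "lincomb n (\<lambda>i. c i j) (\<lambda>i. D (e i)) = lincomb n (\<lambda>i. c i j) (\<lambda>k. lincomb n (\<lambda>i. g i k) e)"
        using c g j e by (intro M.finsum_cong') auto
      also have "\<dots> = lincomb n (\<lambda>i. R.mat_mult n g c i j) e"
        unfolding R.mat_mult_def by (rule lincomb_lincomb) (use c g j e in auto)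
      finally show ?thesis using cl j e by (simp add: lincomb_add)
    qed
    have 2: "f (D (e j)) = lincomb n (\<lambda>i. R.mat_mult n c g i j) e"
    proof -
      have "f (D (e j)) = lincomb n (\<lambda>i. g i j) (\<lambda>i. f (e i))"
        unfolding g(2) [OF j] by (rule linear_lincomb [OF f]) (use g j e in auto)
      also have "\<dots> = lincomb n (\<lambda>i. g i j) (\<lambda>k. lincomb n (\<lambda>i. c i k) e)"
        using c g j e by (intro M.finsum_cong') auto
      also have "\<dots> = lincomb n (\<lambda>i. R.mat_mult n c g i j) e"
        unfolding R.mat_mult_def by (rule lincomb_lincomb) (use c g j e in auto)
      finally show ?thesis .
    qed
    have "D (f (e j)) = lincomb n (\<lambda>i. ?h i j) e \<oplus>\<^bsub>M\<^esub> f (D (e j))"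
      unfolding 1 2 using cl j e
      by (subst lincomb_add [symmetric]) (auto intro!: M.finsum_cong')
    then show "h (e j) = lincomb n (\<lambda>i. ?h i j) e"
      using eq e j cl D' f' by (subst eq) (auto simp: M.diff_eq_iff)
  qed (use cl in auto)
  moreover have "(\<Oplus>i\<in>{..<n}. ?h i i) \<oplus> (\<Oplus>i\<in>{..<n}. R.mat_mult n c g i i) =
      \<delta> (module_trace R M f) \<oplus> (\<Oplus>i\<in>{..<n}. R.mat_mult n c g i i)"
  proof -
    have "(\<Oplus>i\<in>{..<n}. ?h i i) \<oplus> (\<Oplus>i\<in>{..<n}. R.mat_mult n c g i i) =
       (\<Oplus>i\<in>{..<n}. ?h i i \<oplus> R.mat_mult n c g i i)"
      using cl by (intro R.finsum_addf [symmetric]) auto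
    also have "\<dots> = (\<Oplus>i\<in>{..<n}. \<delta> (c i i) \<oplus> R.mat_mult n g c i i)"
      using cl by (intro R.finsum_cong') (auto simp: R.a_comm [of "\<delta> _"])
    also have "\<dots> = (\<Oplus>i\<in>{..<n}. \<delta> (c i i)) \<oplus> (\<Oplus>i\<in>{..<n}. R.mat_mult n g c i i)"
      using cl by (intro R.finsum_addf) auto
    also have "(\<Oplus>i\<in>{..<n}. R.mat_mult n g c i i) = (\<Oplus>i\<in>{..<n}. R.mat_mult n c g i i)"
      using c g by (intro R.mat_trace_comm) auto
    also have "(\<Oplus>i\<in>{..<n}. \<delta> (c i i)) = \<delta> (module_trace R M f)"
      unfolding c(3) by (rule finsum_additive [symmetric]) (use \<delta>' c R.abelian_group_axioms in auto)
    finally show ?thesis .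
  qed
  ultimately show ?thesis
    using cl c \<delta>'(1) trace_closed [OF b f] by (simp add: R.finsum_closed Pi_def)
qed

end

section \<open>Lie-Rinehart algebras of derivations\<close>

text \<open>A Lie-Rinehart algebra with injective anchor, realized inside the derivations of \<open>A\<close>. Identities in
\<open>L\<close> may be checked on elements of \<open>A\<close>.\<close>

locale lie_rinehart = L?: module A L for A (structure) and L :: "('a, 'a \<Rightarrow> 'a, 'x) module_scheme" +
  assumes anchor: "\<delta> \<in> carrier L \<Longrightarrow> deriv_over A (self_module A) \<delta> \<delta>"
    and L_add: "\<delta> \<in> carrier L \<Longrightarrow> \<eta> \<in> carrier L \<Longrightarrow> a \<in> carrier A \<Longrightarrow> (\<delta> \<oplus>\<^bsub>L\<^esub> \<eta>) a = \<delta> a \<oplus> \<eta> a"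
    and L_smult: "\<delta> \<in> carrier L \<Longrightarrow> b \<in> carrier A \<Longrightarrow> a \<in> carrier A \<Longrightarrow> (b \<odot>\<^bsub>L\<^esub> \<delta>) a = b \<otimes> \<delta> a"
    and bracket_closed [simp, intro]: "\<delta> \<in> carrier L \<Longrightarrow> \<eta> \<in> carrier L \<Longrightarrow> lie_bracket A \<delta> \<eta> \<in> carrier L"
    and L_ext: "\<delta> \<in> carrier L \<Longrightarrow> \<eta> \<in> carrier L \<Longrightarrow> (\<And>a. a \<in> carrier A \<Longrightarrow> \<delta> a = \<eta> a) \<Longrightarrow> \<delta> = \<eta>"
begin

abbreviation br where "br \<equiv> lie_bracket A"

lemma anchorD:
  assumes "\<delta> \<in> carrier L"
  shows "a \<in> carrier A \<Longrightarrow> \<delta> a \<in> carrier A"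
    and "a \<in> carrier A \<Longrightarrow> b \<in> carrier A \<Longrightarrow> \<delta> (a \<oplus> b) = \<delta> a \<oplus> \<delta> b"
    and "a \<in> carrier A \<Longrightarrow> b \<in> carrier A \<Longrightarrow> \<delta> (a \<otimes> b) = a \<otimes> \<delta> b \<oplus> \<delta> a \<otimes> b"
  using module.deriv_overD [OF R.module_self anchor [OF assms], simplified] by auto

lemma deriv_zero:
  assumes "deriv_over A M \<delta> D" "module A M"
  shows "D \<zero>\<^bsub>M\<^esub> = \<zero>\<^bsub>M\<^esub>" "x \<in> carrier M \<Longrightarrow> y \<in> carrier M \<Longrightarrow> D (x \<ominus>\<^bsub>M\<^esub> y) = D x \<ominus>\<^bsub>M\<^esub> D y"
proof -
  interpret M: module A M by fact
  note d = M.deriv_overD [OF assms(1)]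
  have "D \<zero>\<^bsub>M\<^esub> \<oplus>\<^bsub>M\<^esub> D \<zero>\<^bsub>M\<^esub> = D \<zero>\<^bsub>M\<^esub>" using d(3) [of "\<zero>\<^bsub>M\<^esub>" "\<zero>\<^bsub>M\<^esub>"] by simp
  then show "D \<zero>\<^bsub>M\<^esub> = \<zero>\<^bsub>M\<^esub>" using d(2) [of "\<zero>\<^bsub>M\<^esub>"] by (simp add: M.add.r_cancel_one')
  assume xy: "x \<in> carrier M" "y \<in> carrier M"
  have "D (x \<ominus>\<^bsub>M\<^esub> y) \<oplus>\<^bsub>M\<^esub> D y = D x" using xy d(3) [of "x \<ominus>\<^bsub>M\<^esub> y" y] by simp
  then show "D (x \<ominus>\<^bsub>M\<^esub> y) = D x \<ominus>\<^bsub>M\<^esub> D y" using xy d(2) by (simp add: M.eq_diff_iff)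
qed

lemma anchor_diff: "\<delta> \<in> carrier L \<Longrightarrow> a \<in> carrier A \<Longrightarrow> b \<in> carrier A \<Longrightarrow> \<delta> (a \<ominus> b) = \<delta> a \<ominus> \<delta> b"
  using deriv_zero(2) [OF anchor module_self] by simp

lemma anchor_one: "\<delta> \<in> carrier L \<Longrightarrow> \<delta> \<one> = \<zero>"
  using anchorD(3) [of \<delta> \<one> \<one>] anchorD(1) [of \<delta> \<one>] by simp

lemma L_diff: "\<delta> \<in> carrier L \<Longrightarrow> \<eta> \<in> carrier L \<Longrightarrow> a \<in> carrier A \<Longrightarrow> (\<delta> \<ominus>\<^bsub>L\<^esub> \<eta>) a = \<delta> a \<ominus> \<eta> a"
  using L_add [of "\<delta> \<ominus>\<^bsub>L\<^esub> \<eta>" \<eta> a] anchorD(1) by (simp add: R.eq_diff_iff)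

lemma L_zero: "a \<in> carrier A \<Longrightarrow> \<zero>\<^bsub>L\<^esub> a = \<zero>"
  using L_diff [of "\<zero>\<^bsub>L\<^esub>" "\<zero>\<^bsub>L\<^esub>" a] anchorD(1) [of "\<zero>\<^bsub>L\<^esub>" a] by simp

lemma br_apply: "a \<in> carrier A \<Longrightarrow> br \<delta> \<eta> a = \<delta> (\<eta> a) \<ominus> \<eta> (\<delta> a)"
  by (simp add: lie_bracket_def)

lemmas L_apply = L_add L_smult L_diff L_zero br_apply

lemma br_self: "\<delta> \<in> carrier L \<Longrightarrow> br \<delta> \<delta> = \<zero>\<^bsub>L\<^esub>"
  by (rule L_ext) (simp_all add: L_apply anchorD)

lemma br_antisym: "\<delta> \<in> carrier L \<Longrightarrow> \<eta> \<in> carrier L \<Longrightarrow> br \<delta> \<eta> = \<zero>\<^bsub>L\<^esub> \<ominus>\<^bsub>L\<^esub> br \<eta> \<delta>"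
  by (rule L_ext) (simp_all add: L_apply anchorD R.diff_simps R.a_ac)

text \<open>The bracket with \<open>\<delta>\<close> satisfies the Leibniz rule over \<open>\<delta>\<close>, so it extends to fractions in the same way as a
connection does.\<close>

lemma ad_deriv: 
  assumes \<delta>: "\<delta> \<in> carrier L" shows "deriv_over A L \<delta> (br \<delta>)"
  unfolding deriv_over_def
proof (intro conjI ballI)
  fix \<eta> \<theta> assume "\<eta> \<in> carrier L" "\<theta> \<in> carrier L"
  then show "br \<delta> (\<eta> \<oplus>\<^bsub>L\<^esub> \<theta>) = br \<delta> \<eta> \<oplus>\<^bsub>L\<^esub> br \<delta> \<theta>"
    using \<delta> by (intro L_ext) (simp_all add: L_apply anchorD R.diff_simps R.a_ac)
next
  fix a \<eta> assume "a \<in> carrier A" "\<eta> \<in> carrier L"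
  then show "br \<delta> (a \<odot>\<^bsub>L\<^esub> \<eta>) = a \<odot>\<^bsub>L\<^esub> br \<delta> \<eta> \<oplus>\<^bsub>L\<^esub> \<delta> a \<odot>\<^bsub>L\<^esub> \<eta>"
    using \<delta> by (intro L_ext) (simp_all add: L_apply anchorD R.ring_lin)
qed (use \<delta> anchorD(1) [OF \<delta>] in auto)

lemma br_smult_left:
  assumes "\<delta> \<in> carrier L" "\<eta> \<in> carrier L" "a \<in> carrier A"
  shows "br (a \<odot>\<^bsub>L\<^esub> \<delta>) \<eta> = a \<odot>\<^bsub>L\<^esub> br \<delta> \<eta> \<ominus>\<^bsub>L\<^esub> \<eta> a \<odot>\<^bsub>L\<^esub> \<delta>"
  using assms by (intro L_ext) (simp_all add: L_apply anchorD R.ring_lin)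

lemma br_add_left:
  assumes "\<delta> \<in> carrier L" "\<eta> \<in> carrier L" "\<theta> \<in> carrier L"
  shows "br (\<delta> \<oplus>\<^bsub>L\<^esub> \<theta>) \<eta> = br \<delta> \<eta> \<oplus>\<^bsub>L\<^esub> br \<theta> \<eta>"
  using assms by (intro L_ext) (simp_all add: L_apply anchorD R.diff_simps R.a_ac)

text \<open>Arranged without signs, so that additivity of \<open>\<nabla>\<close> applies to it directly.\<close>

lemma jacobi:
  assumes "\<delta> \<in> carrier L" "\<eta> \<in> carrier L" "\<theta> \<in> carrier L"
  shows "br (br \<delta> \<eta>) \<theta> \<oplus>\<^bsub>L\<^esub> br (br \<eta> \<theta>) \<delta> = br (br \<delta> \<theta>) \<eta>"
  using assms by (intro L_ext) (simp_all add: L_apply anchorD anchor_diff R.diff_simps R.a_ac)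

end

text \<open>The letters \<open>a\<close> to \<open>f\<close> stand for the six products of three covariant derivatives, \<open>g\<close> to \<open>l\<close> for the six products
of one with the covariant derivative along a bracket, and \<open>r\<close>, \<open>s\<close> for the two parts into which the Jacobi
identity splits the covariant derivative along a double bracket.\<close>

lemma bianchi_terms:
  fixes G (structure)
  assumes "abelian_group G"
    and c: "a \<in> carrier G" "b \<in> carrier G" "c \<in> carrier G" "d \<in> carrier G" "e \<in> carrier G" "f \<in> carrier G"
      "g \<in> carrier G" "h \<in> carrier G" "i \<in> carrier G" "j \<in> carrier G" "k \<in> carrier G" "l \<in> carrier G"
      "r \<in> carrier G" "s \<in> carrier G"
  shows "((a \<ominus> b \<ominus> g) \<ominus> (d \<ominus> f \<ominus> h)) \<oplus> ((e \<ominus> f \<ominus> k) \<ominus> (a \<ominus> c \<ominus> l)) \<oplus> ((j \<ominus> i) \<ominus> (r \<oplus> s)) =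
     ((c \<ominus> d \<ominus> i) \<ominus> (b \<ominus> e \<ominus> j)) \<oplus> ((l \<ominus> k) \<ominus> r) \<oplus> ((h \<ominus> g) \<ominus> s)"
proof -
  interpret abelian_group G by fact
  have 1: "((a \<ominus> b \<ominus> g) \<ominus> (d \<ominus> f \<ominus> h)) = (a \<ominus> b \<ominus> d \<oplus> f) \<oplus> (h \<ominus> g)"
    using c by (simp add: minus_eq minus_add a_ac)
  have 2: "((e \<ominus> f \<ominus> k) \<ominus> (a \<ominus> c \<ominus> l)) = (e \<ominus> f \<ominus> a \<oplus> c) \<oplus> (l \<ominus> k)"
    using c by (simp add: minus_eq minus_add a_ac)
  have 3: "((c \<ominus> d \<ominus> i) \<ominus> (b \<ominus> e \<ominus> j)) = (c \<ominus> d \<ominus> b \<oplus> e) \<oplus> (j \<ominus> i)"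
    using c by (simp add: minus_eq minus_add a_ac)
  have 4: "(a \<ominus> b \<ominus> d \<oplus> f) \<oplus> (e \<ominus> f \<ominus> a \<oplus> c) = c \<ominus> d \<ominus> b \<oplus> e"
  proof -
    have "(a \<ominus> b \<ominus> d \<oplus> f) \<oplus> (e \<ominus> f \<ominus> a \<oplus> c) = (a \<oplus> \<ominus> a) \<oplus> (f \<oplus> \<ominus> f) \<oplus> (c \<ominus> d \<ominus> b \<oplus> e)"
      using c by (simp add: minus_eq a_ac del: r_neg)
    then show ?thesis using c by (simp add: r_neg)
  qed
  have 5: "P \<oplus> x \<oplus> (Q \<oplus> y) \<oplus> (z \<ominus> (r \<oplus> s)) = ((P \<oplus> Q) \<oplus> z) \<oplus> (y \<ominus> r) \<oplus> (x \<ominus> s)"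
    if "P \<in> carrier G" "Q \<in> carrier G" "x \<in> carrier G" "y \<in> carrier G" "z \<in> carrier G" for P Q x y z
    using that c by (simp add: minus_eq minus_add a_ac)
  show ?thesis unfolding 1 2 3 4 [symmetric] by (rule 5) (use c in simp_all)
qed

section \<open>Connections and curvature\<close>

locale lr_connection = lie_rinehart A L + W?: module A W
  for A (structure) and L :: "('a, 'a \<Rightarrow> 'a, 'x) module_scheme" and W :: "('a, 'w, 'z) module_scheme" +
  fixes nabla :: "('a \<Rightarrow> 'a) \<Rightarrow> 'w \<Rightarrow> 'w"
  assumes conn: "\<delta> \<in> carrier L \<Longrightarrow> deriv_over A W \<delta> (nabla \<delta>)"
    and conn_add: "\<delta> \<in> carrier L \<Longrightarrow> \<eta> \<in> carrier L \<Longrightarrow> w \<in> carrier W \<Longrightarrow>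
      nabla (\<delta> \<oplus>\<^bsub>L\<^esub> \<eta>) w = nabla \<delta> w \<oplus>\<^bsub>W\<^esub> nabla \<eta> w"
    and conn_smult: "\<delta> \<in> carrier L \<Longrightarrow> a \<in> carrier A \<Longrightarrow> w \<in> carrier W \<Longrightarrow>
      nabla (a \<odot>\<^bsub>L\<^esub> \<delta>) w = a \<odot>\<^bsub>W\<^esub> nabla \<delta> w"
begin

abbreviation curv where "curv \<equiv> curvature A W nabla"

lemma conn_closed: "\<delta> \<in> carrier L \<Longrightarrow> w \<in> carrier W \<Longrightarrow> nabla \<delta> w \<in> carrier W"
  using W.deriv_overD(2) [OF conn] .

lemma conn_diff:
  assumes "\<delta> \<in> carrier L" "\<eta> \<in> carrier L" "w \<in> carrier W"
  shows "nabla (\<delta> \<ominus>\<^bsub>L\<^esub> \<eta>) w = nabla \<delta> w \<ominus>\<^bsub>W\<^esub> nabla \<eta> w"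
  using conn_add [of "\<delta> \<ominus>\<^bsub>L\<^esub> \<eta>" \<eta> w] assms conn_closed by (simp add: W.M.eq_diff_iff)

lemma conn_zero: "w \<in> carrier W \<Longrightarrow> nabla \<zero>\<^bsub>L\<^esub> w = \<zero>\<^bsub>W\<^esub>"
  using conn_diff [of "\<zero>\<^bsub>L\<^esub>" "\<zero>\<^bsub>L\<^esub>" w] conn_closed [of "\<zero>\<^bsub>L\<^esub>" w] by simp

lemma conn_minus_arg: "\<delta> \<in> carrier L \<Longrightarrow> v \<in> carrier W \<Longrightarrow> w \<in> carrier W \<Longrightarrow>
    nabla \<delta> (v \<ominus>\<^bsub>W\<^esub> w) = nabla \<delta> v \<ominus>\<^bsub>W\<^esub> nabla \<delta> w"
  using deriv_zero(2) [OF conn] W.module_axioms by blast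

lemma conn_add_arg: "\<delta> \<in> carrier L \<Longrightarrow> v \<in> carrier W \<Longrightarrow> w \<in> carrier W \<Longrightarrow>
    nabla \<delta> (v \<oplus>\<^bsub>W\<^esub> w) = nabla \<delta> v \<oplus>\<^bsub>W\<^esub> nabla \<delta> w"
  using W.deriv_overD(3) [OF conn] .

lemma conn_leibniz: "\<delta> \<in> carrier L \<Longrightarrow> a \<in> carrier A \<Longrightarrow> w \<in> carrier W \<Longrightarrow>
    nabla \<delta> (a \<odot>\<^bsub>W\<^esub> w) = a \<odot>\<^bsub>W\<^esub> nabla \<delta> w \<oplus>\<^bsub>W\<^esub> \<delta> a \<odot>\<^bsub>W\<^esub> w"
  using W.deriv_overD(4) [OF conn] .

lemmas conn_simps = conn_closed conn_diff conn_zero conn_minus_arg conn_add conn_smult conn_add_arg conn_leibniz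

lemma curv_apply: "w \<in> carrier W \<Longrightarrow>
    curv \<delta> \<eta> w = (nabla \<delta> (nabla \<eta> w) \<ominus>\<^bsub>W\<^esub> nabla \<eta> (nabla \<delta> w)) \<ominus>\<^bsub>W\<^esub> nabla (br \<delta> \<eta>) w"
  by (simp add: curvature_def)

lemma curv_closed: "\<delta> \<in> carrier L \<Longrightarrow> \<eta> \<in> carrier L \<Longrightarrow> w \<in> carrier W \<Longrightarrow> curv \<delta> \<eta> w \<in> carrier W"
  by (simp add: curv_apply conn_closed)

lemma curv_linear:
  assumes "\<delta> \<in> carrier L" "\<eta> \<in> carrier L"
  shows "deriv_over A W (\<lambda>_. \<zero>) (curv \<delta> \<eta>)"
  unfolding deriv_over_def
proof (intro conjI ballI)
  fix x y assume "x \<in> carrier W" "y \<in> carrier W"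
  then show "curv \<delta> \<eta> (x \<oplus>\<^bsub>W\<^esub> y) = curv \<delta> \<eta> x \<oplus>\<^bsub>W\<^esub> curv \<delta> \<eta> y"
    using assms by (simp add: curv_apply conn_simps W.M.diff_simps W.M.a_ac)
next
  fix a x assume ax: "a \<in> carrier A" "x \<in> carrier W"
  then have "curv \<delta> \<eta> (a \<odot>\<^bsub>W\<^esub> x) = a \<odot>\<^bsub>W\<^esub> curv \<delta> \<eta> x"
    using assms by (simp add: curv_apply conn_simps br_apply anchorD W.lin)
  then show "curv \<delta> \<eta> (a \<odot>\<^bsub>W\<^esub> x) = a \<odot>\<^bsub>W\<^esub> curv \<delta> \<eta> x \<oplus>\<^bsub>W\<^esub> \<zero> \<odot>\<^bsub>W\<^esub> x"
    using assms ax by (simp add: curv_closed)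
qed (use assms curv_closed in auto)

lemma curv_add_left:
  assumes "\<delta> \<in> carrier L" "\<delta>' \<in> carrier L" "\<eta> \<in> carrier L" "w \<in> carrier W"
  shows "curv (\<delta> \<oplus>\<^bsub>L\<^esub> \<delta>') \<eta> w = curv \<delta> \<eta> w \<oplus>\<^bsub>W\<^esub> curv \<delta>' \<eta> w"
  using assms by (simp add: curv_apply conn_simps br_add_left W.M.diff_simps W.M.a_ac)

lemma curv_smult_left:
  assumes "\<delta> \<in> carrier L" "a \<in> carrier A" "\<eta> \<in> carrier L" "w \<in> carrier W"
  shows "curv (a \<odot>\<^bsub>L\<^esub> \<delta>) \<eta> w = a \<odot>\<^bsub>W\<^esub> curv \<delta> \<eta> w"
  using assms by (simp add: curv_apply conn_simps br_smult_left anchorD W.lin)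

lemma curv_self: "\<delta> \<in> carrier L \<Longrightarrow> w \<in> carrier W \<Longrightarrow> curv \<delta> \<delta> w = \<zero>\<^bsub>W\<^esub>"
  by (simp add: curv_apply br_self conn_simps)

lemma curv_antisym:
  assumes "\<delta> \<in> carrier L" "\<eta> \<in> carrier L" "w \<in> carrier W"
  shows "curv \<delta> \<eta> w = \<ominus>\<^bsub>W\<^esub> curv \<eta> \<delta> w"
  using assms by (simp add: curv_apply br_antisym [of \<delta> \<eta>] conn_simps W.M.diff_simps W.M.a_ac)

lemma curv_smult_right:
  assumes "\<delta> \<in> carrier L" "a \<in> carrier A" "\<eta> \<in> carrier L" "w \<in> carrier W"
  shows "curv \<delta> (a \<odot>\<^bsub>L\<^esub> \<eta>) w = a \<odot>\<^bsub>W\<^esub> curv \<delta> \<eta> w"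
  using assms by (simp add: curv_antisym [of \<delta>] curv_smult_left curv_closed W.smult_r_minus)

text \<open>The covariant derivative of an endomorphism \<open>f\<close>.\<close>

abbreviation comm where "comm \<delta> f w \<equiv> nabla \<delta> (f w) \<ominus>\<^bsub>W\<^esub> f (nabla \<delta> w)"

text \<open>The two Leibniz terms \<open>\<delta>(a) f(w)\<close> cancel in the commutator.\<close>

lemma comm_linear:
  assumes "\<delta> \<in> carrier L" "deriv_over A W (\<lambda>_. \<zero>) f"
  shows "deriv_over A W (\<lambda>_. \<zero>) (comm \<delta> f)"
  unfolding deriv_over_def
proof (intro conjI ballI)
  note f = W.deriv_overD [OF assms(2)]
  fix x y assume "x \<in> carrier W" "y \<in> carrier W"
  then show "comm \<delta> f (x \<oplus>\<^bsub>W\<^esub> y) = comm \<delta> f x \<oplus>\<^bsub>W\<^esub> comm \<delta> f y"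
    using assms by (simp add: conn_simps f W.M.diff_simps W.M.a_ac)
next
  note f = W.deriv_overD [OF assms(2)]
  fix a x assume ax: "a \<in> carrier A" "x \<in> carrier W"
  then show "comm \<delta> f (a \<odot>\<^bsub>W\<^esub> x) = a \<odot>\<^bsub>W\<^esub> comm \<delta> f x \<oplus>\<^bsub>W\<^esub> \<zero> \<odot>\<^bsub>W\<^esub> x"
    using assms by (simp add: conn_simps f anchorD W.lin)
qed (use assms W.deriv_overD [OF assms(2)] in \<open>auto simp: conn_closed\<close>)

text \<open>Expanding every curvature gives triple products of \<open>\<nabla>\<close>, which cancel as in the Jacobi identity for
operators, products of \<open>\<nabla>\<close> with \<open>\<nabla>\<close> of a bracket, which cancel between commutators and curvatures,
and \<open>\<nabla>\<close> of double brackets, which cancel by the Jacobi identity.\<close>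

lemma bianchi:
  assumes "\<delta> \<in> carrier L" "\<eta> \<in> carrier L" "\<theta> \<in> carrier L" "w \<in> carrier W"
  shows "(comm \<delta> (curv \<eta> \<theta>) w \<oplus>\<^bsub>W\<^esub> comm \<theta> (curv \<delta> \<eta>) w) \<oplus>\<^bsub>W\<^esub> curv (br \<delta> \<theta>) \<eta> w =
    (comm \<eta> (curv \<delta> \<theta>) w \<oplus>\<^bsub>W\<^esub> curv (br \<delta> \<eta>) \<theta> w) \<oplus>\<^bsub>W\<^esub> curv (br \<eta> \<theta>) \<delta> w"
proof -
  note c = assms
  have r: "nabla (br (br \<delta> \<theta>) \<eta>) w = nabla (br (br \<delta> \<eta>) \<theta>) w \<oplus>\<^bsub>W\<^esub> nabla (br (br \<eta> \<theta>) \<delta>) w"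
    using c by (simp add: jacobi [OF c(1,2,3), symmetric] conn_add)
  have e: "comm x (curv y z) w = (nabla x (nabla y (nabla z w)) \<ominus>\<^bsub>W\<^esub> nabla x (nabla z (nabla y w)) \<ominus>\<^bsub>W\<^esub> nabla x (nabla (br y z) w))
     \<ominus>\<^bsub>W\<^esub> (nabla y (nabla z (nabla x w)) \<ominus>\<^bsub>W\<^esub> nabla z (nabla y (nabla x w)) \<ominus>\<^bsub>W\<^esub> nabla (br y z) (nabla x w))"
    if "x \<in> carrier L" "y \<in> carrier L" "z \<in> carrier L" for x y z
    using that c(4) by (simp add: curv_apply conn_closed conn_minus_arg)
  show ?thesis
    unfolding e [OF c(1,2,3)] e [OF c(3,1,2)] e [OF c(2,1,3)]
    unfolding curv_apply [OF c(4)] r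
    by (rule bianchi_terms [OF W.M.abelian_group_axioms]) (use c in \<open>simp_all add: conn_closed\<close>)
qed

end

section \<open>Two connections\<close>

locale lr_connections = N: lr_connection A L W nabla + X: lr_connection A L W nabla'
  for A (structure) and L :: "('a, 'a \<Rightarrow> 'a, 'x) module_scheme" and W :: "('a, 'w, 'z) module_scheme"
    and nabla nabla'
begin

definition conn_diff_map :: "('a \<Rightarrow> 'a) \<Rightarrow> 'w \<Rightarrow> 'w" where
  "conn_diff_map \<delta> w = nabla' \<delta> w \<ominus>\<^bsub>W\<^esub> nabla \<delta> w"

text \<open>The Leibniz terms \<open>\<delta>(a) w\<close> of the two connections cancel.\<close>

lemma conn_diff_linear:
  assumes "\<delta> \<in> carrier L"
  shows "deriv_over A W (\<lambda>_. \<zero>) (conn_diff_map \<delta>)"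
  unfolding deriv_over_def conn_diff_map_def
proof (intro conjI ballI)
  fix x y assume "x \<in> carrier W" "y \<in> carrier W"
  then show "nabla' \<delta> (x \<oplus>\<^bsub>W\<^esub> y) \<ominus>\<^bsub>W\<^esub> nabla \<delta> (x \<oplus>\<^bsub>W\<^esub> y) = (nabla' \<delta> x \<ominus>\<^bsub>W\<^esub> nabla \<delta> x) \<oplus>\<^bsub>W\<^esub> (nabla' \<delta> y \<ominus>\<^bsub>W\<^esub> nabla \<delta> y)"
    using assms by (simp add: N.conn_simps X.conn_simps N.W.M.diff_simps N.W.M.a_ac)
next
  fix a x assume ax: "a \<in> carrier A" "x \<in> carrier W"
  then show "nabla' \<delta> (a \<odot>\<^bsub>W\<^esub> x) \<ominus>\<^bsub>W\<^esub> nabla \<delta> (a \<odot>\<^bsub>W\<^esub> x) = a \<odot>\<^bsub>W\<^esub> (nabla' \<delta> x \<ominus>\<^bsub>W\<^esub> nabla \<delta> x) \<oplus>\<^bsub>W\<^esub> \<zero> \<odot>\<^bsub>W\<^esub> x"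
    using assms by (simp add: N.conn_simps X.conn_simps N.anchorD N.W.lin)
qed (use assms in \<open>auto simp: N.conn_closed X.conn_closed\<close>)

lemma conn_diff_add:
  assumes "\<delta> \<in> carrier L" "\<eta> \<in> carrier L" "w \<in> carrier W"
  shows "conn_diff_map (\<delta> \<oplus>\<^bsub>L\<^esub> \<eta>) w = conn_diff_map \<delta> w \<oplus>\<^bsub>W\<^esub> conn_diff_map \<eta> w"
  using assms by (simp add: conn_diff_map_def N.conn_simps X.conn_simps N.W.M.diff_simps N.W.M.a_ac)

lemma conn_diff_smult:
  assumes "\<delta> \<in> carrier L" "a \<in> carrier A" "w \<in> carrier W"
  shows "conn_diff_map (a \<odot>\<^bsub>L\<^esub> \<delta>) w = a \<odot>\<^bsub>W\<^esub> conn_diff_map \<delta> w"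
  using assms by (simp add: conn_diff_map_def N.conn_simps X.conn_simps N.W.smult_minus_distr)

text \<open>Writing \<open>E\<close> for the difference, \<open>[\<nabla>' \<eta>, E \<delta>]\<close> and \<open>[\<nabla> \<delta>, E \<eta>]\<close> together account for the quadratic term of
\<open>[\<nabla> \<delta> + E \<delta>, \<nabla> \<eta> + E \<eta>]\<close>, so only linear expressions in \<open>E\<close> appear.\<close>

lemma curvature_change:
  assumes "\<delta> \<in> carrier L" "\<eta> \<in> carrier L" "w \<in> carrier W"
  shows "(X.curv \<delta> \<eta> w \<oplus>\<^bsub>W\<^esub> X.comm \<eta> (conn_diff_map \<delta>) w) \<oplus>\<^bsub>W\<^esub> conn_diff_map (N.br \<delta> \<eta>) w =
    N.curv \<delta> \<eta> w \<oplus>\<^bsub>W\<^esub> N.comm \<delta> (conn_diff_map \<eta>) w"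
  using assms by (simp add: conn_diff_map_def N.curv_apply X.curv_apply N.conn_simps X.conn_simps N.W.M.diff_simps N.W.M.a_ac)

end

section \<open>The Lie-Rinehart structure on stalks\<close>

text \<open>The complement \<open>S\<close> of \<open>p\<close> has a name of its own, so that everything here is an instance of
localization at a multiplicative set.\<close>

locale lr_prime = lie_rinehart A L for A (structure) and L :: "('a, 'a \<Rightarrow> 'a, 'x) module_scheme" +
  fixes p and S
  assumes S_eq: "carrier A - p = S" and multset_S: "multset A S"

sublocale lr_prime \<subseteq> RS: loc_mod A S "self_module A"
  by (intro loc_mod.intro multset_S module_self)

sublocale lr_prime \<subseteq> LS: loc_mod A S L
  by (intro loc_mod.intro multset_S module_axioms)

sublocale lr_prime \<subseteq> K: cring "loc_ring A S"
  by (rule RS.loc_ring_cring)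

sublocale lr_prime \<subseteq> LM: module "loc_ring A S" "loc_module A L S"
  by (rule LS.loc_module_module)

context lr_prime
begin

abbreviation K where "K \<equiv> loc_ring A S"
abbreviation LQ where "LQ \<equiv> loc_module A L S"
abbreviation act where "act \<equiv> stalk_action A p"
abbreviation sbr where "sbr \<equiv> stalk_bracket A L p"
abbreviation DK where "DK \<delta> \<equiv> loc_der A (self_module A) S \<delta> \<delta>"
abbreviation u where "u s \<equiv> RS.frac \<one> s"
abbreviation \<iota> where "\<iota> \<delta> \<equiv> LS.frac \<delta> \<one>"

lemma DK_deriv: "\<delta> \<in> carrier L \<Longrightarrow> deriv_over K (self_module K) (DK \<delta>) (DK \<delta>)"
proof -
  assume \<delta>: "\<delta> \<in> carrier L"
  have "deriv_over K (loc_module A (self_module A) S) (DK \<delta>) (DK \<delta>)"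
    by (rule RS.loc_der_deriv [OF anchor [OF \<delta>] anchor [OF \<delta>]])
  then show ?thesis by (simp add: deriv_over_def)
qed

lemma DK_frac:
  assumes "\<delta> \<in> carrier L" "a \<in> carrier A" "t \<in> S"
  shows "DK \<delta> (RS.frac a t) = RS.frac (t \<otimes> \<delta> a \<ominus> a \<otimes> \<delta> t) (t \<otimes> t)"
  using RS.loc_der_frac [OF anchor [OF assms(1)], of a t] assms anchorD(1) [OF assms(1)] by (simp add: m_comm)

lemma frac_\<iota>: "\<delta> \<in> carrier L \<Longrightarrow> s \<in> S \<Longrightarrow> LS.frac \<delta> s = u s \<odot>\<^bsub>LQ\<^esub> \<iota> \<delta>"
  using LS.frac_smult [of \<one> \<delta> s \<one>] RS.S_one by simp

lemma \<iota>_closed: "\<delta> \<in> carrier L \<Longrightarrow> \<iota> \<delta> \<in> carrier LQ" and u_closed: "s \<in> S \<Longrightarrow> u s \<in> carrier K"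
  using LS.frac_closed RS.frac_closed RS.S_one by simp_all

text \<open>The action is \<open>(1/s)\<close> times the localized derivation. Independence of the representative of \<open>\<delta>/s\<close> holds
because \<open>v r \<delta> = v s \<eta>\<close> as derivations of \<open>A\<close>, and independence of the second representative is that of
the quotient rule.\<close>

lemma act_frac:
  assumes \<delta>: "\<delta> \<in> carrier L" and s: "s \<in> S" and Y: "Y \<in> carrier K"
  shows "act (LS.frac \<delta> s) Y = u s \<otimes>\<^bsub>K\<^esub> DK \<delta> Y"
proof -
  obtain a t where Y: "a \<in> carrier A" "t \<in> S" "Y = RS.frac a t" by (rule RS.loc_ring_cases [OF Y])
  have 1: "(\<Union>(a, t)\<in>Y. RS.frac (t \<otimes> \<delta> a \<ominus> a \<otimes> \<delta> t) (s \<otimes> (t \<otimes> t))) = RS.frac (t \<otimes> \<delta> a \<ominus> a \<otimes> \<delta> t) (s \<otimes> (t \<otimes> t))"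
    if \<delta>: "\<delta> \<in> carrier L" and s: "s \<in> S" for \<delta> s
    unfolding Y(3)
  proof (rule RS.UN_frac)
    note d = anchorD(1) [OF \<delta>]
    fix b r assume b: "b \<in> carrier (self_module A)" "r \<in> S" "RS.frac b r = RS.frac a t"
    have *: "RS.frac (t \<otimes> \<delta> a \<ominus> a \<otimes> \<delta> t) (s \<otimes> (t \<otimes> t)) = u s \<otimes>\<^bsub>K\<^esub> DK \<delta> (RS.frac a t)"
      if "a \<in> carrier A" "t \<in> S" for a t
      using that \<delta> s d RS.frac_smult [of \<one> "t \<otimes> \<delta> a \<ominus> a \<otimes> \<delta> t" s "t \<otimes> t"] by (simp add: DK_frac)
    show "RS.frac (r \<otimes> \<delta> b \<ominus> b \<otimes> \<delta> r) (s \<otimes> (r \<otimes> r)) = RS.frac (t \<otimes> \<delta> a \<ominus> a \<otimes> \<delta> t) (s \<otimes> (t \<otimes> t))"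
      using b Y(1,2) by (simp only: * self_module_simps)
  qed (use Y in auto)
  have "act (LS.frac \<delta> s) Y = (\<Union>(\<delta>, s)\<in>LS.frac \<delta> s. RS.frac (t \<otimes> \<delta> a \<ominus> a \<otimes> \<delta> t) (s \<otimes> (t \<otimes> t)))"
    unfolding stalk_action_def S_eq by (rule SUP_cong [OF refl], clarify, drule LS.mem_fracD, rule 1) auto
  also have "\<dots> = RS.frac (t \<otimes> \<delta> a \<ominus> a \<otimes> \<delta> t) (s \<otimes> (t \<otimes> t))"
  proof (rule LS.UN_frac [OF \<delta> s])
    fix \<eta> r assume \<eta>: "\<eta> \<in> carrier L" "r \<in> S" "LS.frac \<eta> r = LS.frac \<delta> s"
    then obtain v where v: "v \<in> S" "v \<odot>\<^bsub>L\<^esub> (r \<odot>\<^bsub>L\<^esub> \<delta>) = v \<odot>\<^bsub>L\<^esub> (s \<odot>\<^bsub>L\<^esub> \<eta>)"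
      using \<delta> s by (auto simp: LS.frac_eq_iff)
    have c: "v \<in> carrier A" "r \<in> carrier A" "s \<in> carrier A" "t \<in> carrier A" using v \<eta> s Y by auto
    have *: "v \<otimes> (r \<otimes> \<delta> x) = v \<otimes> (s \<otimes> \<eta> x)" if "x \<in> carrier A" for x
      using fun_cong [OF v(2), of x] that c \<eta> \<delta> by (simp add: L_smult)
    note d = anchorD(1) [OF \<delta>] anchorD(1) [OF \<eta>(1)]
    have "v \<otimes> (r \<otimes> (t \<otimes> t) \<otimes> (t \<otimes> \<delta> a \<ominus> a \<otimes> \<delta> t)) = (t \<otimes> t) \<otimes> (t \<otimes> (v \<otimes> (r \<otimes> \<delta> a)) \<ominus> a \<otimes> (v \<otimes> (r \<otimes> \<delta> t)))"
      using c d Y(1) by (simp add: R.minus_distr m_ac)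
    also have "\<dots> = v \<otimes> (s \<otimes> (t \<otimes> t) \<otimes> (t \<otimes> \<eta> a \<ominus> a \<otimes> \<eta> t))"
      unfolding * [OF c(4)] * [OF Y(1)] using c d Y(1) by (simp add: R.minus_distr m_ac)
    finally show "RS.frac (t \<otimes> \<eta> a \<ominus> a \<otimes> \<eta> t) (r \<otimes> (t \<otimes> t)) = RS.frac (t \<otimes> \<delta> a \<ominus> a \<otimes> \<delta> t) (s \<otimes> (t \<otimes> t))"
      using v c d Y \<eta> s by (subst RS.frac_eq_iff) (auto intro!: bexI [of _ v])
  qed
  also have "\<dots> = u s \<otimes>\<^bsub>K\<^esub> DK \<delta> Y"
    using Y \<delta> s anchorD(1) [OF \<delta>] RS.frac_smult [of \<one> "t \<otimes> \<delta> a \<ominus> a \<otimes> \<delta> t" s "t \<otimes> t"] by (simp add: DK_frac)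
  finally show ?thesis .
qed

lemma act_frac_frac:
  assumes "\<delta> \<in> carrier L" "s \<in> S" "a \<in> carrier A" "t \<in> S"
  shows "act (LS.frac \<delta> s) (RS.frac a t) = RS.frac (t \<otimes> \<delta> a \<ominus> a \<otimes> \<delta> t) (s \<otimes> (t \<otimes> t))"
  using assms anchorD(1) [OF assms(1)] RS.frac_smult [of \<one> "t \<otimes> \<delta> a \<ominus> a \<otimes> \<delta> t" s "t \<otimes> t"]
  by (simp add: DK_frac act_frac)

lemma act_add:
  assumes X: "X \<in> carrier LQ" and Y: "Y \<in> carrier K" "Z \<in> carrier K"
  shows "act X (Y \<oplus>\<^bsub>K\<^esub> Z) = act X Y \<oplus>\<^bsub>K\<^esub> act X Z"
proof -
  obtain \<delta> s where x: "\<delta> \<in> carrier L" "s \<in> S" "X = LS.frac \<delta> s" by (rule LS.Q_cases [OF X])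
  note d = module.deriv_overD [OF K.module_self DK_deriv [OF x(1)]]
  have "act X (Y \<oplus>\<^bsub>K\<^esub> Z) = u s \<otimes>\<^bsub>K\<^esub> DK \<delta> (Y \<oplus>\<^bsub>K\<^esub> Z)" unfolding x(3) by (rule act_frac) (use x Y in blast)+
  also have "DK \<delta> (Y \<oplus>\<^bsub>K\<^esub> Z) = DK \<delta> Y \<oplus>\<^bsub>K\<^esub> DK \<delta> Z" using d(3) [of Y Z] Y by simp
  also have "u s \<otimes>\<^bsub>K\<^esub> (DK \<delta> Y \<oplus>\<^bsub>K\<^esub> DK \<delta> Z) = u s \<otimes>\<^bsub>K\<^esub> DK \<delta> Y \<oplus>\<^bsub>K\<^esub> u s \<otimes>\<^bsub>K\<^esub> DK \<delta> Z"
    by (rule K.r_distr) (use d(1) Y u_closed [OF x(2)] in blast)+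
  finally show ?thesis unfolding x(3) using act_frac [OF x(1,2)] Y by simp
qed

text \<open>The numerator of the bracket of \<open>\<delta>/s\<close> and \<open>\<eta>/t\<close> over \<open>(s t)^2\<close>.\<close>

definition br_num where
  "br_num \<delta> s \<eta> t = ((s \<otimes> t) \<odot>\<^bsub>L\<^esub> lie_bracket A \<delta> \<eta> \<ominus>\<^bsub>L\<^esub> (s \<otimes> \<delta> t) \<odot>\<^bsub>L\<^esub> \<eta>) \<oplus>\<^bsub>L\<^esub> (t \<otimes> \<eta> s) \<odot>\<^bsub>L\<^esub> \<delta>"

abbreviation br_frac where "br_frac \<delta> s \<eta> t \<equiv> LS.frac (br_num \<delta> s \<eta> t) ((s \<otimes> t) \<otimes> (s \<otimes> t))"

lemma br_num_closed:
  assumes "\<delta> \<in> carrier L" "\<eta> \<in> carrier L" "s \<in> S" "t \<in> S"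
  shows "br_num \<delta> s \<eta> t \<in> carrier L"
  using assms anchorD(1) [OF assms(1)] anchorD(1) [OF assms(2)] by (simp add: br_num_def)

text \<open>The bracket is written as \<open>(1/s) [\<delta>, \<eta>/t]\<close> plus a multiple of \<open>\<delta>/s\<close> by the action of \<open>\<eta>/t\<close>. Both parts
depend on \<open>\<eta>/t\<close> only as a fraction, which is why the bracket is well defined in that argument.\<close>

lemma br_frac_right:
  assumes \<delta>: "\<delta> \<in> carrier L" and \<eta>: "\<eta> \<in> carrier L" and s: "s \<in> S" and t: "t \<in> S"
  shows "br_frac \<delta> s \<eta> t = u s \<odot>\<^bsub>LQ\<^esub> loc_der A L S \<delta> (br \<delta>) (LS.frac \<eta> t) \<oplus>\<^bsub>LQ\<^esub>
    (u s \<otimes>\<^bsub>K\<^esub> act (LS.frac \<eta> t) (RS.frac s \<one>)) \<odot>\<^bsub>LQ\<^esub> LS.frac \<delta> s"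
proof -
  note d = anchorD(1) [OF \<delta>] anchorD(1) [OF \<eta>]
  have c: "s \<in> carrier A" "t \<in> carrier A" using s t by auto
  let ?a = "t \<odot>\<^bsub>L\<^esub> br \<delta> \<eta> \<ominus>\<^bsub>L\<^esub> \<delta> t \<odot>\<^bsub>L\<^esub> \<eta>" and ?b = "\<eta> s \<odot>\<^bsub>L\<^esub> \<delta>"
  have 1: "u s \<odot>\<^bsub>LQ\<^esub> loc_der A L S \<delta> (br \<delta>) (LS.frac \<eta> t) = LS.frac ?a (s \<otimes> (t \<otimes> t))"
    using LS.frac_smult [of \<one> ?a s "t \<otimes> t"] \<delta> \<eta> s t c d by (simp add: LS.loc_der_frac [OF ad_deriv])
  have "act (LS.frac \<eta> t) (RS.frac s \<one>) = RS.frac (\<eta> s) t"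
    using \<eta> t c d RS.S_one by (simp add: act_frac_frac anchor_one)
  then have 2: "(u s \<otimes>\<^bsub>K\<^esub> act (LS.frac \<eta> t) (RS.frac s \<one>)) \<odot>\<^bsub>LQ\<^esub> LS.frac \<delta> s = LS.frac ?b (s \<otimes> t \<otimes> s)"
    using \<delta> \<eta> s t c d RS.frac_smult [of \<one> "\<eta> s" s t] LS.frac_smult [of "\<eta> s" \<delta> "s \<otimes> t" s] by simp
  have 3: "s \<otimes> (s \<otimes> (t \<otimes> t)) = (s \<otimes> t) \<otimes> (s \<otimes> t)" "t \<otimes> (s \<otimes> t \<otimes> s) = (s \<otimes> t) \<otimes> (s \<otimes> t)"
    using c by (simp_all add: m_ac)
  have "LS.frac ?a (s \<otimes> (t \<otimes> t)) = LS.frac (s \<odot>\<^bsub>L\<^esub> ?a) ((s \<otimes> t) \<otimes> (s \<otimes> t))"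
    using LS.frac_cancel [of ?a "s \<otimes> (t \<otimes> t)" s] \<delta> \<eta> s t c d unfolding 3 by simp
  moreover have "LS.frac ?b (s \<otimes> t \<otimes> s) = LS.frac (t \<odot>\<^bsub>L\<^esub> ?b) ((s \<otimes> t) \<otimes> (s \<otimes> t))"
    using LS.frac_cancel [of ?b "s \<otimes> t \<otimes> s" t] \<delta> \<eta> s t c d unfolding 3 by simp
  moreover have "br_num \<delta> s \<eta> t = s \<odot>\<^bsub>L\<^esub> ?a \<oplus>\<^bsub>L\<^esub> t \<odot>\<^bsub>L\<^esub> ?b"
    unfolding br_num_def using \<delta> \<eta> c d by (simp add: smult_minus_distr smult_assoc1)
  ultimately show ?thesis unfolding 1 2 using \<delta> \<eta> s t c d by (simp del: minus_add_distrib)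
qed

lemma br_frac_antisym:
  assumes \<delta>: "\<delta> \<in> carrier L" and \<eta>: "\<eta> \<in> carrier L" and s: "s \<in> S" and t: "t \<in> S"
  shows "br_frac \<eta> t \<delta> s = \<ominus>\<^bsub>LQ\<^esub> br_frac \<delta> s \<eta> t"
proof -
  note d = anchorD(1) [OF \<delta>] anchorD(1) [OF \<eta>]
  have c: "s \<in> carrier A" "t \<in> carrier A" using s t by auto
  have "br_num \<eta> t \<delta> s \<oplus>\<^bsub>L\<^esub> br_num \<delta> s \<eta> t = \<zero>\<^bsub>L\<^esub>"
    unfolding br_num_def br_antisym [OF \<eta> \<delta>] using \<delta> \<eta> c d by (simp add: lin)
  then have "br_frac \<eta> t \<delta> s \<oplus>\<^bsub>LQ\<^esub> br_frac \<delta> s \<eta> t = \<zero>\<^bsub>LQ\<^esub>"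
    using br_num_closed assms c by (simp add: m_comm [of t s] LS.frac_zero)
  then show ?thesis
    using LM.M.minus_equality [of "br_frac \<eta> t \<delta> s" "br_frac \<delta> s \<eta> t"] br_num_closed assms by simp
qed

text \<open>Independence of the right representative is \<open>br_frac_right\<close>; independence of the left one follows by
antisymmetry.\<close>

lemma sbr_frac:
  assumes \<delta>: "\<delta> \<in> carrier L" and \<eta>: "\<eta> \<in> carrier L" and s: "s \<in> S" and t: "t \<in> S"
  shows "sbr (LS.frac \<delta> s) (LS.frac \<eta> t) = br_frac \<delta> s \<eta> t"
proof -
  have r: "br_frac \<delta> s \<eta>' t' = br_frac \<delta> s \<eta> t"
    if "\<delta> \<in> carrier L" "\<eta> \<in> carrier L" "s \<in> S" "t \<in> S" "\<eta>' \<in> carrier L" "t' \<in> S" "LS.frac \<eta>' t' = LS.frac \<eta> t"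
    for \<delta> s \<eta> t \<eta>' t'
    using that by (simp only: br_frac_right)
  have l: "br_frac \<delta>' s' \<eta> t = br_frac \<delta> s \<eta> t"
    if "\<delta> \<in> carrier L" "\<eta> \<in> carrier L" "s \<in> S" "t \<in> S" "\<delta>' \<in> carrier L" "s' \<in> S" "LS.frac \<delta>' s' = LS.frac \<delta> s"
    for \<delta> s \<eta> t \<delta>' s'
    using that br_frac_antisym [of \<eta> \<delta> t s] br_frac_antisym [of \<eta> \<delta>' t s'] r [of \<eta> \<delta> t s \<delta>' s'] by simp
  have "sbr (LS.frac \<delta> s) (LS.frac \<eta> t) = (\<Union>(\<delta>, s)\<in>LS.frac \<delta> s. \<Union>(\<eta>, t)\<in>LS.frac \<eta> t. br_frac \<delta> s \<eta> t)"
    by (simp only: stalk_bracket_def br_num_def S_eq)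
  also have "\<dots> = (\<Union>(\<delta>, s)\<in>LS.frac \<delta> s. br_frac \<delta> s \<eta> t)"
  proof (rule SUP_cong [OF refl], clarify, drule LS.mem_fracD)
    fix \<delta> s assume 1: "\<delta> \<in> carrier L \<and> s \<in> S"
    show "(\<Union>(\<eta>, t)\<in>LS.frac \<eta> t. br_frac \<delta> s \<eta> t) = br_frac \<delta> s \<eta> t"
      by (rule LS.UN_frac [OF \<eta> t]) (rule r, use 1 \<eta> t in auto)
  qed
  also have "\<dots> = br_frac \<delta> s \<eta> t"
    by (rule LS.UN_frac [OF \<delta> s]) (rule l, use \<delta> \<eta> s t in auto)
  finally show ?thesis .
qed

lemma sbr_closed: "X \<in> carrier LQ \<Longrightarrow> Y \<in> carrier LQ \<Longrightarrow> sbr X Y \<in> carrier LQ"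
proof -
  assume X: "X \<in> carrier LQ" and Y: "Y \<in> carrier LQ"
  obtain \<delta> s where x: "\<delta> \<in> carrier L" "s \<in> S" "X = LS.frac \<delta> s" by (rule LS.Q_cases [OF X])
  obtain \<eta> t where y: "\<eta> \<in> carrier L" "t \<in> S" "Y = LS.frac \<eta> t" by (rule LS.Q_cases [OF Y])
  show ?thesis unfolding x(3) y(3) sbr_frac [OF x(1) y(1) x(2) y(2)]
    using x y br_num_closed by auto
qed

text \<open>The Leibniz rule on both sides for \<open>[(1/s) \<delta>, (1/t) \<eta>]\<close>, with the negative term moved to the left.\<close>

lemma sbr_expand:
  assumes \<delta>: "\<delta> \<in> carrier L" and \<eta>: "\<eta> \<in> carrier L" and s: "s \<in> S" and t: "t \<in> S"
  shows "sbr (LS.frac \<delta> s) (LS.frac \<eta> t) \<oplus>\<^bsub>LQ\<^esub> (u t \<otimes>\<^bsub>K\<^esub> DK \<eta> (u s)) \<odot>\<^bsub>LQ\<^esub> \<iota> \<delta> =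
    (u s \<otimes>\<^bsub>K\<^esub> u t) \<odot>\<^bsub>LQ\<^esub> \<iota> (br \<delta> \<eta>) \<oplus>\<^bsub>LQ\<^esub> (u s \<otimes>\<^bsub>K\<^esub> DK \<delta> (u t)) \<odot>\<^bsub>LQ\<^esub> \<iota> \<eta>"
proof -
  note d = anchorD(1) [OF \<delta>] anchorD(1) [OF \<eta>]
  have c: "s \<in> carrier A" "t \<in> carrier A" using s t by auto
  let ?D = "(s \<otimes> t) \<otimes> (s \<otimes> t)"
  have 1: "(u s \<otimes>\<^bsub>K\<^esub> u t) \<odot>\<^bsub>LQ\<^esub> \<iota> (br \<delta> \<eta>) = LS.frac ((s \<otimes> t) \<odot>\<^bsub>L\<^esub> br \<delta> \<eta>) ?D"
    using LS.frac_cancel [of "br \<delta> \<eta>" "s \<otimes> t" "s \<otimes> t"] \<delta> \<eta> s t c RS.S_one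
      RS.frac_smult [of \<one> \<one> s t] LS.frac_smult [of \<one> "br \<delta> \<eta>" "s \<otimes> t" \<one>] by simp
  have 2: "(u s \<otimes>\<^bsub>K\<^esub> DK \<delta> (u t)) \<odot>\<^bsub>LQ\<^esub> \<iota> \<eta> = LS.frac (\<ominus>\<^bsub>L\<^esub> ((s \<otimes> \<delta> t) \<odot>\<^bsub>L\<^esub> \<eta>)) ((s \<otimes> t) \<otimes> (s \<otimes> t))"
    if \<delta>: "\<delta> \<in> carrier L" and \<eta>: "\<eta> \<in> carrier L" and s: "s \<in> S" and t: "t \<in> S" for \<delta> \<eta> s t
  proof -
    note d = anchorD(1) [OF \<delta>] anchorD(1) [OF \<eta>]
    have c: "s \<in> carrier A" "t \<in> carrier A" using s t by auto
    have "DK \<delta> (u t) = RS.frac (\<ominus> \<delta> t) (t \<otimes> t)"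
      using \<delta> t c d by (simp add: DK_frac anchor_one R.minus_eq)
    then have "(u s \<otimes>\<^bsub>K\<^esub> DK \<delta> (u t)) \<odot>\<^bsub>LQ\<^esub> \<iota> \<eta> = LS.frac ((\<ominus> \<delta> t) \<odot>\<^bsub>L\<^esub> \<eta>) (s \<otimes> (t \<otimes> t))"
      using \<eta> s t c d RS.S_one RS.frac_smult [of \<one> "\<ominus> \<delta> t" s "t \<otimes> t"] LS.frac_smult [of "\<ominus> \<delta> t" \<eta> "s \<otimes> (t \<otimes> t)" \<one>]
      by simp
    also have "\<dots> = LS.frac (s \<odot>\<^bsub>L\<^esub> ((\<ominus> \<delta> t) \<odot>\<^bsub>L\<^esub> \<eta>)) (s \<otimes> (s \<otimes> (t \<otimes> t)))"
      using \<eta> s t c d by (intro LS.frac_cancel [symmetric]) auto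
    also have "s \<otimes> (s \<otimes> (t \<otimes> t)) = (s \<otimes> t) \<otimes> (s \<otimes> t)" using c by (simp add: m_ac)
    also have "s \<odot>\<^bsub>L\<^esub> ((\<ominus> \<delta> t) \<odot>\<^bsub>L\<^esub> \<eta>) = \<ominus>\<^bsub>L\<^esub> ((s \<otimes> \<delta> t) \<odot>\<^bsub>L\<^esub> \<eta>)"
      using \<eta> c d by (simp add: smult_l_minus smult_r_minus smult_assoc1)
    finally show ?thesis .
  qed
  have 3: "(u t \<otimes>\<^bsub>K\<^esub> DK \<eta> (u s)) \<odot>\<^bsub>LQ\<^esub> \<iota> \<delta> = LS.frac (\<ominus>\<^bsub>L\<^esub> ((t \<otimes> \<eta> s) \<odot>\<^bsub>L\<^esub> \<delta>)) ?D"
    using 2 [OF \<eta> \<delta> t s] c by (simp add: m_comm [of t s])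
  have "br_num \<delta> s \<eta> t \<oplus>\<^bsub>L\<^esub> \<ominus>\<^bsub>L\<^esub> ((t \<otimes> \<eta> s) \<odot>\<^bsub>L\<^esub> \<delta>) = (s \<otimes> t) \<odot>\<^bsub>L\<^esub> br \<delta> \<eta> \<oplus>\<^bsub>L\<^esub> \<ominus>\<^bsub>L\<^esub> ((s \<otimes> \<delta> t) \<odot>\<^bsub>L\<^esub> \<eta>)"
    unfolding br_num_def using \<delta> \<eta> c d by (simp add: M.minus_eq M.a_assoc M.r_neg)
  then show ?thesis
    unfolding sbr_frac [OF assms] 1 2 [OF assms] 3 using \<delta> \<eta> s t c d br_num_closed [OF assms] by simp
qed

end

section \<open>Closed and exact forms on stalks\<close>

text \<open>The letters \<open>p\<close>, \<open>q\<close>, \<open>r\<close>, \<open>v\<close>, \<open>w\<close>, \<open>z\<close> stand for the terms containing derivatives of denominators; each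
occurs once with either sign.\<close>

lemma (in abelian_group) cocycle_cancel:
  assumes c: "E1 \<in> carrier G" "E2 \<in> carrier G" "E3 \<in> carrier G" "B12 \<in> carrier G" "B13 \<in> carrier G" "B23 \<in> carrier G"
    "p \<in> carrier G" "q \<in> carrier G" "r \<in> carrier G" "v \<in> carrier G" "w \<in> carrier G" "z \<in> carrier G"
    and hyp: "(E1 \<oplus> E3) \<oplus> B13 = (E2 \<oplus> B12) \<oplus> B23"
  shows "(E1 \<oplus> (p \<oplus> q)) \<ominus> (E2 \<oplus> (r \<oplus> v)) \<oplus> (E3 \<oplus> (w \<oplus> z)) \<ominus> ((B12 \<oplus> q) \<ominus> v) \<oplus> ((B13 \<oplus> \<ominus> p) \<ominus> z) \<ominus> ((B23 \<oplus> \<ominus> r) \<ominus> \<ominus> w) = \<zero>"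
    (is "?l = _")
proof -
  let ?s = "p \<oplus> (q \<oplus> (r \<oplus> (v \<oplus> (w \<oplus> z))))"
  \<comment> \<open>Collecting positive and negative terms separately leaves the same sum \<open>?s\<close> on both sides.\<close>
  have "?l = (((E1 \<oplus> E3) \<oplus> B13) \<oplus> ?s) \<ominus> (((E2 \<oplus> B12) \<oplus> B23) \<oplus> ?s)"
    using c by (simp only: minus_eq minus_add minus_minus a_ac a_closed a_inv_closed)
  also have "\<dots> = \<zero>" unfolding hyp using c by (simp add: minus_eq r_neg)
  finally show ?thesis .
qed

lemma (in abelian_group) exact_cancel:
  assumes c: "F \<in> carrier G" "F' \<in> carrier G" "E1 \<in> carrier G" "E2 \<in> carrier G" "B \<in> carrier G"
    "p \<in> carrier G" "q \<in> carrier G" and hyp: "(F' \<oplus> E2) \<oplus> B = F \<oplus> E1"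
  shows "F' = F \<oplus> ((E1 \<oplus> p) \<ominus> (E2 \<oplus> q) \<ominus> ((B \<oplus> p) \<ominus> q))"
proof -
  have 1: "F \<oplus> ((E1 \<oplus> p) \<ominus> (E2 \<oplus> q) \<ominus> ((B \<oplus> p) \<ominus> q)) = (F \<oplus> E1) \<oplus> ((p \<oplus> q) \<ominus> (E2 \<oplus> (B \<oplus> (p \<oplus> q))))"
    using c by (simp only: minus_eq minus_add minus_minus a_ac a_closed a_inv_closed)
  have 2: "(F \<oplus> E1) \<oplus> ((p \<oplus> q) \<ominus> (E2 \<oplus> (B \<oplus> (p \<oplus> q)))) = F' \<oplus> ((E2 \<oplus> (B \<oplus> (p \<oplus> q))) \<ominus> (E2 \<oplus> (B \<oplus> (p \<oplus> q))))"
    unfolding hyp [symmetric] using c by (simp only: minus_eq minus_add minus_minus a_ac a_closed a_inv_closed)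
  show ?thesis unfolding 1 2 using c by (simp add: minus_eq r_neg)
qed

text \<open>The cocycle condition for \<open>(1/s) \<delta>\<close>, \<open>(1/t) \<eta>\<close>, \<open>(1/r) \<theta>\<close> after all operations have been expanded. Here \<open>u1\<close>,
\<open>u2\<close>, \<open>u3\<close> are the inverses of the denominators, \<open>d12\<close> is the first derivation applied to \<open>u2\<close> and so on,
\<open>f12\<close> is the value of the form on the first two global derivations, \<open>e1\<close> is the first derivation applied to
\<open>f23\<close>, and \<open>b12\<close> is the value on the bracket of the first two and the third. The hypothesis is the cocycle
condition for the global derivations.\<close>

lemma (in cring) cocycle_ring_identity:
  assumes c: "u1 \<in> carrier R" "u2 \<in> carrier R" "u3 \<in> carrier R"
    "d12 \<in> carrier R" "d13 \<in> carrier R" "d21 \<in> carrier R" "d23 \<in> carrier R" "d31 \<in> carrier R" "d32 \<in> carrier R"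
    "f12 \<in> carrier R" "f13 \<in> carrier R" "f23 \<in> carrier R" "e1 \<in> carrier R" "e2 \<in> carrier R" "e3 \<in> carrier R"
    "b12 \<in> carrier R" "b13 \<in> carrier R" "b23 \<in> carrier R"
    and hyp: "(e1 \<oplus> e3) \<oplus> b13 = (e2 \<oplus> b12) \<oplus> b23"
  shows "u1 \<otimes> (u2 \<otimes> (u3 \<otimes> e1 \<oplus> d13 \<otimes> f23) \<oplus> d12 \<otimes> (u3 \<otimes> f23))
    \<ominus> u2 \<otimes> (u1 \<otimes> (u3 \<otimes> e2 \<oplus> d23 \<otimes> f13) \<oplus> d21 \<otimes> (u3 \<otimes> f13))
    \<oplus> u3 \<otimes> (u1 \<otimes> (u2 \<otimes> e3 \<oplus> d32 \<otimes> f12) \<oplus> d31 \<otimes> (u2 \<otimes> f12))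
    \<ominus> (((u1 \<otimes> u2) \<otimes> (u3 \<otimes> b12) \<oplus> (u1 \<otimes> d12) \<otimes> (u3 \<otimes> f23)) \<ominus> (u2 \<otimes> d21) \<otimes> (u3 \<otimes> f13))
    \<oplus> (((u1 \<otimes> u3) \<otimes> (u2 \<otimes> b13) \<oplus> (u1 \<otimes> d13) \<otimes> (u2 \<otimes> (\<ominus> f23))) \<ominus> (u3 \<otimes> d31) \<otimes> (u2 \<otimes> f12))
    \<ominus> (((u2 \<otimes> u3) \<otimes> (u1 \<otimes> b23) \<oplus> (u2 \<otimes> d23) \<otimes> (u1 \<otimes> (\<ominus> f13))) \<ominus> (u3 \<otimes> d32) \<otimes> (u1 \<otimes> (\<ominus> f12))) = \<zero>"
proof -
  let ?E = "\<lambda>x. u1 \<otimes> (u2 \<otimes> (u3 \<otimes> x))"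
  let ?p = "u1 \<otimes> (u2 \<otimes> (d13 \<otimes> f23))" and ?q = "u1 \<otimes> (u3 \<otimes> (d12 \<otimes> f23))" and ?r = "u1 \<otimes> (u2 \<otimes> (d23 \<otimes> f13))"
  let ?v = "u2 \<otimes> (u3 \<otimes> (d21 \<otimes> f13))" and ?w = "u1 \<otimes> (u3 \<otimes> (d32 \<otimes> f12))" and ?z = "u2 \<otimes> (u3 \<otimes> (d31 \<otimes> f12))"
  have "u1 \<otimes> (u2 \<otimes> (u3 \<otimes> e1 \<oplus> d13 \<otimes> f23) \<oplus> d12 \<otimes> (u3 \<otimes> f23)) = ?E e1 \<oplus> (?p \<oplus> ?q)"
    "u2 \<otimes> (u1 \<otimes> (u3 \<otimes> e2 \<oplus> d23 \<otimes> f13) \<oplus> d21 \<otimes> (u3 \<otimes> f13)) = ?E e2 \<oplus> (?r \<oplus> ?v)"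
    "u3 \<otimes> (u1 \<otimes> (u2 \<otimes> e3 \<oplus> d32 \<otimes> f12) \<oplus> d31 \<otimes> (u2 \<otimes> f12)) = ?E e3 \<oplus> (?w \<oplus> ?z)"
    using c by (simp_all only: r_distr m_ac a_ac m_closed a_closed)
  moreover have "(u1 \<otimes> u2) \<otimes> (u3 \<otimes> b12) = ?E b12" "(u1 \<otimes> d12) \<otimes> (u3 \<otimes> f23) = ?q" "(u2 \<otimes> d21) \<otimes> (u3 \<otimes> f13) = ?v"
    "(u1 \<otimes> u3) \<otimes> (u2 \<otimes> b13) = ?E b13" "(u1 \<otimes> d13) \<otimes> (u2 \<otimes> (\<ominus> f23)) = \<ominus> ?p" "(u3 \<otimes> d31) \<otimes> (u2 \<otimes> f12) = ?z"
    "(u2 \<otimes> u3) \<otimes> (u1 \<otimes> b23) = ?E b23" "(u2 \<otimes> d23) \<otimes> (u1 \<otimes> (\<ominus> f13)) = \<ominus> ?r" "(u3 \<otimes> d32) \<otimes> (u1 \<otimes> (\<ominus> f12)) = \<ominus> ?w"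
    using c by (simp_all only: r_minus m_ac m_closed a_inv_closed)
  moreover have "(?E e1 \<oplus> ?E e3) \<oplus> ?E b13 = (?E e2 \<oplus> ?E b12) \<oplus> ?E b23"
  proof -
    have "?E ((e1 \<oplus> e3) \<oplus> b13) = ?E ((e2 \<oplus> b12) \<oplus> b23)" unfolding hyp ..
    then show ?thesis using c by (simp only: r_distr m_closed a_closed)
  qed
  ultimately show ?thesis using c by (simp only: cocycle_cancel m_closed)
qed

text \<open>The analogue for a coboundary: \<open>g1\<close>, \<open>g2\<close> are the values of the 1-form on the global derivations, \<open>e1\<close> is the
first derivation applied to \<open>g2\<close> and \<open>e2\<close> the second applied to \<open>g1\<close>.\<close>

lemma (in cring) exact_ring_identity:
  assumes c: "u1 \<in> carrier R" "u2 \<in> carrier R" "d12 \<in> carrier R" "d21 \<in> carrier R"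
    "g1 \<in> carrier R" "g2 \<in> carrier R" "e1 \<in> carrier R" "e2 \<in> carrier R" "b \<in> carrier R"
    "f \<in> carrier R" "f' \<in> carrier R"
    and hyp: "(f' \<oplus> e2) \<oplus> b = f \<oplus> e1"
  shows "u1 \<otimes> (u2 \<otimes> f') = u1 \<otimes> (u2 \<otimes> f) \<oplus> (u1 \<otimes> (u2 \<otimes> e1 \<oplus> d12 \<otimes> g2) \<ominus> u2 \<otimes> (u1 \<otimes> e2 \<oplus> d21 \<otimes> g1)
      \<ominus> (((u1 \<otimes> u2) \<otimes> b \<oplus> (u1 \<otimes> d12) \<otimes> g2) \<ominus> (u2 \<otimes> d21) \<otimes> g1))"
proof -
  let ?E = "\<lambda>x. u1 \<otimes> (u2 \<otimes> x)"
  let ?p = "u1 \<otimes> (d12 \<otimes> g2)" and ?q = "u2 \<otimes> (d21 \<otimes> g1)"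
  have 1: "u1 \<otimes> (u2 \<otimes> e1 \<oplus> d12 \<otimes> g2) = ?E e1 \<oplus> ?p" "u2 \<otimes> (u1 \<otimes> e2 \<oplus> d21 \<otimes> g1) = ?E e2 \<oplus> ?q"
    "(u1 \<otimes> u2) \<otimes> b = ?E b" "(u1 \<otimes> d12) \<otimes> g2 = ?p" "(u2 \<otimes> d21) \<otimes> g1 = ?q"
    using c by (simp_all only: r_distr m_ac m_closed)
  have "?E ((f' \<oplus> e2) \<oplus> b) = ?E (f \<oplus> e1)" unfolding hyp ..
  then have 2: "(?E f' \<oplus> ?E e2) \<oplus> ?E b = ?E f \<oplus> ?E e1" using c by (simp only: r_distr m_closed a_closed)
  show ?thesis unfolding 1 by (rule exact_cancel [OF _ _ _ _ _ _ _ 2]) (use c in simp_all)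
qed

context lr_prime
begin

lemma DKD:
  assumes "\<delta> \<in> carrier L" 
  shows "a \<in> carrier K \<Longrightarrow> DK \<delta> a \<in> carrier K"
    and "a \<in> carrier K \<Longrightarrow> b \<in> carrier K \<Longrightarrow> DK \<delta> (a \<otimes>\<^bsub>K\<^esub> b) = a \<otimes>\<^bsub>K\<^esub> DK \<delta> b \<oplus>\<^bsub>K\<^esub> DK \<delta> a \<otimes>\<^bsub>K\<^esub> b"
  by (fact module.deriv_overD(1,4) [OF K.module_self DK_deriv [OF assms], unfolded self_module_simps])+

text \<open>A linear form sees the bracket of fractions only through its values on the global derivations and their
bracket.\<close>

lemma functional_bracket:
  assumes cl: "\<And>X. X \<in> carrier LQ \<Longrightarrow> \<psi> X \<in> carrier K"
    and add: "\<And>X Y. X \<in> carrier LQ \<Longrightarrow> Y \<in> carrier LQ \<Longrightarrow> \<psi> (X \<oplus>\<^bsub>LQ\<^esub> Y) = \<psi> X \<oplus>\<^bsub>K\<^esub> \<psi> Y"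
    and smult: "\<And>a X. a \<in> carrier K \<Longrightarrow> X \<in> carrier LQ \<Longrightarrow> \<psi> (a \<odot>\<^bsub>LQ\<^esub> X) = a \<otimes>\<^bsub>K\<^esub> \<psi> X"
    and \<delta>: "\<delta> \<in> carrier L" and \<eta>: "\<eta> \<in> carrier L" and s: "s \<in> S" and t: "t \<in> S"
  shows "\<psi> (sbr (LS.frac \<delta> s) (LS.frac \<eta> t)) =
    ((u s \<otimes>\<^bsub>K\<^esub> u t) \<otimes>\<^bsub>K\<^esub> \<psi> (\<iota> (br \<delta> \<eta>)) \<oplus>\<^bsub>K\<^esub> (u s \<otimes>\<^bsub>K\<^esub> DK \<delta> (u t)) \<otimes>\<^bsub>K\<^esub> \<psi> (\<iota> \<eta>))
     \<ominus>\<^bsub>K\<^esub> (u t \<otimes>\<^bsub>K\<^esub> DK \<eta> (u s)) \<otimes>\<^bsub>K\<^esub> \<psi> (\<iota> \<delta>)"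
proof -
  note i = \<iota>_closed [OF \<delta>] \<iota>_closed [OF \<eta>] \<iota>_closed [OF bracket_closed [OF \<delta> \<eta>]]
  note us = u_closed [OF s] u_closed [OF t]
  note D = DKD(1) [OF \<delta> us(2)] DKD(1) [OF \<eta> us(1)]
  have b: "sbr (LS.frac \<delta> s) (LS.frac \<eta> t) \<in> carrier LQ"
    using \<delta> \<eta> s t by (intro sbr_closed LS.frac_closed)
  note m = K.m_closed LM.smult_closed
  have "\<psi> (sbr (LS.frac \<delta> s) (LS.frac \<eta> t)) \<oplus>\<^bsub>K\<^esub> (u t \<otimes>\<^bsub>K\<^esub> DK \<eta> (u s)) \<otimes>\<^bsub>K\<^esub> \<psi> (\<iota> \<delta>) =
    \<psi> (sbr (LS.frac \<delta> s) (LS.frac \<eta> t) \<oplus>\<^bsub>LQ\<^esub> (u t \<otimes>\<^bsub>K\<^esub> DK \<eta> (u s)) \<odot>\<^bsub>LQ\<^esub> \<iota> \<delta>)"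
    by (simp only: add [OF b m(2) [OF m(1) [OF us(2) D(2)] i(1)]] smult [OF m(1) [OF us(2) D(2)] i(1)])
  also have "\<dots> = (u s \<otimes>\<^bsub>K\<^esub> u t) \<otimes>\<^bsub>K\<^esub> \<psi> (\<iota> (br \<delta> \<eta>)) \<oplus>\<^bsub>K\<^esub> (u s \<otimes>\<^bsub>K\<^esub> DK \<delta> (u t)) \<otimes>\<^bsub>K\<^esub> \<psi> (\<iota> \<eta>)"
    unfolding sbr_expand [OF \<delta> \<eta> s t]
    by (simp only: add [OF m(2) [OF m(1) [OF us] i(3)] m(2) [OF m(1) [OF us(1) D(1)] i(2)]]
        smult [OF m(1) [OF us] i(3)] smult [OF m(1) [OF us(1) D(1)] i(2)])
  finally have e: "\<psi> (sbr (LS.frac \<delta> s) (LS.frac \<eta> t)) \<oplus>\<^bsub>K\<^esub> (u t \<otimes>\<^bsub>K\<^esub> DK \<eta> (u s)) \<otimes>\<^bsub>K\<^esub> \<psi> (\<iota> \<delta>) =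
    (u s \<otimes>\<^bsub>K\<^esub> u t) \<otimes>\<^bsub>K\<^esub> \<psi> (\<iota> (br \<delta> \<eta>)) \<oplus>\<^bsub>K\<^esub> (u s \<otimes>\<^bsub>K\<^esub> DK \<delta> (u t)) \<otimes>\<^bsub>K\<^esub> \<psi> (\<iota> \<eta>)" .
  show ?thesis
    by (rule iffD2 [OF K.eq_diff_iff e])
      (rule K.a_closed [OF m(1) [OF m(1) [OF us] cl [OF i(3)]] m(1) [OF m(1) [OF us(1) D(1)] cl [OF i(2)]]]
        m(1) [OF m(1) [OF us(2) D(2)] cl [OF i(1)]] cl [OF b])+
qed

text \<open>An alternating form over the local ring that satisfies the cocycle condition on global derivations
satisfies it on all germs, since germs are multiples \<open>(1/s) \<delta>\<close> and the derivatives of the factors \<open>1/s\<close> cancel.\<close>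

lemma stalk_cocycle:
  assumes cl: "\<And>X Y. X \<in> carrier LQ \<Longrightarrow> Y \<in> carrier LQ \<Longrightarrow> \<phi> X Y \<in> carrier K"
    and add: "\<And>X X' Y. X \<in> carrier LQ \<Longrightarrow> X' \<in> carrier LQ \<Longrightarrow> Y \<in> carrier LQ \<Longrightarrow> \<phi> (X \<oplus>\<^bsub>LQ\<^esub> X') Y = \<phi> X Y \<oplus>\<^bsub>K\<^esub> \<phi> X' Y"
    and smult: "\<And>a X Y. a \<in> carrier K \<Longrightarrow> X \<in> carrier LQ \<Longrightarrow> Y \<in> carrier LQ \<Longrightarrow> \<phi> (a \<odot>\<^bsub>LQ\<^esub> X) Y = a \<otimes>\<^bsub>K\<^esub> \<phi> X Y"
    and anti: "\<And>X Y. X \<in> carrier LQ \<Longrightarrow> Y \<in> carrier LQ \<Longrightarrow> \<phi> Y X = \<ominus>\<^bsub>K\<^esub> \<phi> X Y"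
    and hyp: "\<And>\<delta> \<eta> \<theta>. \<delta> \<in> carrier L \<Longrightarrow> \<eta> \<in> carrier L \<Longrightarrow> \<theta> \<in> carrier L \<Longrightarrow>
      (DK \<delta> (\<phi> (\<iota> \<eta>) (\<iota> \<theta>)) \<oplus>\<^bsub>K\<^esub> DK \<theta> (\<phi> (\<iota> \<delta>) (\<iota> \<eta>))) \<oplus>\<^bsub>K\<^esub> \<phi> (\<iota> (br \<delta> \<theta>)) (\<iota> \<eta>) =
      (DK \<eta> (\<phi> (\<iota> \<delta>) (\<iota> \<theta>)) \<oplus>\<^bsub>K\<^esub> \<phi> (\<iota> (br \<delta> \<eta>)) (\<iota> \<theta>)) \<oplus>\<^bsub>K\<^esub> \<phi> (\<iota> (br \<eta> \<theta>)) (\<iota> \<delta>)"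
    and XYZ: "X \<in> carrier LQ" "Y \<in> carrier LQ" "Z \<in> carrier LQ"
  shows "act X (\<phi> Y Z) \<ominus>\<^bsub>K\<^esub> act Y (\<phi> X Z) \<oplus>\<^bsub>K\<^esub> act Z (\<phi> X Y)
    \<ominus>\<^bsub>K\<^esub> \<phi> (sbr X Y) Z \<oplus>\<^bsub>K\<^esub> \<phi> (sbr X Z) Y \<ominus>\<^bsub>K\<^esub> \<phi> (sbr Y Z) X = \<zero>\<^bsub>K\<^esub>"
proof -
  obtain \<delta> s where x: "\<delta> \<in> carrier L" "s \<in> S" "X = LS.frac \<delta> s" by (rule LS.Q_cases [OF XYZ(1)])
  obtain \<eta> t where y: "\<eta> \<in> carrier L" "t \<in> S" "Y = LS.frac \<eta> t" by (rule LS.Q_cases [OF XYZ(2)])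
  obtain \<theta> r where z: "\<theta> \<in> carrier L" "r \<in> S" "Z = LS.frac \<theta> r" by (rule LS.Q_cases [OF XYZ(3)])
  note i = \<iota>_closed [OF x(1)] \<iota>_closed [OF y(1)] \<iota>_closed [OF z(1)]
  note us = u_closed [OF x(2)] u_closed [OF y(2)] u_closed [OF z(2)]
  have right: "\<phi> P (a \<odot>\<^bsub>LQ\<^esub> Q) = a \<otimes>\<^bsub>K\<^esub> \<phi> P Q" if "a \<in> carrier K" "P \<in> carrier LQ" "Q \<in> carrier LQ" for a P Q
    by (simp only: anti [of "a \<odot>\<^bsub>LQ\<^esub> Q" P] anti [of Q P] smult LM.smult_closed that K.r_minus cl)
  have r: "\<phi> P (LS.frac \<eta> t) = u t \<otimes>\<^bsub>K\<^esub> \<phi> P (\<iota> \<eta>)"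
    if "\<eta> \<in> carrier L" "t \<in> S" "P \<in> carrier LQ" for \<eta> t P
    by (simp only: frac_\<iota> right \<iota>_closed u_closed that)
  \<comment> \<open>Each operation is expanded so that \<open>\<phi>\<close> is evaluated on global derivations only.\<close>
  have lr: "\<phi> (LS.frac \<delta> s) (LS.frac \<eta> t) = u s \<otimes>\<^bsub>K\<^esub> (u t \<otimes>\<^bsub>K\<^esub> \<phi> (\<iota> \<delta>) (\<iota> \<eta>))"
    if "\<delta> \<in> carrier L" "s \<in> S" "\<eta> \<in> carrier L" "t \<in> S" for \<delta> s \<eta> t
    unfolding r [OF that(3,4) LS.frac_closed [OF that(1,2)]]
    by (simp only: frac_\<iota> smult \<iota>_closed u_closed that) (intro K.m_lcomm u_closed cl \<iota>_closed that)
  have B: "\<phi> (sbr (LS.frac \<delta> s) (LS.frac \<eta> t)) (LS.frac \<theta> r) =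
    ((u s \<otimes>\<^bsub>K\<^esub> u t) \<otimes>\<^bsub>K\<^esub> (u r \<otimes>\<^bsub>K\<^esub> \<phi> (\<iota> (br \<delta> \<eta>)) (\<iota> \<theta>)) \<oplus>\<^bsub>K\<^esub> (u s \<otimes>\<^bsub>K\<^esub> DK \<delta> (u t)) \<otimes>\<^bsub>K\<^esub> (u r \<otimes>\<^bsub>K\<^esub> \<phi> (\<iota> \<eta>) (\<iota> \<theta>)))
     \<ominus>\<^bsub>K\<^esub> (u t \<otimes>\<^bsub>K\<^esub> DK \<eta> (u s)) \<otimes>\<^bsub>K\<^esub> (u r \<otimes>\<^bsub>K\<^esub> \<phi> (\<iota> \<delta>) (\<iota> \<theta>))"
    if c: "\<delta> \<in> carrier L" "s \<in> S" "\<eta> \<in> carrier L" "t \<in> S" "\<theta> \<in> carrier L" "r \<in> S" for \<delta> s \<eta> t \<theta> r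
  proof -
    have f: "LS.frac \<theta> r \<in> carrier LQ" using c by blast
    have "\<phi> (sbr (LS.frac \<delta> s) (LS.frac \<eta> t)) (LS.frac \<theta> r) =
      ((u s \<otimes>\<^bsub>K\<^esub> u t) \<otimes>\<^bsub>K\<^esub> \<phi> (\<iota> (br \<delta> \<eta>)) (LS.frac \<theta> r) \<oplus>\<^bsub>K\<^esub> (u s \<otimes>\<^bsub>K\<^esub> DK \<delta> (u t)) \<otimes>\<^bsub>K\<^esub> \<phi> (\<iota> \<eta>) (LS.frac \<theta> r))
      \<ominus>\<^bsub>K\<^esub> (u t \<otimes>\<^bsub>K\<^esub> DK \<eta> (u s)) \<otimes>\<^bsub>K\<^esub> \<phi> (\<iota> \<delta>) (LS.frac \<theta> r)"
      by (rule functional_bracket [of "\<lambda>P. \<phi> P (LS.frac \<theta> r)",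
            OF cl [OF _ f] add [OF _ _ f] smult [OF _ _ f] c(1,3,2,4)])
    then show ?thesis
      by (simp only: r [OF c(5,6)] \<iota>_closed bracket_closed c)
  qed
  have act: "act (LS.frac \<delta> s) (a \<otimes>\<^bsub>K\<^esub> (b \<otimes>\<^bsub>K\<^esub> f)) =
      u s \<otimes>\<^bsub>K\<^esub> (a \<otimes>\<^bsub>K\<^esub> (b \<otimes>\<^bsub>K\<^esub> DK \<delta> f \<oplus>\<^bsub>K\<^esub> DK \<delta> b \<otimes>\<^bsub>K\<^esub> f) \<oplus>\<^bsub>K\<^esub> DK \<delta> a \<otimes>\<^bsub>K\<^esub> (b \<otimes>\<^bsub>K\<^esub> f))"
    if "\<delta> \<in> carrier L" "s \<in> S" "a \<in> carrier K" "b \<in> carrier K" "f \<in> carrier K" for \<delta> s a b f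
    by (simp only: act_frac DKD K.m_closed that)
  have "u s \<otimes>\<^bsub>K\<^esub> (u t \<otimes>\<^bsub>K\<^esub> (u r \<otimes>\<^bsub>K\<^esub> DK \<delta> (\<phi> (\<iota> \<eta>) (\<iota> \<theta>)) \<oplus>\<^bsub>K\<^esub> DK \<delta> (u r) \<otimes>\<^bsub>K\<^esub> \<phi> (\<iota> \<eta>) (\<iota> \<theta>)) \<oplus>\<^bsub>K\<^esub> DK \<delta> (u t) \<otimes>\<^bsub>K\<^esub> (u r \<otimes>\<^bsub>K\<^esub> \<phi> (\<iota> \<eta>) (\<iota> \<theta>)))
    \<ominus>\<^bsub>K\<^esub> u t \<otimes>\<^bsub>K\<^esub> (u s \<otimes>\<^bsub>K\<^esub> (u r \<otimes>\<^bsub>K\<^esub> DK \<eta> (\<phi> (\<iota> \<delta>) (\<iota> \<theta>)) \<oplus>\<^bsub>K\<^esub> DK \<eta> (u r) \<otimes>\<^bsub>K\<^esub> \<phi> (\<iota> \<delta>) (\<iota> \<theta>)) \<oplus>\<^bsub>K\<^esub> DK \<eta> (u s) \<otimes>\<^bsub>K\<^esub> (u r \<otimes>\<^bsub>K\<^esub> \<phi> (\<iota> \<delta>) (\<iota> \<theta>)))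
    \<oplus>\<^bsub>K\<^esub> u r \<otimes>\<^bsub>K\<^esub> (u s \<otimes>\<^bsub>K\<^esub> (u t \<otimes>\<^bsub>K\<^esub> DK \<theta> (\<phi> (\<iota> \<delta>) (\<iota> \<eta>)) \<oplus>\<^bsub>K\<^esub> DK \<theta> (u t) \<otimes>\<^bsub>K\<^esub> \<phi> (\<iota> \<delta>) (\<iota> \<eta>)) \<oplus>\<^bsub>K\<^esub> DK \<theta> (u s) \<otimes>\<^bsub>K\<^esub> (u t \<otimes>\<^bsub>K\<^esub> \<phi> (\<iota> \<delta>) (\<iota> \<eta>)))
    \<ominus>\<^bsub>K\<^esub> (((u s \<otimes>\<^bsub>K\<^esub> u t) \<otimes>\<^bsub>K\<^esub> (u r \<otimes>\<^bsub>K\<^esub> \<phi> (\<iota> (br \<delta> \<eta>)) (\<iota> \<theta>)) \<oplus>\<^bsub>K\<^esub> (u s \<otimes>\<^bsub>K\<^esub> DK \<delta> (u t)) \<otimes>\<^bsub>K\<^esub> (u r \<otimes>\<^bsub>K\<^esub> \<phi> (\<iota> \<eta>) (\<iota> \<theta>))) \<ominus>\<^bsub>K\<^esub> (u t \<otimes>\<^bsub>K\<^esub> DK \<eta> (u s)) \<otimes>\<^bsub>K\<^esub> (u r \<otimes>\<^bsub>K\<^esub> \<phi> (\<iota> \<delta>) (\<iota> \<theta>)))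
    \<oplus>\<^bsub>K\<^esub> (((u s \<otimes>\<^bsub>K\<^esub> u r) \<otimes>\<^bsub>K\<^esub> (u t \<otimes>\<^bsub>K\<^esub> \<phi> (\<iota> (br \<delta> \<theta>)) (\<iota> \<eta>)) \<oplus>\<^bsub>K\<^esub> (u s \<otimes>\<^bsub>K\<^esub> DK \<delta> (u r)) \<otimes>\<^bsub>K\<^esub> (u t \<otimes>\<^bsub>K\<^esub> (\<ominus>\<^bsub>K\<^esub> \<phi> (\<iota> \<eta>) (\<iota> \<theta>)))) \<ominus>\<^bsub>K\<^esub> (u r \<otimes>\<^bsub>K\<^esub> DK \<theta> (u s)) \<otimes>\<^bsub>K\<^esub> (u t \<otimes>\<^bsub>K\<^esub> \<phi> (\<iota> \<delta>) (\<iota> \<eta>)))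
    \<ominus>\<^bsub>K\<^esub> (((u t \<otimes>\<^bsub>K\<^esub> u r) \<otimes>\<^bsub>K\<^esub> (u s \<otimes>\<^bsub>K\<^esub> \<phi> (\<iota> (br \<eta> \<theta>)) (\<iota> \<delta>)) \<oplus>\<^bsub>K\<^esub> (u t \<otimes>\<^bsub>K\<^esub> DK \<eta> (u r)) \<otimes>\<^bsub>K\<^esub> (u s \<otimes>\<^bsub>K\<^esub> (\<ominus>\<^bsub>K\<^esub> \<phi> (\<iota> \<delta>) (\<iota> \<theta>)))) \<ominus>\<^bsub>K\<^esub> (u r \<otimes>\<^bsub>K\<^esub> DK \<theta> (u t)) \<otimes>\<^bsub>K\<^esub> (u s \<otimes>\<^bsub>K\<^esub> (\<ominus>\<^bsub>K\<^esub> \<phi> (\<iota> \<delta>) (\<iota> \<eta>)))) = \<zero>\<^bsub>K\<^esub>"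
    by (rule K.cocycle_ring_identity)
      (intro us DKD(1) cl i \<iota>_closed bracket_closed x(1) y(1) z(1) hyp)+
  then show ?thesis
    by (simp only: x(3) y(3) z(3) lr B act x(1,2) y(1,2) z(1,2) u_closed cl i
        anti [OF i(2,3)] anti [OF i(1,3)] anti [OF i(1,2)])
qed

text \<open>A relation \<open>\<phi>' = \<phi> + d\<psi>\<close> between forms over the local ring need only be checked on global derivations,
for the same reason as in \<open>stalk_cocycle\<close>.\<close>

lemma stalk_exact:
  assumes cl: "\<And>X. X \<in> carrier LQ \<Longrightarrow> \<psi> X \<in> carrier K"
    and add: "\<And>X Y. X \<in> carrier LQ \<Longrightarrow> Y \<in> carrier LQ \<Longrightarrow> \<psi> (X \<oplus>\<^bsub>LQ\<^esub> Y) = \<psi> X \<oplus>\<^bsub>K\<^esub> \<psi> Y"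
    and smult: "\<And>a X. a \<in> carrier K \<Longrightarrow> X \<in> carrier LQ \<Longrightarrow> \<psi> (a \<odot>\<^bsub>LQ\<^esub> X) = a \<otimes>\<^bsub>K\<^esub> \<psi> X"
    and cl2: "\<And>\<delta> \<eta>. \<delta> \<in> carrier L \<Longrightarrow> \<eta> \<in> carrier L \<Longrightarrow> \<phi> (\<iota> \<delta>) (\<iota> \<eta>) \<in> carrier K"
      "\<And>\<delta> \<eta>. \<delta> \<in> carrier L \<Longrightarrow> \<eta> \<in> carrier L \<Longrightarrow> \<phi>' (\<iota> \<delta>) (\<iota> \<eta>) \<in> carrier K"
    and bil: "\<And>\<delta> \<eta> s t. \<delta> \<in> carrier L \<Longrightarrow> \<eta> \<in> carrier L \<Longrightarrow> s \<in> S \<Longrightarrow> t \<in> S \<Longrightarrow>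
        \<phi> (LS.frac \<delta> s) (LS.frac \<eta> t) = u s \<otimes>\<^bsub>K\<^esub> (u t \<otimes>\<^bsub>K\<^esub> \<phi> (\<iota> \<delta>) (\<iota> \<eta>))"
      "\<And>\<delta> \<eta> s t. \<delta> \<in> carrier L \<Longrightarrow> \<eta> \<in> carrier L \<Longrightarrow> s \<in> S \<Longrightarrow> t \<in> S \<Longrightarrow>
        \<phi>' (LS.frac \<delta> s) (LS.frac \<eta> t) = u s \<otimes>\<^bsub>K\<^esub> (u t \<otimes>\<^bsub>K\<^esub> \<phi>' (\<iota> \<delta>) (\<iota> \<eta>))"
    and hyp: "\<And>\<delta> \<eta>. \<delta> \<in> carrier L \<Longrightarrow> \<eta> \<in> carrier L \<Longrightarrow>
      (\<phi>' (\<iota> \<delta>) (\<iota> \<eta>) \<oplus>\<^bsub>K\<^esub> DK \<eta> (\<psi> (\<iota> \<delta>))) \<oplus>\<^bsub>K\<^esub> \<psi> (\<iota> (br \<delta> \<eta>)) = \<phi> (\<iota> \<delta>) (\<iota> \<eta>) \<oplus>\<^bsub>K\<^esub> DK \<delta> (\<psi> (\<iota> \<eta>))"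
    and XY: "X \<in> carrier LQ" "Y \<in> carrier LQ"
  shows "\<phi>' X Y = \<phi> X Y \<oplus>\<^bsub>K\<^esub> (act X (\<psi> Y) \<ominus>\<^bsub>K\<^esub> act Y (\<psi> X) \<ominus>\<^bsub>K\<^esub> \<psi> (sbr X Y))"
proof -
  obtain \<delta> s where x: "\<delta> \<in> carrier L" "s \<in> S" "X = LS.frac \<delta> s" by (rule LS.Q_cases [OF XY(1)])
  obtain \<eta> t where y: "\<eta> \<in> carrier L" "t \<in> S" "Y = LS.frac \<eta> t" by (rule LS.Q_cases [OF XY(2)])
  note i = \<iota>_closed [OF x(1)] \<iota>_closed [OF y(1)]
  note us = u_closed [OF x(2)] u_closed [OF y(2)]
  have \<psi>: "\<psi> (LS.frac \<delta> s) = u s \<otimes>\<^bsub>K\<^esub> \<psi> (\<iota> \<delta>)" if "\<delta> \<in> carrier L" "s \<in> S" for \<delta> s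
    by (simp only: frac_\<iota> smult \<iota>_closed u_closed that)
  have act: "act (LS.frac \<delta> s) (a \<otimes>\<^bsub>K\<^esub> f) = u s \<otimes>\<^bsub>K\<^esub> (a \<otimes>\<^bsub>K\<^esub> DK \<delta> f \<oplus>\<^bsub>K\<^esub> DK \<delta> a \<otimes>\<^bsub>K\<^esub> f)"
    if "\<delta> \<in> carrier L" "s \<in> S" "a \<in> carrier K" "f \<in> carrier K" for \<delta> s a f
    by (simp only: act_frac DKD K.m_closed that)
  have B: "\<psi> (sbr (LS.frac \<delta> s) (LS.frac \<eta> t)) =
    ((u s \<otimes>\<^bsub>K\<^esub> u t) \<otimes>\<^bsub>K\<^esub> \<psi> (\<iota> (br \<delta> \<eta>)) \<oplus>\<^bsub>K\<^esub> (u s \<otimes>\<^bsub>K\<^esub> DK \<delta> (u t)) \<otimes>\<^bsub>K\<^esub> \<psi> (\<iota> \<eta>))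
     \<ominus>\<^bsub>K\<^esub> (u t \<otimes>\<^bsub>K\<^esub> DK \<eta> (u s)) \<otimes>\<^bsub>K\<^esub> \<psi> (\<iota> \<delta>)"
    by (rule functional_bracket [OF cl add smult x(1) y(1) x(2) y(2)])
  show ?thesis
    unfolding x(3) y(3) bil(1) [OF x(1) y(1) x(2) y(2)] bil(2) [OF x(1) y(1) x(2) y(2)] B
      \<psi> [OF x(1,2)] \<psi> [OF y(1,2)] act [OF x(1,2) us(2) cl [OF i(2)]] act [OF y(1,2) us(1) cl [OF i(1)]]
    by (rule K.exact_ring_identity)
      (intro us DKD(1) cl cl2 i \<iota>_closed bracket_closed x(1) y(1) hyp)+
qed

end

section \<open>The trace of the curvature on stalks\<close>

lemma (in module) trace_zero:
  assumes b: "is_basis R M n e" and h: "deriv_over R M (\<lambda>_. \<zero>) h" and eq: "\<And>x. x \<in> carrier M \<Longrightarrow> h x = \<zero>\<^bsub>M\<^esub>"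
  shows "module_trace R M h = \<zero>"
  using trace_smult [OF b h R.zero_closed h] trace_closed [OF b h] eq by simp

locale lr_prime_conn = lr_prime A L p S + lr_connection A L W nabla
  for A (structure) and L :: "('a, 'a \<Rightarrow> 'a, 'x) module_scheme" and p S
    and W :: "('a, 'w, 'z) module_scheme" and nabla

sublocale lr_prime_conn \<subseteq> WS: loc_mod A S W
  by (intro loc_mod.intro multset_S W.module_axioms)

sublocale lr_prime_conn \<subseteq> WM: module "loc_ring A S" "loc_module A W S"
  by (rule WS.loc_module_module)

context lr_prime_conn
begin

abbreviation WQ where "WQ \<equiv> loc_module A W S"
abbreviation sc where "sc \<equiv> stalk_curvature A W nabla p"

text \<open>The curvature is linear over \<open>A\<close> in all three arguments, so it is compatible with changing representatives.\<close>

lemma sc_frac: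
  assumes \<delta>: "\<delta> \<in> carrier L" and \<eta>: "\<eta> \<in> carrier L" and w: "w \<in> carrier W"
    and s: "s \<in> S" and t: "t \<in> S" and r: "r \<in> S"
  shows "sc (LS.frac \<delta> s) (LS.frac \<eta> t) (WS.frac w r) = WS.frac (curv \<delta> \<eta> w) (s \<otimes> (t \<otimes> r))"
proof -
  have tri: "curv (a \<odot>\<^bsub>L\<^esub> \<delta>) (b \<odot>\<^bsub>L\<^esub> \<eta>) (c \<odot>\<^bsub>W\<^esub> w) = (a \<otimes> b \<otimes> c) \<odot>\<^bsub>W\<^esub> curv \<delta> \<eta> w"
    if "a \<in> carrier A" "b \<in> carrier A" "c \<in> carrier A" "\<delta> \<in> carrier L" "\<eta> \<in> carrier L" "w \<in> carrier W" for a b c \<delta> \<eta> w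
    using that W.linearD(3) [OF curv_linear] by (simp add: curv_smult_left curv_smult_right curv_closed W.smult_assoc1 [symmetric] m_ac)
  have eq: "WS.frac (curv \<delta>' \<eta>' w') (s' \<otimes> (t' \<otimes> r')) = WS.frac (curv \<delta> \<eta> w) (s \<otimes> (t \<otimes> r))"
    if 1: "\<delta>' \<in> carrier L" "\<eta>' \<in> carrier L" "w' \<in> carrier W" "s' \<in> S" "t' \<in> S" "r' \<in> S"
      and 2: "LS.frac \<delta>' s' = LS.frac \<delta> s" "LS.frac \<eta>' t' = LS.frac \<eta> t" "WS.frac w' r' = WS.frac w r"
    for \<delta>' s' \<eta>' t' w' r'
  proof -
    obtain a where a: "a \<in> S" "a \<odot>\<^bsub>L\<^esub> (s' \<odot>\<^bsub>L\<^esub> \<delta>) = a \<odot>\<^bsub>L\<^esub> (s \<odot>\<^bsub>L\<^esub> \<delta>')"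
      using 2(1) LS.frac_eq_iff [OF 1(1) \<delta> 1(4) s] by blast
    obtain b where b: "b \<in> S" "b \<odot>\<^bsub>L\<^esub> (t' \<odot>\<^bsub>L\<^esub> \<eta>) = b \<odot>\<^bsub>L\<^esub> (t \<odot>\<^bsub>L\<^esub> \<eta>')"
      using 2(2) LS.frac_eq_iff [OF 1(2) \<eta> 1(5) t] by blast
    obtain c where c: "c \<in> S" "c \<odot>\<^bsub>W\<^esub> (r' \<odot>\<^bsub>W\<^esub> w) = c \<odot>\<^bsub>W\<^esub> (r \<odot>\<^bsub>W\<^esub> w')"
      using 2(3) WS.frac_eq_iff [OF 1(3) w 1(6) r] by blast
    have [simp]: "s \<in> carrier A" "t \<in> carrier A" "r \<in> carrier A" "s' \<in> carrier A" "t' \<in> carrier A" "r' \<in> carrier A"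
      "a \<in> carrier A" "b \<in> carrier A" "c \<in> carrier A" using 1 s t r a(1) b(1) c(1) by auto
    have "(a \<otimes> b \<otimes> c) \<odot>\<^bsub>W\<^esub> ((s' \<otimes> (t' \<otimes> r')) \<odot>\<^bsub>W\<^esub> curv \<delta> \<eta> w) =
      curv ((a \<otimes> s') \<odot>\<^bsub>L\<^esub> \<delta>) ((b \<otimes> t') \<odot>\<^bsub>L\<^esub> \<eta>) ((c \<otimes> r') \<odot>\<^bsub>W\<^esub> w)"
      using \<delta> \<eta> w by (simp add: tri curv_closed W.smult_assoc1 [symmetric] m_ac)
    also have "\<dots> = curv ((a \<otimes> s) \<odot>\<^bsub>L\<^esub> \<delta>') ((b \<otimes> t) \<odot>\<^bsub>L\<^esub> \<eta>') ((c \<otimes> r) \<odot>\<^bsub>W\<^esub> w')"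
      using a(2) b(2) c(2) \<delta> \<eta> w 1(1-3) by (simp add: L.smult_assoc1 W.smult_assoc1)
    also have "\<dots> = (a \<otimes> b \<otimes> c) \<odot>\<^bsub>W\<^esub> ((s \<otimes> (t \<otimes> r)) \<odot>\<^bsub>W\<^esub> curv \<delta>' \<eta>' w')"
      using 1(1-3) by (simp add: tri curv_closed W.smult_assoc1 [symmetric] m_ac)
    finally have e: "(a \<otimes> b \<otimes> c) \<odot>\<^bsub>W\<^esub> ((s' \<otimes> (t' \<otimes> r')) \<odot>\<^bsub>W\<^esub> curv \<delta> \<eta> w) =
       (a \<otimes> b \<otimes> c) \<odot>\<^bsub>W\<^esub> ((s \<otimes> (t \<otimes> r)) \<odot>\<^bsub>W\<^esub> curv \<delta>' \<eta>' w')" .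
    have "a \<otimes> b \<otimes> c \<in> S" using a b c by blast
    then show ?thesis
      using e 1 \<delta> \<eta> w s t r curv_closed by (subst WS.frac_eq_iff) auto
  qed
  have "sc (LS.frac \<delta> s) (LS.frac \<eta> t) (WS.frac w r) = (\<Union>(\<delta>, s)\<in>LS.frac \<delta> s. \<Union>(\<eta>, t)\<in>LS.frac \<eta> t. \<Union>(w, r)\<in>WS.frac w r.
     WS.frac (curv \<delta> \<eta> w) (s \<otimes> (t \<otimes> r)))"
    by (simp only: stalk_curvature_def S_eq)
  also have "\<dots> = WS.frac (curv \<delta> \<eta> w) (s \<otimes> (t \<otimes> r))"
  proof (rule UN_constant_eq [OF LS.mem_frac_self [OF \<delta> s]], clarify)
    fix \<delta>' s' assume m1: "(\<delta>', s') \<in> LS.frac \<delta> s"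
    show "(\<Union>(\<eta>, t)\<in>LS.frac \<eta> t. \<Union>(w, r)\<in>WS.frac w r. WS.frac (curv \<delta>' \<eta> w) (s' \<otimes> (t \<otimes> r))) = WS.frac (curv \<delta> \<eta> w) (s \<otimes> (t \<otimes> r))"
    proof (rule UN_constant_eq [OF LS.mem_frac_self [OF \<eta> t]], clarify)
      fix \<eta>' t' assume m2: "(\<eta>', t') \<in> LS.frac \<eta> t"
      show "(\<Union>(w, r)\<in>WS.frac w r. WS.frac (curv \<delta>' \<eta>' w) (s' \<otimes> (t' \<otimes> r))) = WS.frac (curv \<delta> \<eta> w) (s \<otimes> (t \<otimes> r))"
      proof (rule UN_constant_eq [OF WS.mem_frac_self [OF w r]], clarify)
        fix w' r' assume m3: "(w', r') \<in> WS.frac w r"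
        show "WS.frac (curv \<delta>' \<eta>' w') (s' \<otimes> (t' \<otimes> r')) = WS.frac (curv \<delta> \<eta> w) (s \<otimes> (t \<otimes> r))"
          by (rule eq) (use LS.mem_fracD [OF m1] LS.mem_fracD [OF m2] WS.mem_fracD [OF m3]
              LS.frac_eq_of_mem [OF \<delta> s m1] LS.frac_eq_of_mem [OF \<eta> t m2] WS.frac_eq_of_mem [OF w r m3] in blast)+
      qed
    qed
  qed
  finally show ?thesis .
qed

lemma sc_linear:
  assumes X: "X \<in> carrier LQ" and Y: "Y \<in> carrier LQ"
  shows "deriv_over K WQ (\<lambda>_. \<zero>\<^bsub>K\<^esub>) (sc X Y)"
proof -
  obtain \<delta> s where x: "\<delta> \<in> carrier L" "s \<in> S" "X = LS.frac \<delta> s" by (rule LS.Q_cases [OF X])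
  obtain \<eta> t where y: "\<eta> \<in> carrier L" "t \<in> S" "Y = LS.frac \<eta> t" by (rule LS.Q_cases [OF Y])
  note lin = W.linearD [OF curv_linear [OF x(1) y(1)]]
  show ?thesis
  proof (rule WM.linearI)
    fix Z assume Z: "Z \<in> carrier WQ"
    obtain w r where z: "w \<in> carrier W" "r \<in> S" "Z = WS.frac w r" by (rule WS.Q_cases [OF Z])
    show "sc X Y Z \<in> carrier WQ" using x y z by (simp add: sc_frac curv_closed)
  next
    fix Z Z' assume Z: "Z \<in> carrier WQ" "Z' \<in> carrier WQ"
    obtain w w' r where z: "w \<in> carrier W" "w' \<in> carrier W" "r \<in> S" "Z = WS.frac w r" "Z' = WS.frac w' r"
      by (rule WS.Q_cases2 [OF Z])
    show "sc X Y (Z \<oplus>\<^bsub>WQ\<^esub> Z') = sc X Y Z \<oplus>\<^bsub>WQ\<^esub> sc X Y Z'" using x y z by (simp add: sc_frac curv_closed lin)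
  next
    fix a Z assume a: "a \<in> carrier K" and Z: "Z \<in> carrier WQ"
    obtain w r where z: "w \<in> carrier W" "r \<in> S" "Z = WS.frac w r" by (rule WS.Q_cases [OF Z])
    obtain b q where b: "b \<in> carrier A" "q \<in> S" "a = RS.frac b q" by (rule RS.loc_ring_cases [OF a])
    have "s \<otimes> (t \<otimes> (q \<otimes> r)) = q \<otimes> (s \<otimes> (t \<otimes> r))" using x(2) y(2) z(2) b(2) RS.S_in by (simp add: m_ac)
    then show "sc X Y (a \<odot>\<^bsub>WQ\<^esub> Z) = a \<odot>\<^bsub>WQ\<^esub> sc X Y Z" using x y z b by (simp add: sc_frac curv_closed lin)
  qed
qed

lemma sc_add_left:
  assumes X: "X \<in> carrier LQ" "X' \<in> carrier LQ" and Y: "Y \<in> carrier LQ" and Z: "Z \<in> carrier WQ"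
  shows "sc (X \<oplus>\<^bsub>LQ\<^esub> X') Y Z = sc X Y Z \<oplus>\<^bsub>WQ\<^esub> sc X' Y Z"
proof -
  obtain \<delta> \<delta>' s where x: "\<delta> \<in> carrier L" "\<delta>' \<in> carrier L" "s \<in> S" "X = LS.frac \<delta> s" "X' = LS.frac \<delta>' s"
    by (rule LS.Q_cases2 [OF X])
  obtain \<eta> t where y: "\<eta> \<in> carrier L" "t \<in> S" "Y = LS.frac \<eta> t" by (rule LS.Q_cases [OF Y])
  obtain w r where z: "w \<in> carrier W" "r \<in> S" "Z = WS.frac w r" by (rule WS.Q_cases [OF Z])
  show ?thesis using x y z by (simp add: sc_frac curv_closed curv_add_left)
qed

lemma sc_smult_left:
  assumes a: "a \<in> carrier K" and X: "X \<in> carrier LQ" and Y: "Y \<in> carrier LQ" and Z: "Z \<in> carrier WQ"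
  shows "sc (a \<odot>\<^bsub>LQ\<^esub> X) Y Z = a \<odot>\<^bsub>WQ\<^esub> sc X Y Z"
proof -
  obtain b q where b: "b \<in> carrier A" "q \<in> S" "a = RS.frac b q" by (rule RS.loc_ring_cases [OF a])
  obtain \<delta> s where x: "\<delta> \<in> carrier L" "s \<in> S" "X = LS.frac \<delta> s" by (rule LS.Q_cases [OF X])
  obtain \<eta> t where y: "\<eta> \<in> carrier L" "t \<in> S" "Y = LS.frac \<eta> t" by (rule LS.Q_cases [OF Y])
  obtain w r where z: "w \<in> carrier W" "r \<in> S" "Z = WS.frac w r" by (rule WS.Q_cases [OF Z])
  have "(q \<otimes> s) \<otimes> (t \<otimes> r) = q \<otimes> (s \<otimes> (t \<otimes> r))" using x(2) y(2) z(2) b(2) RS.S_in by (simp add: m_assoc)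
  then show ?thesis using x y z b by (simp add: sc_frac curv_closed curv_smult_left)
qed

lemma sc_antisym:
  assumes X: "X \<in> carrier LQ" and Y: "Y \<in> carrier LQ" and Z: "Z \<in> carrier WQ"
  shows "sc X Y Z \<oplus>\<^bsub>WQ\<^esub> sc Y X Z = \<zero>\<^bsub>WQ\<^esub>"
proof -
  obtain \<delta> s where x: "\<delta> \<in> carrier L" "s \<in> S" "X = LS.frac \<delta> s" by (rule LS.Q_cases [OF X])
  obtain \<eta> t where y: "\<eta> \<in> carrier L" "t \<in> S" "Y = LS.frac \<eta> t" by (rule LS.Q_cases [OF Y])
  obtain w r where z: "w \<in> carrier W" "r \<in> S" "Z = WS.frac w r" by (rule WS.Q_cases [OF Z])
  have "t \<otimes> (s \<otimes> r) = s \<otimes> (t \<otimes> r)" using x(2) y(2) z(2) RS.S_in by (simp add: m_ac)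
  then show ?thesis
    using x y z by (simp add: sc_frac curv_closed curv_antisym [of \<delta> \<eta>] W.M.l_neg WS.frac_zero)
qed

lemma sc_self:
  assumes X: "X \<in> carrier LQ" and Z: "Z \<in> carrier WQ"
  shows "sc X X Z = \<zero>\<^bsub>WQ\<^esub>"
proof -
  obtain \<delta> s where x: "\<delta> \<in> carrier L" "s \<in> S" "X = LS.frac \<delta> s" by (rule LS.Q_cases [OF X])
  obtain w r where z: "w \<in> carrier W" "r \<in> S" "Z = WS.frac w r" by (rule WS.Q_cases [OF Z])
  show ?thesis using x z by (simp add: sc_frac curv_self WS.frac_zero)
qed

text \<open>The localization of an endomorphism of \<open>W\<close> and its trace; a linear map is a derivation over \<open>0\<close>.\<close>

abbreviation lf where "lf f \<equiv> loc_der A W S (\<lambda>_. \<zero>) f"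
abbreviation TR where "TR f \<equiv> module_trace K WQ (lf f)"

lemma lf_linear:
  assumes "deriv_over A W (\<lambda>_. \<zero>) f"
  shows "deriv_over K WQ (\<lambda>_. \<zero>\<^bsub>K\<^esub>) (lf f)"
proof (rule WM.linearI)
  note f = W.linearD [OF assms]
  fix Z assume Z: "Z \<in> carrier WQ"
  obtain w r where z: "w \<in> carrier W" "r \<in> S" "Z = WS.frac w r" by (rule WS.Q_cases [OF Z])
  then show "lf f Z \<in> carrier WQ" using f by (simp add: WS.loc_der_linear [OF assms])
  fix a assume a: "a \<in> carrier K" 
  obtain b q where b: "b \<in> carrier A" "q \<in> S" "a = RS.frac b q" by (rule RS.loc_ring_cases [OF a])
  show "lf f (a \<odot>\<^bsub>WQ\<^esub> Z) = a \<odot>\<^bsub>WQ\<^esub> lf f Z" using f z b by (simp add: WS.loc_der_linear [OF assms])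
next
  note f = W.linearD [OF assms]
  fix Z Z' assume Z: "Z \<in> carrier WQ" "Z' \<in> carrier WQ"
  obtain w w' r where z: "w \<in> carrier W" "w' \<in> carrier W" "r \<in> S" "Z = WS.frac w r" "Z' = WS.frac w' r"
    by (rule WS.Q_cases2 [OF Z])
  then show "lf f (Z \<oplus>\<^bsub>WQ\<^esub> Z') = lf f Z \<oplus>\<^bsub>WQ\<^esub> lf f Z'" using f by (simp add: WS.loc_der_linear [OF assms])
qed

lemma lf_frac: "deriv_over A W (\<lambda>_. \<zero>) f \<Longrightarrow> w \<in> carrier W \<Longrightarrow> r \<in> S \<Longrightarrow> lf f (WS.frac w r) = WS.frac (f w) r"
  by (rule WS.loc_der_linear)

context
  fixes n e assumes basis: "is_basis K WQ n e"
begin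

lemma TR_add:
  assumes f: "deriv_over A W (\<lambda>_. \<zero>) f" and g: "deriv_over A W (\<lambda>_. \<zero>) g"
  shows "TR (\<lambda>w. f w \<oplus>\<^bsub>W\<^esub> g w) = TR f \<oplus>\<^bsub>K\<^esub> TR g"
proof (rule WM.trace_add [OF basis lf_linear [OF f] lf_linear [OF g] lf_linear [OF W.linear_add [OF f g]]])
  fix Z assume Z: "Z \<in> carrier WQ"
  obtain w r where z: "w \<in> carrier W" "r \<in> S" "Z = WS.frac w r" by (rule WS.Q_cases [OF Z])
  then show "lf (\<lambda>w. f w \<oplus>\<^bsub>W\<^esub> g w) Z = lf f Z \<oplus>\<^bsub>WQ\<^esub> lf g Z"
    using W.linearD(1) [OF f] W.linearD(1) [OF g] by (simp add: lf_frac f g W.linear_add)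
qed

lemma TR_cong:
  assumes f: "deriv_over A W (\<lambda>_. \<zero>) f" and g: "deriv_over A W (\<lambda>_. \<zero>) g" and eq: "\<And>w. w \<in> carrier W \<Longrightarrow> f w = g w"
  shows "TR f = TR g"
proof (rule WM.trace_cong [OF basis lf_linear [OF f] lf_linear [OF g]])
  fix Z assume Z: "Z \<in> carrier WQ"
  obtain w r where z: "w \<in> carrier W" "r \<in> S" "Z = WS.frac w r" by (rule WS.Q_cases [OF Z])
  then show "lf f Z = lf g Z" by (simp add: lf_frac f g eq)
qed

text \<open>The localization of \<open>\<nabla> \<delta>\<close> is a derivation over the localized \<open>\<delta>\<close>, and its commutator with the localized \<open>f\<close>
is the localized commutator. So \<open>trace_commutator\<close> applies in the stalk.\<close>

lemma TR_comm:
  assumes \<delta>: "\<delta> \<in> carrier L" and f: "deriv_over A W (\<lambda>_. \<zero>) f"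
  shows "TR (comm \<delta> f) = DK \<delta> (TR f)"
proof (rule WM.trace_commutator [OF basis lf_linear [OF f] DK_deriv [OF \<delta>] _ lf_linear [OF comm_linear [OF \<delta> f]]])
  show D: "deriv_over K WQ (DK \<delta>) (loc_der A W S \<delta> (nabla \<delta>))"
    by (rule WS.loc_der_deriv [OF conn [OF \<delta>] anchor [OF \<delta>]])
  fix Z assume Z: "Z \<in> carrier WQ"
  obtain w r where z: "w \<in> carrier W" "r \<in> S" "Z = WS.frac w r" by (rule WS.Q_cases [OF Z])
  note fD = W.linearD [OF f]
  have r: "r \<in> carrier A" "\<delta> r \<in> carrier A" using z(2) anchorD(1) [OF \<delta>] by auto
  let ?N = "\<lambda>w. r \<odot>\<^bsub>W\<^esub> nabla \<delta> w \<ominus>\<^bsub>W\<^esub> \<delta> r \<odot>\<^bsub>W\<^esub> w"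
  have N: "?N v \<in> carrier W" if "v \<in> carrier W" for v using that r \<delta> by (simp add: conn_closed)
  have 1: "lf (comm \<delta> f) Z = WS.frac (r \<odot>\<^bsub>W\<^esub> comm \<delta> f w) (r \<otimes> r)"
    unfolding z(3) lf_frac [OF comm_linear [OF \<delta> f] z(1,2)]
    by (rule WS.frac_cancel [symmetric]) (use z \<delta> fD in \<open>simp_all add: conn_closed\<close>)
  have 2: "loc_der A W S \<delta> (nabla \<delta>) (lf f Z) = WS.frac (?N (f w)) (r \<otimes> r)"
    unfolding z(3) lf_frac [OF f z(1,2)] by (rule WS.loc_der_frac [OF conn [OF \<delta>] fD(1) [OF z(1)] z(2)])
  have 3: "lf f (loc_der A W S \<delta> (nabla \<delta>) Z) = WS.frac (f (?N w)) (r \<otimes> r)"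
    unfolding z(3) WS.loc_der_frac [OF conn [OF \<delta>] z(1,2)] by (rule lf_frac [OF f N [OF z(1)]]) (use z in blast)
  have fN: "f (?N w) = r \<odot>\<^bsub>W\<^esub> f (nabla \<delta> w) \<ominus>\<^bsub>W\<^esub> \<delta> r \<odot>\<^bsub>W\<^esub> f w"
    using deriv_zero(2) [OF f W.module_axioms] fD r z(1) \<delta> by (simp add: conn_closed)
  have "r \<odot>\<^bsub>W\<^esub> comm \<delta> f w \<oplus>\<^bsub>W\<^esub> f (?N w) = ?N (f w)"
    unfolding fN using fD(1) r z(1) \<delta> conn_closed by (simp add: W.lin)
  then have h: "lf (comm \<delta> f) Z \<oplus>\<^bsub>WQ\<^esub> lf f (loc_der A W S \<delta> (nabla \<delta>) Z) = loc_der A W S \<delta> (nabla \<delta>) (lf f Z)"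
    unfolding 1 2 3 using N fD(1) r z \<delta> by (simp add: conn_closed)
  show "lf (comm \<delta> f) Z = loc_der A W S \<delta> (nabla \<delta>) (lf f Z) \<ominus>\<^bsub>WQ\<^esub> lf f (loc_der A W S \<delta> (nabla \<delta>) Z)"
    by (rule iffD2 [OF WM.M.eq_diff_iff, OF _ _ _ h])
      (use Z WM.linearD(1) [OF lf_linear [OF f]] WM.linearD(1) [OF lf_linear [OF comm_linear [OF \<delta> f]]] WM.deriv_overD(2) [OF D] in auto)
qed

abbreviation \<phi> where "\<phi> X Y \<equiv> module_trace K WQ (sc X Y)"

lemma \<phi>_closed: "X \<in> carrier LQ \<Longrightarrow> Y \<in> carrier LQ \<Longrightarrow> \<phi> X Y \<in> carrier K"
  by (rule WM.trace_closed [OF basis sc_linear])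

lemma \<phi>_add: "X \<in> carrier LQ \<Longrightarrow> X' \<in> carrier LQ \<Longrightarrow> Y \<in> carrier LQ \<Longrightarrow> \<phi> (X \<oplus>\<^bsub>LQ\<^esub> X') Y = \<phi> X Y \<oplus>\<^bsub>K\<^esub> \<phi> X' Y"
  by (rule WM.trace_add [OF basis]) (simp_all add: sc_linear [simplified] sc_add_left)

lemma \<phi>_smult: "a \<in> carrier K \<Longrightarrow> X \<in> carrier LQ \<Longrightarrow> Y \<in> carrier LQ \<Longrightarrow> \<phi> (a \<odot>\<^bsub>LQ\<^esub> X) Y = a \<otimes>\<^bsub>K\<^esub> \<phi> X Y"
  by (rule WM.trace_smult [OF basis sc_linear _ sc_linear]) (simp_all add: sc_smult_left)

lemma \<phi>_self: "X \<in> carrier LQ \<Longrightarrow> \<phi> X X = \<zero>\<^bsub>K\<^esub>"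
  by (rule WM.trace_zero [OF basis sc_linear]) (simp_all add: sc_self)

lemma \<phi>_antisym:
  assumes X: "X \<in> carrier LQ" and Y: "Y \<in> carrier LQ"
  shows "\<phi> Y X = \<ominus>\<^bsub>K\<^esub> \<phi> X Y"
proof -
  have "module_trace K WQ (\<lambda>_. \<zero>\<^bsub>WQ\<^esub>) = \<phi> Y X \<oplus>\<^bsub>K\<^esub> \<phi> X Y"
    by (rule WM.trace_add [OF basis sc_linear [OF Y X] sc_linear [OF X Y] WM.linear_zero]) (simp add: sc_antisym X Y)
  moreover have "module_trace K WQ (\<lambda>_. \<zero>\<^bsub>WQ\<^esub>) = \<zero>\<^bsub>K\<^esub>"
    by (rule WM.trace_zero [OF basis WM.linear_zero]) simp
  ultimately have "\<phi> Y X \<oplus>\<^bsub>K\<^esub> \<phi> X Y = \<zero>\<^bsub>K\<^esub>" by (rule trans [OF sym])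
  then show ?thesis by (intro K.minus_equality [symmetric] \<phi>_closed X Y)
qed

lemma \<phi>_\<iota>:
  assumes "\<delta> \<in> carrier L" "\<eta> \<in> carrier L"
  shows "\<phi> (\<iota> \<delta>) (\<iota> \<eta>) = TR (curv \<delta> \<eta>)"
proof (rule WM.trace_cong [OF basis sc_linear lf_linear])
  fix Z assume Z: "Z \<in> carrier WQ"
  obtain w r where z: "w \<in> carrier W" "r \<in> S" "Z = WS.frac w r" by (rule WS.Q_cases [OF Z])
  then show "sc (\<iota> \<delta>) (\<iota> \<eta>) Z = lf (curv \<delta> \<eta>) Z"
    using assms RS.S_one by (simp add: sc_frac lf_frac curv_linear)
qed (use assms \<iota>_closed curv_linear in auto)

text \<open>The trace of the Bianchi identity, with each commutator replaced by a derivative.\<close>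

lemma trace_curvature_cocycle:
  assumes "X \<in> carrier LQ" "Y \<in> carrier LQ" "Z \<in> carrier LQ"
  shows "act X (\<phi> Y Z) \<ominus>\<^bsub>K\<^esub> act Y (\<phi> X Z) \<oplus>\<^bsub>K\<^esub> act Z (\<phi> X Y)
    \<ominus>\<^bsub>K\<^esub> \<phi> (sbr X Y) Z \<oplus>\<^bsub>K\<^esub> \<phi> (sbr X Z) Y \<ominus>\<^bsub>K\<^esub> \<phi> (sbr Y Z) X = \<zero>\<^bsub>K\<^esub>"
proof (rule stalk_cocycle [OF \<phi>_closed \<phi>_add \<phi>_smult \<phi>_antisym _ assms])
  fix \<delta> \<eta> \<theta> assume c: "\<delta> \<in> carrier L" "\<eta> \<in> carrier L" "\<theta> \<in> carrier L"
  note b = bracket_closed [OF c(1,2)] bracket_closed [OF c(1,3)] bracket_closed [OF c(2,3)]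
  note l = comm_linear [OF c(1) curv_linear [OF c(2,3)]] comm_linear [OF c(3) curv_linear [OF c(1,2)]]
    comm_linear [OF c(2) curv_linear [OF c(1,3)]]
    curv_linear [OF b(2) c(2)] curv_linear [OF b(1) c(3)] curv_linear [OF b(3) c(1)]
  have "TR (\<lambda>w. (comm \<delta> (curv \<eta> \<theta>) w \<oplus>\<^bsub>W\<^esub> comm \<theta> (curv \<delta> \<eta>) w) \<oplus>\<^bsub>W\<^esub> curv (br \<delta> \<theta>) \<eta> w) =
    TR (\<lambda>w. (comm \<eta> (curv \<delta> \<theta>) w \<oplus>\<^bsub>W\<^esub> curv (br \<delta> \<eta>) \<theta> w) \<oplus>\<^bsub>W\<^esub> curv (br \<eta> \<theta>) \<delta> w)"
    by (rule TR_cong [OF W.linear_add [OF W.linear_add [OF l(1,2)] l(4)] W.linear_add [OF W.linear_add [OF l(3,5)] l(6)]])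
      (rule bianchi [OF c])
  then show "(DK \<delta> (\<phi> (\<iota> \<eta>) (\<iota> \<theta>)) \<oplus>\<^bsub>K\<^esub> DK \<theta> (\<phi> (\<iota> \<delta>) (\<iota> \<eta>))) \<oplus>\<^bsub>K\<^esub> \<phi> (\<iota> (br \<delta> \<theta>)) (\<iota> \<eta>) =
      (DK \<eta> (\<phi> (\<iota> \<delta>) (\<iota> \<theta>)) \<oplus>\<^bsub>K\<^esub> \<phi> (\<iota> (br \<delta> \<eta>)) (\<iota> \<theta>)) \<oplus>\<^bsub>K\<^esub> \<phi> (\<iota> (br \<eta> \<theta>)) (\<iota> \<delta>)"
    unfolding TR_add [OF W.linear_add [OF l(1,2)] l(4)] TR_add [OF l(1,2)]
      TR_add [OF W.linear_add [OF l(3,5)] l(6)] TR_add [OF l(3,5)]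
      TR_comm [OF c(1) curv_linear [OF c(2,3)]] TR_comm [OF c(3) curv_linear [OF c(1,2)]]
      TR_comm [OF c(2) curv_linear [OF c(1,3)]]
      \<phi>_\<iota> [OF c(2,3)] \<phi>_\<iota> [OF c(1,2)] \<phi>_\<iota> [OF c(1,3)] \<phi>_\<iota> [OF b(2) c(2)] \<phi>_\<iota> [OF b(1) c(3)] \<phi>_\<iota> [OF b(3) c(1)] .
qed

end

end

section \<open>Two connections on a stalk\<close>

lemma (in lr_prime_conn) \<phi>_frac:
  assumes b: "is_basis K WQ n e" and c: "\<delta> \<in> carrier L" "\<eta> \<in> carrier L" "s \<in> S" "t \<in> S"
  shows "\<phi> (LS.frac \<delta> s) (LS.frac \<eta> t) = u s \<otimes>\<^bsub>K\<^esub> (u t \<otimes>\<^bsub>K\<^esub> \<phi> (\<iota> \<delta>) (\<iota> \<eta>))"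
proof -
  note i = \<iota>_closed [OF c(1)] \<iota>_closed [OF c(2)] u_closed [OF c(3)] u_closed [OF c(4)]
  have f: "LS.frac \<eta> t \<in> carrier LQ" using c by blast
  have "\<phi> (\<iota> \<delta>) (LS.frac \<eta> t) = \<ominus>\<^bsub>K\<^esub> \<phi> (LS.frac \<eta> t) (\<iota> \<delta>)"
    by (rule \<phi>_antisym [OF b f i(1)])
  also have "\<phi> (LS.frac \<eta> t) (\<iota> \<delta>) = u t \<otimes>\<^bsub>K\<^esub> \<phi> (\<iota> \<eta>) (\<iota> \<delta>)"
    unfolding frac_\<iota> [OF c(2,4)] by (rule \<phi>_smult [OF b i(4,2,1)])
  also have "\<ominus>\<^bsub>K\<^esub> (u t \<otimes>\<^bsub>K\<^esub> \<phi> (\<iota> \<eta>) (\<iota> \<delta>)) = u t \<otimes>\<^bsub>K\<^esub> (\<ominus>\<^bsub>K\<^esub> \<phi> (\<iota> \<eta>) (\<iota> \<delta>))"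
    by (rule K.r_minus [symmetric, OF i(4) \<phi>_closed [OF b i(2,1)]])
  also have "\<ominus>\<^bsub>K\<^esub> \<phi> (\<iota> \<eta>) (\<iota> \<delta>) = \<phi> (\<iota> \<delta>) (\<iota> \<eta>)"
    by (rule \<phi>_antisym [symmetric, OF b i(2,1)])
  finally show ?thesis
    unfolding frac_\<iota> [OF c(1,3)] using \<phi>_smult [OF b i(3,1) f] by (rule trans [rotated, OF arg_cong])
qed

text \<open>The localization of an \<open>A\<close>-bilinear map, with denominators multiplied as in the curvature on stalks.\<close>

definition stalk_map2 ::
    "('a, 'y) ring_scheme \<Rightarrow> ('a, 'w, 'z) module_scheme \<Rightarrow> ('l \<Rightarrow> 'w \<Rightarrow> 'w) \<Rightarrow> 'a set
      \<Rightarrow> ('l \<times> 'a) set \<Rightarrow> ('w \<times> 'a) set \<Rightarrow> ('w \<times> 'a) set" where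
  "stalk_map2 A W f p X Z = (\<Union>(\<delta>, s)\<in>X. \<Union>(w, r)\<in>Z. germ_fraction A W p (f \<delta> w) (s \<otimes>\<^bsub>A\<^esub> r))"

locale lr_prime_conns = lr_prime A L p S + lr_connections A L W nabla nabla'
  for A (structure) and L :: "('a, 'a \<Rightarrow> 'a, 'x) module_scheme" and p S
    and W :: "('a, 'w, 'z) module_scheme" and nabla nabla'

sublocale lr_prime_conns \<subseteq> NP: lr_prime_conn A L p S W nabla
  by (intro lr_prime_conn.intro lr_prime_axioms N.lr_connection_axioms)

sublocale lr_prime_conns \<subseteq> XP: lr_prime_conn A L p S W nabla'
  by (intro lr_prime_conn.intro lr_prime_axioms X.lr_connection_axioms)

context lr_prime_conns
begin

abbreviation sd where "sd \<equiv> stalk_map2 A W conn_diff_map p"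

lemmas cd_lin = N.W.linearD [OF conn_diff_linear]

text \<open>The difference of connections is bilinear over \<open>A\<close>, hence compatible with changing representatives.\<close>

lemma sd_frac:
  assumes \<delta>: "\<delta> \<in> carrier L" and w: "w \<in> carrier W" and s: "s \<in> S" and r: "r \<in> S"
  shows "sd (LS.frac \<delta> s) (NP.WS.frac w r) = NP.WS.frac (conn_diff_map \<delta> w) (s \<otimes> r)"
proof -
  have bi: "conn_diff_map (a \<odot>\<^bsub>L\<^esub> \<delta>) (c \<odot>\<^bsub>W\<^esub> w) = (a \<otimes> c) \<odot>\<^bsub>W\<^esub> conn_diff_map \<delta> w"
    if "a \<in> carrier A" "c \<in> carrier A" "\<delta> \<in> carrier L" "w \<in> carrier W" for a c \<delta> w
    using that cd_lin(3) [OF that(3,2,4)] cd_lin(1) [OF that(3,4)]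
    by (simp add: conn_diff_smult N.W.smult_assoc1)
  have eq: "NP.WS.frac (conn_diff_map \<delta>' w') (s' \<otimes> r') = NP.WS.frac (conn_diff_map \<delta> w) (s \<otimes> r)"
    if 1: "\<delta>' \<in> carrier L" "w' \<in> carrier W" "s' \<in> S" "r' \<in> S"
      and 2: "LS.frac \<delta>' s' = LS.frac \<delta> s" "NP.WS.frac w' r' = NP.WS.frac w r"
    for \<delta>' s' w' r'
  proof -
    obtain a where a: "a \<in> S" "a \<odot>\<^bsub>L\<^esub> (s' \<odot>\<^bsub>L\<^esub> \<delta>) = a \<odot>\<^bsub>L\<^esub> (s \<odot>\<^bsub>L\<^esub> \<delta>')"
      using 2(1) LS.frac_eq_iff [OF 1(1) \<delta> 1(3) s] by blast
    obtain c where c: "c \<in> S" "c \<odot>\<^bsub>W\<^esub> (r' \<odot>\<^bsub>W\<^esub> w) = c \<odot>\<^bsub>W\<^esub> (r \<odot>\<^bsub>W\<^esub> w')"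
      using 2(2) NP.WS.frac_eq_iff [OF 1(2) w 1(4) r] by blast
    have [simp]: "s \<in> carrier A" "r \<in> carrier A" "s' \<in> carrier A" "r' \<in> carrier A"
      "a \<in> carrier A" "c \<in> carrier A" using 1 s r a(1) c(1) by auto
    note cl = cd_lin(1) [OF \<delta> w] cd_lin(1) [OF 1(1,2)]
    have "(a \<otimes> c) \<odot>\<^bsub>W\<^esub> ((s' \<otimes> r') \<odot>\<^bsub>W\<^esub> conn_diff_map \<delta> w) =
      conn_diff_map ((a \<otimes> s') \<odot>\<^bsub>L\<^esub> \<delta>) ((c \<otimes> r') \<odot>\<^bsub>W\<^esub> w)"
      using \<delta> w cl by (simp add: bi N.W.smult_assoc1 [symmetric] m_ac)
    also have "\<dots> = conn_diff_map ((a \<otimes> s) \<odot>\<^bsub>L\<^esub> \<delta>') ((c \<otimes> r) \<odot>\<^bsub>W\<^esub> w')"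
      using a(2) c(2) \<delta> w 1(1-2) by (simp add: L.smult_assoc1 N.W.smult_assoc1)
    also have "\<dots> = (a \<otimes> c) \<odot>\<^bsub>W\<^esub> ((s \<otimes> r) \<odot>\<^bsub>W\<^esub> conn_diff_map \<delta>' w')"
      using 1(1-2) cl by (simp add: bi N.W.smult_assoc1 [symmetric] m_ac)
    finally have e: "(a \<otimes> c) \<odot>\<^bsub>W\<^esub> ((s' \<otimes> r') \<odot>\<^bsub>W\<^esub> conn_diff_map \<delta> w) =
       (a \<otimes> c) \<odot>\<^bsub>W\<^esub> ((s \<otimes> r) \<odot>\<^bsub>W\<^esub> conn_diff_map \<delta>' w')" .
    have "a \<otimes> c \<in> S" using a c by blast
    then show ?thesis
      using e 1 \<delta> w s r cl by (subst NP.WS.frac_eq_iff) auto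
  qed
  have "sd (LS.frac \<delta> s) (NP.WS.frac w r) = (\<Union>(\<delta>, s)\<in>LS.frac \<delta> s. \<Union>(w, r)\<in>NP.WS.frac w r.
     NP.WS.frac (conn_diff_map \<delta> w) (s \<otimes> r))"
    by (simp only: stalk_map2_def S_eq)
  also have "\<dots> = NP.WS.frac (conn_diff_map \<delta> w) (s \<otimes> r)"
  proof (rule UN_constant_eq [OF LS.mem_frac_self [OF \<delta> s]], clarify)
    fix \<delta>' s' assume m1: "(\<delta>', s') \<in> LS.frac \<delta> s"
    show "(\<Union>(w, r)\<in>NP.WS.frac w r. NP.WS.frac (conn_diff_map \<delta>' w) (s' \<otimes> r)) = NP.WS.frac (conn_diff_map \<delta> w) (s \<otimes> r)"
    proof (rule UN_constant_eq [OF NP.WS.mem_frac_self [OF w r]], clarify)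
      fix w' r' assume m3: "(w', r') \<in> NP.WS.frac w r"
      show "NP.WS.frac (conn_diff_map \<delta>' w') (s' \<otimes> r') = NP.WS.frac (conn_diff_map \<delta> w) (s \<otimes> r)"
        by (rule eq) (use LS.mem_fracD [OF m1] NP.WS.mem_fracD [OF m3]
            LS.frac_eq_of_mem [OF \<delta> s m1] NP.WS.frac_eq_of_mem [OF w r m3] in blast)+
    qed
  qed
  finally show ?thesis .
qed

lemma sd_linear:
  assumes X: "X \<in> carrier LQ"
  shows "deriv_over K NP.WQ (\<lambda>_. \<zero>\<^bsub>K\<^esub>) (sd X)"
proof -
  obtain \<delta> s where x: "\<delta> \<in> carrier L" "s \<in> S" "X = LS.frac \<delta> s" by (rule LS.Q_cases [OF X])
  note lin = N.W.linearD [OF conn_diff_linear [OF x(1)]]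
  show ?thesis
  proof (rule NP.WM.linearI)
    fix Z assume Z: "Z \<in> carrier NP.WQ"
    obtain w r where z: "w \<in> carrier W" "r \<in> S" "Z = NP.WS.frac w r" by (rule NP.WS.Q_cases [OF Z])
    show "sd X Z \<in> carrier NP.WQ" using x z lin by (simp add: sd_frac)
  next
    fix Z Z' assume Z: "Z \<in> carrier NP.WQ" "Z' \<in> carrier NP.WQ"
    obtain w w' r where z: "w \<in> carrier W" "w' \<in> carrier W" "r \<in> S" "Z = NP.WS.frac w r" "Z' = NP.WS.frac w' r"
      by (rule NP.WS.Q_cases2 [OF Z])
    show "sd X (Z \<oplus>\<^bsub>NP.WQ\<^esub> Z') = sd X Z \<oplus>\<^bsub>NP.WQ\<^esub> sd X Z'" using x z by (simp add: sd_frac lin)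
  next
    fix a Z assume a: "a \<in> carrier K" and Z: "Z \<in> carrier NP.WQ"
    obtain w r where z: "w \<in> carrier W" "r \<in> S" "Z = NP.WS.frac w r" by (rule NP.WS.Q_cases [OF Z])
    obtain b q where b: "b \<in> carrier A" "q \<in> S" "a = RS.frac b q" by (rule RS.loc_ring_cases [OF a])
    have "s \<otimes> (q \<otimes> r) = q \<otimes> (s \<otimes> r)" using x(2) z(2) b(2) RS.S_in by (simp add: m_ac)
    then show "sd X (a \<odot>\<^bsub>NP.WQ\<^esub> Z) = a \<odot>\<^bsub>NP.WQ\<^esub> sd X Z" using x z b by (simp add: sd_frac lin)
  qed
qed

lemma sd_add:
  assumes X: "X \<in> carrier LQ" "X' \<in> carrier LQ" and Z: "Z \<in> carrier NP.WQ"
  shows "sd (X \<oplus>\<^bsub>LQ\<^esub> X') Z = sd X Z \<oplus>\<^bsub>NP.WQ\<^esub> sd X' Z"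
proof -
  obtain \<delta> \<delta>' s where x: "\<delta> \<in> carrier L" "\<delta>' \<in> carrier L" "s \<in> S" "X = LS.frac \<delta> s" "X' = LS.frac \<delta>' s"
    by (rule LS.Q_cases2 [OF X])
  obtain w r where z: "w \<in> carrier W" "r \<in> S" "Z = NP.WS.frac w r" by (rule NP.WS.Q_cases [OF Z])
  show ?thesis using x z cd_lin(1) [OF x(1) z(1)] cd_lin(1) [OF x(2) z(1)] by (simp add: sd_frac conn_diff_add)
qed

lemma sd_smult:
  assumes a: "a \<in> carrier K" and X: "X \<in> carrier LQ" and Z: "Z \<in> carrier NP.WQ"
  shows "sd (a \<odot>\<^bsub>LQ\<^esub> X) Z = a \<odot>\<^bsub>NP.WQ\<^esub> sd X Z"
proof -
  obtain b q where b: "b \<in> carrier A" "q \<in> S" "a = RS.frac b q" by (rule RS.loc_ring_cases [OF a])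
  obtain \<delta> s where x: "\<delta> \<in> carrier L" "s \<in> S" "X = LS.frac \<delta> s" by (rule LS.Q_cases [OF X])
  obtain w r where z: "w \<in> carrier W" "r \<in> S" "Z = NP.WS.frac w r" by (rule NP.WS.Q_cases [OF Z])
  have "(q \<otimes> s) \<otimes> r = q \<otimes> (s \<otimes> r)" using x(2) z(2) b(2) RS.S_in by (simp add: m_assoc)
  then show ?thesis using x z b cd_lin(1) [OF x(1) z(1)] by (simp add: sd_frac conn_diff_smult)
qed

context
  fixes n e assumes basis: "is_basis K NP.WQ n e"
begin

abbreviation \<psi> where "\<psi> X \<equiv> module_trace K NP.WQ (sd X)"

lemma \<psi>_closed: "X \<in> carrier LQ \<Longrightarrow> \<psi> X \<in> carrier K"
  by (rule NP.WM.trace_closed [OF basis sd_linear])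

lemma \<psi>_add: "X \<in> carrier LQ \<Longrightarrow> X' \<in> carrier LQ \<Longrightarrow> \<psi> (X \<oplus>\<^bsub>LQ\<^esub> X') = \<psi> X \<oplus>\<^bsub>K\<^esub> \<psi> X'"
  by (rule NP.WM.trace_add [OF basis]) (simp_all add: sd_linear [simplified] sd_add)

lemma \<psi>_smult: "a \<in> carrier K \<Longrightarrow> X \<in> carrier LQ \<Longrightarrow> \<psi> (a \<odot>\<^bsub>LQ\<^esub> X) = a \<otimes>\<^bsub>K\<^esub> \<psi> X"
  by (rule NP.WM.trace_smult [OF basis sd_linear _ sd_linear]) (simp_all add: sd_smult)

lemma \<psi>_\<iota>:
  assumes "\<delta> \<in> carrier L"
  shows "\<psi> (\<iota> \<delta>) = NP.TR (conn_diff_map \<delta>)"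
proof (rule NP.WM.trace_cong [OF basis sd_linear NP.lf_linear])
  fix Z assume Z: "Z \<in> carrier NP.WQ"
  obtain w r where z: "w \<in> carrier W" "r \<in> S" "Z = NP.WS.frac w r" by (rule NP.WS.Q_cases [OF Z])
  then show "sd (\<iota> \<delta>) Z = NP.lf (conn_diff_map \<delta>) Z"
    using assms RS.S_one by (simp add: sd_frac NP.lf_frac conn_diff_linear)
qed (use assms \<iota>_closed conn_diff_linear in auto)

text \<open>The trace of \<open>curvature_change\<close>. Here \<open>trace_commutator\<close> is used for the old connection in one argument and
for the new one in the other.\<close>

lemma trace_curvature_diff:
  assumes "X \<in> carrier LQ" "Y \<in> carrier LQ"
  shows "XP.\<phi> X Y = NP.\<phi> X Y \<oplus>\<^bsub>K\<^esub> (act X (\<psi> Y) \<ominus>\<^bsub>K\<^esub> act Y (\<psi> X) \<ominus>\<^bsub>K\<^esub> \<psi> (sbr X Y))"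
proof (rule stalk_exact [OF \<psi>_closed \<psi>_add \<psi>_smult _ _ NP.\<phi>_frac [OF basis] XP.\<phi>_frac [OF basis] _ assms])
  show "NP.\<phi> (\<iota> \<delta>) (\<iota> \<eta>) \<in> carrier K" "XP.\<phi> (\<iota> \<delta>) (\<iota> \<eta>) \<in> carrier K"
    if "\<delta> \<in> carrier L" "\<eta> \<in> carrier L" for \<delta> \<eta>
    by (intro NP.\<phi>_closed [OF basis] XP.\<phi>_closed [OF basis] \<iota>_closed that)+
next
  fix \<delta> \<eta> assume c: "\<delta> \<in> carrier L" "\<eta> \<in> carrier L"
  note b = bracket_closed [OF c]
  note l = X.curv_linear [OF c] X.comm_linear [OF c(2) conn_diff_linear [OF c(1)]] conn_diff_linear [OF b]
    N.curv_linear [OF c] N.comm_linear [OF c(1) conn_diff_linear [OF c(2)]]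
  have "NP.TR (\<lambda>w. (X.curv \<delta> \<eta> w \<oplus>\<^bsub>W\<^esub> X.comm \<eta> (conn_diff_map \<delta>) w) \<oplus>\<^bsub>W\<^esub> conn_diff_map (br \<delta> \<eta>) w) =
    NP.TR (\<lambda>w. N.curv \<delta> \<eta> w \<oplus>\<^bsub>W\<^esub> N.comm \<delta> (conn_diff_map \<eta>) w)"
    by (rule NP.TR_cong [OF basis N.W.linear_add [OF N.W.linear_add [OF l(1,2)] l(3)] N.W.linear_add [OF l(4,5)]])
      (rule curvature_change [OF c])
  then show "(XP.\<phi> (\<iota> \<delta>) (\<iota> \<eta>) \<oplus>\<^bsub>K\<^esub> DK \<eta> (\<psi> (\<iota> \<delta>))) \<oplus>\<^bsub>K\<^esub> \<psi> (\<iota> (br \<delta> \<eta>)) = NP.\<phi> (\<iota> \<delta>) (\<iota> \<eta>) \<oplus>\<^bsub>K\<^esub> DK \<delta> (\<psi> (\<iota> \<eta>))"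
    unfolding NP.TR_add [OF basis N.W.linear_add [OF l(1,2)] l(3)] NP.TR_add [OF basis l(1,2)] NP.TR_add [OF basis l(4,5)]
      NP.TR_comm [OF basis c(1) conn_diff_linear [OF c(2)]] XP.TR_comm [OF basis c(2) conn_diff_linear [OF c(1)]]
      NP.\<phi>_\<iota> [OF basis c] XP.\<phi>_\<iota> [OF basis c] \<psi>_\<iota> [OF c(1)] \<psi>_\<iota> [OF c(2)] \<psi>_\<iota> [OF b] .
qed

end

end

section \<open>Sections\<close>

lemma struct_sheaf_simps [simp]:
  "carrier (struct_sheaf A V) = carrier (sections A (self_module A) V)"
  "mult (struct_sheaf A V) = smult (sections A (self_module A) V)"
  "one (struct_sheaf A V) = (\<lambda>p\<in>V. germ_fraction A (self_module A) p \<one>\<^bsub>A\<^esub> \<one>\<^bsub>A\<^esub>)"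
  "zero (struct_sheaf A V) = zero (sections A (self_module A) V)"
  "add (struct_sheaf A V) = add (sections A (self_module A) V)"
  by (simp_all add: struct_sheaf_def Let_def)

lemma opens_Spec:
  assumes "openin (zariski A) V" shows "V \<subseteq> Spec A"
proof -
  have "topspace (zariski A) = \<Union>{{p \<in> Spec A. f \<notin> p} | f. f \<in> carrier A}"
    unfolding zariski_def by (rule topology_generated_by_topspace)
  then show ?thesis using openin_subset [OF assms] by blast
qed

lemma opens_subset: "openin (zariski A) V \<Longrightarrow> p \<in> V \<Longrightarrow> primeideal p A"
  using opens_Spec [of A V] by (simp add: Spec_def subset_iff)

lemma opens_Int: "V' \<in> opens A V \<Longrightarrow> V'' \<in> opens A V \<Longrightarrow> V' \<inter> V'' \<in> opens A V"
  by (simp add: openin_Int le_infI1)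

text \<open>Denominators are inverted on such sets, which are the neighbourhoods used to spread out germs.\<close>

lemma basic_open:
  assumes "openin (zariski A) V" "f \<in> carrier A"
  shows "{q \<in> V. f \<notin> q} \<in> opens A V"
proof -
  have "openin (zariski A) {p \<in> Spec A. f \<notin> p}"
    unfolding zariski_def by (rule topology_generated_by_Basis) (use assms in blast)
  then have "openin (zariski A) (V \<inter> {p \<in> Spec A. f \<notin> p})" by (rule openin_Int [OF assms(1)])
  moreover have "V \<inter> {p \<in> Spec A. f \<notin> p} = {q \<in> V. f \<notin> q}"
    using opens_Spec [OF assms(1)] by blast
  ultimately show ?thesis by simp
qed

definition frac_on :: "('a, 'y) ring_scheme \<Rightarrow> ('a, 'm, 'x) module_scheme \<Rightarrow> 'a set set \<Rightarrow> ('m, 'a) sec \<Rightarrow> 'm \<Rightarrow> 'a \<Rightarrow> bool"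
  where "frac_on A M V \<sigma> m s \<longleftrightarrow> m \<in> carrier M \<and> s \<in> carrier A \<and> (\<forall>q\<in>V. s \<notin> q \<and> \<sigma> q = germ_fraction A M q m s)"

lemma frac_onD:
  assumes "frac_on A M V \<sigma> m s" "q \<in> V"
  shows "m \<in> carrier M" "s \<in> carrier A - q" "\<sigma> q = germ_fraction A M q m s"
  using assms by (simp_all add: frac_on_def)

lemma frac_onI:
  assumes "m \<in> carrier M" "s \<in> carrier A"
    and "\<And>q. q \<in> V \<Longrightarrow> s \<notin> q" "\<And>q. q \<in> V \<Longrightarrow> \<sigma> q = germ_fraction A M q m s"
  shows "frac_on A M V \<sigma> m s"
  using assms by (simp add: frac_on_def)

lemma sections_carrier:
  "carrier (sections A M V) = {\<sigma> \<in> extensional V. \<forall>p\<in>V. \<exists>V'\<in>opens A V. p \<in> V' \<and> (\<exists>m s. frac_on A M V' \<sigma> m s)}"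
  unfolding sections_def frac_on_def by (simp add: Bex_def)

lemma frac_on_subset: "frac_on A M V \<sigma> m s \<Longrightarrow> V' \<subseteq> V \<Longrightarrow> frac_on A M V' \<sigma> m s"
  by (auto simp: frac_on_def)

lemma sectionI:
  assumes "\<sigma> \<in> extensional V" "\<And>p. p \<in> V \<Longrightarrow> \<exists>V' m s. V' \<in> opens A V \<and> p \<in> V' \<and> frac_on A M V' \<sigma> m s"
  shows "\<sigma> \<in> carrier (sections A M V)"
  unfolding sections_carrier
proof (rule CollectI, intro conjI ballI assms(1))
  fix p assume p: "p \<in> V"
  from assms(2) [OF p] obtain V' m s where *: "V' \<in> opens A V" "p \<in> V'" "frac_on A M V' \<sigma> m s"
    by (elim exE conjE)
  show "\<exists>V'\<in>opens A V. p \<in> V' \<and> (\<exists>m s. frac_on A M V' \<sigma> m s)"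
    by (rule bexI [OF _ *(1)], rule conjI [OF *(2)], rule exI, rule exI, rule *(3))
qed

lemma section_local:
  assumes "\<sigma> \<in> carrier (sections A M V)" "p \<in> V"
  obtains V' m s where "V' \<in> opens A V" "p \<in> V'" "frac_on A M V' \<sigma> m s"
proof -
  have "\<forall>p\<in>V. \<exists>V'\<in>opens A V. p \<in> V' \<and> (\<exists>m s. frac_on A M V' \<sigma> m s)"
    using assms(1) by (simp add: sections_carrier)
  from bspec [OF this assms(2)] show thesis by (elim bexE conjE exE) (rule that)
qed

lemma section_local2:
  assumes "\<sigma> \<in> carrier (sections A M V)" "\<tau> \<in> carrier (sections A N V)" "p \<in> V"
  obtains V' m s n t where "V' \<in> opens A V" "p \<in> V'" "frac_on A M V' \<sigma> m s" "frac_on A N V' \<tau> n t"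
proof -
  obtain V1 m s where 1: "V1 \<in> opens A V" "p \<in> V1" "frac_on A M V1 \<sigma> m s" by (rule section_local [OF assms(1,3)])
  obtain V2 n t where 2: "V2 \<in> opens A V" "p \<in> V2" "frac_on A N V2 \<tau> n t" by (rule section_local [OF assms(2,3)])
  show thesis
    by (rule that [OF opens_Int [OF 1(1) 2(1)] IntI [OF 1(2) 2(2)]
          frac_on_subset [OF 1(3) Int_lower1] frac_on_subset [OF 2(3) Int_lower2]])
qed

lemma section_local3:
  assumes "\<sigma> \<in> carrier (sections A M V)" "\<tau> \<in> carrier (sections A N V)" "\<omega> \<in> carrier (sections A P V)" "p \<in> V"
  obtains V' m s n t k r where "V' \<in> opens A V" "p \<in> V'" "frac_on A M V' \<sigma> m s" "frac_on A N V' \<tau> n t" "frac_on A P V' \<omega> k r"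
proof -
  obtain V1 m s n t where 1: "V1 \<in> opens A V" "p \<in> V1" "frac_on A M V1 \<sigma> m s" "frac_on A N V1 \<tau> n t"
    by (rule section_local2 [OF assms(1,2,4)])
  obtain V2 k r where 2: "V2 \<in> opens A V" "p \<in> V2" "frac_on A P V2 \<omega> k r" by (rule section_local [OF assms(3,4)])
  show thesis
    by (rule that [OF opens_Int [OF 1(1) 2(1)] IntI [OF 1(2) 2(2)]
          frac_on_subset [OF 1(3) Int_lower1] frac_on_subset [OF 1(4) Int_lower1] frac_on_subset [OF 2(3) Int_lower2]])
qed

lemma section_extensional: "\<sigma> \<in> carrier (sections A M V) \<Longrightarrow> \<sigma> \<in> extensional V"
  by (simp add: sections_carrier)

lemma section_ext:
  assumes "\<sigma> \<in> carrier (sections A M V)" "\<tau> \<in> carrier (sections A M V)" "\<And>p. p \<in> V \<Longrightarrow> \<sigma> p = \<tau> p"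
  shows "\<sigma> = \<tau>"
  by (rule extensionalityI [OF section_extensional [OF assms(1)] section_extensional [OF assms(2)] assms(3)])

lemma section_restrict:
  assumes "\<sigma> \<in> carrier (sections A M V)" "V' \<in> opens A V"
  shows "restrict \<sigma> V' \<in> carrier (sections A M V')"
proof (rule sectionI)
  fix p assume p: "p \<in> V'"
  have "p \<in> V" using p assms(2) by blast
  then obtain V1 m s where 1: "V1 \<in> opens A V" "p \<in> V1" "frac_on A M V1 \<sigma> m s"
    by (rule section_local [OF assms(1)])
  have 2: "V1 \<inter> V' \<in> opens A V'" using 1(1) assms(2) by (simp add: openin_Int)
  have 3: "frac_on A M (V1 \<inter> V') (restrict \<sigma> V') m s" using 1(3) by (simp add: frac_on_def)
  from 2 3 p 1(2) show "\<exists>V'' m s. V'' \<in> opens A V' \<and> p \<in> V'' \<and> frac_on A M V'' (restrict \<sigma> V') m s"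
    by (intro exI [of _ "V1 \<inter> V'"] exI [of _ m] exI [of _ s]) simp
qed simp

lemma frac_section:
  assumes "openin (zariski A) V" "frac_on A M V \<sigma> m s" "\<sigma> \<in> extensional V"
  shows "\<sigma> \<in> carrier (sections A M V)"
proof (rule sectionI [OF assms(3)])
  fix p assume "p \<in> V"
  then show "\<exists>V' m s. V' \<in> opens A V \<and> p \<in> V' \<and> frac_on A M V' \<sigma> m s"
    using assms(1,2) by (intro exI [of _ V] exI [of _ m] exI [of _ s]) simp
qed

lemma sections_simps:
  "p \<in> V \<Longrightarrow> \<zero>\<^bsub>sections A M V\<^esub> p = \<zero>\<^bsub>stalk A M p\<^esub>"
  "p \<in> V \<Longrightarrow> (\<sigma> \<oplus>\<^bsub>sections A M V\<^esub> \<tau>) p = \<sigma> p \<oplus>\<^bsub>stalk A M p\<^esub> \<tau> p"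
  "p \<in> V \<Longrightarrow> (f \<odot>\<^bsub>sections A M V\<^esub> \<sigma>) p = f p \<odot>\<^bsub>stalk A M p\<^esub> \<sigma> p"
  "\<zero>\<^bsub>sections A M V\<^esub> \<in> extensional V" "\<sigma> \<oplus>\<^bsub>sections A M V\<^esub> \<tau> \<in> extensional V" "f \<odot>\<^bsub>sections A M V\<^esub> \<sigma> \<in> extensional V"
  by (simp_all add: sections_def)

abbreviation stalk_ring :: "('a, 'y) ring_scheme \<Rightarrow> 'a set \<Rightarrow> ('a \<times> 'a) set ring" where
  "stalk_ring A p \<equiv> loc_ring A (carrier A - p)"

lemma (in cring) multset_prime: 
  assumes "primeideal p R" shows "multset R (carrier R - p)"
proof -
  interpret primeideal p R by fact
  show ?thesis
  proof (intro multset.intro multset_axioms.intro)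
    show "\<one> \<in> carrier R - p" using I_notcarr one_imp_carrier by blast
    show "s \<otimes> t \<in> carrier R - p" if "s \<in> carrier R - p" "t \<in> carrier R - p" for s t
      using that I_prime by blast
  qed (auto intro: is_cring)
qed

text \<open>The sheaf associated to a single module. Sections are families of germs, so their operations are
pointwise and identities between them hold as soon as they hold in every stalk.\<close>

locale sheaf_mod = module A M for A (structure) and M (structure)
begin

lemma loc_mod_prime: "primeideal p A \<Longrightarrow> loc_mod A (carrier A - p) M"
  by (intro loc_mod.intro multset_prime module_axioms)

lemma stalk_module: "primeideal p A \<Longrightarrow> module (stalk_ring A p) (stalk A M p)"
  by (rule loc_mod.loc_module_module [OF loc_mod_prime])

lemma prime_one: "primeideal p A \<Longrightarrow> \<one> \<in> carrier A - p"
  using multset.S_one [OF multset_prime] .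

lemma prime_mult: "primeideal p A \<Longrightarrow> s \<in> carrier A - p \<Longrightarrow> t \<in> carrier A - p \<Longrightarrow> s \<otimes> t \<in> carrier A - p"
  using multset.S_mult [OF multset_prime] .

lemma section_stalk:
  assumes "openin (zariski A) V" "\<sigma> \<in> carrier (sections A M V)" "p \<in> V"
  shows "\<sigma> p \<in> carrier (stalk A M p)"
proof -
  obtain V' m s where 1: "V' \<in> opens A V" "p \<in> V'" "frac_on A M V' \<sigma> m s" by (rule section_local [OF assms(2,3)])
  note f = frac_onD [OF 1(3,2)]
  show ?thesis unfolding f(3)
    by (rule loc_mod.frac_closed [OF loc_mod_prime [OF opens_subset [OF assms(1,3)]] f(1,2)])
qed

lemma zero_section: "openin (zariski A) V \<Longrightarrow> \<zero>\<^bsub>sections A M V\<^esub> \<in> carrier (sections A M V)"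
proof (rule frac_section [of _ _ _ _ "\<zero>\<^bsub>M\<^esub>" \<one>])
  assume V: "openin (zariski A) V"
  show "frac_on A M V \<zero>\<^bsub>sections A M V\<^esub> \<zero>\<^bsub>M\<^esub> \<one>"
  proof (rule frac_onI)
    fix q assume q: "q \<in> V"
    show "\<one> \<notin> q" using prime_one [OF opens_subset [OF V q]] by simp
    show "\<zero>\<^bsub>sections A M V\<^esub> q = germ_fraction A M q \<zero>\<^bsub>M\<^esub> \<one>"
      using q by (simp add: sections_simps loc_module_def)
  qed simp_all
qed (simp_all add: sections_simps)

lemma add_section:
  assumes V: "openin (zariski A) V" and \<sigma>: "\<sigma> \<in> carrier (sections A M V)" and \<tau>: "\<tau> \<in> carrier (sections A M V)"
  shows "\<sigma> \<oplus>\<^bsub>sections A M V\<^esub> \<tau> \<in> carrier (sections A M V)"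
proof (rule sectionI)
  fix p assume p: "p \<in> V"
  obtain V' m s n t where 1: "V' \<in> opens A V" "p \<in> V'" "frac_on A M V' \<sigma> m s" "frac_on A M V' \<tau> n t"
    by (rule section_local2 [OF \<sigma> \<tau> p])
  have "frac_on A M V' (\<sigma> \<oplus>\<^bsub>sections A M V\<^esub> \<tau>) (t \<odot>\<^bsub>M\<^esub> m \<oplus>\<^bsub>M\<^esub> s \<odot>\<^bsub>M\<^esub> n) (s \<otimes> t)"
  proof (rule frac_onI)
    fix q assume q: "q \<in> V'"
    have qV: "q \<in> V" using q 1(1) by blast
    have pq: "primeideal q A" by (rule opens_subset [OF V qV])
    note fs = frac_onD [OF 1(3) q] and ft = frac_onD [OF 1(4) q]
    note c = fs(2) ft(2) fs(1) ft(1)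
    show "s \<otimes> t \<notin> q" using prime_mult [OF pq c(1,2)] by blast
    show "(\<sigma> \<oplus>\<^bsub>sections A M V\<^esub> \<tau>) q = germ_fraction A M q (t \<odot>\<^bsub>M\<^esub> m \<oplus>\<^bsub>M\<^esub> s \<odot>\<^bsub>M\<^esub> n) (s \<otimes> t)"
      using loc_mod.frac_add_frac [OF loc_mod_prime [OF pq] c(3,4,1,2)] qV
      by (simp add: sections_simps fs(3) ft(3))
  qed (use 1(3,4) in \<open>simp_all add: frac_on_def\<close>)
  then show "\<exists>V' m s. V' \<in> opens A V \<and> p \<in> V' \<and> frac_on A M V' (\<sigma> \<oplus>\<^bsub>sections A M V\<^esub> \<tau>) m s"
    using 1 by blast
qed (simp add: sections_simps)

lemma smult_section:
  assumes V: "openin (zariski A) V" and f: "f \<in> carrier (sections A (self_module A) V)" and \<tau>: "\<tau> \<in> carrier (sections A M V)"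
  shows "f \<odot>\<^bsub>sections A M V\<^esub> \<tau> \<in> carrier (sections A M V)"
proof (rule sectionI)
  fix p assume p: "p \<in> V"
  obtain V' m s n t where 1: "V' \<in> opens A V" "p \<in> V'" "frac_on A (self_module A) V' f m s" "frac_on A M V' \<tau> n t"
    by (rule section_local2 [OF f \<tau> p])
  have "frac_on A M V' (f \<odot>\<^bsub>sections A M V\<^esub> \<tau>) (m \<odot>\<^bsub>M\<^esub> n) (s \<otimes> t)"
  proof (rule frac_onI)
    fix q assume q: "q \<in> V'"
    have qV: "q \<in> V" using q 1(1) by blast
    have pq: "primeideal q A" by (rule opens_subset [OF V qV])
    note fs = frac_onD [OF 1(3) q, unfolded self_module_simps] and ft = frac_onD [OF 1(4) q]
    note c = fs(2) ft(2) fs(1) ft(1)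
    show "s \<otimes> t \<notin> q" using prime_mult [OF pq c(1,2)] by blast
    show "(f \<odot>\<^bsub>sections A M V\<^esub> \<tau>) q = germ_fraction A M q (m \<odot>\<^bsub>M\<^esub> n) (s \<otimes> t)"
      using loc_mod.frac_smult [OF loc_mod_prime [OF pq] c(3,4,1,2)] qV
      by (simp add: sections_simps fs(3) ft(3))
  qed (use 1(3,4) in \<open>simp_all add: frac_on_def\<close>)
  then show "\<exists>V' m s. V' \<in> opens A V \<and> p \<in> V' \<and> frac_on A M V' (f \<odot>\<^bsub>sections A M V\<^esub> \<tau>) m s"
    using 1 by blast
qed (simp add: sections_simps)

lemma neg_section:
  assumes V: "openin (zariski A) V" and \<sigma>: "\<sigma> \<in> carrier (sections A M V)"
  shows "\<exists>\<tau>\<in>carrier (sections A M V). \<tau> \<oplus>\<^bsub>sections A M V\<^esub> \<sigma> = \<zero>\<^bsub>sections A M V\<^esub>"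
proof
  let ?\<tau> = "\<lambda>p\<in>V. \<ominus>\<^bsub>stalk A M p\<^esub> \<sigma> p"
  show t: "?\<tau> \<in> carrier (sections A M V)"
  proof (rule sectionI)
    fix p assume p: "p \<in> V"
    obtain V' m s where 1: "V' \<in> opens A V" "p \<in> V'" "frac_on A M V' \<sigma> m s" by (rule section_local [OF \<sigma> p])
    have "frac_on A M V' ?\<tau> (\<ominus>\<^bsub>M\<^esub> m) s"
    proof (rule frac_onI)
      fix q assume q: "q \<in> V'"
      have qV: "q \<in> V" using q 1(1) by blast
      have pq: "primeideal q A" by (rule opens_subset [OF V qV])
      note fs = frac_onD [OF 1(3) q]
      note c = fs(2) fs(1)
      interpret Q: abelian_group "stalk A M q" by (rule loc_mod.Q_abelian_group [OF loc_mod_prime [OF pq]])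
      note fr = loc_mod.frac_closed [OF loc_mod_prime [OF pq] _ c(1)]
      have "germ_fraction A M q (\<ominus>\<^bsub>M\<^esub> m) s \<oplus>\<^bsub>stalk A M q\<^esub> germ_fraction A M q m s = \<zero>\<^bsub>stalk A M q\<^esub>"
        using loc_mod.frac_add [OF loc_mod_prime [OF pq] M.a_inv_closed [OF c(2)] c(2,1)]
          loc_mod.frac_zero [OF loc_mod_prime [OF pq] c(1)] c(2) by (simp add: M.l_neg)
      from Q.minus_equality [OF this fr [OF c(2)] fr [OF M.a_inv_closed [OF c(2)]]]
      show "?\<tau> q = germ_fraction A M q (\<ominus>\<^bsub>M\<^esub> m) s" using qV by (simp add: fs(3))
      show "s \<notin> q" using c by blast
    qed (use 1(3) in \<open>simp_all add: frac_on_def\<close>)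
    then show "\<exists>V' m s. V' \<in> opens A V \<and> p \<in> V' \<and> frac_on A M V' ?\<tau> m s"
      using 1 by blast
  qed simp
  show "?\<tau> \<oplus>\<^bsub>sections A M V\<^esub> \<sigma> = \<zero>\<^bsub>sections A M V\<^esub>"
  proof (rule section_ext [OF add_section [OF V t \<sigma>] zero_section [OF V]])
    fix p assume p: "p \<in> V"
    interpret Q: abelian_group "stalk A M p" by (rule loc_mod.Q_abelian_group [OF loc_mod_prime [OF opens_subset [OF V p]]])
    show "(?\<tau> \<oplus>\<^bsub>sections A M V\<^esub> \<sigma>) p = \<zero>\<^bsub>sections A M V\<^esub> p"
      using p Q.l_neg [OF section_stalk [OF V \<sigma> p]] by (simp add: sections_simps)
  qed
qed

lemma sections_abelian_group:
  assumes V: "openin (zariski A) V"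
  shows "abelian_group (sections A M V)"
proof (rule abelian_groupI)
  fix x y z assume c: "x \<in> carrier (sections A M V)" "y \<in> carrier (sections A M V)" "z \<in> carrier (sections A M V)"
  show "x \<oplus>\<^bsub>sections A M V\<^esub> y \<oplus>\<^bsub>sections A M V\<^esub> z = x \<oplus>\<^bsub>sections A M V\<^esub> (y \<oplus>\<^bsub>sections A M V\<^esub> z)"
  proof (rule section_ext [of _ A M V])
    fix p assume p: "p \<in> V"
    interpret Q: abelian_group "stalk A M p" by (rule loc_mod.Q_abelian_group [OF loc_mod_prime [OF opens_subset [OF V p]]])
    show "(x \<oplus>\<^bsub>sections A M V\<^esub> y \<oplus>\<^bsub>sections A M V\<^esub> z) p = (x \<oplus>\<^bsub>sections A M V\<^esub> (y \<oplus>\<^bsub>sections A M V\<^esub> z)) p"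
      using p Q.a_assoc [OF section_stalk [OF V c(1) p] section_stalk [OF V c(2) p] section_stalk [OF V c(3) p]]
      by (simp add: sections_simps)
  qed (intro add_section V c)+
  show "x \<oplus>\<^bsub>sections A M V\<^esub> y = y \<oplus>\<^bsub>sections A M V\<^esub> x"
  proof (rule section_ext [of _ A M V])
    fix p assume p: "p \<in> V"
    interpret Q: abelian_group "stalk A M p" by (rule loc_mod.Q_abelian_group [OF loc_mod_prime [OF opens_subset [OF V p]]])
    show "(x \<oplus>\<^bsub>sections A M V\<^esub> y) p = (y \<oplus>\<^bsub>sections A M V\<^esub> x) p"
      using p Q.a_comm [OF section_stalk [OF V c(1) p] section_stalk [OF V c(2) p]] by (simp add: sections_simps)
  qed (intro add_section V c)+
  show "\<zero>\<^bsub>sections A M V\<^esub> \<oplus>\<^bsub>sections A M V\<^esub> x = x"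
  proof (rule section_ext [of _ A M V])
    fix p assume p: "p \<in> V"
    interpret Q: abelian_group "stalk A M p" by (rule loc_mod.Q_abelian_group [OF loc_mod_prime [OF opens_subset [OF V p]]])
    show "(\<zero>\<^bsub>sections A M V\<^esub> \<oplus>\<^bsub>sections A M V\<^esub> x) p = x p"
      using p Q.l_zero [OF section_stalk [OF V c(1) p]] by (simp add: sections_simps)
  qed (intro add_section zero_section V c)+
qed (use V zero_section add_section neg_section in auto)

end

lemma (in cring) sheaf_mod_self: "sheaf_mod R (self_module R)"
  by (intro sheaf_mod.intro module_self)

lemma (in cring) struct_sheaf_cring:
  assumes V: "openin (zariski R) V"
  shows "cring (struct_sheaf R V)"
proof -
  interpret S: sheaf_mod R "self_module R" by (rule sheaf_mod_self)
  interpret G: abelian_group "sections R (self_module R) V" by (rule S.sections_abelian_group [OF V])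
  let ?O = "struct_sheaf R V"
  have K: "cring (stalk_ring R p)" if "p \<in> V" for p
    by (rule multset.loc_ring_cring [OF multset_prime [OF opens_subset [OF V that]]])
  have one: "\<one>\<^bsub>?O\<^esub> \<in> carrier ?O" unfolding struct_sheaf_simps
  proof (rule frac_section [OF V, of _ _ \<one> \<one>])
    show "frac_on R (self_module R) V (\<lambda>p\<in>V. germ_fraction R (self_module R) p \<one> \<one>) \<one> \<one>"
      by (rule frac_onI) (use S.prime_one [OF opens_subset [OF V]] in simp_all)
  qed simp
  note st = S.section_stalk [OF V]
  have mu: "x \<otimes>\<^bsub>?O\<^esub> y \<in> carrier ?O" if "x \<in> carrier ?O" "y \<in> carrier ?O" for x y
    using S.smult_section [OF V, of x y] that by simp
  have ext: "x = y" if "x \<in> carrier ?O" "y \<in> carrier ?O" "\<And>p. p \<in> V \<Longrightarrow> x p = y p" for x y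
    using section_ext [of x R "self_module R" V y] that by simp
  show ?thesis
  proof (rule cringI)
    show "abelian_group ?O"
    proof (rule abelian_groupI)
      fix x assume x: "x \<in> carrier ?O"
      then show "\<exists>y\<in>carrier ?O. y \<oplus>\<^bsub>?O\<^esub> x = \<zero>\<^bsub>?O\<^esub>" using S.neg_section [OF V, of x] by simp
    qed (simp_all add: G.a_ac)
    show "comm_monoid ?O"
    proof (rule comm_monoidI [OF mu one])
      fix x y z assume c: "x \<in> carrier ?O" "y \<in> carrier ?O" "z \<in> carrier ?O"
      show "x \<otimes>\<^bsub>?O\<^esub> y \<otimes>\<^bsub>?O\<^esub> z = x \<otimes>\<^bsub>?O\<^esub> (y \<otimes>\<^bsub>?O\<^esub> z)"
      proof (rule ext [OF mu [OF mu [OF c(1,2)] c(3)] mu [OF c(1) mu [OF c(2,3)]]])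
        fix p assume p: "p \<in> V"
        interpret K: cring "stalk_ring R p" by (rule K [OF p])
        show "(x \<otimes>\<^bsub>?O\<^esub> y \<otimes>\<^bsub>?O\<^esub> z) p = (x \<otimes>\<^bsub>?O\<^esub> (y \<otimes>\<^bsub>?O\<^esub> z)) p"
          using K.m_assoc [of "x p" "y p" "z p"] c p st by (simp add: sections_simps)
      qed
    next
      fix x assume c: "x \<in> carrier ?O"
      show "\<one>\<^bsub>?O\<^esub> \<otimes>\<^bsub>?O\<^esub> x = x"
      proof (rule ext [OF mu [OF one c] c])
        fix p assume p: "p \<in> V"
        interpret K: cring "stalk_ring R p" by (rule K [OF p])
        show "(\<one>\<^bsub>?O\<^esub> \<otimes>\<^bsub>?O\<^esub> x) p = x p"
          using K.l_one [of "x p"] c p st by (simp add: sections_simps)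
      qed
    next
      fix x y assume c: "x \<in> carrier ?O" "y \<in> carrier ?O"
      show "x \<otimes>\<^bsub>?O\<^esub> y = y \<otimes>\<^bsub>?O\<^esub> x"
      proof (rule ext [OF mu [OF c] mu [OF c(2,1)]])
        fix p assume p: "p \<in> V"
        interpret K: cring "stalk_ring R p" by (rule K [OF p])
        show "(x \<otimes>\<^bsub>?O\<^esub> y) p = (y \<otimes>\<^bsub>?O\<^esub> x) p"
          using K.m_comm [of "x p" "y p"] c p st by (simp add: sections_simps)
      qed
    qed
    fix x y z assume c: "x \<in> carrier ?O" "y \<in> carrier ?O" "z \<in> carrier ?O"
    have ad: "x \<oplus>\<^bsub>?O\<^esub> y \<in> carrier ?O" if "x \<in> carrier ?O" "y \<in> carrier ?O" for x y
      using that by simp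
    show "(x \<oplus>\<^bsub>?O\<^esub> y) \<otimes>\<^bsub>?O\<^esub> z = x \<otimes>\<^bsub>?O\<^esub> z \<oplus>\<^bsub>?O\<^esub> y \<otimes>\<^bsub>?O\<^esub> z"
    proof (rule ext [OF mu [OF ad [OF c(1,2)] c(3)] ad [OF mu [OF c(1,3)] mu [OF c(2,3)]]])
      fix p assume p: "p \<in> V"
      interpret K: cring "stalk_ring R p" by (rule K [OF p])
      show "((x \<oplus>\<^bsub>?O\<^esub> y) \<otimes>\<^bsub>?O\<^esub> z) p = (x \<otimes>\<^bsub>?O\<^esub> z \<oplus>\<^bsub>?O\<^esub> y \<otimes>\<^bsub>?O\<^esub> z) p"
        using K.l_distr [of "x p" "y p" "z p"] c p st by (simp add: sections_simps)
    qed
  qed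
qed

context sheaf_mod
begin

lemma sections_module:
  assumes V: "openin (zariski A) V"
  shows "module (struct_sheaf A V) (sections A M V)"
proof -
  interpret S: sheaf_mod A "self_module A" by (rule sheaf_mod_self)
  interpret O: cring "struct_sheaf A V" by (rule struct_sheaf_cring [OF V])
  let ?O = "struct_sheaf A V" and ?G = "sections A M V"
  have K: "module (stalk_ring A p) (stalk A M p)" if "p \<in> V" for p
    by (rule stalk_module [OF opens_subset [OF V that]])
  have sm: "f \<odot>\<^bsub>?G\<^esub> x \<in> carrier ?G" if "f \<in> carrier ?O" "x \<in> carrier ?G" for f x
    using smult_section [OF V] that by simp
  note ad = add_section [OF V]
  note st = section_stalk [OF V] and sO = S.section_stalk [OF V]
  have one: "\<one>\<^bsub>?O\<^esub> \<odot>\<^bsub>?G\<^esub> x = x" if c: "x \<in> carrier ?G" for x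
  proof (rule section_ext [OF sm [OF O.one_closed c] c])
    fix p assume p: "p \<in> V"
    show "(\<one>\<^bsub>?O\<^esub> \<odot>\<^bsub>?G\<^esub> x) p = x p"
      using module.smult_one [OF K [OF p], of "x p"] c p st by (simp add: sections_simps)
  qed
  have rd: "f \<odot>\<^bsub>?G\<^esub> (x \<oplus>\<^bsub>?G\<^esub> y) = f \<odot>\<^bsub>?G\<^esub> x \<oplus>\<^bsub>?G\<^esub> f \<odot>\<^bsub>?G\<^esub> y"
    if c: "f \<in> carrier ?O" "x \<in> carrier ?G" "y \<in> carrier ?G" for f x y
  proof (rule section_ext [OF sm [OF c(1) ad [OF c(2,3)]] ad [OF sm [OF c(1,2)] sm [OF c(1,3)]]])
    fix p assume p: "p \<in> V"
    show "(f \<odot>\<^bsub>?G\<^esub> (x \<oplus>\<^bsub>?G\<^esub> y)) p = (f \<odot>\<^bsub>?G\<^esub> x \<oplus>\<^bsub>?G\<^esub> f \<odot>\<^bsub>?G\<^esub> y) p"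
      using module.smult_r_distr [OF K [OF p], of "f p" "x p" "y p"] c p st sO by (simp add: sections_simps)
  qed
  have ld: "(f \<oplus>\<^bsub>?O\<^esub> g) \<odot>\<^bsub>?G\<^esub> x = f \<odot>\<^bsub>?G\<^esub> x \<oplus>\<^bsub>?G\<^esub> g \<odot>\<^bsub>?G\<^esub> x"
    if c: "f \<in> carrier ?O" "g \<in> carrier ?O" "x \<in> carrier ?G" for f g x
  proof (rule section_ext [OF sm [OF O.a_closed [OF c(1,2)] c(3)] ad [OF sm [OF c(1,3)] sm [OF c(2,3)]]])
    fix p assume p: "p \<in> V"
    show "((f \<oplus>\<^bsub>?O\<^esub> g) \<odot>\<^bsub>?G\<^esub> x) p = (f \<odot>\<^bsub>?G\<^esub> x \<oplus>\<^bsub>?G\<^esub> g \<odot>\<^bsub>?G\<^esub> x) p"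
      using module.smult_l_distr [OF K [OF p], of "f p" "g p" "x p"] c p st sO by (simp add: sections_simps)
  qed
  have as: "(f \<otimes>\<^bsub>?O\<^esub> g) \<odot>\<^bsub>?G\<^esub> x = f \<odot>\<^bsub>?G\<^esub> (g \<odot>\<^bsub>?G\<^esub> x)"
    if c: "f \<in> carrier ?O" "g \<in> carrier ?O" "x \<in> carrier ?G" for f g x
  proof (rule section_ext [OF sm [OF O.m_closed [OF c(1,2)] c(3)] sm [OF c(1) sm [OF c(2,3)]]])
    fix p assume p: "p \<in> V"
    show "((f \<otimes>\<^bsub>?O\<^esub> g) \<odot>\<^bsub>?G\<^esub> x) p = (f \<odot>\<^bsub>?G\<^esub> (g \<odot>\<^bsub>?G\<^esub> x)) p"
      using module.smult_assoc1 [OF K [OF p], of "f p" "g p" "x p"] c p st sO by (simp add: sections_simps)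
  qed
  show ?thesis
    by (rule moduleI [OF struct_sheaf_cring [OF V] sections_abelian_group [OF V] sm ld rd as one])
qed

lemma sections_finsum:
  assumes V: "openin (zariski A) V" and p: "p \<in> V" and "finite I" "\<And>i. i \<in> I \<Longrightarrow> \<sigma> i \<in> carrier (sections A M V)"
  shows "(\<Oplus>\<^bsub>sections A M V\<^esub>i\<in>I. \<sigma> i) p = (\<Oplus>\<^bsub>stalk A M p\<^esub>i\<in>I. \<sigma> i p)"
  by (rule finsum_additive [where f = "\<lambda>\<sigma>. \<sigma> p"])
    (use assms in \<open>auto simp: sections_simps intro: sections_abelian_group section_stalk
      loc_mod.Q_abelian_group loc_mod_prime opens_subset\<close>)

end

section \<open>Frames and the trace on stalks\<close>

lemma opens_trans: "V'' \<in> opens A V' \<Longrightarrow> V' \<in> opens A V \<Longrightarrow> V'' \<in> opens A V"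
  by (simp add: subset_iff)

lemma (in module) is_basisI:
  assumes e: "\<And>i. i < n \<Longrightarrow> e i \<in> carrier M"
    and ex: "\<And>x. x \<in> carrier M \<Longrightarrow> \<exists>c. (\<forall>i<n. c i \<in> carrier R) \<and> x = lincomb n c e"
    and un: "\<And>c d i. (\<And>i. i < n \<Longrightarrow> c i \<in> carrier R) \<Longrightarrow> (\<And>i. i < n \<Longrightarrow> d i \<in> carrier R) \<Longrightarrow>
      lincomb n c e = lincomb n d e \<Longrightarrow> i < n \<Longrightarrow> c i = d i"
  shows "is_basis R M n e"
  unfolding is_basis_def
proof (intro conjI ballI ex_ex1I)
  show "e \<in> {..<n} \<rightarrow> carrier M" using e by auto
next
  fix x assume x: "x \<in> carrier M"
  obtain c where c: "\<forall>i<n. c i \<in> carrier R" "x = lincomb n c e" using ex [OF x] by (elim exE conjE)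
  have "lincomb n c e = lincomb n (restrict c {..<n}) e"
    using c(1) e by (intro M.finsum_cong') auto
  then show "\<exists>c. c \<in> {..<n} \<rightarrow>\<^sub>E carrier R \<and> x = lincomb n c e"
    using c by (intro exI [of _ "restrict c {..<n}"]) auto
next
  fix x c d assume c: "c \<in> {..<n} \<rightarrow>\<^sub>E carrier R \<and> x = lincomb n c e" and d: "d \<in> {..<n} \<rightarrow>\<^sub>E carrier R \<and> x = lincomb n d e"
  have c1: "c i \<in> carrier R" and d1: "d i \<in> carrier R" if "i < n" for i using c d that by auto
  have "lincomb n c e = lincomb n d e" using conjunct2 [OF c] conjunct2 [OF d] by (rule trans [OF sym])
  from un [OF c1 d1 this] show "c = d"
    by (intro PiE_ext [OF conjunct1 [OF c] conjunct1 [OF d]]) simp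
qed

context sheaf_mod
begin

lemma section_glue:
  assumes "\<sigma> \<in> extensional V" "\<And>p. p \<in> V \<Longrightarrow> \<exists>V'. V' \<in> opens A V \<and> p \<in> V' \<and> restrict \<sigma> V' \<in> carrier (sections A M V')"
  shows "\<sigma> \<in> carrier (sections A M V)"
proof (rule sectionI [OF assms(1)])
  fix p assume p: "p \<in> V"
  obtain V' where V': "V' \<in> opens A V" "p \<in> V'" "restrict \<sigma> V' \<in> carrier (sections A M V')"
    using assms(2) [OF p] by (elim exE conjE)
  obtain V1 m s where 1: "V1 \<in> opens A V'" "p \<in> V1" "frac_on A M V1 (restrict \<sigma> V') m s"
    by (rule section_local [OF V'(3,2)])
  have "V1 \<in> opens A V" by (rule opens_trans [OF 1(1) V'(1)])
  moreover have "V1 \<subseteq> V'" using 1(1) by simp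
  then have "frac_on A M V1 \<sigma> m s" using 1(3) by (simp add: frac_on_def subset_iff)
  ultimately show "\<exists>V' m s. V' \<in> opens A V \<and> p \<in> V' \<and> frac_on A M V' \<sigma> m s"
    using 1(2) by (intro exI conjI)
qed

lemma germ_extend:
  assumes V: "openin (zariski A) V" and p: "p \<in> V" and Z: "Z \<in> carrier (stalk A M p)"
  obtains V' \<sigma> where "V' \<in> opens A V" "p \<in> V'" "\<sigma> \<in> carrier (sections A M V')" "\<sigma> p = Z"
proof -
  obtain m s where ms: "m \<in> carrier M" "s \<in> carrier A - p" "Z = germ_fraction A M p m s"
    by (rule loc_mod.Q_cases [OF loc_mod_prime [OF opens_subset [OF V p]] Z])
  let ?V = "{q \<in> V. s \<notin> q}"
  have o: "?V \<in> opens A V" using basic_open [OF V] ms(2) by simp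
  have pV: "p \<in> ?V" using p ms(2) by simp
  let ?\<sigma> = "\<lambda>q\<in>?V. germ_fraction A M q m s"
  have "frac_on A M ?V ?\<sigma> m s" using ms by (simp add: frac_on_def)
  then have "?\<sigma> \<in> carrier (sections A M ?V)" using o by (intro frac_section) simp_all
  then show thesis using that [OF o pV, of ?\<sigma>] ms(3) pV by simp
qed

lemma germs_extend:
  fixes n :: nat
  assumes V: "openin (zariski A) V" and p: "p \<in> V" and Z: "\<And>i. i < n \<Longrightarrow> Z i \<in> carrier (stalk A M p)"
  shows "\<exists>V' \<sigma>. V' \<in> opens A V \<and> p \<in> V' \<and> (\<forall>i<n. \<sigma> i \<in> carrier (sections A M V') \<and> \<sigma> i p = Z i)"
  using Z
proof (induction n)
  case 0
  then show ?case using V p by (intro exI [of _ V]) simp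
next
  case (Suc n)
  from Suc.IH [OF Suc.prems] obtain V1 \<sigma> where 1: "V1 \<in> opens A V" "p \<in> V1"
    "\<forall>i<n. \<sigma> i \<in> carrier (sections A M V1) \<and> \<sigma> i p = Z i" by (auto simp: less_SucI)
  have V1: "openin (zariski A) V1" using 1(1) by simp
  obtain V2 \<tau> where 2: "V2 \<in> opens A V1" "p \<in> V2" "\<tau> \<in> carrier (sections A M V2)" "\<tau> p = Z n"
    by (rule germ_extend [OF V1 1(2) Suc.prems [OF lessI]])
  have "V2 \<in> opens A V" by (rule opens_trans [OF 2(1) 1(1)])
  moreover have "\<forall>i<Suc n. (if i = n then \<tau> else restrict (\<sigma> i) V2) \<in> carrier (sections A M V2) \<and>
     (if i = n then \<tau> else restrict (\<sigma> i) V2) p = Z i"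
  proof (intro allI impI)
    fix i assume i: "i < Suc n"
    show "(if i = n then \<tau> else restrict (\<sigma> i) V2) \<in> carrier (sections A M V2) \<and>
       (if i = n then \<tau> else restrict (\<sigma> i) V2) p = Z i"
    proof (cases "i = n")
      case False
      then have "\<sigma> i \<in> carrier (sections A M V1)" "\<sigma> i p = Z i" using 1(3) i by simp_all
      then show ?thesis using section_restrict [of "\<sigma> i" A M V1 V2] 2(1,2) False by simp
    qed (use 2(3,4) in simp)
  qed
  ultimately show ?case using 2(2)
    by (intro exI [of _ V2] exI [of _ "\<lambda>i. if i = n then \<tau> else restrict (\<sigma> i) V2"]) simp
qed

text \<open>An equation between germs of fractions is witnessed by one element \<open>u\<close> outside \<open>p\<close>, and it persists wherever
\<open>u\<close> does not vanish.\<close>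

lemma eq_near:
  assumes V: "openin (zariski A) V" and p: "p \<in> V" and \<sigma>: "\<sigma> \<in> carrier (sections A M V)" and \<tau>: "\<tau> \<in> carrier (sections A M V)"
    and eq: "\<sigma> p = \<tau> p"
  obtains V' where "V' \<in> opens A V" "p \<in> V'" "restrict \<sigma> V' = restrict \<tau> V'"
proof -
  obtain V1 m s n t where 1: "V1 \<in> opens A V" "p \<in> V1" "frac_on A M V1 \<sigma> m s" "frac_on A M V1 \<tau> n t"
    by (rule section_local2 [OF \<sigma> \<tau> p])
  note fs = frac_onD [OF 1(3)] and ft = frac_onD [OF 1(4)]
  have "germ_fraction A M p m s = germ_fraction A M p n t" using eq fs(3) [OF 1(2)] ft(3) [OF 1(2)] by simp
  then obtain u where u: "u \<in> carrier A - p" "u \<odot>\<^bsub>M\<^esub> (s \<odot>\<^bsub>M\<^esub> n) = u \<odot>\<^bsub>M\<^esub> (t \<odot>\<^bsub>M\<^esub> m)"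
    using loc_mod.frac_eq_iff [OF loc_mod_prime [OF opens_subset [OF V p]] fs(1) [OF 1(2)] ft(1) [OF 1(2)] fs(2) [OF 1(2)] ft(2) [OF 1(2)]]
    by blast
  \<comment> \<open>The same \<open>u\<close> proves the equality of the two fractions at every prime that does not contain it.\<close>
  let ?V = "{q \<in> V1. u \<notin> q}"
  have V1: "openin (zariski A) V1" using 1(1) by simp
  have o: "?V \<in> opens A V1" using basic_open [OF V1] u(1) by simp
  have "\<sigma> q = \<tau> q" if q: "q \<in> ?V" for q
  proof -
    have q1: "q \<in> V1" "u \<in> carrier A - q" using q u(1) by simp_all
    have "germ_fraction A M q m s = germ_fraction A M q n t"
      using loc_mod.frac_eq_iff [OF loc_mod_prime [OF opens_subset [OF V1 q1(1)]] fs(1) [OF q1(1)] ft(1) [OF q1(1)] fs(2) [OF q1(1)] ft(2) [OF q1(1)]]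
        u(2) q1(2) by blast
    then show ?thesis using fs(3) [OF q1(1)] ft(3) [OF q1(1)] by simp
  qed
  then have "restrict \<sigma> ?V = restrict \<tau> ?V" by (intro restrict_ext) simp
  moreover have "?V \<in> opens A V" by (rule opens_trans [OF o 1(1)])
  moreover have "p \<in> ?V" using 1(2) u(1) by simp
  ultimately show thesis using that by blast
qed

lemma lincomb_point:
  fixes n :: nat
  assumes V: "openin (zariski A) V" and p: "p \<in> V"
    and c: "\<And>i. i < n \<Longrightarrow> c i \<in> carrier (struct_sheaf A V)" and e: "\<And>i. i < n \<Longrightarrow> e i \<in> carrier (sections A M V)"
  shows "(\<Oplus>\<^bsub>sections A M V\<^esub>i\<in>{..<n}. c i \<odot>\<^bsub>sections A M V\<^esub> e i) p =
    (\<Oplus>\<^bsub>stalk A M p\<^esub>i\<in>{..<n}. c i p \<odot>\<^bsub>stalk A M p\<^esub> e i p)"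
proof -
  have "(\<Oplus>\<^bsub>sections A M V\<^esub>i\<in>{..<n}. c i \<odot>\<^bsub>sections A M V\<^esub> e i) p =
    (\<Oplus>\<^bsub>stalk A M p\<^esub>i\<in>{..<n}. (c i \<odot>\<^bsub>sections A M V\<^esub> e i) p)"
    by (rule sections_finsum [OF V p]) (use c e smult_section [OF V] in auto)
  then show ?thesis using p by (simp add: sections_simps)
qed

lemma frame_basis: "is_frame A M V n e \<Longrightarrow> V' \<in> opens A V \<Longrightarrow> is_basis (struct_sheaf A V') (sections A M V') n (\<lambda>i. restrict (e i) V')"
  by (simp add: is_frame_def)

lemma frame_open: "is_frame A M V n e \<Longrightarrow> openin (zariski A) V"
  by (simp add: is_frame_def)

lemma frame_closed: "is_frame A M V n e \<Longrightarrow> i < n \<Longrightarrow> e i \<in> carrier (sections A M V)"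
  by (auto simp: is_frame_def)

lemma frame_restrict:
  assumes f: "is_frame A M V n e" and V': "V' \<in> opens A V"
  shows "is_frame A M V' n (\<lambda>i. restrict (e i) V')"
  unfolding is_frame_def
proof (intro conjI ballI)
  show "openin (zariski A) V'" using V' by simp
  show "(\<lambda>i. restrict (e i) V') \<in> {..<n} \<rightarrow> carrier (sections A M V')"
    using section_restrict [OF frame_closed [OF f] V'] by simp
  fix V'' assume V'': "V'' \<in> opens A V'"
  have "V' \<inter> V'' = V''" using V'' by blast
  moreover have "V'' \<in> opens A V" by (rule opens_trans [OF V'' V'])
  ultimately show "is_basis (struct_sheaf A V'') (sections A M V'') n (\<lambda>i. restrict (restrict (e i) V') V'')"
    using frame_basis [OF f, of V''] by simp
qed

lemma frame_self_basis:
  assumes "is_frame A M V n e" shows "is_basis (struct_sheaf A V) (sections A M V) n (\<lambda>i. restrict (e i) V)"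
  by (rule frame_basis [OF assms]) (use frame_open [OF assms] in simp)

text \<open>A germ spreads out to a section near \<open>p\<close>, which the frame generates there. If two combinations agree at \<open>p\<close>,
they agree on a neighbourhood by \<open>eq_near\<close>, and the frame restricted to it is still a basis. Both steps
use that a frame stays a basis over every smaller open set.\<close>

lemma frame_stalk_basis:
  assumes f: "is_frame A M V n e" and p: "p \<in> V"
  shows "is_basis (stalk_ring A p) (stalk A M p) n (\<lambda>i. e i p)"
proof -
  note V = frame_open [OF f]
  interpret O: sheaf_mod A "self_module A" by (rule sheaf_mod_self)
  note K = stalk_module [OF opens_subset [OF V p]]
  show ?thesis
  proof (rule module.is_basisI [OF K])
    fix i assume "i < n" then show "e i p \<in> carrier (stalk A M p)"
      by (rule section_stalk [OF V frame_closed [OF f] p])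
  next
    fix Z assume Z: "Z \<in> carrier (stalk A M p)"
    obtain V' \<sigma> where s: "V' \<in> opens A V" "p \<in> V'" "\<sigma> \<in> carrier (sections A M V')" "\<sigma> p = Z"
      by (rule germ_extend [OF V p Z])
    have V': "openin (zariski A) V'" using s(1) by simp
    obtain c where c: "c \<in> {..<n} \<rightarrow>\<^sub>E carrier (struct_sheaf A V')"
      "\<sigma> = (\<Oplus>\<^bsub>sections A M V'\<^esub>i\<in>{..<n}. c i \<odot>\<^bsub>sections A M V'\<^esub> restrict (e i) V')"
      using frame_basis [OF f s(1)] s(3) unfolding is_basis_def by blast
    have c1: "c i \<in> carrier (struct_sheaf A V')" if "i < n" for i using c(1) that by auto
    have "Z = (\<Oplus>\<^bsub>stalk A M p\<^esub>i\<in>{..<n}. c i p \<odot>\<^bsub>stalk A M p\<^esub> restrict (e i) V' p)"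
      unfolding s(4) [symmetric] by (subst c(2), rule lincomb_point [OF V' s(2) c1 section_restrict [OF frame_closed [OF f] s(1)]])
    then have "Z = (\<Oplus>\<^bsub>stalk A M p\<^esub>i\<in>{..<n}. c i p \<odot>\<^bsub>stalk A M p\<^esub> e i p)" using s(2) by simp
    moreover have "\<forall>i<n. c i p \<in> carrier (stalk_ring A p)" using O.section_stalk [OF V' _ s(2)] c1 by simp
    ultimately show "\<exists>c. (\<forall>i<n. c i \<in> carrier (stalk_ring A p)) \<and> Z = (\<Oplus>\<^bsub>stalk A M p\<^esub>i\<in>{..<n}. c i \<odot>\<^bsub>stalk A M p\<^esub> e i p)"
      by (intro exI [of _ "\<lambda>i. c i p"] conjI)
  next
    fix c d i
    assume c: "\<And>i. i < n \<Longrightarrow> c i \<in> carrier (stalk_ring A p)" and d: "\<And>i. i < n \<Longrightarrow> d i \<in> carrier (stalk_ring A p)"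
      and eq: "(\<Oplus>\<^bsub>stalk A M p\<^esub>i\<in>{..<n}. c i \<odot>\<^bsub>stalk A M p\<^esub> e i p) = (\<Oplus>\<^bsub>stalk A M p\<^esub>i\<in>{..<n}. d i \<odot>\<^bsub>stalk A M p\<^esub> e i p)"
      and i: "i < n"
    have "\<exists>V' \<sigma>. V' \<in> opens A V \<and> p \<in> V' \<and> (\<forall>i<n. \<sigma> i \<in> carrier (sections A (self_module A) V') \<and> \<sigma> i p = c i)"
      by (rule O.germs_extend [OF V p]) (use c in simp)
    then obtain V1 \<gamma> where 1: "V1 \<in> opens A V" "p \<in> V1" "\<forall>i<n. \<gamma> i \<in> carrier (sections A (self_module A) V1) \<and> \<gamma> i p = c i"
      by (elim exE conjE)
    have V1: "openin (zariski A) V1" using 1(1) by simp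
    have "\<exists>V' \<sigma>. V' \<in> opens A V1 \<and> p \<in> V' \<and> (\<forall>i<n. \<sigma> i \<in> carrier (sections A (self_module A) V') \<and> \<sigma> i p = d i)"
      by (rule O.germs_extend [OF V1 1(2)]) (use d in simp)
    then obtain V2 \<eta> where 2: "V2 \<in> opens A V1" "p \<in> V2" "\<forall>i<n. \<eta> i \<in> carrier (sections A (self_module A) V2) \<and> \<eta> i p = d i"
      by (elim exE conjE)
    have V2: "openin (zariski A) V2" using 2(1) by simp
    have V2V: "V2 \<in> opens A V" by (rule opens_trans [OF 2(1) 1(1)])
    let ?\<gamma> = "\<lambda>i. restrict (\<gamma> i) V2" and ?e = "\<lambda>i. restrict (e i) V2"
    let ?lc = "\<lambda>V c e. \<Oplus>\<^bsub>sections A M V\<^esub>i\<in>{..<n}. c i \<odot>\<^bsub>sections A M V\<^esub> e i"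
    have g: "?\<gamma> i \<in> carrier (struct_sheaf A V2)" "?\<gamma> i p = c i" if "i < n" for i
      using section_restrict [of "\<gamma> i" A "self_module A" V1 V2] 2(1) 1(3) 2(2) that by simp_all
    have h: "\<eta> i \<in> carrier (struct_sheaf A V2)" "\<eta> i p = d i" if "i < n" for i
      using 2(3) that by simp_all
    have e: "?e i \<in> carrier (sections A M V2)" if "i < n" for i
      by (rule section_restrict [OF frame_closed [OF f that] V2V])
    note SM = sections_module [OF V2]
    have pe: "?lc V2 ?\<gamma> ?e p = ?lc V2 \<eta> ?e p"
    proof -
      have "?lc V2 ?\<gamma> ?e p = (\<Oplus>\<^bsub>stalk A M p\<^esub>i\<in>{..<n}. ?\<gamma> i p \<odot>\<^bsub>stalk A M p\<^esub> ?e i p)"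
        by (rule lincomb_point [OF V2 2(2) g(1) e])
      also have "\<dots> = (\<Oplus>\<^bsub>stalk A M p\<^esub>i\<in>{..<n}. c i \<odot>\<^bsub>stalk A M p\<^esub> e i p)"
        using c section_stalk [OF V frame_closed [OF f] p] g(2) 2(2) module.smult_closed [OF K]
        by (intro abelian_monoid.finsum_cong' [OF abelian_group.axioms(1) [OF module.axioms(2) [OF K]]]) auto
      also have "\<dots> = (\<Oplus>\<^bsub>stalk A M p\<^esub>i\<in>{..<n}. \<eta> i p \<odot>\<^bsub>stalk A M p\<^esub> ?e i p)"
        unfolding eq using d section_stalk [OF V frame_closed [OF f] p] h(2) 2(2) module.smult_closed [OF K]
        by (intro abelian_monoid.finsum_cong' [OF abelian_group.axioms(1) [OF module.axioms(2) [OF K]]]) auto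
      also have "\<dots> = ?lc V2 \<eta> ?e p"
        by (rule lincomb_point [OF V2 2(2) h(1) e, symmetric])
      finally show ?thesis .
    qed
    have lcg: "?lc V2 ?\<gamma> ?e \<in> carrier (sections A M V2)" by (rule module.lincomb_closed [OF SM g(1) e])
    have lch: "?lc V2 \<eta> ?e \<in> carrier (sections A M V2)" by (rule module.lincomb_closed [OF SM h(1) e])
    obtain V3 where 3: "V3 \<in> opens A V2" "p \<in> V3" "restrict (?lc V2 ?\<gamma> ?e) V3 = restrict (?lc V2 \<eta> ?e) V3"
      by (rule eq_near [OF V2 2(2) lcg lch pe])
    have V3: "openin (zariski A) V3" using 3(1) by simp
    have V3V: "V3 \<in> opens A V" by (rule opens_trans [OF 3(1) V2V])
    have sub: "V3 \<subseteq> V2" using 3(1) by simp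
    have res: "restrict (?lc V2 x ?e) V3 = ?lc V3 (\<lambda>i. restrict (x i) V3) (\<lambda>i. restrict (e i) V3)"
      if x: "\<And>i. i < n \<Longrightarrow> x i \<in> carrier (struct_sheaf A V2)" for x
    proof (rule section_ext [OF section_restrict [OF module.lincomb_closed [OF SM x e] 3(1)]])
      have x3: "restrict (x i) V3 \<in> carrier (struct_sheaf A V3)" if "i < n" for i
        using section_restrict [of "x i" A "self_module A" V2 V3] 3(1) x [OF that] by simp
      have e3: "restrict (e i) V3 \<in> carrier (sections A M V3)" if "i < n" for i
        by (rule section_restrict [OF frame_closed [OF f that] V3V])
      show "?lc V3 (\<lambda>i. restrict (x i) V3) (\<lambda>i. restrict (e i) V3) \<in> carrier (sections A M V3)"
        by (rule module.lincomb_closed [OF sections_module [OF V3] x3 e3])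
      fix q assume q: "q \<in> V3"
      then have q2: "q \<in> V2" using sub by blast
      show "restrict (?lc V2 x ?e) V3 q = ?lc V3 (\<lambda>i. restrict (x i) V3) (\<lambda>i. restrict (e i) V3) q"
        using lincomb_point [OF V2 q2 x e] lincomb_point [OF V3 q x3 e3] q q2 by simp
    qed
    have "restrict (?\<gamma> i) V3 = restrict (\<eta> i) V3"
    proof (rule module.basis_unique [OF sections_module [OF V3] frame_basis [OF f V3V] _ _ _ i])
      show "restrict (?\<gamma> i) V3 \<in> carrier (struct_sheaf A V3)" "restrict (\<eta> i) V3 \<in> carrier (struct_sheaf A V3)" if "i < n" for i
        unfolding struct_sheaf_simps
        by (rule section_restrict [OF g(1) [OF that, unfolded struct_sheaf_simps] 3(1)],
            rule section_restrict [OF h(1) [OF that, unfolded struct_sheaf_simps] 3(1)])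
      show "?lc V3 (\<lambda>i. restrict (?\<gamma> i) V3) (\<lambda>i. restrict (e i) V3) = ?lc V3 (\<lambda>i. restrict (\<eta> i) V3) (\<lambda>i. restrict (e i) V3)"
      proof -
        have "restrict (?lc V2 ?\<gamma> ?e) V3 = ?lc V3 (\<lambda>i. restrict (?\<gamma> i) V3) (\<lambda>i. restrict (e i) V3)" by (rule res [OF g(1)])
        moreover have "restrict (?lc V2 \<eta> ?e) V3 = ?lc V3 (\<lambda>i. restrict (\<eta> i) V3) (\<lambda>i. restrict (e i) V3)" by (rule res [OF h(1)])
        ultimately show ?thesis using 3(3) by (simp only:)
      qed
    qed
    from fun_cong [OF this, of p] show "c i = d i" using 3(2) g(2) [OF i] h(2) [OF i] by simp
  qed
qed

text \<open>The matrix of the map on sections in the frame, evaluated at \<open>p\<close>, is the matrix of \<open>f p\<close> in the induced basis of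
the stalk.\<close>

lemma frame_trace:
  assumes f: "is_frame A M V n e"
    and lin: "\<And>p. p \<in> V \<Longrightarrow> deriv_over (stalk_ring A p) (stalk A M p) (\<lambda>_. \<zero>\<^bsub>stalk_ring A p\<^esub>) (f p)"
    and sec: "\<And>\<omega>. \<omega> \<in> carrier (sections A M V) \<Longrightarrow> (\<lambda>p\<in>V. f p (\<omega> p)) \<in> carrier (sections A M V)"
  shows "module_trace (struct_sheaf A V) (sections A M V) (\<lambda>\<omega>. \<lambda>p\<in>V. f p (\<omega> p)) =
    (\<lambda>p\<in>V. module_trace (stalk_ring A p) (stalk A M p) (f p))"
    and "(\<lambda>p\<in>V. module_trace (stalk_ring A p) (stalk A M p) (f p)) \<in> carrier (struct_sheaf A V)"
proof -
  let ?t = "module_trace (struct_sheaf A V) (sections A M V) (\<lambda>\<omega>. \<lambda>p\<in>V. f p (\<omega> p))"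
  let ?u = "\<lambda>p\<in>V. module_trace (stalk_ring A p) (stalk A M p) (f p)"
  note V = frame_open [OF f]
  interpret O: sheaf_mod A "self_module A" by (rule sheaf_mod_self)
  interpret OR: cring "struct_sheaf A V" by (rule struct_sheaf_cring [OF V])
  note SM = sections_module [OF V]
  let ?\<Phi> = "\<lambda>\<omega>. \<lambda>p\<in>V. f p (\<omega> p)"
  note K = stalk_module [OF opens_subset [OF V]]
  have lD: "f p x \<in> carrier (stalk A M p)" "f p (x \<oplus>\<^bsub>stalk A M p\<^esub> y) = f p x \<oplus>\<^bsub>stalk A M p\<^esub> f p y"
    "f p (a \<odot>\<^bsub>stalk A M p\<^esub> x) = a \<odot>\<^bsub>stalk A M p\<^esub> f p x"
    if "p \<in> V" "x \<in> carrier (stalk A M p)" "y \<in> carrier (stalk A M p)" "a \<in> carrier (stalk_ring A p)" for p x y a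
    using module.linearD [OF K [OF that(1)] lin [OF that(1)]] that by simp_all
  have \<Phi>: "deriv_over (struct_sheaf A V) (sections A M V) (\<lambda>_. \<zero>\<^bsub>struct_sheaf A V\<^esub>) ?\<Phi>"
  proof (rule module.linearI [OF SM])
    fix x assume x: "x \<in> carrier (sections A M V)"
    show "?\<Phi> x \<in> carrier (sections A M V)" by (rule sec [OF x])
    fix y assume y: "y \<in> carrier (sections A M V)"
    show "?\<Phi> (x \<oplus>\<^bsub>sections A M V\<^esub> y) = ?\<Phi> x \<oplus>\<^bsub>sections A M V\<^esub> ?\<Phi> y"
    proof (rule section_ext [OF sec [OF add_section [OF V x y]] add_section [OF V sec [OF x] sec [OF y]]])
      fix p assume p: "p \<in> V"
      show "?\<Phi> (x \<oplus>\<^bsub>sections A M V\<^esub> y) p = (?\<Phi> x \<oplus>\<^bsub>sections A M V\<^esub> ?\<Phi> y) p"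
        using p module.linearD(2) [OF K [OF p] lin [OF p] section_stalk [OF V x p] section_stalk [OF V y p]]
        by (simp add: sections_simps)
    qed
  next
    fix a x assume a: "a \<in> carrier (struct_sheaf A V)" and x: "x \<in> carrier (sections A M V)"
    note a' = a [unfolded struct_sheaf_simps]
    show "?\<Phi> (a \<odot>\<^bsub>sections A M V\<^esub> x) = a \<odot>\<^bsub>sections A M V\<^esub> ?\<Phi> x"
    proof (rule section_ext [OF sec [OF smult_section [OF V a' x]] smult_section [OF V a' sec [OF x]]])
      fix p assume p: "p \<in> V"
      have "a p \<in> carrier (stalk_ring A p)" using O.section_stalk [OF V a' p] by simp
      then show "?\<Phi> (a \<odot>\<^bsub>sections A M V\<^esub> x) p = (a \<odot>\<^bsub>sections A M V\<^esub> ?\<Phi> x) p"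
        using p module.linearD(3) [OF K [OF p] lin [OF p] _ section_stalk [OF V x p], of "a p"]
        by (simp add: sections_simps)
    qed
  qed
  note B = frame_self_basis [OF f]
  obtain c where c: "\<And>i j. i < n \<Longrightarrow> j < n \<Longrightarrow> c i j \<in> carrier (struct_sheaf A V)"
    "\<And>j. j < n \<Longrightarrow> ?\<Phi> (restrict (e j) V) = (\<Oplus>\<^bsub>sections A M V\<^esub>i\<in>{..<n}. c i j \<odot>\<^bsub>sections A M V\<^esub> restrict (e i) V)"
    "?t = (\<Oplus>\<^bsub>struct_sheaf A V\<^esub>i\<in>{..<n}. c i i)"
    using module.linear_matrix [OF SM B \<Phi>] by blast
  have tO: "?t \<in> carrier (struct_sheaf A V)" by (rule module.trace_closed [OF SM B \<Phi>])
  have "?t p = module_trace (stalk_ring A p) (stalk A M p) (f p)" if p: "p \<in> V" for p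
  proof -
    have cp: "c i j p \<in> carrier (stalk_ring A p)" if "i < n" "j < n" for i j
      using O.section_stalk [OF V _ p] c(1) [OF that] by simp
    have fe: "f p (e j p) = (\<Oplus>\<^bsub>stalk A M p\<^esub>i\<in>{..<n}. c i j p \<odot>\<^bsub>stalk A M p\<^esub> e i p)" if j: "j < n" for j
    proof -
      have "(\<Oplus>\<^bsub>sections A M V\<^esub>i\<in>{..<n}. c i j \<odot>\<^bsub>sections A M V\<^esub> restrict (e i) V) p =
        (\<Oplus>\<^bsub>stalk A M p\<^esub>i\<in>{..<n}. c i j p \<odot>\<^bsub>stalk A M p\<^esub> restrict (e i) V p)"
        by (rule lincomb_point [OF V p c(1) [OF _ j] module.basis_closed [OF SM B]])
      then show ?thesis using fun_cong [OF c(2) [OF j], of p] p by simp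
    qed
    have "module_trace (stalk_ring A p) (stalk A M p) (f p) = (\<Oplus>\<^bsub>stalk_ring A p\<^esub>i\<in>{..<n}. c i i p)"
      by (rule module.module_trace_eq [OF K [OF p] frame_stalk_basis [OF f p] lin [OF p] cp fe])
    also have "\<dots> = ?t p"
      unfolding c(3)
    proof (rule finsum_additive [where f = "\<lambda>\<sigma>. \<sigma> p", symmetric])
      show "abelian_group (struct_sheaf A V)" by (rule OR.abelian_group_axioms)
      interpret KR: cring "stalk_ring A p" by (rule module.axioms(1) [OF K [OF p]])
      show "abelian_group (stalk_ring A p)" by (rule KR.abelian_group_axioms)
    qed (use O.section_stalk [OF V _ p] p c(1) in \<open>auto simp: sections_simps\<close>)
    finally show ?thesis by (rule sym)
  qed
  then show "?t = ?u"
    by (intro extensionalityI [of _ V]) (use section_extensional tO in auto)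
  then show "?u \<in> carrier (struct_sheaf A V)" using tO by (simp only:)
qed

text \<open>The locus is covered by sets with frames, over which \<open>frame_trace\<close> identifies the trace with the family of
stalk traces. So this family is a section, and the covering also shows that the definite description is unique.\<close>

lemma sheaf_trace_eq:
  assumes V: "openin (zariski A) V" "V \<subseteq> locally_free_locus A M"
    and lin: "\<And>p. p \<in> V \<Longrightarrow> deriv_over (stalk_ring A p) (stalk A M p) (\<lambda>_. \<zero>\<^bsub>stalk_ring A p\<^esub>) (f p)"
    and sec: "\<And>V' \<omega>. V' \<in> opens A V \<Longrightarrow> \<omega> \<in> carrier (sections A M V') \<Longrightarrow> (\<lambda>p\<in>V'. f p (\<omega> p)) \<in> carrier (sections A M V')"
  shows "sheaf_trace A M V (\<lambda>V' \<omega>. \<lambda>p\<in>V'. f p (\<omega> p)) = (\<lambda>p\<in>V. module_trace (stalk_ring A p) (stalk A M p) (f p))"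
    and "(\<lambda>p\<in>V. module_trace (stalk_ring A p) (stalk A M p) (f p)) \<in> carrier (struct_sheaf A V)"
proof -
  let ?u = "\<lambda>p\<in>V. module_trace (stalk_ring A p) (stalk A M p) (f p)"
  interpret O: sheaf_mod A "self_module A" by (rule sheaf_mod_self)
  have tr: "module_trace (struct_sheaf A V') (sections A M V') (\<lambda>\<omega>. \<lambda>p\<in>V'. f p (\<omega> p)) = restrict ?u V'"
    "restrict ?u V' \<in> carrier (struct_sheaf A V')"
    if V': "V' \<in> opens A V" and fr: "is_frame A M V' n e" for V' n e
  proof -
    have sub: "V' \<subseteq> V" using V' by simp
    have u: "(\<lambda>p\<in>V'. module_trace (stalk_ring A p) (stalk A M p) (f p)) = restrict ?u V'"
      using sub by (intro restrict_ext) (simp add: subset_iff)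
    have l: "deriv_over (stalk_ring A p) (stalk A M p) (\<lambda>_. \<zero>\<^bsub>stalk_ring A p\<^esub>) (f p)" if "p \<in> V'" for p
      using lin that sub by blast
    show "module_trace (struct_sheaf A V') (sections A M V') (\<lambda>\<omega>. \<lambda>p\<in>V'. f p (\<omega> p)) = restrict ?u V'"
      "restrict ?u V' \<in> carrier (struct_sheaf A V')"
      using frame_trace [OF fr l sec [OF V']] unfolding u by blast+
  qed
  \<comment> \<open>A frame near \<open>p\<close> is restricted to its intersection with \<open>V\<close>.\<close>
  have cover: "\<exists>V' n e. V' \<in> opens A V \<and> p \<in> V' \<and> is_frame A M V' n e" if p: "p \<in> V" for p
  proof -
    have "p \<in> locally_free_locus A M" using p V(2) by (rule rev_subsetD)
    then obtain V1 n e where 1: "is_frame A M V1 n e" "p \<in> V1" unfolding locally_free_locus_def by blast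
    have "V1 \<inter> V \<in> opens A V1" "V1 \<inter> V \<in> opens A V" using V(1) frame_open [OF 1(1)] by (simp_all add: openin_Int)
    then show ?thesis using frame_restrict [OF 1(1)] 1(2) p by blast
  qed
  show u: "?u \<in> carrier (struct_sheaf A V)"
    unfolding struct_sheaf_simps
  proof (rule O.section_glue)
    fix p assume p: "p \<in> V"
    obtain V' n e where *: "V' \<in> opens A V" "p \<in> V'" "is_frame A M V' n e" using cover [OF p] by (elim exE conjE)
    show "\<exists>V'. V' \<in> opens A V \<and> p \<in> V' \<and> restrict ?u V' \<in> carrier (sections A (self_module A) V')"
      using *(1,2) tr(2) [OF *(1,3), unfolded struct_sheaf_simps] by (intro exI conjI)
  qed simp
  show "sheaf_trace A M V (\<lambda>V' \<omega>. \<lambda>p\<in>V'. f p (\<omega> p)) = ?u"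
    unfolding sheaf_trace_def
  proof (rule the_equality)
    show "?u \<in> carrier (struct_sheaf A V) \<and> (\<forall>V'\<in>opens A V. (\<exists>n e. is_frame A M V' n e) \<longrightarrow>
       restrict ?u V' = module_trace (struct_sheaf A V') (sections A M V') (\<lambda>\<omega>. \<lambda>p\<in>V'. f p (\<omega> p)))"
    proof (intro conjI ballI impI)
      fix V' assume V': "V' \<in> opens A V" and "\<exists>n e. is_frame A M V' n e"
      then obtain n e where "is_frame A M V' n e" by (elim exE)
      from tr(1) [OF V' this] show "restrict ?u V' = module_trace (struct_sheaf A V') (sections A M V') (\<lambda>\<omega>. \<lambda>p\<in>V'. f p (\<omega> p))"
        by (rule sym)
    qed (rule u)
  next
    fix t assume t: "t \<in> carrier (struct_sheaf A V) \<and> (\<forall>V'\<in>opens A V. (\<exists>n e. is_frame A M V' n e) \<longrightarrow>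
       restrict t V' = module_trace (struct_sheaf A V') (sections A M V') (\<lambda>\<omega>. \<lambda>p\<in>V'. f p (\<omega> p)))"
    show "t = ?u"
    proof (rule section_ext [of _ A "self_module A" V])
      show "t \<in> carrier (sections A (self_module A) V)" "?u \<in> carrier (sections A (self_module A) V)"
        using t u by simp_all
      fix p assume p: "p \<in> V"
      obtain V' n e where *: "V' \<in> opens A V" "p \<in> V'" "is_frame A M V' n e" using cover [OF p] by (elim exE conjE)
      have "restrict t V' = module_trace (struct_sheaf A V') (sections A M V') (\<lambda>\<omega>. \<lambda>p\<in>V'. f p (\<omega> p))"
        by (rule mp [OF bspec [OF conjunct2 [OF t] *(1)]], rule exI, rule exI, rule *(3))
      then have "restrict t V' p = restrict ?u V' p" unfolding tr(1) [OF *(1,3)] by (rule fun_cong)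
      then show "t p = ?u p" using *(2) by simp
    qed
  qed
qed

end

section \<open>The linear Lie-Rinehart algebra\<close>

lemma pointwise_module_simps:
  "carrier (pointwise_module X M C) = C"
  "\<zero>\<^bsub>pointwise_module X M C\<^esub> = (\<lambda>x\<in>X. \<zero>\<^bsub>M\<^esub>)"
  "f \<oplus>\<^bsub>pointwise_module X M C\<^esub> g = (\<lambda>x\<in>X. f x \<oplus>\<^bsub>M\<^esub> g x)"
  "a \<odot>\<^bsub>pointwise_module X M C\<^esub> f = (\<lambda>x\<in>X. a \<odot>\<^bsub>M\<^esub> f x)"
  by (simp_all add: pointwise_module_def)

context module
begin

lemma pointwise_module_module:
  assumes C: "\<And>f x. f \<in> C \<Longrightarrow> x \<in> X \<Longrightarrow> f x \<in> carrier M" "\<And>f. f \<in> C \<Longrightarrow> f \<in> extensional X"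
    and zero: "(\<lambda>x\<in>X. \<zero>\<^bsub>M\<^esub>) \<in> C"
    and add: "\<And>f g. f \<in> C \<Longrightarrow> g \<in> C \<Longrightarrow> (\<lambda>x\<in>X. f x \<oplus>\<^bsub>M\<^esub> g x) \<in> C"
    and smult: "\<And>a f. a \<in> carrier R \<Longrightarrow> f \<in> C \<Longrightarrow> (\<lambda>x\<in>X. a \<odot>\<^bsub>M\<^esub> f x) \<in> C"
  shows "module R (pointwise_module X M C)"
proof (rule moduleI [OF R.is_cring abelian_groupI], unfold pointwise_module_simps)
  fix f g h assume c: "f \<in> C" "g \<in> C" "h \<in> C"
  show "(\<lambda>x\<in>X. (\<lambda>x\<in>X. f x \<oplus>\<^bsub>M\<^esub> g x) x \<oplus>\<^bsub>M\<^esub> h x) = (\<lambda>x\<in>X. f x \<oplus>\<^bsub>M\<^esub> (\<lambda>x\<in>X. g x \<oplus>\<^bsub>M\<^esub> h x) x)"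
    by (rule restrict_ext) (simp add: C(1) c M.a_assoc)
next
  fix f g assume c: "f \<in> C" "g \<in> C"
  show "(\<lambda>x\<in>X. f x \<oplus>\<^bsub>M\<^esub> g x) = (\<lambda>x\<in>X. g x \<oplus>\<^bsub>M\<^esub> f x)"
    by (rule restrict_ext) (simp add: C(1) c M.a_comm)
next
  fix f assume c: "f \<in> C"
  show "(\<lambda>x\<in>X. (\<lambda>x\<in>X. \<zero>\<^bsub>M\<^esub>) x \<oplus>\<^bsub>M\<^esub> f x) = f"
    by (rule extensionalityI [of _ X]) (simp_all add: C c)
  show "(\<lambda>x\<in>X. \<one> \<odot>\<^bsub>M\<^esub> f x) = f"
    by (rule extensionalityI [of _ X]) (simp_all add: C c)
  show "\<exists>g\<in>C. (\<lambda>x\<in>X. g x \<oplus>\<^bsub>M\<^esub> f x) = (\<lambda>x\<in>X. \<zero>\<^bsub>M\<^esub>)"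
  proof (rule bexI [OF _ smult [OF R.a_inv_closed [OF R.one_closed] c]])
    show "(\<lambda>x\<in>X. (\<lambda>x\<in>X. (\<ominus> \<one>) \<odot>\<^bsub>M\<^esub> f x) x \<oplus>\<^bsub>M\<^esub> f x) = (\<lambda>x\<in>X. \<zero>\<^bsub>M\<^esub>)"
      by (rule restrict_ext) (simp add: C(1) c smult_l_minus M.l_neg)
  qed
next
  fix a b f assume c: "a \<in> carrier R" "b \<in> carrier R" "f \<in> C"
  show "(\<lambda>x\<in>X. (a \<oplus> b) \<odot>\<^bsub>M\<^esub> f x) = (\<lambda>x\<in>X. (\<lambda>x\<in>X. a \<odot>\<^bsub>M\<^esub> f x) x \<oplus>\<^bsub>M\<^esub> (\<lambda>x\<in>X. b \<odot>\<^bsub>M\<^esub> f x) x)"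
    by (rule restrict_ext) (simp add: C(1) c smult_l_distr)
  show "(\<lambda>x\<in>X. (a \<otimes> b) \<odot>\<^bsub>M\<^esub> f x) = (\<lambda>x\<in>X. a \<odot>\<^bsub>M\<^esub> (\<lambda>x\<in>X. b \<odot>\<^bsub>M\<^esub> f x) x)"
    by (rule restrict_ext) (simp add: C(1) c smult_assoc1)
next
  fix a f g assume c: "a \<in> carrier R" "f \<in> C" "g \<in> C"
  show "(\<lambda>x\<in>X. a \<odot>\<^bsub>M\<^esub> (\<lambda>x\<in>X. f x \<oplus>\<^bsub>M\<^esub> g x) x) = (\<lambda>x\<in>X. (\<lambda>x\<in>X. a \<odot>\<^bsub>M\<^esub> f x) x \<oplus>\<^bsub>M\<^esub> (\<lambda>x\<in>X. a \<odot>\<^bsub>M\<^esub> g x) x)"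
    by (rule restrict_ext) (simp add: C(1) c smult_r_distr)
qed (use zero add smult in blast)+

lemma pointwise_minus:
  assumes P: "module R (pointwise_module X M C)" and C: "\<And>f x. f \<in> C \<Longrightarrow> x \<in> X \<Longrightarrow> f x \<in> carrier M"
    and c: "f \<in> C" "g \<in> C" "x \<in> X"
  shows "(f \<ominus>\<^bsub>pointwise_module X M C\<^esub> g) x = f x \<ominus>\<^bsub>M\<^esub> g x"
proof -
  interpret P: module R "pointwise_module X M C" by (rule P)
  let ?h = "f \<ominus>\<^bsub>pointwise_module X M C\<^esub> g"
  have h: "?h \<in> C" using P.M.minus_closed c by (simp add: pointwise_module_simps)
  have "?h \<oplus>\<^bsub>pointwise_module X M C\<^esub> g = f"
    by (rule P.M.diff_add_cancel) (simp_all add: pointwise_module_simps c)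
  from fun_cong [OF this, of x] have "?h x \<oplus>\<^bsub>M\<^esub> g x = f x" using c(3) by (simp add: pointwise_module_simps)
  then show ?thesis using C [OF h c(3)] C [OF c(1,3)] C [OF c(2,3)] by (simp add: M.eq_diff_iff)
qed

end

locale linear_lr = algebra F A + W: module A W
  for F :: "('f, 'k) ring_scheme" and A :: "('f, 'a, 'y) module_scheme" and W :: "('a, 'w, 'z) module_scheme"
begin

abbreviation "endF \<equiv> carrier (EndF F A W)"
abbreviation "der \<equiv> carrier (Der F A)"
abbreviation "V \<equiv> linear_LR F A W"

lemma endF_iff: "f \<in> endF \<longleftrightarrow> f \<in> extensional (carrier W) \<and> (\<forall>w\<in>carrier W. f w \<in> carrier W) \<and>
   (\<forall>v\<in>carrier W. \<forall>w\<in>carrier W. f (v \<oplus>\<^bsub>W\<^esub> w) = f v \<oplus>\<^bsub>W\<^esub> f w) \<and>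
   (\<forall>c\<in>carrier F. \<forall>w\<in>carrier W. f ((c \<odot>\<^bsub>A\<^esub> \<one>\<^bsub>A\<^esub>) \<odot>\<^bsub>W\<^esub> w) = (c \<odot>\<^bsub>A\<^esub> \<one>\<^bsub>A\<^esub>) \<odot>\<^bsub>W\<^esub> f w)"
  by (auto simp: EndF_def pointwise_module_simps linear_maps_def restrict_scalars_def PiE_iff)

lemma der_iff: "\<delta> \<in> der \<longleftrightarrow> \<delta> \<in> extensional (carrier A) \<and> (\<forall>x\<in>carrier A. \<delta> x \<in> carrier A) \<and>
   (\<forall>x\<in>carrier A. \<forall>y\<in>carrier A. \<delta> (x \<oplus>\<^bsub>A\<^esub> y) = \<delta> x \<oplus>\<^bsub>A\<^esub> \<delta> y) \<and>
   (\<forall>c\<in>carrier F. \<forall>x\<in>carrier A. \<delta> (c \<odot>\<^bsub>A\<^esub> x) = c \<odot>\<^bsub>A\<^esub> \<delta> x) \<and>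
   (\<forall>a\<in>carrier A. \<forall>b\<in>carrier A. \<delta> (a \<otimes>\<^bsub>A\<^esub> b) = a \<otimes>\<^bsub>A\<^esub> \<delta> b \<oplus>\<^bsub>A\<^esub> \<delta> a \<otimes>\<^bsub>A\<^esub> b)"
  by (auto simp: Der_def pointwise_module_simps linear_maps_def PiE_iff)

lemma endFD:
  assumes "f \<in> endF"
  shows "f \<in> extensional (carrier W)" "w \<in> carrier W \<Longrightarrow> f w \<in> carrier W"
    "v \<in> carrier W \<Longrightarrow> w \<in> carrier W \<Longrightarrow> f (v \<oplus>\<^bsub>W\<^esub> w) = f v \<oplus>\<^bsub>W\<^esub> f w"
    "c \<in> carrier F \<Longrightarrow> w \<in> carrier W \<Longrightarrow> f ((c \<odot>\<^bsub>A\<^esub> \<one>\<^bsub>A\<^esub>) \<odot>\<^bsub>W\<^esub> w) = (c \<odot>\<^bsub>A\<^esub> \<one>\<^bsub>A\<^esub>) \<odot>\<^bsub>W\<^esub> f w"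
  using assms by (simp_all add: endF_iff)

lemma endFI:
  assumes "\<And>w. w \<in> carrier W \<Longrightarrow> f w \<in> carrier W"
    "\<And>v w. v \<in> carrier W \<Longrightarrow> w \<in> carrier W \<Longrightarrow> f (v \<oplus>\<^bsub>W\<^esub> w) = f v \<oplus>\<^bsub>W\<^esub> f w"
    "\<And>c w. c \<in> carrier F \<Longrightarrow> w \<in> carrier W \<Longrightarrow> f ((c \<odot>\<^bsub>A\<^esub> \<one>\<^bsub>A\<^esub>) \<odot>\<^bsub>W\<^esub> w) = (c \<odot>\<^bsub>A\<^esub> \<one>\<^bsub>A\<^esub>) \<odot>\<^bsub>W\<^esub> f w"
  shows "(\<lambda>w\<in>carrier W. f w) \<in> endF"
  using assms by (simp add: endF_iff)

lemma derD:
  assumes "\<delta> \<in> der"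
  shows "\<delta> \<in> extensional (carrier A)" "x \<in> carrier A \<Longrightarrow> \<delta> x \<in> carrier A"
    "x \<in> carrier A \<Longrightarrow> y \<in> carrier A \<Longrightarrow> \<delta> (x \<oplus>\<^bsub>A\<^esub> y) = \<delta> x \<oplus>\<^bsub>A\<^esub> \<delta> y"
    "c \<in> carrier F \<Longrightarrow> x \<in> carrier A \<Longrightarrow> \<delta> (c \<odot>\<^bsub>A\<^esub> x) = c \<odot>\<^bsub>A\<^esub> \<delta> x"
    "x \<in> carrier A \<Longrightarrow> y \<in> carrier A \<Longrightarrow> \<delta> (x \<otimes>\<^bsub>A\<^esub> y) = x \<otimes>\<^bsub>A\<^esub> \<delta> y \<oplus>\<^bsub>A\<^esub> \<delta> x \<otimes>\<^bsub>A\<^esub> y"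
  using assms by (simp_all add: der_iff)

lemma derI:
  assumes "\<And>x. x \<in> carrier A \<Longrightarrow> \<delta> x \<in> carrier A"
    "\<And>x y. x \<in> carrier A \<Longrightarrow> y \<in> carrier A \<Longrightarrow> \<delta> (x \<oplus>\<^bsub>A\<^esub> y) = \<delta> x \<oplus>\<^bsub>A\<^esub> \<delta> y"
    "\<And>c x. c \<in> carrier F \<Longrightarrow> x \<in> carrier A \<Longrightarrow> \<delta> (c \<odot>\<^bsub>A\<^esub> x) = c \<odot>\<^bsub>A\<^esub> \<delta> x"
    "\<And>x y. x \<in> carrier A \<Longrightarrow> y \<in> carrier A \<Longrightarrow> \<delta> (x \<otimes>\<^bsub>A\<^esub> y) = x \<otimes>\<^bsub>A\<^esub> \<delta> y \<oplus>\<^bsub>A\<^esub> \<delta> x \<otimes>\<^bsub>A\<^esub> y"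
  shows "(\<lambda>x\<in>carrier A. \<delta> x) \<in> der"
  using assms by (simp add: der_iff)

lemma EndF_eq: "EndF F A W = pointwise_module (carrier W) W endF"
  by (simp add: EndF_def pointwise_module_def)

lemma smult_endF: "a \<in> carrier A \<Longrightarrow> f \<in> endF \<Longrightarrow> (\<lambda>w\<in>carrier W. a \<odot>\<^bsub>W\<^esub> f w) \<in> endF"
  by (rule endFI) (simp_all add: endFD W.lin smult_closed)

lemma EndF_module: "module A (pointwise_module (carrier W) W endF)"
proof (rule W.pointwise_module_module)
  show "(\<lambda>w\<in>carrier W. \<zero>\<^bsub>W\<^esub>) \<in> endF" by (rule endFI) simp_all
  show "(\<lambda>w\<in>carrier W. f w \<oplus>\<^bsub>W\<^esub> g w) \<in> endF" if "f \<in> endF" "g \<in> endF" for f g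
    by (rule endFI) (simp_all add: endFD that W.smult_r_distr W.M.a_ac)
qed (simp_all add: endFD smult_endF)

lemma End_right_closed: "f \<in> endF \<Longrightarrow> a \<in> carrier A \<Longrightarrow> End_right W f a \<in> endF"
  unfolding End_right_def
proof (rule endFI)
  fix c w assume f: "f \<in> endF" and a: "a \<in> carrier A" and c: "c \<in> carrier F" and w: "w \<in> carrier W"
  have "a \<odot>\<^bsub>W\<^esub> ((c \<odot>\<^bsub>A\<^esub> \<one>\<^bsub>A\<^esub>) \<odot>\<^bsub>W\<^esub> w) = (c \<odot>\<^bsub>A\<^esub> \<one>\<^bsub>A\<^esub>) \<odot>\<^bsub>W\<^esub> (a \<odot>\<^bsub>W\<^esub> w)"
    using a c w by (simp add: W.smult_assoc1 [symmetric] m_comm)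
  then show "f (a \<odot>\<^bsub>W\<^esub> ((c \<odot>\<^bsub>A\<^esub> \<one>\<^bsub>A\<^esub>) \<odot>\<^bsub>W\<^esub> w)) = (c \<odot>\<^bsub>A\<^esub> \<one>\<^bsub>A\<^esub>) \<odot>\<^bsub>W\<^esub> f (a \<odot>\<^bsub>W\<^esub> w)"
    using endFD(4) [OF f c] a w by simp
qed (simp_all add: endFD W.smult_r_distr)

definition inner_der where "inner_der f = (\<lambda>a\<in>carrier A. \<lambda>w\<in>carrier W. f (a \<odot>\<^bsub>W\<^esub> w) \<ominus>\<^bsub>W\<^esub> a \<odot>\<^bsub>W\<^esub> f w)"

text \<open>The bimodule structure of the operators on \<open>W\<close> in terms of elements.\<close>

lemma inner_derivations_eq: "inner_derivations F A W = inner_der ` endF"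
  unfolding inner_derivations_def
proof (rule image_cong [OF refl])
  interpret E: module A "pointwise_module (carrier W) W endF" by (rule EndF_module)
  fix f assume f: "f \<in> endF"
  show "(\<lambda>a\<in>carrier A. End_right W f a \<ominus>\<^bsub>EndF F A W\<^esub> (a \<odot>\<^bsub>EndF F A W\<^esub> f)) = inner_der f"
    unfolding inner_der_def
  proof (rule restrict_ext)
    fix a assume a: "a \<in> carrier A"
    have s: "a \<odot>\<^bsub>EndF F A W\<^esub> f \<in> endF" unfolding EndF_def pointwise_module_simps(4)
      using smult_endF [OF a f] by (simp add: EndF_def)
    note e = End_right_closed [OF f a]
    have "End_right W f a \<ominus>\<^bsub>EndF F A W\<^esub> (a \<odot>\<^bsub>EndF F A W\<^esub> f) \<in> endF"
      using E.M.minus_closed [of "End_right W f a" "a \<odot>\<^bsub>EndF F A W\<^esub> f"] e s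
      by (simp add: pointwise_module_simps EndF_eq [symmetric])
    then show "End_right W f a \<ominus>\<^bsub>EndF F A W\<^esub> (a \<odot>\<^bsub>EndF F A W\<^esub> f) = (\<lambda>w\<in>carrier W. f (a \<odot>\<^bsub>W\<^esub> w) \<ominus>\<^bsub>W\<^esub> a \<odot>\<^bsub>W\<^esub> f w)"
    proof (rule extensionalityI [OF endFD(1)])
      fix w assume w: "w \<in> carrier W"
      have "(End_right W f a \<ominus>\<^bsub>pointwise_module (carrier W) W endF\<^esub> (a \<odot>\<^bsub>EndF F A W\<^esub> f)) w = End_right W f a w \<ominus>\<^bsub>W\<^esub> (a \<odot>\<^bsub>EndF F A W\<^esub> f) w"
        by (rule W.pointwise_minus [OF EndF_module _ e s w]) (rule endFD(2))
      then show "(End_right W f a \<ominus>\<^bsub>EndF F A W\<^esub> (a \<odot>\<^bsub>EndF F A W\<^esub> f)) w = (\<lambda>w\<in>carrier W. f (a \<odot>\<^bsub>W\<^esub> w) \<ominus>\<^bsub>W\<^esub> a \<odot>\<^bsub>W\<^esub> f w) w"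
        using w by (simp add: EndF_eq [symmetric] End_right_def) (simp add: EndF_def pointwise_module_simps)
    qed simp
  qed
qed

definition pointwise_sum where "pointwise_sum g h = (\<lambda>a\<in>carrier A. \<lambda>w\<in>carrier W. g a w \<oplus>\<^bsub>W\<^esub> h a w)"

lemma kodaira_spencer_eq: "kodaira_spencer F A W \<delta> = (\<lambda>g. pointwise_sum g (der_to_End A W \<delta>)) ` inner_derivations F A W"
  unfolding kodaira_spencer_def a_r_coset_def' Der_End_def pointwise_module_simps pointwise_sum_def EndF_def
  by blast

lemma inner_der_add:
  assumes "f \<in> endF" "g \<in> endF"
  shows "pointwise_sum (inner_der f) (inner_der g) = inner_der (\<lambda>w\<in>carrier W. f w \<oplus>\<^bsub>W\<^esub> g w)"
  unfolding pointwise_sum_def inner_der_def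
  by (rule restrict_ext, rule restrict_ext) (simp add: endFD assms W.lin)

text \<open>The inner derivations are a group, so a coset of it is trivial if and only if its representative is inner.\<close>

lemma V_kernel_iff:
  assumes \<delta>: "\<delta> \<in> der"
  shows "kodaira_spencer F A W \<delta> = inner_derivations F A W \<longleftrightarrow> der_to_End A W \<delta> \<in> inner_derivations F A W"
proof
  interpret E: module A "pointwise_module (carrier W) W endF" by (rule EndF_module)
  assume eq: "kodaira_spencer F A W \<delta> = inner_derivations F A W"
  have z: "(\<lambda>w\<in>carrier W. \<zero>\<^bsub>W\<^esub>) \<in> endF" using E.M.zero_closed by (simp add: pointwise_module_simps)
  have "pointwise_sum (inner_der (\<lambda>w\<in>carrier W. \<zero>\<^bsub>W\<^esub>)) (der_to_End A W \<delta>) = der_to_End A W \<delta>"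
    unfolding pointwise_sum_def inner_der_def der_to_End_def
    by (rule restrict_ext, rule restrict_ext) (simp add: derD [OF \<delta>])
  then have "der_to_End A W \<delta> \<in> kodaira_spencer F A W \<delta>"
    unfolding kodaira_spencer_eq inner_derivations_eq using z by (metis image_eqI)
  then show "der_to_End A W \<delta> \<in> inner_derivations F A W" unfolding eq .
next
  interpret E: module A "pointwise_module (carrier W) W endF" by (rule EndF_module)
  assume "der_to_End A W \<delta> \<in> inner_derivations F A W"
  then obtain f where f: "f \<in> endF" "der_to_End A W \<delta> = inner_der f" unfolding inner_derivations_eq by blast
  have ad: "(\<lambda>w\<in>carrier W. g w \<oplus>\<^bsub>W\<^esub> f w) \<in> endF" if "g \<in> endF" for g
    using E.M.a_closed [of g f] that f(1) by (simp add: pointwise_module_simps)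
  show "kodaira_spencer F A W \<delta> = inner_derivations F A W"
    unfolding kodaira_spencer_eq inner_derivations_eq f(2)
  proof (rule subset_antisym; rule subsetI)
    fix x assume "x \<in> (\<lambda>g. pointwise_sum g (inner_der f)) ` inner_der ` endF"
    then obtain g where g: "g \<in> endF" "x = pointwise_sum (inner_der g) (inner_der f)" by blast
    show "x \<in> inner_der ` endF" unfolding g(2) inner_der_add [OF g(1) f(1)] by (rule imageI [OF ad [OF g(1)]])
  next
    fix x assume "x \<in> inner_der ` endF"
    then obtain g where g: "g \<in> endF" "x = inner_der g" by blast
    let ?h = "g \<ominus>\<^bsub>pointwise_module (carrier W) W endF\<^esub> f"
    have h: "?h \<in> endF" using E.M.minus_closed [of g f] g(1) f(1) by (simp add: pointwise_module_simps)
    have "(\<lambda>w\<in>carrier W. ?h w \<oplus>\<^bsub>W\<^esub> f w) = g"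
      using E.M.diff_add_cancel [of g f] g(1) f(1) by (simp add: pointwise_module_simps)
    then have "x = pointwise_sum (inner_der ?h) (inner_der f)" unfolding g(2) inner_der_add [OF h f(1)] by simp
    then show "x \<in> (\<lambda>g. pointwise_sum g (inner_der f)) ` inner_der ` endF" using h by blast
  qed
qed

text \<open>That \<open>der_to_End A W \<delta>\<close> is the inner derivation of \<open>f\<close> means \<open>\<delta>(a) w = f(a w) - a f(w)\<close>, which is the Leibniz
rule for \<open>f\<close>.\<close>

lemma linear_LR_iff: "\<delta> \<in> carrier V \<longleftrightarrow> \<delta> \<in> der \<and> (\<exists>f\<in>endF. \<forall>a\<in>carrier A. \<forall>w\<in>carrier W.
    f (a \<odot>\<^bsub>W\<^esub> w) = a \<odot>\<^bsub>W\<^esub> f w \<oplus>\<^bsub>W\<^esub> \<delta> a \<odot>\<^bsub>W\<^esub> w)"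
proof -
  have "\<delta> \<in> carrier V \<longleftrightarrow> \<delta> \<in> der \<and> kodaira_spencer F A W \<delta> = inner_derivations F A W"
    by (simp add: linear_LR_def kernel_def HH1_End_def A_FactGroup_def FactGroup_def)
  moreover have "der_to_End A W \<delta> \<in> inner_derivations F A W \<longleftrightarrow> (\<exists>f\<in>endF. \<forall>a\<in>carrier A. \<forall>w\<in>carrier W.
    f (a \<odot>\<^bsub>W\<^esub> w) = a \<odot>\<^bsub>W\<^esub> f w \<oplus>\<^bsub>W\<^esub> \<delta> a \<odot>\<^bsub>W\<^esub> w)" if \<delta>: "\<delta> \<in> der"
  proof -
    have "der_to_End A W \<delta> = inner_der f \<longleftrightarrow> (\<forall>a\<in>carrier A. \<forall>w\<in>carrier W.
      f (a \<odot>\<^bsub>W\<^esub> w) = a \<odot>\<^bsub>W\<^esub> f w \<oplus>\<^bsub>W\<^esub> \<delta> a \<odot>\<^bsub>W\<^esub> w)" if f: "f \<in> endF" for f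
    proof -
      have "der_to_End A W \<delta> = inner_der f \<longleftrightarrow> (\<forall>a\<in>carrier A. \<forall>w\<in>carrier W. \<delta> a \<odot>\<^bsub>W\<^esub> w = f (a \<odot>\<^bsub>W\<^esub> w) \<ominus>\<^bsub>W\<^esub> a \<odot>\<^bsub>W\<^esub> f w)"
        unfolding der_to_End_def inner_der_def by (simp add: restrict_def fun_eq_iff) (metis (no_types, opaque_lifting))
      also have "\<dots> \<longleftrightarrow> (\<forall>a\<in>carrier A. \<forall>w\<in>carrier W. f (a \<odot>\<^bsub>W\<^esub> w) = a \<odot>\<^bsub>W\<^esub> f w \<oplus>\<^bsub>W\<^esub> \<delta> a \<odot>\<^bsub>W\<^esub> w)"
        using endFD(2) [OF f] derD(2) [OF \<delta>]
        by (intro ball_cong refl) (simp add: W.M.eq_diff_iff W.M.a_comm eq_commute)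
      finally show ?thesis .
    qed
    then show ?thesis unfolding inner_derivations_eq by (simp add: image_iff cong: bex_cong)
  qed
  ultimately show ?thesis using V_kernel_iff by (simp cong: conj_cong)
qed

lemma V_der: "\<delta> \<in> carrier V \<Longrightarrow> \<delta> \<in> der"
  by (simp add: linear_LR_iff)

lemma V_eq: "V = pointwise_module (carrier A) (self_module A) (carrier V)"
  by (simp add: linear_LR_def Der_def pointwise_module_def)

lemma self_module: "module A (self_module A)"
  by (rule module_self)

text \<open>An operator with the Leibniz rule commutes with the scalars of \<open>F\<close>, since \<open>\<delta>\<close> vanishes on them.\<close>

lemma linear_LR_I:
  assumes \<delta>: "\<delta> \<in> der" and cl: "\<And>w. w \<in> carrier W \<Longrightarrow> f w \<in> carrier W"
    and add: "\<And>v w. v \<in> carrier W \<Longrightarrow> w \<in> carrier W \<Longrightarrow> f (v \<oplus>\<^bsub>W\<^esub> w) = f v \<oplus>\<^bsub>W\<^esub> f w"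
    and leib: "\<And>a w. a \<in> carrier A \<Longrightarrow> w \<in> carrier W \<Longrightarrow> f (a \<odot>\<^bsub>W\<^esub> w) = a \<odot>\<^bsub>W\<^esub> f w \<oplus>\<^bsub>W\<^esub> \<delta> a \<odot>\<^bsub>W\<^esub> w"
  shows "\<delta> \<in> carrier V"
proof -
  have "\<delta> \<one>\<^bsub>A\<^esub> \<oplus>\<^bsub>A\<^esub> \<delta> \<one>\<^bsub>A\<^esub> = \<delta> \<one>\<^bsub>A\<^esub>" using derD(5) [OF \<delta>, of "\<one>\<^bsub>A\<^esub>" "\<one>\<^bsub>A\<^esub>"] derD(2) [OF \<delta>] by simp
  then have "\<delta> \<one>\<^bsub>A\<^esub> = \<zero>\<^bsub>A\<^esub>" using derD(2) [OF \<delta>] add.r_cancel_one' by simp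
  then have z: "\<delta> (c \<odot>\<^bsub>A\<^esub> \<one>\<^bsub>A\<^esub>) = \<zero>\<^bsub>A\<^esub>" if "c \<in> carrier F" for c
    using derD(4) [OF \<delta> that, of "\<one>\<^bsub>A\<^esub>"] that by simp
  have "(\<lambda>w\<in>carrier W. f w) \<in> endF"
    by (rule endFI) (simp_all add: cl add leib z)
  then show ?thesis
    unfolding linear_LR_iff by (intro conjI \<delta> bexI [of _ "\<lambda>w\<in>carrier W. f w"]) (simp_all add: leib)
qed

lemma linear_LR_lift:
  assumes "\<delta> \<in> carrier V"
  shows "\<exists>f. f \<in> endF \<and> (\<forall>a\<in>carrier A. \<forall>w\<in>carrier W. f (a \<odot>\<^bsub>W\<^esub> w) = a \<odot>\<^bsub>W\<^esub> f w \<oplus>\<^bsub>W\<^esub> \<delta> a \<odot>\<^bsub>W\<^esub> w)"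
  using assms [unfolded linear_LR_iff] by (elim conjE bexE) (intro exI conjI)

lemma smult_F_comm:
  "c \<in> carrier F \<Longrightarrow> a \<in> carrier A \<Longrightarrow> x \<in> carrier A \<Longrightarrow> a \<otimes>\<^bsub>A\<^esub> (c \<odot>\<^bsub>A\<^esub> x) = c \<odot>\<^bsub>A\<^esub> (a \<otimes>\<^bsub>A\<^esub> x)"
  using smult_assoc2 [of c x a] by (simp add: m_comm)

lemma V_zero: "(\<lambda>x\<in>carrier A. \<zero>\<^bsub>A\<^esub>) \<in> carrier V"
proof (rule linear_LR_I [where f = "\<lambda>_. \<zero>\<^bsub>W\<^esub>"])
  show "(\<lambda>x\<in>carrier A. \<zero>\<^bsub>A\<^esub>) \<in> der" by (rule derI) simp_all
qed simp_all

lemma V_add: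
  assumes "\<delta> \<in> carrier V" "\<eta> \<in> carrier V"
  shows "(\<lambda>x\<in>carrier A. \<delta> x \<oplus>\<^bsub>A\<^esub> \<eta> x) \<in> carrier V"
proof -
  from linear_LR_lift [OF assms(1)] obtain f where f: "f \<in> endF"
    "\<forall>a\<in>carrier A. \<forall>w\<in>carrier W. f (a \<odot>\<^bsub>W\<^esub> w) = a \<odot>\<^bsub>W\<^esub> f w \<oplus>\<^bsub>W\<^esub> \<delta> a \<odot>\<^bsub>W\<^esub> w"
    by (elim exE conjE)
  from linear_LR_lift [OF assms(2)] obtain g where g: "g \<in> endF"
    "\<forall>a\<in>carrier A. \<forall>w\<in>carrier W. g (a \<odot>\<^bsub>W\<^esub> w) = a \<odot>\<^bsub>W\<^esub> g w \<oplus>\<^bsub>W\<^esub> \<eta> a \<odot>\<^bsub>W\<^esub> w"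
    by (elim exE conjE)
  note d = derD [OF V_der [OF assms(1)]] and e = derD [OF V_der [OF assms(2)]]
  show ?thesis
  proof (rule linear_LR_I [where f = "\<lambda>w. f w \<oplus>\<^bsub>W\<^esub> g w"])
    show "(\<lambda>x\<in>carrier A. \<delta> x \<oplus>\<^bsub>A\<^esub> \<eta> x) \<in> der"
      by (rule derI) (simp_all add: d e smult_r_distr l_distr r_distr a_ac)
  qed (simp_all add: endFD [OF f(1)] endFD [OF g(1)] f(2) g(2) d e W.smult_r_distr W.smult_l_distr W.M.a_ac)
qed

lemma V_smult:
  assumes "\<delta> \<in> carrier V" "b \<in> carrier A"
  shows "(\<lambda>x\<in>carrier A. b \<otimes>\<^bsub>A\<^esub> \<delta> x) \<in> carrier V"
proof -
  from linear_LR_lift [OF assms(1)] obtain f where f: "f \<in> endF"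
    "\<forall>a\<in>carrier A. \<forall>w\<in>carrier W. f (a \<odot>\<^bsub>W\<^esub> w) = a \<odot>\<^bsub>W\<^esub> f w \<oplus>\<^bsub>W\<^esub> \<delta> a \<odot>\<^bsub>W\<^esub> w"
    by (elim exE conjE)
  note d = derD [OF V_der [OF assms(1)]] and b = assms(2)
  show ?thesis
  proof (rule linear_LR_I [where f = "\<lambda>w. b \<odot>\<^bsub>W\<^esub> f w"])
    show "(\<lambda>x\<in>carrier A. b \<otimes>\<^bsub>A\<^esub> \<delta> x) \<in> der"
    proof (rule derI)
      show "b \<otimes>\<^bsub>A\<^esub> \<delta> (x \<otimes>\<^bsub>A\<^esub> y) = x \<otimes>\<^bsub>A\<^esub> (b \<otimes>\<^bsub>A\<^esub> \<delta> y) \<oplus>\<^bsub>A\<^esub> b \<otimes>\<^bsub>A\<^esub> \<delta> x \<otimes>\<^bsub>A\<^esub> y"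
        if "x \<in> carrier A" "y \<in> carrier A" for x y
        using that b by (simp add: d r_distr m_ac)
    qed (simp_all add: d b smult_F_comm r_distr)
    show "b \<odot>\<^bsub>W\<^esub> f (a \<odot>\<^bsub>W\<^esub> w) = a \<odot>\<^bsub>W\<^esub> (b \<odot>\<^bsub>W\<^esub> f w) \<oplus>\<^bsub>W\<^esub> (\<lambda>x\<in>carrier A. b \<otimes>\<^bsub>A\<^esub> \<delta> x) a \<odot>\<^bsub>W\<^esub> w"
      if "a \<in> carrier A" "w \<in> carrier W" for a w
      using that b by (simp add: f(2) endFD [OF f(1)] d W.smult_r_distr W.smult_assoc1 [symmetric] m_comm)
  qed (simp_all add: endFD [OF f(1)] b W.smult_r_distr)
qed

text \<open>If \<open>f\<close> and \<open>g\<close> lift \<open>\<delta>\<close> and \<open>\<eta>\<close>, then \<open>f g - g f\<close> lifts the bracket: the mixed terms cancel.\<close>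

lemma V_bracket:
  assumes "\<delta> \<in> carrier V" "\<eta> \<in> carrier V"
  shows "lie_bracket A \<delta> \<eta> \<in> carrier V"
proof -
  from linear_LR_lift [OF assms(1)] obtain f where f: "f \<in> endF"
    "\<forall>a\<in>carrier A. \<forall>w\<in>carrier W. f (a \<odot>\<^bsub>W\<^esub> w) = a \<odot>\<^bsub>W\<^esub> f w \<oplus>\<^bsub>W\<^esub> \<delta> a \<odot>\<^bsub>W\<^esub> w"
    by (elim exE conjE)
  from linear_LR_lift [OF assms(2)] obtain g where g: "g \<in> endF"
    "\<forall>a\<in>carrier A. \<forall>w\<in>carrier W. g (a \<odot>\<^bsub>W\<^esub> w) = a \<odot>\<^bsub>W\<^esub> g w \<oplus>\<^bsub>W\<^esub> \<eta> a \<odot>\<^bsub>W\<^esub> w"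
    by (elim exE conjE)
  note d = derD [OF V_der [OF assms(1)]] and e = derD [OF V_der [OF assms(2)]]
  show ?thesis unfolding lie_bracket_def
  proof (rule linear_LR_I [where f = "\<lambda>w. f (g w) \<ominus>\<^bsub>W\<^esub> g (f w)"])
    show "(\<lambda>x\<in>carrier A. \<delta> (\<eta> x) \<ominus>\<^bsub>A\<^esub> \<eta> (\<delta> x)) \<in> der"
    proof (rule derI)
      show "\<delta> (\<eta> (x \<otimes>\<^bsub>A\<^esub> y)) \<ominus>\<^bsub>A\<^esub> \<eta> (\<delta> (x \<otimes>\<^bsub>A\<^esub> y)) = x \<otimes>\<^bsub>A\<^esub> (\<delta> (\<eta> y) \<ominus>\<^bsub>A\<^esub> \<eta> (\<delta> y)) \<oplus>\<^bsub>A\<^esub> (\<delta> (\<eta> x) \<ominus>\<^bsub>A\<^esub> \<eta> (\<delta> x)) \<otimes>\<^bsub>A\<^esub> y"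
        if "x \<in> carrier A" "y \<in> carrier A" for x y
        using that by (simp add: d e diff_simps minus_distr a_ac)
    qed (simp_all add: d e diff_simps a_ac smult_minus_distr)
    show "f (g (a \<odot>\<^bsub>W\<^esub> w)) \<ominus>\<^bsub>W\<^esub> g (f (a \<odot>\<^bsub>W\<^esub> w)) = a \<odot>\<^bsub>W\<^esub> (f (g w) \<ominus>\<^bsub>W\<^esub> g (f w)) \<oplus>\<^bsub>W\<^esub> (\<lambda>x\<in>carrier A. \<delta> (\<eta> x) \<ominus>\<^bsub>A\<^esub> \<eta> (\<delta> x)) a \<odot>\<^bsub>W\<^esub> w"
      if "a \<in> carrier A" "w \<in> carrier W" for a w
      using that by (simp add: f(2) g(2) endFD [OF f(1)] endFD [OF g(1)] d e W.lin)
    show "f (g (v \<oplus>\<^bsub>W\<^esub> w)) \<ominus>\<^bsub>W\<^esub> g (f (v \<oplus>\<^bsub>W\<^esub> w)) = f (g v) \<ominus>\<^bsub>W\<^esub> g (f v) \<oplus>\<^bsub>W\<^esub> (f (g w) \<ominus>\<^bsub>W\<^esub> g (f w))"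
      if "v \<in> carrier W" "w \<in> carrier W" for v w
      using that by (simp add: endFD [OF f(1)] endFD [OF g(1)] W.M.diff_simps W.M.a_ac)
  qed (simp_all add: endFD [OF f(1)] endFD [OF g(1)] W.smult_minus_distr)
qed

lemma V_module: "module A V"
proof -
  have "module A (pointwise_module (carrier A) (self_module A) (carrier V))"
  by (rule module.pointwise_module_module [OF self_module], unfold self_module_simps)
      (simp_all add: derD [OF V_der] V_zero V_add V_smult)
  then show ?thesis unfolding V_eq [symmetric] .
qed

lemma V_lie_rinehart: "lie_rinehart A V"
proof (intro lie_rinehart.intro lie_rinehart_axioms.intro V_module V_bracket)
  have V: "\<delta> \<oplus>\<^bsub>V\<^esub> \<eta> = (\<lambda>x\<in>carrier A. \<delta> x \<oplus>\<^bsub>A\<^esub> \<eta> x)" "b \<odot>\<^bsub>V\<^esub> \<delta> = (\<lambda>x\<in>carrier A. b \<otimes>\<^bsub>A\<^esub> \<delta> x)" for \<delta> \<eta> b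
    by (simp_all add: linear_LR_def Der_def pointwise_module_def)
  show "(\<delta> \<oplus>\<^bsub>V\<^esub> \<eta>) a = \<delta> a \<oplus>\<^bsub>A\<^esub> \<eta> a" if "a \<in> carrier A" for \<delta> \<eta> a unfolding V using that by simp
  show "(b \<odot>\<^bsub>V\<^esub> \<delta>) a = b \<otimes>\<^bsub>A\<^esub> \<delta> a" if "a \<in> carrier A" for \<delta> b a unfolding V using that by simp
  show "deriv_over A (self_module A) \<delta> \<delta>" if "\<delta> \<in> carrier V" for \<delta>
    using derD [OF V_der [OF that]] by (simp add: deriv_over_def)
  show "\<delta> = \<eta>" if "\<delta> \<in> carrier V" "\<eta> \<in> carrier V" "\<And>a. a \<in> carrier A \<Longrightarrow> \<delta> a = \<eta> a" for \<delta> \<eta>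
    by (rule extensionalityI [OF derD(1) [OF V_der [OF that(1)]] derD(1) [OF V_der [OF that(2)]] that(3)])
qed

lemma connection_lr_connection:
  assumes "is_connection F A W nabla"
  shows "lr_connection A V W nabla"
proof (intro lr_connection.intro lr_connection_axioms.intro V_lie_rinehart W.module_axioms)
  have n: "nabla \<delta> \<in> endF" if "\<delta> \<in> carrier V" for \<delta>
    using assms that unfolding is_connection_def linear_maps_def by (auto simp: PiE_iff)
  have l: "nabla \<delta> (a \<odot>\<^bsub>W\<^esub> w) = a \<odot>\<^bsub>W\<^esub> nabla \<delta> w \<oplus>\<^bsub>W\<^esub> \<delta> a \<odot>\<^bsub>W\<^esub> w"
    if "\<delta> \<in> carrier V" "a \<in> carrier A" "w \<in> carrier W" for \<delta> a w
    using assms that unfolding is_connection_def by simp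
  have ad: "nabla (\<delta> \<oplus>\<^bsub>V\<^esub> \<eta>) = nabla \<delta> \<oplus>\<^bsub>EndF F A W\<^esub> nabla \<eta>" if "\<delta> \<in> carrier V" "\<eta> \<in> carrier V" for \<delta> \<eta>
    using assms that unfolding is_connection_def linear_maps_def by simp
  have sm: "nabla (a \<odot>\<^bsub>V\<^esub> \<delta>) = a \<odot>\<^bsub>EndF F A W\<^esub> nabla \<delta>" if "\<delta> \<in> carrier V" "a \<in> carrier A" for \<delta> a
    using assms that unfolding is_connection_def linear_maps_def by simp
  show "deriv_over A W \<delta> (nabla \<delta>)" if "\<delta> \<in> carrier V" for \<delta>
    using endFD(2,3) [OF n [OF that]] l [OF that] derD(2) [OF V_der [OF that]] by (simp add: deriv_over_def)
  show "nabla (\<delta> \<oplus>\<^bsub>V\<^esub> \<eta>) w = nabla \<delta> w \<oplus>\<^bsub>W\<^esub> nabla \<eta> w"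
    if "\<delta> \<in> carrier V" "\<eta> \<in> carrier V" "w \<in> carrier W" for \<delta> \<eta> w
    unfolding ad [OF that(1,2)] using that(3) by (simp add: EndF_def pointwise_module_simps)
  show "nabla (a \<odot>\<^bsub>V\<^esub> \<delta>) w = a \<odot>\<^bsub>W\<^esub> nabla \<delta> w"
    if "\<delta> \<in> carrier V" "a \<in> carrier A" "w \<in> carrier W" for \<delta> a w
    unfolding sm [OF that(1,2)] using that(3) by (simp add: EndF_def pointwise_module_simps)
qed

end

section \<open>The differential in low degrees\<close>

context abelian_group
begin

lemma pow_sign: "x \<in> carrier G \<Longrightarrow> [(1::int)] \<cdot> x = x" "x \<in> carrier G \<Longrightarrow> [(- 1::int)] \<cdot> x = \<ominus> x"
  using add.int_pow_1 [of x] add.int_pow_neg [of x 1] by (simp_all add: add_pow_def a_inv_def)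

lemma sign_sum_1:
  assumes "x 0 \<in> carrier G" "x (Suc 0) \<in> carrier G" "b (0, Suc 0) \<in> carrier G"
  shows "(\<Oplus>i\<in>{..Suc 0}. [((-1) ^ i :: int)] \<cdot> x i) \<oplus>
     (\<Oplus>ij\<in>{(i, j). i < j \<and> j \<le> Suc 0}. [((-1) ^ (fst ij + snd ij) :: int)] \<cdot> b ij) = x 0 \<ominus> x (Suc 0) \<ominus> b (0, Suc 0)"
proof -
  have 1: "{..Suc 0} = {0, Suc 0}" by auto
  have 2: "{(i, j). i < j \<and> j \<le> Suc 0} = {(0, Suc 0)}" by auto
  have "(\<Oplus>i\<in>{..Suc 0}. [((-1) ^ i :: int)] \<cdot> x i) = x 0 \<oplus> \<ominus> x (Suc 0)"
    unfolding 1 using assms by (simp add: pow_sign)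
  moreover have "(\<Oplus>ij\<in>{(i, j). i < j \<and> j \<le> Suc 0}. [((-1) ^ (fst ij + snd ij) :: int)] \<cdot> b ij) = \<ominus> b (0, Suc 0)"
    unfolding 2 using assms by (simp add: pow_sign)
  ultimately show ?thesis by (simp add: minus_eq)
qed

lemma sign_sum_2:
  assumes "x 0 \<in> carrier G" "x (Suc 0) \<in> carrier G" "x 2 \<in> carrier G"
    and "b (0, Suc 0) \<in> carrier G" "b (0, 2) \<in> carrier G" "b (Suc 0, 2) \<in> carrier G"
  shows "(\<Oplus>i\<in>{..2}. [((-1) ^ i :: int)] \<cdot> x i) \<oplus>
     (\<Oplus>ij\<in>{(i, j). i < j \<and> j \<le> 2}. [((-1) ^ (fst ij + snd ij) :: int)] \<cdot> b ij) =
     x 0 \<ominus> x (Suc 0) \<oplus> x 2 \<ominus> b (0, Suc 0) \<oplus> b (0, 2) \<ominus> b (Suc 0, 2)"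
proof -
  have 1: "{..2} = {0, Suc 0, 2::nat}" by auto
  have 2: "{(i, j). i < j \<and> j \<le> 2} = {(0, Suc 0), (0, 2), (Suc 0, 2::nat)}" by auto
  have "(\<Oplus>i\<in>{..2}. [((-1) ^ i :: int)] \<cdot> x i) = x 0 \<oplus> (\<ominus> x (Suc 0) \<oplus> x 2)"
    unfolding 1 using assms by (simp add: pow_sign)
  moreover have "(\<Oplus>ij\<in>{(i, j). i < j \<and> j \<le> 2}. [((-1) ^ (fst ij + snd ij) :: int)] \<cdot> b ij) =
    \<ominus> b (0, Suc 0) \<oplus> (b (0, 2) \<oplus> \<ominus> b (Suc 0, 2))"
    unfolding 2 using assms by (simp add: pow_sign)
  ultimately show ?thesis using assms by (simp add: minus_eq a_assoc)
qed

end

lemma tuples_1: "gs \<in> tuples A L (Suc 0) V \<longleftrightarrow> (\<exists>g. gs = [g] \<and> g \<in> carrier (sections A L V))"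
  by (auto simp: tuples_def length_Suc_conv)

lemma tuples_2: "gs \<in> tuples A L 2 V \<longleftrightarrow> (\<exists>g h. gs = [g, h] \<and> g \<in> carrier (sections A L V) \<and> h \<in> carrier (sections A L V))"
  by (auto simp: tuples_def numeral_2_eq_2 length_Suc_conv)

lemma tuples_3: "gs \<in> tuples A L 3 V \<longleftrightarrow> (\<exists>g h k. gs = [g, h, k] \<and> g \<in> carrier (sections A L V) \<and>
    h \<in> carrier (sections A L V) \<and> k \<in> carrier (sections A L V))"
  by (auto simp: tuples_def numeral_3_eq_3 length_Suc_conv)

lemma nths_minus_2: "nths [g, h] (- {0}) = [h]" "nths [g, h] (- {Suc 0}) = [g]" "nths [g, h] (- {0, Suc 0}) = []"
  by (simp_all add: nths_Cons)

lemma nths_minus_3: "nths [g, h, k] (- {0}) = [h, k]" "nths [g, h, k] (- {Suc 0}) = [g, k]" "nths [g, h, k] (- {2}) = [g, h]"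
  "nths [g, h, k] (- {0, Suc 0}) = [k]" "nths [g, h, k] (- {0, 2}) = [h]" "nths [g, h, k] (- {Suc 0, 2}) = [g]"
  by (simp_all add: nths_Cons)

context lie_rinehart
begin

lemma sheaf_mod_L: "sheaf_mod A L" by (intro sheaf_mod.intro L.module_axioms)
lemma sheaf_mod_O: "sheaf_mod A (self_module A)" by (rule sheaf_mod_self)

lemma at_prime: "primeideal p A \<Longrightarrow> lr_prime A L p (carrier A - p)"
  by (intro lr_prime.intro lr_prime_axioms.intro lie_rinehart_axioms refl multset_prime)

lemma O_cring: "openin (zariski A) V \<Longrightarrow> cring (struct_sheaf A V)"
  by (rule struct_sheaf_cring)

lemma O_stalk: "openin (zariski A) V \<Longrightarrow> t \<in> carrier (struct_sheaf A V) \<Longrightarrow> p \<in> V \<Longrightarrow> t p \<in> carrier (stalk_ring A p)"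
  using sheaf_mod.section_stalk [OF sheaf_mod_O, of V t p] by simp

lemma O_ext: "x \<in> carrier (struct_sheaf A V) \<Longrightarrow> y \<in> carrier (struct_sheaf A V) \<Longrightarrow> (\<And>p. p \<in> V \<Longrightarrow> x p = y p) \<Longrightarrow> x = y"
  using section_ext [of x A "self_module A" V y] by simp

lemma O_add: "p \<in> V \<Longrightarrow> (x \<oplus>\<^bsub>struct_sheaf A V\<^esub> y) p = x p \<oplus>\<^bsub>stalk_ring A p\<^esub> y p"
  by (simp add: sections_simps)

lemma O_mult: "p \<in> V \<Longrightarrow> (x \<otimes>\<^bsub>struct_sheaf A V\<^esub> y) p = x p \<otimes>\<^bsub>stalk_ring A p\<^esub> y p"
  by (simp add: sections_simps)

lemma O_zero: "p \<in> V \<Longrightarrow> \<zero>\<^bsub>struct_sheaf A V\<^esub> p = \<zero>\<^bsub>stalk_ring A p\<^esub>"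
  by (simp add: sections_simps)

lemma K_cring: "openin (zariski A) V \<Longrightarrow> p \<in> V \<Longrightarrow> cring (stalk_ring A p)"
  by (rule multset.loc_ring_cring [OF multset_prime [OF opens_subset]])

lemma O_minus:
  assumes V: "openin (zariski A) V" and x: "x \<in> carrier (struct_sheaf A V)" and y: "y \<in> carrier (struct_sheaf A V)" and p: "p \<in> V"
  shows "(x \<ominus>\<^bsub>struct_sheaf A V\<^esub> y) p = x p \<ominus>\<^bsub>stalk_ring A p\<^esub> y p"
proof -
  interpret O: cring "struct_sheaf A V" by (rule O_cring [OF V])
  interpret K: cring "stalk_ring A p" by (rule K_cring [OF V p])
  have "(x \<ominus>\<^bsub>struct_sheaf A V\<^esub> y) \<oplus>\<^bsub>struct_sheaf A V\<^esub> y = x" by (rule O.diff_add_cancel [OF x y])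
  from fun_cong [OF this, of p] have "(x \<ominus>\<^bsub>struct_sheaf A V\<^esub> y) p \<oplus>\<^bsub>stalk_ring A p\<^esub> y p = x p"
    unfolding O_add [OF p] .
  from iffD2 [OF K.eq_diff_iff, OF O_stalk [OF V x p] O_stalk [OF V y p] O_stalk [OF V O.minus_closed [OF x y] p] this]
  show ?thesis .
qed

definition act_sec where "act_sec V g t = (\<lambda>q\<in>V. stalk_action A q (g q) (t q))"
definition br_sec where "br_sec V g h = (\<lambda>q\<in>V. stalk_bracket A L q (g q) (h q))"

text \<open>Over a set on which both sections are single fractions, the quotient rule exhibits the result as a fraction.\<close>

lemma act_sec_closed:
  assumes V: "openin (zariski A) V" and g: "g \<in> carrier (sections A L V)" and t: "t \<in> carrier (struct_sheaf A V)"
  shows "act_sec V g t \<in> carrier (struct_sheaf A V)"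
  unfolding struct_sheaf_simps
proof (rule sectionI)
  fix p assume p: "p \<in> V"
  obtain V' \<delta> s a r where 1: "V' \<in> opens A V" "p \<in> V'" "frac_on A L V' g \<delta> s" "frac_on A (self_module A) V' t a r"
    by (rule section_local2 [OF g t [unfolded struct_sheaf_simps] p])
  have "frac_on A (self_module A) V' (act_sec V g t) (r \<otimes> \<delta> a \<ominus> a \<otimes> \<delta> r) (s \<otimes> (r \<otimes> r))"
  proof (rule frac_onI)
    have c: "\<delta> \<in> carrier L" "s \<in> carrier A" "a \<in> carrier A" "r \<in> carrier A" using 1(3,4) by (simp_all add: frac_on_def)
    show "r \<otimes> \<delta> a \<ominus> a \<otimes> \<delta> r \<in> carrier (self_module A)" "s \<otimes> (r \<otimes> r) \<in> carrier A"
      using c anchorD(1) [OF c(1)] by simp_all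
    fix q assume q: "q \<in> V'"
    have qV: "q \<in> V" using q 1(1) by blast
    have pq: "primeideal q A" by (rule opens_subset [OF V qV])
    note fs = frac_onD [OF 1(3) q] and ft = frac_onD [OF 1(4) q, unfolded self_module_simps]
    show "s \<otimes> (r \<otimes> r) \<notin> q" using multset.S_mult [OF multset_prime [OF pq] fs(2) multset.S_mult [OF multset_prime [OF pq] ft(2) ft(2)]] by blast
    show "act_sec V g t q = germ_fraction A (self_module A) q (r \<otimes> \<delta> a \<ominus> a \<otimes> \<delta> r) (s \<otimes> (r \<otimes> r))"
      using lr_prime.act_frac_frac [OF at_prime [OF pq] fs(1,2) ft(1,2)] qV by (simp add: act_sec_def fs(3) ft(3))
  qed
  then show "\<exists>V' m s. V' \<in> opens A V \<and> p \<in> V' \<and> frac_on A (self_module A) V' (act_sec V g t) m s"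
    using 1(1,2) by (intro exI conjI)
qed (simp add: act_sec_def)

lemma br_sec_closed:
  assumes V: "openin (zariski A) V" and g: "g \<in> carrier (sections A L V)" and h: "h \<in> carrier (sections A L V)"
  shows "br_sec V g h \<in> carrier (sections A L V)"
proof (rule sectionI)
  fix p assume p: "p \<in> V"
  obtain V' \<delta> s \<eta> r where 1: "V' \<in> opens A V" "p \<in> V'" "frac_on A L V' g \<delta> s" "frac_on A L V' h \<eta> r"
    by (rule section_local2 [OF g h p])
  let ?n = "((s \<otimes> r) \<odot>\<^bsub>L\<^esub> lie_bracket A \<delta> \<eta> \<ominus>\<^bsub>L\<^esub> (s \<otimes> \<delta> r) \<odot>\<^bsub>L\<^esub> \<eta>) \<oplus>\<^bsub>L\<^esub> (r \<otimes> \<eta> s) \<odot>\<^bsub>L\<^esub> \<delta>"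
  have "frac_on A L V' (br_sec V g h) ?n ((s \<otimes> r) \<otimes> (s \<otimes> r))"
  proof (rule frac_onI)
    have c: "\<delta> \<in> carrier L" "s \<in> carrier A" "\<eta> \<in> carrier L" "r \<in> carrier A" using 1(3,4) by (simp_all add: frac_on_def)
    show "?n \<in> carrier L" "(s \<otimes> r) \<otimes> (s \<otimes> r) \<in> carrier A"
      using c anchorD(1) [OF c(1)] anchorD(1) [OF c(3)] by simp_all
    fix q assume q: "q \<in> V'"
    have qV: "q \<in> V" using q 1(1) by blast
    have pq: "primeideal q A" by (rule opens_subset [OF V qV])
    interpret P: lr_prime A L q "carrier A - q" by (rule at_prime [OF pq])
    note fs = frac_onD [OF 1(3) q] and ft = frac_onD [OF 1(4) q]
    show "(s \<otimes> r) \<otimes> (s \<otimes> r) \<notin> q"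
      using multset.S_mult [OF multset_prime [OF pq] multset.S_mult [OF multset_prime [OF pq] fs(2) ft(2)] multset.S_mult [OF multset_prime [OF pq] fs(2) ft(2)]] by blast
    show "br_sec V g h q = germ_fraction A L q ?n ((s \<otimes> r) \<otimes> (s \<otimes> r))"
      unfolding br_sec_def restrict_apply'[OF qV] fs(3) ft(3) P.sbr_frac [OF fs(1) ft(1) fs(2) ft(2)] P.br_num_def ..
  qed
  then show "\<exists>V' m s. V' \<in> opens A V \<and> p \<in> V' \<and> frac_on A L V' (br_sec V g h) m s"
    using 1(1,2) by (intro exI conjI)
qed (simp add: br_sec_def)

lemma differential_1:
  assumes V: "V \<in> opens A U" and g: "g \<in> carrier (sections A L V)" and h: "h \<in> carrier (sections A L V)"
    and c: "\<And>k. k \<in> carrier (sections A L V) \<Longrightarrow> \<psi> V [k] \<in> carrier (struct_sheaf A V)"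
  shows "differential A L U (Suc 0) \<psi> V [g, h] =
    act_sec V g (\<psi> V [h]) \<ominus>\<^bsub>struct_sheaf A V\<^esub> act_sec V h (\<psi> V [g]) \<ominus>\<^bsub>struct_sheaf A V\<^esub> \<psi> V [br_sec V g h]"
proof -
  have Vo: "openin (zariski A) V" using V by simp
  interpret O: cring "struct_sheaf A V" by (rule O_cring [OF Vo])
  have t: "[g, h] \<in> tuples A L (Suc (Suc 0)) V" using g h by (simp add: tuples_def)
  let ?x = "\<lambda>i. \<lambda>q\<in>V. stalk_action A q (([g, h] ! i) q) (\<psi> V (nths [g, h] (- {i})) q)"
  let ?b = "\<lambda>ij. \<psi> V ((\<lambda>q\<in>V. stalk_bracket A L q (([g, h] ! fst ij) q) (([g, h] ! snd ij) q)) # nths [g, h] (- {fst ij, snd ij}))"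
  have x: "?x 0 = act_sec V g (\<psi> V [h])" "?x (Suc 0) = act_sec V h (\<psi> V [g])"
    unfolding nths_minus_2 act_sec_def by simp_all
  have b: "?b (0, Suc 0) = \<psi> V [br_sec V g h]"
    unfolding fst_conv snd_conv nths_minus_2 br_sec_def by simp
  have "differential A L U (Suc 0) \<psi> V [g, h] =
    (\<Oplus>\<^bsub>struct_sheaf A V\<^esub>i\<in>{..Suc 0}. [((-1) ^ i :: int)] \<cdot>\<^bsub>struct_sheaf A V\<^esub> ?x i) \<oplus>\<^bsub>struct_sheaf A V\<^esub>
    (\<Oplus>\<^bsub>struct_sheaf A V\<^esub>ij\<in>{(i, j). i < j \<and> j \<le> Suc 0}. [((-1) ^ (fst ij + snd ij) :: int)] \<cdot>\<^bsub>struct_sheaf A V\<^esub> ?b ij)"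
    unfolding differential_def restrict_apply' [OF V] restrict_apply' [OF t] ..
  also have "\<dots> = ?x 0 \<ominus>\<^bsub>struct_sheaf A V\<^esub> ?x (Suc 0) \<ominus>\<^bsub>struct_sheaf A V\<^esub> ?b (0, Suc 0)"
    by (rule O.sign_sum_1; unfold x b; intro act_sec_closed Vo g h c br_sec_closed)
  finally show ?thesis unfolding x b .
qed

lemma differential_2:
  assumes V: "V \<in> opens A U" and g: "g \<in> carrier (sections A L V)" and h: "h \<in> carrier (sections A L V)"
    and k: "k \<in> carrier (sections A L V)"
    and c: "\<And>k l. k \<in> carrier (sections A L V) \<Longrightarrow> l \<in> carrier (sections A L V) \<Longrightarrow> \<phi> V [k, l] \<in> carrier (struct_sheaf A V)"
  shows "differential A L U 2 \<phi> V [g, h, k] =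
    act_sec V g (\<phi> V [h, k]) \<ominus>\<^bsub>struct_sheaf A V\<^esub> act_sec V h (\<phi> V [g, k]) \<oplus>\<^bsub>struct_sheaf A V\<^esub> act_sec V k (\<phi> V [g, h])
    \<ominus>\<^bsub>struct_sheaf A V\<^esub> \<phi> V [br_sec V g h, k] \<oplus>\<^bsub>struct_sheaf A V\<^esub> \<phi> V [br_sec V g k, h] \<ominus>\<^bsub>struct_sheaf A V\<^esub> \<phi> V [br_sec V h k, g]"
proof -
  have Vo: "openin (zariski A) V" using V by simp
  interpret O: cring "struct_sheaf A V" by (rule O_cring [OF Vo])
  have t: "[g, h, k] \<in> tuples A L (Suc 2) V" using g h k by (simp add: tuples_def)
  let ?x = "\<lambda>i. \<lambda>q\<in>V. stalk_action A q (([g, h, k] ! i) q) (\<phi> V (nths [g, h, k] (- {i})) q)"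
  let ?b = "\<lambda>ij. \<phi> V ((\<lambda>q\<in>V. stalk_bracket A L q (([g, h, k] ! fst ij) q) (([g, h, k] ! snd ij) q)) # nths [g, h, k] (- {fst ij, snd ij}))"
  have x: "?x 0 = act_sec V g (\<phi> V [h, k])" "?x (Suc 0) = act_sec V h (\<phi> V [g, k])" "?x 2 = act_sec V k (\<phi> V [g, h])"
    unfolding nths_minus_3 act_sec_def by simp_all
  have b: "?b (0, Suc 0) = \<phi> V [br_sec V g h, k]" "?b (0, 2) = \<phi> V [br_sec V g k, h]" "?b (Suc 0, 2) = \<phi> V [br_sec V h k, g]"
    unfolding fst_conv snd_conv nths_minus_3 br_sec_def by simp_all
  have "differential A L U 2 \<phi> V [g, h, k] =
    (\<Oplus>\<^bsub>struct_sheaf A V\<^esub>i\<in>{..2}. [((-1) ^ i :: int)] \<cdot>\<^bsub>struct_sheaf A V\<^esub> ?x i) \<oplus>\<^bsub>struct_sheaf A V\<^esub>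
    (\<Oplus>\<^bsub>struct_sheaf A V\<^esub>ij\<in>{(i, j). i < j \<and> j \<le> 2}. [((-1) ^ (fst ij + snd ij) :: int)] \<cdot>\<^bsub>struct_sheaf A V\<^esub> ?b ij)"
    unfolding differential_def restrict_apply' [OF V] restrict_apply' [OF t] ..
  also have "\<dots> = ?x 0 \<ominus>\<^bsub>struct_sheaf A V\<^esub> ?x (Suc 0) \<oplus>\<^bsub>struct_sheaf A V\<^esub> ?x 2 \<ominus>\<^bsub>struct_sheaf A V\<^esub> ?b (0, Suc 0)
     \<oplus>\<^bsub>struct_sheaf A V\<^esub> ?b (0, 2) \<ominus>\<^bsub>struct_sheaf A V\<^esub> ?b (Suc 0, 2)"
    by (rule O.sign_sum_2; unfold x b; intro act_sec_closed Vo g h k c br_sec_closed)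
  finally show ?thesis unfolding x b .
qed

end

section \<open>Cochains of degree one and two\<close>

context lie_rinehart
begin

abbreviation sec_L where "sec_L V \<equiv> carrier (sections A L V)"

lemma open_of: "V \<in> opens A U \<Longrightarrow> openin (zariski A) V"
  by simp

lemma cochains_add:
  assumes "V \<in> opens A U" "gs \<in> tuples A L p V"
  shows "(\<phi> \<oplus>\<^bsub>cochains A L U p\<^esub> \<psi>) V gs = \<phi> V gs \<oplus>\<^bsub>struct_sheaf A V\<^esub> \<psi> V gs"
  unfolding cochains_def ring_record_simps restrict_apply' [OF assms(1)] restrict_apply' [OF assms(2)] ..

lemma restrict_section_add:
  assumes "V' \<subseteq> V"
  shows "restrict (x \<oplus>\<^bsub>struct_sheaf A V\<^esub> y) V' = restrict x V' \<oplus>\<^bsub>struct_sheaf A V'\<^esub> restrict y V'"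
proof (rule extensionalityI [of _ V'])
  show "restrict x V' \<oplus>\<^bsub>struct_sheaf A V'\<^esub> restrict y V' \<in> extensional V'" by (simp add: sections_simps)
  fix p assume p: "p \<in> V'"
  show "restrict (x \<oplus>\<^bsub>struct_sheaf A V\<^esub> y) V' p = (restrict x V' \<oplus>\<^bsub>struct_sheaf A V'\<^esub> restrict y V') p"
    unfolding O_add [OF p] restrict_apply' [OF p] by (rule O_add [OF subsetD [OF assms p]])
qed simp

lemma cochain_1I:
  assumes ext: "\<phi> \<in> extensional (opens A U)" "\<And>V. V \<in> opens A U \<Longrightarrow> \<phi> V \<in> extensional (tuples A L (Suc 0) V)"
    and cl: "\<And>V g. V \<in> opens A U \<Longrightarrow> g \<in> sec_L V \<Longrightarrow> \<phi> V [g] \<in> carrier (struct_sheaf A V)"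
    and add: "\<And>V g h. V \<in> opens A U \<Longrightarrow> g \<in> sec_L V \<Longrightarrow> h \<in> sec_L V \<Longrightarrow>
      \<phi> V [g \<oplus>\<^bsub>sections A L V\<^esub> h] = \<phi> V [g] \<oplus>\<^bsub>struct_sheaf A V\<^esub> \<phi> V [h]"
    and smult: "\<And>V f g. V \<in> opens A U \<Longrightarrow> f \<in> carrier (struct_sheaf A V) \<Longrightarrow> g \<in> sec_L V \<Longrightarrow>
      \<phi> V [f \<odot>\<^bsub>sections A L V\<^esub> g] = f \<otimes>\<^bsub>struct_sheaf A V\<^esub> \<phi> V [g]"
    and res: "\<And>V V' g. V \<in> opens A U \<Longrightarrow> V' \<in> opens A V \<Longrightarrow> g \<in> sec_L V \<Longrightarrow> \<phi> V' [restrict g V'] = restrict (\<phi> V [g]) V'"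
  shows "\<phi> \<in> carrier (cochains A L U (Suc 0))"
proof -
  have mem: "\<phi> \<in> (\<Pi>\<^sub>E V\<in>opens A U. tuples A L (Suc 0) V \<rightarrow>\<^sub>E carrier (struct_sheaf A V))"
  proof (rule PiE_I)
    fix V assume V: "V \<in> opens A U"
    show "\<phi> V \<in> tuples A L (Suc 0) V \<rightarrow>\<^sub>E carrier (struct_sheaf A V)"
    proof (rule PiE_I)
      fix gs assume "gs \<in> tuples A L (Suc 0) V"
      then obtain g where "gs = [g]" "g \<in> sec_L V" unfolding tuples_1 by blast
      then show "\<phi> V gs \<in> carrier (struct_sheaf A V)" by (simp only: cl [OF V])
    next
      fix gs assume "gs \<notin> tuples A L (Suc 0) V"
      then show "\<phi> V gs = undefined" by (rule extensional_arb [OF ext(2) [OF V]])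
    qed
  next
    fix V assume "V \<notin> opens A U"
    then show "\<phi> V = undefined" by (rule extensional_arb [OF ext(1)])
  qed
  show ?thesis unfolding cochains_def ring_record_simps partial_object.simps
  proof (rule CollectI, intro conjI ballI mem)
    fix V gs assume V: "V \<in> opens A U" and gs: "gs \<in> tuples A L (Suc 0) V"
    obtain g where g: "gs = [g]" "g \<in> sec_L V" using gs unfolding tuples_1 by blast
    show "\<forall>i<Suc 0. \<forall>g\<in>sec_L V. \<forall>h\<in>sec_L V.
        \<phi> V (gs[i := g \<oplus>\<^bsub>sections A L V\<^esub> h]) = \<phi> V (gs[i := g]) \<oplus>\<^bsub>struct_sheaf A V\<^esub> \<phi> V (gs[i := h])"
    proof (intro allI impI ballI)
      fix i :: nat and x y assume i: "i < Suc 0" and x: "x \<in> sec_L V" and y: "y \<in> sec_L V"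
      from i have "i = 0" by simp
      then show "\<phi> V (gs[i := x \<oplus>\<^bsub>sections A L V\<^esub> y]) = \<phi> V (gs[i := x]) \<oplus>\<^bsub>struct_sheaf A V\<^esub> \<phi> V (gs[i := y])"
        using add [OF V x y] unfolding g(1) by (simp only: list_update_code)
    qed
    show "\<forall>i<Suc 0. \<forall>f\<in>carrier (struct_sheaf A V). \<forall>g\<in>sec_L V.
        \<phi> V (gs[i := f \<odot>\<^bsub>sections A L V\<^esub> g]) = f \<otimes>\<^bsub>struct_sheaf A V\<^esub> \<phi> V (gs[i := g])"
    proof (intro allI impI ballI)
      fix i :: nat and f g' assume i: "i < Suc 0" and f: "f \<in> carrier (struct_sheaf A V)" and g': "g' \<in> sec_L V"
      from i have "i = 0" by simp
      then show "\<phi> V (gs[i := f \<odot>\<^bsub>sections A L V\<^esub> g']) = f \<otimes>\<^bsub>struct_sheaf A V\<^esub> \<phi> V (gs[i := g'])"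
        using smult [OF V f g'] unfolding g(1) by (simp only: list_update_code)
    qed
    show "\<forall>i<Suc 0. \<forall>j<i. gs ! i = gs ! j \<longrightarrow> \<phi> V gs = \<zero>\<^bsub>struct_sheaf A V\<^esub>" by simp
    fix V' assume V': "V' \<in> opens A V"
    show "\<phi> V' (map (\<lambda>g. restrict g V') gs) = restrict (\<phi> V gs) V'"
      using res [OF V V' g(2)] unfolding g(1) list.map .
  qed
qed

lemma cochain_1D:
  assumes \<phi>: "\<phi> \<in> carrier (cochains A L U (Suc 0))" and V: "V \<in> opens A U"
  shows "g \<in> sec_L V \<Longrightarrow> \<phi> V [g] \<in> carrier (struct_sheaf A V)"
    "g \<in> sec_L V \<Longrightarrow> h \<in> sec_L V \<Longrightarrow> \<phi> V [g \<oplus>\<^bsub>sections A L V\<^esub> h] = \<phi> V [g] \<oplus>\<^bsub>struct_sheaf A V\<^esub> \<phi> V [h]"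
    "f \<in> carrier (struct_sheaf A V) \<Longrightarrow> g \<in> sec_L V \<Longrightarrow> \<phi> V [f \<odot>\<^bsub>sections A L V\<^esub> g] = f \<otimes>\<^bsub>struct_sheaf A V\<^esub> \<phi> V [g]"
    "V' \<in> opens A V \<Longrightarrow> g \<in> sec_L V \<Longrightarrow> \<phi> V' [restrict g V'] = restrict (\<phi> V [g]) V'"
proof -
  have t: "[g] \<in> tuples A L (Suc 0) V" if "g \<in> sec_L V" for g using that by (simp add: tuples_def)
  note * = \<phi> [unfolded cochains_def partial_object.simps ring_record_simps, THEN CollectD]
  show "g \<in> sec_L V \<Longrightarrow> \<phi> V [g] \<in> carrier (struct_sheaf A V)"
    by (rule PiE_mem [OF PiE_mem [OF conjunct1 [OF *] V] t])
  show "\<phi> V [g \<oplus>\<^bsub>sections A L V\<^esub> h] = \<phi> V [g] \<oplus>\<^bsub>struct_sheaf A V\<^esub> \<phi> V [h]" if g: "g \<in> sec_L V" and h: "h \<in> sec_L V"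
    using conjunct1 [OF bspec [OF bspec [OF conjunct2 [OF *] V] t [OF g]], rule_format, OF zero_less_Suc g h] by (simp only: list_update_code)
  show "\<phi> V [f \<odot>\<^bsub>sections A L V\<^esub> g] = f \<otimes>\<^bsub>struct_sheaf A V\<^esub> \<phi> V [g]" if f: "f \<in> carrier (struct_sheaf A V)" and g: "g \<in> sec_L V"
    using conjunct1 [OF conjunct2 [OF bspec [OF bspec [OF conjunct2 [OF *] V] t [OF g]]], rule_format, OF zero_less_Suc f g] by (simp only: list_update_code)
  show "\<phi> V' [restrict g V'] = restrict (\<phi> V [g]) V'" if V': "V' \<in> opens A V" and g: "g \<in> sec_L V"
    using bspec [OF conjunct2 [OF conjunct2 [OF conjunct2 [OF bspec [OF bspec [OF conjunct2 [OF *] V] t [OF g]]]]] V'] by simp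
qed

text \<open>For an antisymmetric map linearity in the first argument suffices. Alternation is a separate
hypothesis, as it does not follow from antisymmetry when \<open>2\<close> is not invertible.\<close>

lemma cochain_2I:
  assumes ext: "\<phi> \<in> extensional (opens A U)" "\<And>V. V \<in> opens A U \<Longrightarrow> \<phi> V \<in> extensional (tuples A L 2 V)"
    and cl: "\<And>V g h. V \<in> opens A U \<Longrightarrow> g \<in> sec_L V \<Longrightarrow> h \<in> sec_L V \<Longrightarrow> \<phi> V [g, h] \<in> carrier (struct_sheaf A V)"
    and add: "\<And>V g g' h. V \<in> opens A U \<Longrightarrow> g \<in> sec_L V \<Longrightarrow> g' \<in> sec_L V \<Longrightarrow> h \<in> sec_L V \<Longrightarrow>
      \<phi> V [g \<oplus>\<^bsub>sections A L V\<^esub> g', h] = \<phi> V [g, h] \<oplus>\<^bsub>struct_sheaf A V\<^esub> \<phi> V [g', h]"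
    and smult: "\<And>V f g h. V \<in> opens A U \<Longrightarrow> f \<in> carrier (struct_sheaf A V) \<Longrightarrow> g \<in> sec_L V \<Longrightarrow> h \<in> sec_L V \<Longrightarrow>
      \<phi> V [f \<odot>\<^bsub>sections A L V\<^esub> g, h] = f \<otimes>\<^bsub>struct_sheaf A V\<^esub> \<phi> V [g, h]"
    and self: "\<And>V g. V \<in> opens A U \<Longrightarrow> g \<in> sec_L V \<Longrightarrow> \<phi> V [g, g] = \<zero>\<^bsub>struct_sheaf A V\<^esub>"
    and anti: "\<And>V g h. V \<in> opens A U \<Longrightarrow> g \<in> sec_L V \<Longrightarrow> h \<in> sec_L V \<Longrightarrow> \<phi> V [h, g] = \<ominus>\<^bsub>struct_sheaf A V\<^esub> \<phi> V [g, h]"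
    and res: "\<And>V V' g h. V \<in> opens A U \<Longrightarrow> V' \<in> opens A V \<Longrightarrow> g \<in> sec_L V \<Longrightarrow> h \<in> sec_L V \<Longrightarrow>
      \<phi> V' [restrict g V', restrict h V'] = restrict (\<phi> V [g, h]) V'"
  shows "\<phi> \<in> carrier (cochains A L U 2)"
proof -
  have mem: "\<phi> \<in> (\<Pi>\<^sub>E V\<in>opens A U. tuples A L 2 V \<rightarrow>\<^sub>E carrier (struct_sheaf A V))"
  proof (rule PiE_I)
    fix V assume V: "V \<in> opens A U"
    show "\<phi> V \<in> tuples A L 2 V \<rightarrow>\<^sub>E carrier (struct_sheaf A V)"
    proof (rule PiE_I)
      fix gs assume "gs \<in> tuples A L 2 V"
      then obtain g h where "gs = [g, h]" "g \<in> sec_L V" "h \<in> sec_L V" unfolding tuples_2 by blast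
      then show "\<phi> V gs \<in> carrier (struct_sheaf A V)" by (simp only: cl [OF V])
    next
      fix gs assume "gs \<notin> tuples A L 2 V"
      then show "\<phi> V gs = undefined" by (rule extensional_arb [OF ext(2) [OF V]])
    qed
  next
    fix V assume "V \<notin> opens A U"
    then show "\<phi> V = undefined" by (rule extensional_arb [OF ext(1)])
  qed
  have two: "i = 0 \<or> i = Suc 0" if "i < 2" for i :: nat using that by auto
  show ?thesis unfolding cochains_def ring_record_simps partial_object.simps
  proof (rule CollectI, intro conjI ballI mem)
    fix V gs assume V: "V \<in> opens A U" and gs: "gs \<in> tuples A L 2 V"
    obtain g h where g: "gs = [g, h]" "g \<in> sec_L V" "h \<in> sec_L V" using gs unfolding tuples_2 by blast
    interpret O: cring "struct_sheaf A V" by (rule O_cring [OF open_of [OF V]])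
    show "\<forall>i<2. \<forall>g\<in>sec_L V. \<forall>h\<in>sec_L V.
        \<phi> V (gs[i := g \<oplus>\<^bsub>sections A L V\<^esub> h]) = \<phi> V (gs[i := g]) \<oplus>\<^bsub>struct_sheaf A V\<^esub> \<phi> V (gs[i := h])"
    proof (intro allI impI ballI)
      fix i :: nat and x y assume i: "i < 2" and x: "x \<in> sec_L V" and y: "y \<in> sec_L V"
      note xy = sheaf_mod.add_section [OF sheaf_mod_L open_of [OF V] x y]
      from two [OF i] show "\<phi> V (gs[i := x \<oplus>\<^bsub>sections A L V\<^esub> y]) = \<phi> V (gs[i := x]) \<oplus>\<^bsub>struct_sheaf A V\<^esub> \<phi> V (gs[i := y])"
      proof
        assume "i = 0"
        then show ?thesis using add [OF V x y g(3)] unfolding g(1) by (simp only: list_update_code)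
      next
        assume "i = Suc 0"
        moreover have "\<phi> V [g, x \<oplus>\<^bsub>sections A L V\<^esub> y] = \<phi> V [g, x] \<oplus>\<^bsub>struct_sheaf A V\<^esub> \<phi> V [g, y]"
          unfolding anti [OF V xy g(2)] anti [OF V x g(2)] anti [OF V y g(2)] add [OF V x y g(2)]
          by (rule O.minus_add [OF cl [OF V x g(2)] cl [OF V y g(2)]])
        ultimately show ?thesis unfolding g(1) by (simp only: list_update_code)
      qed
    qed
    show "\<forall>i<2. \<forall>f\<in>carrier (struct_sheaf A V). \<forall>g\<in>sec_L V.
        \<phi> V (gs[i := f \<odot>\<^bsub>sections A L V\<^esub> g]) = f \<otimes>\<^bsub>struct_sheaf A V\<^esub> \<phi> V (gs[i := g])"
    proof (intro allI impI ballI)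
      fix i :: nat and f x assume i: "i < 2" and f: "f \<in> carrier (struct_sheaf A V)" and x: "x \<in> sec_L V"
      note fx = sheaf_mod.smult_section [OF sheaf_mod_L open_of [OF V] f [unfolded struct_sheaf_simps] x]
      from two [OF i] show "\<phi> V (gs[i := f \<odot>\<^bsub>sections A L V\<^esub> x]) = f \<otimes>\<^bsub>struct_sheaf A V\<^esub> \<phi> V (gs[i := x])"
      proof
        assume "i = 0"
        then show ?thesis using smult [OF V f x g(3)] unfolding g(1) by (simp only: list_update_code)
      next
        assume "i = Suc 0"
        moreover have "\<phi> V [g, f \<odot>\<^bsub>sections A L V\<^esub> x] = f \<otimes>\<^bsub>struct_sheaf A V\<^esub> \<phi> V [g, x]"
          unfolding anti [OF V fx g(2)] anti [OF V x g(2)] smult [OF V f x g(2)]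
          by (rule O.r_minus [OF f cl [OF V x g(2)], symmetric])
        ultimately show ?thesis unfolding g(1) by (simp only: list_update_code)
      qed
    qed
    show "\<forall>i<2. \<forall>j<i. gs ! i = gs ! j \<longrightarrow> \<phi> V gs = \<zero>\<^bsub>struct_sheaf A V\<^esub>"
    proof (intro allI impI)
      fix i j :: nat assume i: "i < 2" and j: "j < i" and eq: "gs ! i = gs ! j"
      have "i = Suc 0" "j = 0" using i j by simp_all
      with eq have "h = g" unfolding g(1) by simp
      then show "\<phi> V gs = \<zero>\<^bsub>struct_sheaf A V\<^esub>" using self [OF V g(2)] unfolding g(1) by (simp only:)
    qed
    fix V' assume V': "V' \<in> opens A V"
    show "\<phi> V' (map (\<lambda>g. restrict g V') gs) = restrict (\<phi> V gs) V'"
      using res [OF V V' g(2,3)] unfolding g(1) list.map .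
  qed
qed

lemma act_sec_add:
  assumes V: "openin (zariski A) V" and g: "g \<in> sec_L V"
    and x: "x \<in> carrier (struct_sheaf A V)" and y: "y \<in> carrier (struct_sheaf A V)"
  shows "act_sec V g (x \<oplus>\<^bsub>struct_sheaf A V\<^esub> y) = act_sec V g x \<oplus>\<^bsub>struct_sheaf A V\<^esub> act_sec V g y"
proof -
  interpret O: cring "struct_sheaf A V" by (rule O_cring [OF V])
  show ?thesis
  proof (rule O_ext [OF act_sec_closed [OF V g O.a_closed [OF x y]] O.a_closed [OF act_sec_closed [OF V g x] act_sec_closed [OF V g y]]])
    fix p assume p: "p \<in> V"
    show "act_sec V g (x \<oplus>\<^bsub>struct_sheaf A V\<^esub> y) p = (act_sec V g x \<oplus>\<^bsub>struct_sheaf A V\<^esub> act_sec V g y) p"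
      unfolding O_add [OF p] act_sec_def restrict_apply' [OF p]
      by (rule lr_prime.act_add [OF at_prime [OF opens_subset [OF V p]] sheaf_mod.section_stalk [OF sheaf_mod_L V g p] O_stalk [OF V x p] O_stalk [OF V y p]])
  qed
qed

lemma cochains_1_add_closed:
  assumes \<phi>: "\<phi> \<in> carrier (cochains A L U (Suc 0))" and \<psi>: "\<psi> \<in> carrier (cochains A L U (Suc 0))"
  shows "\<phi> \<oplus>\<^bsub>cochains A L U (Suc 0)\<^esub> \<psi> \<in> carrier (cochains A L U (Suc 0))"
proof (rule cochain_1I)
  have t: "[g] \<in> tuples A L (Suc 0) V" if "g \<in> sec_L V" for g V using that by (simp add: tuples_def)
  show "\<phi> \<oplus>\<^bsub>cochains A L U (Suc 0)\<^esub> \<psi> \<in> extensional (opens A U)" by (simp add: cochains_def)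
  fix V assume V: "V \<in> opens A U"
  interpret O: cring "struct_sheaf A V" by (rule O_cring [OF open_of [OF V]])
  show "(\<phi> \<oplus>\<^bsub>cochains A L U (Suc 0)\<^esub> \<psi>) V \<in> extensional (tuples A L (Suc 0) V)"
    unfolding cochains_def ring_record_simps restrict_apply' [OF V] by (rule restrict_extensional)
  note e = cochains_add [OF V t]
  note f = cochain_1D [OF \<phi> V] and s = cochain_1D [OF \<psi> V]
  show "(\<phi> \<oplus>\<^bsub>cochains A L U (Suc 0)\<^esub> \<psi>) V [g] \<in> carrier (struct_sheaf A V)" if g: "g \<in> sec_L V" for g
    unfolding e [OF g] by (intro O.a_closed f s g)
  show "(\<phi> \<oplus>\<^bsub>cochains A L U (Suc 0)\<^esub> \<psi>) V [g \<oplus>\<^bsub>sections A L V\<^esub> h] =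
      (\<phi> \<oplus>\<^bsub>cochains A L U (Suc 0)\<^esub> \<psi>) V [g] \<oplus>\<^bsub>struct_sheaf A V\<^esub> (\<phi> \<oplus>\<^bsub>cochains A L U (Suc 0)\<^esub> \<psi>) V [h]"
    if g: "g \<in> sec_L V" and h: "h \<in> sec_L V" for g h
    unfolding e [OF g] e [OF h] e [OF sheaf_mod.add_section [OF sheaf_mod_L open_of [OF V] g h]] f(2) [OF g h] s(2) [OF g h]
    by (simp only: O.a_ac O.a_closed f(1) [OF g] f(1) [OF h] s(1) [OF g] s(1) [OF h])
  show "(\<phi> \<oplus>\<^bsub>cochains A L U (Suc 0)\<^esub> \<psi>) V [k \<odot>\<^bsub>sections A L V\<^esub> g] =
      k \<otimes>\<^bsub>struct_sheaf A V\<^esub> (\<phi> \<oplus>\<^bsub>cochains A L U (Suc 0)\<^esub> \<psi>) V [g]"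
    if k: "k \<in> carrier (struct_sheaf A V)" and g: "g \<in> sec_L V" for k g
    unfolding e [OF g] e [OF sheaf_mod.smult_section [OF sheaf_mod_L open_of [OF V] k [unfolded struct_sheaf_simps] g]] f(3) [OF k g] s(3) [OF k g]
    by (rule O.r_distr [OF f(1) [OF g] s(1) [OF g] k, symmetric])
  show "(\<phi> \<oplus>\<^bsub>cochains A L U (Suc 0)\<^esub> \<psi>) V' [restrict g V'] = restrict ((\<phi> \<oplus>\<^bsub>cochains A L U (Suc 0)\<^esub> \<psi>) V [g]) V'"
    if V': "V' \<in> opens A V" and g: "g \<in> sec_L V" for V' g
  proof -
    have sub: "V' \<subseteq> V" using V' by simp
    show ?thesis
      unfolding e [OF g] cochains_add [OF opens_trans [OF V' V] t [OF section_restrict [OF g V']]]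
        restrict_section_add [OF sub] f(4) [OF V' g] s(4) [OF V' g] ..
  qed
qed

lemma differential_1_closed:
  assumes \<psi>: "\<psi> \<in> carrier (cochains A L U (Suc 0))" and V: "V \<in> opens A U" and g: "g \<in> sec_L V" and h: "h \<in> sec_L V"
  shows "differential A L U (Suc 0) \<psi> V [g, h] \<in> carrier (struct_sheaf A V)"
proof -
  interpret O: cring "struct_sheaf A V" by (rule O_cring [OF open_of [OF V]])
  have d: "differential A L U (Suc 0) \<psi> V [g, h] =
    act_sec V g (\<psi> V [h]) \<ominus>\<^bsub>struct_sheaf A V\<^esub> act_sec V h (\<psi> V [g]) \<ominus>\<^bsub>struct_sheaf A V\<^esub> \<psi> V [br_sec V g h]"
    by (rule differential_1 [OF V g h]) (rule cochain_1D(1) [OF \<psi> V])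
  show ?thesis
    unfolding d
    by (intro O.minus_closed act_sec_closed open_of [OF V] g h br_sec_closed cochain_1D(1) [OF \<psi> V])
qed

lemma differential_1_add:
  assumes \<phi>: "\<phi> \<in> carrier (cochains A L U (Suc 0))" and \<psi>: "\<psi> \<in> carrier (cochains A L U (Suc 0))"
    and V: "V \<in> opens A U" and g: "g \<in> sec_L V" and h: "h \<in> sec_L V"
  shows "differential A L U (Suc 0) (\<phi> \<oplus>\<^bsub>cochains A L U (Suc 0)\<^esub> \<psi>) V [g, h] =
    differential A L U (Suc 0) \<phi> V [g, h] \<oplus>\<^bsub>struct_sheaf A V\<^esub> differential A L U (Suc 0) \<psi> V [g, h]"
proof -
  note Vo = open_of [OF V]
  interpret O: cring "struct_sheaf A V" by (rule O_cring [OF Vo])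
  have t: "[g] \<in> tuples A L (Suc 0) V" if "g \<in> sec_L V" for g using that by (simp add: tuples_def)
  note e = cochains_add [OF V t]
  note f = cochain_1D(1) [OF \<phi> V] and s = cochain_1D(1) [OF \<psi> V]
  note b = br_sec_closed [OF Vo g h]
  have alg: "a \<oplus>\<^bsub>struct_sheaf A V\<^esub> a' \<ominus>\<^bsub>struct_sheaf A V\<^esub> (b \<oplus>\<^bsub>struct_sheaf A V\<^esub> b') \<ominus>\<^bsub>struct_sheaf A V\<^esub> (c \<oplus>\<^bsub>struct_sheaf A V\<^esub> c')
      = (a \<ominus>\<^bsub>struct_sheaf A V\<^esub> b \<ominus>\<^bsub>struct_sheaf A V\<^esub> c) \<oplus>\<^bsub>struct_sheaf A V\<^esub> (a' \<ominus>\<^bsub>struct_sheaf A V\<^esub> b' \<ominus>\<^bsub>struct_sheaf A V\<^esub> c')"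
    if "a \<in> carrier (struct_sheaf A V)" "a' \<in> carrier (struct_sheaf A V)" "b \<in> carrier (struct_sheaf A V)"
      "b' \<in> carrier (struct_sheaf A V)" "c \<in> carrier (struct_sheaf A V)" "c' \<in> carrier (struct_sheaf A V)" for a a' b b' c c'
    using that by (simp only: O.minus_eq O.minus_add O.a_ac O.a_closed O.a_inv_closed)
  have d: "differential A L U (Suc 0) \<theta> V [g, h] =
    act_sec V g (\<theta> V [h]) \<ominus>\<^bsub>struct_sheaf A V\<^esub> act_sec V h (\<theta> V [g]) \<ominus>\<^bsub>struct_sheaf A V\<^esub> \<theta> V [br_sec V g h]"
    if \<theta>: "\<theta> \<in> carrier (cochains A L U (Suc 0))" for \<theta>
    by (rule differential_1 [OF V g h]) (rule cochain_1D(1) [OF \<theta> V])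
  show ?thesis
    unfolding d [OF \<phi>] d [OF \<psi>] d [OF cochains_1_add_closed [OF \<phi> \<psi>]]
      e [OF g] e [OF h] e [OF b] act_sec_add [OF Vo g f [OF h] s [OF h]] act_sec_add [OF Vo h f [OF g] s [OF g]]
    by (intro alg act_sec_closed Vo g h f s b)
qed

end

section \<open>The trace of the curvature is a cocycle\<close>

context lr_connection
begin

abbreviation stalk_tr where
  "stalk_tr p X Y \<equiv> module_trace (stalk_ring A p) (stalk A W p) (stalk_curvature A W nabla p X Y)"

lemma sheaf_mod_W: "sheaf_mod A W" by (intro sheaf_mod.intro W.module_axioms)

lemma conn_at_prime: "primeideal p A \<Longrightarrow> lr_prime_conn A L p (carrier A - p) W nabla"
  by (intro lr_prime_conn.intro at_prime lr_connection_axioms)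

text \<open>The locally free locus is the union of the domains of frames.\<close>

lemma free_stalk:
  assumes "V \<in> opens A (locally_free_locus A W)" "p \<in> V"
  obtains n e where "is_basis (stalk_ring A p) (stalk A W p) n e"
proof -
  have "p \<in> locally_free_locus A W" using assms by blast
  then obtain V1 n e where "is_frame A W V1 n e" "p \<in> V1" unfolding locally_free_locus_def by blast
  then show thesis by (intro that) (rule sheaf_mod.frame_stalk_basis [OF sheaf_mod_W])
qed

text \<open>The curvature maps sections to sections, as it is given by one fraction on any set over which its three
arguments are single fractions.\<close>

lemma curvature_section:
  assumes V: "openin (zariski A) V" and g: "g \<in> sec_L V" and h: "h \<in> sec_L V" and \<omega>: "\<omega> \<in> carrier (sections A W V)"
  shows "(\<lambda>p\<in>V. stalk_curvature A W nabla p (g p) (h p) (\<omega> p)) \<in> carrier (sections A W V)"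
proof (rule sectionI)
  fix p assume p: "p \<in> V"
  obtain V' \<delta> s \<eta> t w r where 1: "V' \<in> opens A V" "p \<in> V'" "frac_on A L V' g \<delta> s" "frac_on A L V' h \<eta> t" "frac_on A W V' \<omega> w r"
    by (rule section_local3 [OF g h \<omega> p])
  have "frac_on A W V' (\<lambda>p\<in>V. stalk_curvature A W nabla p (g p) (h p) (\<omega> p)) (curv \<delta> \<eta> w) (s \<otimes> (t \<otimes> r))"
  proof (rule frac_onI)
    have c: "\<delta> \<in> carrier L" "s \<in> carrier A" "\<eta> \<in> carrier L" "t \<in> carrier A" "w \<in> carrier W" "r \<in> carrier A"
      using 1(3,4,5) by (simp_all add: frac_on_def)
    show "curv \<delta> \<eta> w \<in> carrier W" by (rule curv_closed [OF c(1,3,5)])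
    show "s \<otimes> (t \<otimes> r) \<in> carrier A" using c by simp
    fix q assume q: "q \<in> V'"
    have qV: "q \<in> V" using q 1(1) by blast
    have pq: "primeideal q A" by (rule opens_subset [OF V qV])
    note fg = frac_onD [OF 1(3) q] and fh = frac_onD [OF 1(4) q] and fw = frac_onD [OF 1(5) q]
    note m = multset.S_mult [OF multset_prime [OF pq]]
    show "s \<otimes> (t \<otimes> r) \<notin> q" using m [OF fg(2) m [OF fh(2) fw(2)]] by blast
    show "(\<lambda>p\<in>V. stalk_curvature A W nabla p (g p) (h p) (\<omega> p)) q = germ_fraction A W q (curv \<delta> \<eta> w) (s \<otimes> (t \<otimes> r))"
      unfolding restrict_apply' [OF qV] fg(3) fh(3) fw(3)
      by (rule lr_prime_conn.sc_frac [OF conn_at_prime [OF pq] fg(1) fh(1) fw(1) fg(2) fh(2) fw(2)])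
  qed
  then show "\<exists>V' m s. V' \<in> opens A V \<and> p \<in> V' \<and> frac_on A W V' (\<lambda>p\<in>V. stalk_curvature A W nabla p (g p) (h p) (\<omega> p)) m s"
    using 1(1,2) by (intro exI conjI)
qed simp

text \<open>The curvature of two sections is a family of endomorphisms of the stalks, so its trace can be computed
germwise.\<close>

lemma trace_curvature_eq:
  assumes V: "V \<in> opens A (locally_free_locus A W)" and g: "g \<in> sec_L V" and h: "h \<in> sec_L V"
  shows "trace_curvature A L W (locally_free_locus A W) nabla V [g, h] = (\<lambda>p\<in>V. stalk_tr p (g p) (h p))"
    and "trace_curvature A L W (locally_free_locus A W) nabla V [g, h] \<in> carrier (struct_sheaf A V)"
proof -
  note Vo = open_of [OF V]
  have sub: "V \<subseteq> locally_free_locus A W" using V by simp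
  have lin: "deriv_over (stalk_ring A p) (stalk A W p) (\<lambda>_. \<zero>\<^bsub>stalk_ring A p\<^esub>) (stalk_curvature A W nabla p (g p) (h p))"
    if p: "p \<in> V" for p
    by (rule lr_prime_conn.sc_linear [OF conn_at_prime [OF opens_subset [OF Vo p]]
        sheaf_mod.section_stalk [OF sheaf_mod_L Vo g p] sheaf_mod.section_stalk [OF sheaf_mod_L Vo h p]])
  have sec: "(\<lambda>p\<in>V'. stalk_curvature A W nabla p (g p) (h p) (\<omega> p)) \<in> carrier (sections A W V')"
    if V': "V' \<in> opens A V" and \<omega>: "\<omega> \<in> carrier (sections A W V')" for V' \<omega>
  proof -
    have "(\<lambda>p\<in>V'. stalk_curvature A W nabla p (restrict g V' p) (restrict h V' p) (\<omega> p)) =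
      (\<lambda>p\<in>V'. stalk_curvature A W nabla p (g p) (h p) (\<omega> p))"
      by (rule restrict_ext) (simp only: restrict_apply')
    then show ?thesis
      using curvature_section [OF open_of [OF V'] section_restrict [OF g V'] section_restrict [OF h V'] \<omega>] by (simp only:)
  qed
  have t: "[g, h] \<in> tuples A L 2 V" using g h by (simp add: tuples_def)
  have "trace_curvature A L W (locally_free_locus A W) nabla V [g, h] = sheaf_trace A W V (sheaf_curvature A W nabla g h)"
    unfolding trace_curvature_def restrict_apply' [OF V] restrict_apply' [OF t] by simp
  also have "sheaf_curvature A W nabla g h = (\<lambda>V' \<omega>. \<lambda>p\<in>V'. stalk_curvature A W nabla p (g p) (h p) (\<omega> p))"
    by (intro ext) (simp only: sheaf_curvature_def)
  also have "sheaf_trace A W V (\<lambda>V' \<omega>. \<lambda>p\<in>V'. stalk_curvature A W nabla p (g p) (h p) (\<omega> p)) = (\<lambda>p\<in>V. stalk_tr p (g p) (h p))"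
    by (rule sheaf_mod.sheaf_trace_eq(1) [OF sheaf_mod_W Vo sub lin sec])
  finally show 1: "trace_curvature A L W (locally_free_locus A W) nabla V [g, h] = (\<lambda>p\<in>V. stalk_tr p (g p) (h p))" .
  show "trace_curvature A L W (locally_free_locus A W) nabla V [g, h] \<in> carrier (struct_sheaf A V)"
    unfolding 1 by (rule sheaf_mod.sheaf_trace_eq(2) [OF sheaf_mod_W Vo sub lin sec])
qed

lemma trace_curvature_at:
  assumes "V \<in> opens A (locally_free_locus A W)" "g \<in> sec_L V" "h \<in> sec_L V" "p \<in> V"
  shows "trace_curvature A L W (locally_free_locus A W) nabla V [g, h] p = stalk_tr p (g p) (h p)"
  unfolding trace_curvature_eq(1) [OF assms(1-3)] restrict_apply' [OF assms(4)] ..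

text \<open>All conditions on a cochain are checked on germs, where they hold because the curvature on a stalk is
bilinear and alternating and the trace is linear.\<close>

lemma trace_curvature_cochain:
  "trace_curvature A L W (locally_free_locus A W) nabla \<in> carrier (cochains A L (locally_free_locus A W) 2)"
proof (rule cochain_2I)
  let ?T = "trace_curvature A L W (locally_free_locus A W) nabla"
  show "?T \<in> extensional (opens A (locally_free_locus A W))" by (simp add: trace_curvature_def)
  fix V assume V: "V \<in> opens A (locally_free_locus A W)"
  note Vo = open_of [OF V]
  interpret O: cring "struct_sheaf A V" by (rule O_cring [OF Vo])
  show "?T V \<in> extensional (tuples A L 2 V)"
    unfolding trace_curvature_def restrict_apply' [OF V] by (rule restrict_extensional)
  show cl: "?T V [g, h] \<in> carrier (struct_sheaf A V)" if "g \<in> sec_L V" "h \<in> sec_L V" for g h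
    by (rule trace_curvature_eq(2) [OF V that])
  note st = sheaf_mod.section_stalk [OF sheaf_mod_L Vo]
  note pr = conn_at_prime [OF opens_subset [OF Vo]]
  note at = trace_curvature_at [OF V]
  show "?T V [g \<oplus>\<^bsub>sections A L V\<^esub> g', h] = ?T V [g, h] \<oplus>\<^bsub>struct_sheaf A V\<^esub> ?T V [g', h]"
    if g: "g \<in> sec_L V" and g': "g' \<in> sec_L V" and h: "h \<in> sec_L V" for g g' h
  proof -
    note gg = sheaf_mod.add_section [OF sheaf_mod_L Vo g g']
    show ?thesis
    proof (rule O_ext [OF cl [OF gg h] O.a_closed [OF cl [OF g h] cl [OF g' h]]])
      fix p assume p: "p \<in> V"
      obtain n e where b: "is_basis (stalk_ring A p) (stalk A W p) n e" by (rule free_stalk [OF V p])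
      show "?T V [g \<oplus>\<^bsub>sections A L V\<^esub> g', h] p = (?T V [g, h] \<oplus>\<^bsub>struct_sheaf A V\<^esub> ?T V [g', h]) p"
        unfolding O_add [OF p] at [OF gg h p] at [OF g h p] at [OF g' h p] sections_simps(2) [OF p]
        by (rule lr_prime_conn.\<phi>_add [OF pr [OF p] b st [OF g p] st [OF g' p] st [OF h p]])
    qed
  qed
  show "?T V [f \<odot>\<^bsub>sections A L V\<^esub> g, h] = f \<otimes>\<^bsub>struct_sheaf A V\<^esub> ?T V [g, h]"
    if f: "f \<in> carrier (struct_sheaf A V)" and g: "g \<in> sec_L V" and h: "h \<in> sec_L V" for f g h
  proof -
    note fg = sheaf_mod.smult_section [OF sheaf_mod_L Vo f [unfolded struct_sheaf_simps] g]
    show ?thesis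
    proof (rule O_ext [OF cl [OF fg h] O.m_closed [OF f cl [OF g h]]])
      fix p assume p: "p \<in> V"
      obtain n e where b: "is_basis (stalk_ring A p) (stalk A W p) n e" by (rule free_stalk [OF V p])
      show "?T V [f \<odot>\<^bsub>sections A L V\<^esub> g, h] p = (f \<otimes>\<^bsub>struct_sheaf A V\<^esub> ?T V [g, h]) p"
        unfolding O_mult [OF p] at [OF fg h p] at [OF g h p] sections_simps(3) [OF p]
        by (rule lr_prime_conn.\<phi>_smult [OF pr [OF p] b O_stalk [OF Vo f p] st [OF g p] st [OF h p]])
    qed
  qed
  show "?T V [g, g] = \<zero>\<^bsub>struct_sheaf A V\<^esub>" if g: "g \<in> sec_L V" for g
  proof (rule O_ext [OF cl [OF g g] O.zero_closed])
    fix p assume p: "p \<in> V"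
    obtain n e where b: "is_basis (stalk_ring A p) (stalk A W p) n e" by (rule free_stalk [OF V p])
    show "?T V [g, g] p = \<zero>\<^bsub>struct_sheaf A V\<^esub> p"
      unfolding O_zero [OF p] at [OF g g p] by (rule lr_prime_conn.\<phi>_self [OF pr [OF p] b st [OF g p]])
  qed
  show "?T V [h, g] = \<ominus>\<^bsub>struct_sheaf A V\<^esub> ?T V [g, h]" if g: "g \<in> sec_L V" and h: "h \<in> sec_L V" for g h
  proof -
    have "?T V [h, g] \<oplus>\<^bsub>struct_sheaf A V\<^esub> ?T V [g, h] = \<zero>\<^bsub>struct_sheaf A V\<^esub>"
    proof (rule O_ext [OF O.a_closed [OF cl [OF h g] cl [OF g h]] O.zero_closed])
      fix p assume p: "p \<in> V"
      obtain n e where b: "is_basis (stalk_ring A p) (stalk A W p) n e" by (rule free_stalk [OF V p])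
      interpret K: cring "stalk_ring A p" by (rule K_cring [OF Vo p])
      note c = lr_prime_conn.\<phi>_closed [OF pr [OF p] b st [OF g p] st [OF h p]]
      show "(?T V [h, g] \<oplus>\<^bsub>struct_sheaf A V\<^esub> ?T V [g, h]) p = \<zero>\<^bsub>struct_sheaf A V\<^esub> p"
        unfolding O_zero [OF p] O_add [OF p] at [OF g h p] at [OF h g p]
          lr_prime_conn.\<phi>_antisym [OF pr [OF p] b st [OF g p] st [OF h p]]
        by (rule K.l_neg [OF c])
    qed
    then show ?thesis by (rule O.minus_equality [OF _ cl [OF g h] cl [OF h g], symmetric])
  qed
  show "?T V' [restrict g V', restrict h V'] = restrict (?T V [g, h]) V'"
    if V': "V' \<in> opens A V" and g: "g \<in> sec_L V" and h: "h \<in> sec_L V" for V' g h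
  proof -
    have sub: "V' \<subseteq> V" using V' by simp
    note VU = opens_trans [OF V' V]
    note r = section_restrict [OF g V'] section_restrict [OF h V']
    show ?thesis
    proof (rule extensionalityI [of _ V'])
      show "?T V' [restrict g V', restrict h V'] \<in> extensional V'"
        unfolding trace_curvature_eq(1) [OF VU r] by (rule restrict_extensional)
      fix p assume p: "p \<in> V'"
      show "?T V' [restrict g V', restrict h V'] p = restrict (?T V [g, h]) V' p"
        unfolding trace_curvature_at [OF VU r p] restrict_apply' [OF p] at [OF g h subsetD [OF sub p]] ..
    qed simp
  qed
qed

text \<open>Both sides are sections with the same germs, by \<open>trace_curvature_cocycle\<close>.\<close>

lemma trace_curvature_closed:
  "differential A L (locally_free_locus A W) 2 (trace_curvature A L W (locally_free_locus A W) nabla) =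
    \<zero>\<^bsub>cochains A L (locally_free_locus A W) 3\<^esub>"
proof -
  let ?U = "locally_free_locus A W"
  let ?T = "trace_curvature A L W ?U nabla"
  have "differential A L ?U 2 ?T V [g, h, k] = \<zero>\<^bsub>struct_sheaf A V\<^esub>"
    if V: "V \<in> opens A ?U" and g: "g \<in> sec_L V" and h: "h \<in> sec_L V" and k: "k \<in> sec_L V" for V g h k
  proof -
    note Vo = open_of [OF V]
    interpret O: cring "struct_sheaf A V" by (rule O_cring [OF Vo])
    note cl = trace_curvature_eq(2) [OF V]
    note b = br_sec_closed [OF Vo g h] br_sec_closed [OF Vo g k] br_sec_closed [OF Vo h k]
    note T = act_sec_closed [OF Vo g cl [OF h k]] act_sec_closed [OF Vo h cl [OF g k]] act_sec_closed [OF Vo k cl [OF g h]]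
      cl [OF b(1) k] cl [OF b(2) h] cl [OF b(3) g]
    note S = T(1) T(2) O.minus_closed [OF T(1,2)] T(3) O.a_closed [OF O.minus_closed [OF T(1,2)] T(3)] T(4)
    note S2 = O.minus_closed [OF S(5,6)]
    note S3 = O.a_closed [OF S2 T(5)]
    have d: "differential A L ?U 2 ?T V [g, h, k] =
      act_sec V g (?T V [h, k]) \<ominus>\<^bsub>struct_sheaf A V\<^esub> act_sec V h (?T V [g, k]) \<oplus>\<^bsub>struct_sheaf A V\<^esub> act_sec V k (?T V [g, h])
      \<ominus>\<^bsub>struct_sheaf A V\<^esub> ?T V [br_sec V g h, k] \<oplus>\<^bsub>struct_sheaf A V\<^esub> ?T V [br_sec V g k, h] \<ominus>\<^bsub>struct_sheaf A V\<^esub> ?T V [br_sec V h k, g]"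
      by (rule differential_2 [OF V g h k]) (rule cl)
    show ?thesis unfolding d
    proof (rule O_ext [OF O.minus_closed [OF S3 T(6)] O.zero_closed])
      fix p assume p: "p \<in> V"
      obtain n e where bs: "is_basis (stalk_ring A p) (stalk A W p) n e" by (rule free_stalk [OF V p])
      note st = sheaf_mod.section_stalk [OF sheaf_mod_L Vo _ p]
      note at = trace_curvature_at [OF V _ _ p]
      note coc = lr_prime_conn.trace_curvature_cocycle [OF conn_at_prime [OF opens_subset [OF Vo p]] bs st [OF g] st [OF h] st [OF k]]
      have e: "act_sec V x y p = stalk_action A p (x p) (y p)" "br_sec V x x' p = stalk_bracket A L p (x p) (x' p)" for x y x'
        unfolding act_sec_def br_sec_def restrict_apply' [OF p] by (rule refl)+
      show "(act_sec V g (?T V [h, k]) \<ominus>\<^bsub>struct_sheaf A V\<^esub> act_sec V h (?T V [g, k]) \<oplus>\<^bsub>struct_sheaf A V\<^esub> act_sec V k (?T V [g, h])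
        \<ominus>\<^bsub>struct_sheaf A V\<^esub> ?T V [br_sec V g h, k] \<oplus>\<^bsub>struct_sheaf A V\<^esub> ?T V [br_sec V g k, h] \<ominus>\<^bsub>struct_sheaf A V\<^esub> ?T V [br_sec V h k, g]) p
        = \<zero>\<^bsub>struct_sheaf A V\<^esub> p"
        unfolding O_zero [OF p] O_add [OF p] O_minus [OF Vo S3 T(6) p] O_minus [OF Vo S(5,6) p] O_minus [OF Vo T(1,2) p]
          e at [OF h k] at [OF g k] at [OF g h] at [OF b(1) k] at [OF b(2) h] at [OF b(3) g]
        by (rule coc)
    qed
  qed
  note eq = this
  have "differential A L ?U 2 ?T = (\<lambda>V\<in>opens A ?U. \<lambda>gs\<in>tuples A L (Suc 2) V. differential A L ?U 2 ?T V gs)"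
    by (simp add: differential_def cong: restrict_cong)
  also have "\<dots> = (\<lambda>V\<in>opens A ?U. \<lambda>gs\<in>tuples A L (Suc 2) V. \<zero>\<^bsub>struct_sheaf A V\<^esub>)"
  proof (rule restrict_ext, rule restrict_ext)
    fix V gs assume V: "V \<in> opens A ?U" and gs: "gs \<in> tuples A L (Suc 2) V"
    obtain g h k where g: "gs = [g, h, k]" "g \<in> sec_L V" "h \<in> sec_L V" "k \<in> sec_L V"
      using gs tuples_3 [of gs A L V] by auto
    show "differential A L ?U 2 ?T V gs = \<zero>\<^bsub>struct_sheaf A V\<^esub>" unfolding g(1) by (rule eq [OF V g(2-4)])
  qed
  finally show ?thesis by (simp add: cochains_def)
qed

lemma trace_curvature_in_cocycles:
  "trace_curvature A L W (locally_free_locus A W) nabla \<in> carrier (cocycles A L (locally_free_locus A W) 2)"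
  using trace_curvature_cochain trace_curvature_closed by (simp add: cocycles_def a_kernel_def')

end

section \<open>Change of connection\<close>

context lr_connections
begin

abbreviation "ULF \<equiv> locally_free_locus A W"

lemma conns_at_prime: "primeideal p A \<Longrightarrow> lr_prime_conns A L p (carrier A - p) W nabla nabla'"
  by (intro lr_prime_conns.intro N.at_prime lr_connections_axioms)

text \<open>The trace of the difference of the two connections. Being linear over the functions, it is a 1-cochain on
the whole locus.\<close>

definition diff_cochain where
  "diff_cochain = (\<lambda>V\<in>opens A ULF. \<lambda>gs\<in>tuples A L (Suc 0) V. \<lambda>p\<in>V.
     module_trace (stalk_ring A p) (stalk A W p) (stalk_map2 A W conn_diff_map p ((gs ! 0) p)))"

lemma conn_diff_section:
  assumes V: "openin (zariski A) V" and g: "g \<in> N.sec_L V" and \<omega>: "\<omega> \<in> carrier (sections A W V)"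
  shows "(\<lambda>p\<in>V. stalk_map2 A W conn_diff_map p (g p) (\<omega> p)) \<in> carrier (sections A W V)"
proof (rule sectionI)
  fix p assume p: "p \<in> V"
  obtain V' \<delta> s w r where 1: "V' \<in> opens A V" "p \<in> V'" "frac_on A L V' g \<delta> s" "frac_on A W V' \<omega> w r"
    by (rule section_local2 [OF g \<omega> p])
  have "frac_on A W V' (\<lambda>p\<in>V. stalk_map2 A W conn_diff_map p (g p) (\<omega> p)) (conn_diff_map \<delta> w) (s \<otimes> r)"
  proof (rule frac_onI)
    have c: "\<delta> \<in> carrier L" "s \<in> carrier A" "w \<in> carrier W" "r \<in> carrier A" using 1(3,4) by (simp_all add: frac_on_def)
    show "conn_diff_map \<delta> w \<in> carrier W" by (rule N.W.linearD(1) [OF conn_diff_linear [OF c(1)] c(3)])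
    show "s \<otimes> r \<in> carrier A" using c by simp
    fix q assume q: "q \<in> V'"
    have qV: "q \<in> V" using q 1(1) by blast
    have pq: "primeideal q A" by (rule opens_subset [OF V qV])
    note fg = frac_onD [OF 1(3) q] and fw = frac_onD [OF 1(4) q]
    show "s \<otimes> r \<notin> q" using multset.S_mult [OF N.multset_prime [OF pq] fg(2) fw(2)] by blast
    show "(\<lambda>p\<in>V. stalk_map2 A W conn_diff_map p (g p) (\<omega> p)) q = germ_fraction A W q (conn_diff_map \<delta> w) (s \<otimes> r)"
      unfolding restrict_apply' [OF qV] fg(3) fw(3)
      by (rule lr_prime_conns.sd_frac [OF conns_at_prime [OF pq] fg(1) fw(1) fg(2) fw(2)])
  qed
  then show "\<exists>V' m s. V' \<in> opens A V \<and> p \<in> V' \<and> frac_on A W V' (\<lambda>p\<in>V. stalk_map2 A W conn_diff_map p (g p) (\<omega> p)) m s"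
    using 1(1,2) by (intro exI conjI)
qed simp

lemma diff_cochain_eq:
  assumes V: "V \<in> opens A ULF" and g: "g \<in> N.sec_L V"
  shows "diff_cochain V [g] = (\<lambda>p\<in>V. module_trace (stalk_ring A p) (stalk A W p) (stalk_map2 A W conn_diff_map p (g p)))"
    and "diff_cochain V [g] \<in> carrier (struct_sheaf A V)"
proof -
  note Vo = N.open_of [OF V]
  have sub: "V \<subseteq> ULF" using V by simp
  have lin: "deriv_over (stalk_ring A p) (stalk A W p) (\<lambda>_. \<zero>\<^bsub>stalk_ring A p\<^esub>) (stalk_map2 A W conn_diff_map p (g p))"
    if p: "p \<in> V" for p
    by (rule lr_prime_conns.sd_linear [OF conns_at_prime [OF opens_subset [OF Vo p]] sheaf_mod.section_stalk [OF N.sheaf_mod_L Vo g p]])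
  have sec: "(\<lambda>p\<in>V'. stalk_map2 A W conn_diff_map p (g p) (\<omega> p)) \<in> carrier (sections A W V')"
    if V': "V' \<in> opens A V" and \<omega>: "\<omega> \<in> carrier (sections A W V')" for V' \<omega>
  proof -
    have "(\<lambda>p\<in>V'. stalk_map2 A W conn_diff_map p (restrict g V' p) (\<omega> p)) = (\<lambda>p\<in>V'. stalk_map2 A W conn_diff_map p (g p) (\<omega> p))"
      by (rule restrict_ext) (simp only: restrict_apply')
    then show ?thesis
      using conn_diff_section [OF N.open_of [OF V'] section_restrict [OF g V'] \<omega>] by (simp only:)
  qed
  have t: "[g] \<in> tuples A L (Suc 0) V" using g by (simp add: tuples_def)
  show 1: "diff_cochain V [g] = (\<lambda>p\<in>V. module_trace (stalk_ring A p) (stalk A W p) (stalk_map2 A W conn_diff_map p (g p)))"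
    unfolding diff_cochain_def restrict_apply' [OF V] restrict_apply' [OF t] by simp
  show "diff_cochain V [g] \<in> carrier (struct_sheaf A V)"
    unfolding 1 by (rule sheaf_mod.sheaf_trace_eq(2) [OF N.sheaf_mod_W Vo sub lin sec])
qed

lemma diff_cochain_at:
  assumes "V \<in> opens A ULF" "g \<in> N.sec_L V" "p \<in> V"
  shows "diff_cochain V [g] p = module_trace (stalk_ring A p) (stalk A W p) (stalk_map2 A W conn_diff_map p (g p))"
  unfolding diff_cochain_eq(1) [OF assms(1,2)] restrict_apply' [OF assms(3)] ..

lemma diff_cochain_cochain: "diff_cochain \<in> carrier (cochains A L ULF (Suc 0))"
proof (rule N.cochain_1I)
  show "diff_cochain \<in> extensional (opens A ULF)" by (simp add: diff_cochain_def)
  fix V assume V: "V \<in> opens A ULF"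
  note Vo = N.open_of [OF V]
  interpret O: cring "struct_sheaf A V" by (rule N.O_cring [OF Vo])
  show "diff_cochain V \<in> extensional (tuples A L (Suc 0) V)"
    unfolding diff_cochain_def restrict_apply' [OF V] by (rule restrict_extensional)
  note st = sheaf_mod.section_stalk [OF N.sheaf_mod_L Vo]
  note pr = conns_at_prime [OF opens_subset [OF Vo]]
  note at = diff_cochain_at [OF V]
  show cl: "diff_cochain V [g] \<in> carrier (struct_sheaf A V)" if "g \<in> N.sec_L V" for g
    by (rule diff_cochain_eq(2) [OF V that])
  show "diff_cochain V [g \<oplus>\<^bsub>sections A L V\<^esub> h] = diff_cochain V [g] \<oplus>\<^bsub>struct_sheaf A V\<^esub> diff_cochain V [h]"
    if g: "g \<in> N.sec_L V" and h: "h \<in> N.sec_L V" for g h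
  proof -
    note gh = sheaf_mod.add_section [OF N.sheaf_mod_L Vo g h]
    show ?thesis
    proof (rule N.O_ext [OF cl [OF gh] O.a_closed [OF cl [OF g] cl [OF h]]])
      fix p assume p: "p \<in> V"
      obtain n e where b: "is_basis (stalk_ring A p) (stalk A W p) n e" by (rule N.free_stalk [OF V p])
      show "diff_cochain V [g \<oplus>\<^bsub>sections A L V\<^esub> h] p = (diff_cochain V [g] \<oplus>\<^bsub>struct_sheaf A V\<^esub> diff_cochain V [h]) p"
        unfolding N.O_add [OF p] at [OF gh p] at [OF g p] at [OF h p] sections_simps(2) [OF p]
        by (rule lr_prime_conns.\<psi>_add [OF pr [OF p] b st [OF g p] st [OF h p]])
    qed
  qed
  show "diff_cochain V [f \<odot>\<^bsub>sections A L V\<^esub> g] = f \<otimes>\<^bsub>struct_sheaf A V\<^esub> diff_cochain V [g]"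
    if f: "f \<in> carrier (struct_sheaf A V)" and g: "g \<in> N.sec_L V" for f g
  proof -
    note fg = sheaf_mod.smult_section [OF N.sheaf_mod_L Vo f [unfolded struct_sheaf_simps] g]
    show ?thesis
    proof (rule N.O_ext [OF cl [OF fg] O.m_closed [OF f cl [OF g]]])
      fix p assume p: "p \<in> V"
      obtain n e where b: "is_basis (stalk_ring A p) (stalk A W p) n e" by (rule N.free_stalk [OF V p])
      show "diff_cochain V [f \<odot>\<^bsub>sections A L V\<^esub> g] p = (f \<otimes>\<^bsub>struct_sheaf A V\<^esub> diff_cochain V [g]) p"
        unfolding N.O_mult [OF p] at [OF fg p] at [OF g p] sections_simps(3) [OF p]
        by (rule lr_prime_conns.\<psi>_smult [OF pr [OF p] b N.O_stalk [OF Vo f p] st [OF g p]])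
    qed
  qed
  show "diff_cochain V' [restrict g V'] = restrict (diff_cochain V [g]) V'"
    if V': "V' \<in> opens A V" and g: "g \<in> N.sec_L V" for V' g
  proof -
    have sub: "V' \<subseteq> V" using V' by simp
    note VU = opens_trans [OF V' V]
    note r = section_restrict [OF g V']
    show ?thesis
    proof (rule extensionalityI [of _ V'])
      show "diff_cochain V' [restrict g V'] \<in> extensional V'"
        unfolding diff_cochain_eq(1) [OF VU r] by (rule restrict_extensional)
      fix p assume p: "p \<in> V'"
      show "diff_cochain V' [restrict g V'] p = restrict (diff_cochain V [g]) V' p"
        unfolding diff_cochain_at [OF VU r p] restrict_apply' [OF p] at [OF g subsetD [OF sub p]] ..
    qed simp
  qed
qed

text \<open>The germwise relation \<open>trace_curvature_diff\<close>, read as an equation between sections.\<close>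

lemma trace_curvature_change:
  assumes V: "V \<in> opens A ULF" and g: "g \<in> N.sec_L V" and h: "h \<in> N.sec_L V"
  shows "trace_curvature A L W ULF nabla' V [g, h] =
    trace_curvature A L W ULF nabla V [g, h] \<oplus>\<^bsub>struct_sheaf A V\<^esub> differential A L ULF (Suc 0) diff_cochain V [g, h]"
proof -
  note Vo = N.open_of [OF V]
  interpret O: cring "struct_sheaf A V" by (rule N.O_cring [OF Vo])
  note cl = diff_cochain_eq(2) [OF V]
  note b = N.br_sec_closed [OF Vo g h]
  note T = N.act_sec_closed [OF Vo g cl [OF h]] N.act_sec_closed [OF Vo h cl [OF g]] cl [OF b]
  have d: "differential A L ULF (Suc 0) diff_cochain V [g, h] =
    N.act_sec V g (diff_cochain V [h]) \<ominus>\<^bsub>struct_sheaf A V\<^esub> N.act_sec V h (diff_cochain V [g]) \<ominus>\<^bsub>struct_sheaf A V\<^esub> diff_cochain V [N.br_sec V g h]"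
    by (rule N.differential_1 [OF V g h]) (rule cl)
  show ?thesis
  proof (rule N.O_ext [OF X.trace_curvature_eq(2) [OF V g h]
        O.a_closed [OF N.trace_curvature_eq(2) [OF V g h] N.differential_1_closed [OF diff_cochain_cochain V g h]]])
    fix p assume p: "p \<in> V"
    obtain n e where bs: "is_basis (stalk_ring A p) (stalk A W p) n e" by (rule N.free_stalk [OF V p])
    note st = sheaf_mod.section_stalk [OF N.sheaf_mod_L Vo _ p]
    have e: "N.act_sec V x y p = stalk_action A p (x p) (y p)" "N.br_sec V x x' p = stalk_bracket A L p (x p) (x' p)" for x y x'
      unfolding N.act_sec_def N.br_sec_def restrict_apply' [OF p] by (rule refl)+
    show "trace_curvature A L W ULF nabla' V [g, h] p =
      (trace_curvature A L W ULF nabla V [g, h] \<oplus>\<^bsub>struct_sheaf A V\<^esub> differential A L ULF (Suc 0) diff_cochain V [g, h]) p"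
      unfolding d N.O_add [OF p] N.O_minus [OF Vo O.minus_closed [OF T(1,2)] T(3) p] N.O_minus [OF Vo T(1,2) p]
        X.trace_curvature_at [OF V g h p] N.trace_curvature_at [OF V g h p] e
        diff_cochain_at [OF V g p] diff_cochain_at [OF V h p] diff_cochain_at [OF V b p]
      by (rule lr_prime_conns.trace_curvature_diff [OF conns_at_prime [OF opens_subset [OF Vo p]] bs st [OF g] st [OF h]])
  qed
qed

text \<open>An element \<open>d\<theta> + tr R'\<close> of the new class equals \<open>d(\<theta> + \<psi>) + tr R\<close> with \<open>\<psi>\<close> the trace of the difference of the
connections. The reverse inclusion is the same statement with the connections exchanged.\<close>

lemma cohomology_class_subset:
  "cohomology_class A L ULF 2 (trace_curvature A L W ULF nabla') \<subseteq> cohomology_class A L ULF 2 (trace_curvature A L W ULF nabla)"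
proof
  let ?C = "cochains A L ULF (Suc 0)" and ?d = "differential A L ULF (Suc 0)"
  let ?T = "trace_curvature A L W ULF nabla" and ?T' = "trace_curvature A L W ULF nabla'"
  have cls: "cohomology_class A L ULF 2 T = (\<lambda>\<theta>. \<lambda>V\<in>opens A ULF. \<lambda>gs\<in>tuples A L 2 V. ?d \<theta> V gs \<oplus>\<^bsub>struct_sheaf A V\<^esub> T V gs) ` carrier ?C" for T
    unfolding cohomology_class_def a_r_coset_def' coboundaries_def cocycles_def cochains_def numeral_2_eq_2
    by auto
  fix x assume "x \<in> cohomology_class A L ULF 2 ?T'"
  then obtain \<theta> where \<theta>: "\<theta> \<in> carrier ?C" and x: "x = (\<lambda>V\<in>opens A ULF. \<lambda>gs\<in>tuples A L 2 V. ?d \<theta> V gs \<oplus>\<^bsub>struct_sheaf A V\<^esub> ?T' V gs)"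
    unfolding cls by (elim imageE)
  have "x = (\<lambda>V\<in>opens A ULF. \<lambda>gs\<in>tuples A L 2 V. ?d (\<theta> \<oplus>\<^bsub>?C\<^esub> diff_cochain) V gs \<oplus>\<^bsub>struct_sheaf A V\<^esub> ?T V gs)"
    unfolding x
  proof (rule restrict_ext, rule restrict_ext)
    fix V gs assume V: "V \<in> opens A ULF" and gs: "gs \<in> tuples A L 2 V"
    interpret O: cring "struct_sheaf A V" by (rule N.O_cring [OF N.open_of [OF V]])
    obtain g h where g: "gs = [g, h]" "g \<in> N.sec_L V" "h \<in> N.sec_L V" using gs unfolding tuples_2 by blast
    note c = N.differential_1_closed [OF \<theta> V g(2,3)] N.differential_1_closed [OF diff_cochain_cochain V g(2,3)]
      N.trace_curvature_eq(2) [OF V g(2,3)]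
    show "?d \<theta> V gs \<oplus>\<^bsub>struct_sheaf A V\<^esub> ?T' V gs = ?d (\<theta> \<oplus>\<^bsub>?C\<^esub> diff_cochain) V gs \<oplus>\<^bsub>struct_sheaf A V\<^esub> ?T V gs"
      unfolding g(1) trace_curvature_change [OF V g(2,3)] N.differential_1_add [OF \<theta> diff_cochain_cochain V g(2,3)]
      by (simp only: O.a_ac O.a_closed c)
  qed
  then show "x \<in> cohomology_class A L ULF 2 ?T"
    unfolding cls by (rule image_eqI [OF _ N.cochains_1_add_closed [OF \<theta> diff_cochain_cochain]])
qed

end

section \<open>The first Chern class\<close>

theorem theorem3p2:
  fixes F :: "('f, 'k) ring_scheme"
    and A :: "('f, 'a, 'y) module_scheme"
    and W :: "('a, 'w, 'z) module_scheme"
  defines "V \<equiv> linear_LR F A W"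
    and "U \<equiv> locally_free_locus A W"
  assumes "Ring.field F" and "Module.algebra F A" and "Module.module A W"
    and "finitely_presented A W"
    and "\<exists>nabla. is_connection F A W nabla"
  shows "\<exists>c\<^sub>1\<in>carrier (cohomology A V U 2). \<forall>nabla. is_connection F A W nabla \<longrightarrow>
    trace_curvature A V W U nabla \<in> carrier (cocycles A V U 2) \<and>
    cohomology_class A V U 2 (trace_curvature A V W U nabla) = c\<^sub>1"
proof -
  interpret lr: linear_lr F A W by (intro linear_lr.intro assms(4,5))
  obtain nabla0 where n0: "is_connection F A W nabla0" using assms(7) by blast
  have cocycle: "trace_curvature A V W U nabla \<in> carrier (cocycles A V U 2)" if "is_connection F A W nabla" for nabla
    unfolding V_def U_def by (rule lr_connection.trace_curvature_in_cocycles [OF lr.connection_lr_connection [OF that]])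
  have sub: "cohomology_class A V U 2 (trace_curvature A V W U nabla') \<subseteq> cohomology_class A V U 2 (trace_curvature A V W U nabla)"
    if "is_connection F A W nabla" "is_connection F A W nabla'" for nabla nabla'
    unfolding V_def U_def
    by (rule lr_connections.cohomology_class_subset [OF lr_connections.intro [OF that [THEN lr.connection_lr_connection]]])
  show ?thesis
  proof (intro bexI allI impI conjI)
    show "cohomology_class A V U 2 (trace_curvature A V W U nabla0) \<in> carrier (cohomology A V U 2)"
      using cocycle [OF n0]
      unfolding cohomology_def cohomology_class_def A_FactGroup_def FactGroup_def RCOSETS_def a_r_coset_def by auto
    fix nabla assume n: "is_connection F A W nabla"
    show "trace_curvature A V W U nabla \<in> carrier (cocycles A V U 2)" by (rule cocycle [OF n])
    show "cohomology_class A V U 2 (trace_curvature A V W U nabla) = cohomology_class A V U 2 (trace_curvature A V W U nabla0)"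
      by (intro equalityI sub n n0)
  qed
qed

end
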